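(* Let $N\geqslant 2$. For any $c\in\mathbb{C}$ there exists a unique structure of quantum vertex algebra $(\mathrm{H}^+_N,Y,\mathbf 1,\mathcal S)$ on $\mathrm{H}^+_N$ such that the vacuum vector is the unit $\mathbf 1\in \mathrm{H}^+_N$, the braiding is the map $\mathcal S(z)$ defined (for this $c$) in the context, and the vertex operator map is given by $$Y(x_{[n]}^+ (u_1,\ldots ,u_n),z)=x_{[n]}(z+u_1,\ldots , z+u_n).$$
   Context: **Conventions.** $N\geqslant 2$ is an integer, $h$ a formal parameter, $c\in\mathbb C$. A $\mathbb C[[h]]$-module is topologically free if it is torsion-free, separated and $h$-adically complete (equivalently $\cong V_0[[h]]$ for a complex space $V_0$). Tensor products of $\mathbb C[[h]]$-modules are $h$-adically completed; $\mathrm{Hom}$ means $\mathbb C[[h]]$-module maps. For a $\mathbb C[[h]]$-module $V$, $V((u))_h$ is the module of series $\sum_{r\in\mathbb Z}a_ru^{-r-1}\in V[[u^{\pm1}]]$ with $a_r\to0$ $h$-adically as $r\to\infty$, and $V[u^{-1}]_h$ is the submodule of those lying in $V[[u^{-1}]]$; similarly in several variables (for $V=V_0[[h]]$, $V((u_1,\dots,u_n))_h=V_0((u_1,\dots,u_n))[[h]]$ with $V_0((u_1,\dots,u_n))=V_0[[u_1,\dots,u_n]][u_1^{-1},\dots,u_n^{-1}]$). Expressions $(x_1+\dots+x_n)^r$ with $r<0$ are expanded in nonnegative powers of $x_2,\dots,x_n$. Subscripts on operators indicate the tensor factors on which they act. **The series $S$.** Let $R(u)=I-\frac hu P$ on $\mathbb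 C^N\otimes\mathbb C^N$, $I$ the identity, $P=\sum_{i,j}e_{ij}\otimes e_{ji}$. There is a unique series $G(u,C)=1+\frac{C+N}{N}\frac{h^2}{u^2}-\dots\in\mathbb C[C][[h/u]]$ with $\mathrm{tr}_1(G(u,C)R(u)R(-u-hC)-I)=\mathrm{tr}_2(G(u,C)R(u)R(-u-hC)-I)=0$ ($\mathrm{tr}_i$ is the trace over the $i$-th tensor factor). Put $S(u)=S(u,c)=h^{-2}(G(u,c)R(u)R(-u-hc)-I)\in u^{-2}\,\mathrm{End}\,\mathbb C^N\otimes\mathrm{End}\,\mathbb C^N[[h/u]]$, and $T(z)=S(z)-S(-z)\in \mathrm{End}\,\mathbb C^N\otimes\mathrm{End}\,\mathbb C^N[z^{-1}]_h$. **The algebra $\mathrm{H}^+_N$.** $\mathrm{H}^+_N$ is the quotient of $\mathbb C[x_{ij}^{(-r)}: i,j=1,\dots,N,\ r\geqslant1][[h]]$ by the $h$-adically complete ideal generated by $x_{11}^{(-r)}+\dots+x_{NN}^{(-r)}$, $r\geqslant1$. Put $x^+_{ij}(u)=\sum_{r\geqslant1}x_{ij}^{(-r)}u^{r-1}$, $x^+(u)=\sum_{i,j}e_{ij}\otimes x^+_{ij}(u)$, and $x^+_{[n]}(u)=x^+_{[n]}(u_1,\dots,u_n)=x^+_1(u_1)\cdots x^+_n(u_n)$ with coefficients in $(\mathrm{End}\,\mathbb C^N)^{\otimes n}\otimes \mathrm{H}^+_N$, where $x_k^+(u)=\sum_{i,j}1^{\otimes(k-1)}\otimes e_{ij}\otimes1^{\otimes(n-k)}\otimes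 x^+_{ij}(u)$; $x^+_{[0]}=\mathbf 1$. **Operators.** $x^-(u)=\sum_{i,j}e_{ij}\otimes x^-_{ij}(u)\in\mathrm{End}\,\mathbb C^N\otimes\mathrm{Hom}(\mathrm{H}^+_N,\mathrm{H}^+_N[u^{-1}]_h)$, $x^-_{ij}(u)=\sum_{r\geqslant1}x_{ij}^{(r-1)}u^{-r}$, is the unique operator with $x^-(u)\mathbf 1=0$ and, for all $n\geqslant1$, $$x^-_0(u_0)x^+_{[n]}(u)=-\sum_{j=1}^nS_{0j}(u_0-u_j)\,x_1^+(u_1)\cdots x_{j-1}^+(u_{j-1})x_{j+1}^+(u_{j+1})\cdots x_n^+(u_n).$$ Regard $x^+(u)$ as a multiplication operator and put $x(u)=x^+(u)+x^-(u)\in \mathrm{End}\,\mathbb C^N\otimes\mathrm{Hom}(\mathrm{H}^+_N,\mathrm{H}^+_N((u))_h)$. For $0\leqslant k\leqslant\lfloor n/2\rfloor$ let $I^n_k$ be the family of all sets of $k$ ordered pairs $(p,q)\in\{1,\dots,n\}^2$, $p<q$, such that all coordinates of all pairs in the set are mutually distinct; for $i\in I^n_k$ let $i'$ be the set of elements of $\{1,\dots,n\}$ not appearing in $i$. Define $$x_{[n]}(u_1,\dots,u_n)=\sum_{k=0}^{\lfloor n/2\rfloor}\ \sum_{\substack{i=\{(i_1,j_1),\dots,(i_k,j_k)\}\in I^n_k\\ l_1<\dots<l_{n-2k}\in i'}}S_{i_1j_1}\cdots S_{i_kj_k}\,x_{l_1}(u_{l_1})\cdots x_{l_{n-2k}}(u_{l_{n-2k}}),$$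 with $S_{ij}=S_{ij}(u_i-u_j)$ (the $k=0$ term is $x_1(u_1)\cdots x_n(u_n)$). It lies in $(\mathrm{End}\,\mathbb C^N)^{\otimes n}\otimes\mathrm{Hom}(\mathrm{H}^+_N,\mathrm{H}^+_N((u_1,\dots,u_n))_h)$, so $x_{[n]}(z+u_1,\dots,z+u_n)$ is defined by substituting $z+u_i$ for the $i$-th variable (expanded in nonnegative powers of the $u_i$). **Braiding.** For $n,m\geqslant 1$ and $0\leqslant k\leqslant\min\{m,n\}$ let $I_k^{n,m}$ be the family of all sets of $k$ ordered pairs in $\{1,\dots,n\}\times\{n+1,\dots,n+m\}$ with all coordinates mutually distinct, and $i'$ the complement in $\{1,\dots,n+m\}$ of the coordinates occurring in $i$. $\mathcal S(z):\mathrm{H}^+_N\otimes\mathrm{H}^+_N\to\mathrm{H}^+_N\otimes\mathrm{H}^+_N[z^{-1}]_h$ is the unique $\mathbb C[[h]]$-module map such that for all $n,m\geqslant0$, in $(\mathrm{End}\,\mathbb C^N)^{\otimes (n+m)}\otimes\mathrm{H}^+_N\otimes\mathrm{H}^+_N$, $$\mathcal S(z)\,x^{+13}_{[n]}(u)x^{+24}_{[m]}(v)=\sum_{k=0}^{\min\{m,n\}}\ \sum_{\substack{i=\{(i_1,j_1),\dots,(i_k,j_k)\}\in I_k^{n,m}\\ l_1<\dots<l_{n+m-2k}\in i'}}T_{i_1j_1}\cdots T_{i_kj_k}\,x^+_{l_1}\cdots x^+_{l_{n+m-2k}},$$ where $x_{[n]}^{+13}(u)x_{[m]}^{+24}(v)=x^+_{1\,n+m+1}(u_1)\cdots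 x^+_{n\,n+m+1}(u_n)x^+_{n+1\,n+m+2}(v_1)\cdots x^+_{n+m\,n+m+2}(v_m)$ (empty products being $\mathbf 1$), $T_{i_pj_p}=T_{i_pj_p}(z+u_{i_p}-v_{j_p-n})$, and $x^+_{l}=x^+_{l\,n+m+1}(u_l)$ for $l\leqslant n$, $x^+_l=x^+_{l\,n+m+2}(v_{l-n})$ for $l>n$ (only the $k=0$ term occurs if $n=0$ or $m=0$). **Quantum vertex algebra** (Etingof–Kazhdan): a quadruple $(V,Y,\mathbf 1,\mathcal S)$ such that (1) $V$ is a topologically free $\mathbb C[[h]]$-module. (2) $Y:V\otimes V\to V((z))_h$, $u\otimes v\mapsto Y(z)(u\otimes v)=Y(u,z)v=\sum_{r}u_rv\,z^{-r-1}$ is a $\mathbb C[[h]]$-module map satisfying weak associativity: for all $u,v,w\in V$, $n\geqslant0$ there is $s\geqslant0$ with $(z_0+z_2)^sY(u,z_0+z_2)Y(v,z_2)w-(z_0+z_2)^sY(Y(u,z_0)v,z_2)w\in h^nV[[z_0^{\pm1},z_2^{\pm1}]]$. (3) $\mathbf 1\in V$ satisfies $Y(\mathbf 1,z)v=v$, $Y(v,z)\mathbf 1\in V[[z]]$, $\lim_{z\to0}Y(v,z)\mathbf 1=v$ for all $v\in V$. (4) $\mathcal S(z):V\otimes V\to V\otimes V\otimes\mathbb C((z))[[h]]$ is a $\mathbb C[[h]]$-module map of the form $1+O(h)$ satisfying: the Yang–Baxter equation $\mathcal S_{12}(z_1)\mathcal S_{13}(z_1+z_2)\mathcal S_{23}(z_2)=\mathcal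 S_{23}(z_2)\mathcal S_{13}(z_1+z_2)\mathcal S_{12}(z_1)$; unitarity $\mathcal S_{21}(z)=\mathcal S^{-1}(-z)$; the shift condition $[D\otimes1,\mathcal S(z)]=-\frac{d}{dz}\mathcal S(z)$ with $Dv=v_{-2}\mathbf 1$; $\mathcal S$-locality: for all $u,v\in V$, $n\geqslant0$ there is $r\geqslant0$ such that for all $w\in V$, $(z_1-z_2)^rY(z_1)(1\otimes Y(z_2))(\mathcal S(z_1-z_2)(u\otimes v)\otimes w)-(z_1-z_2)^rY(z_2)(1\otimes Y(z_1))(v\otimes u\otimes w)\in h^nV[[z_1^{\pm1},z_2^{\pm1}]]$; and the hexagon identity $\mathcal S(z_1)(Y(z_2)\otimes1)=(Y(z_2)\otimes1)\mathcal S_{23}(z_1)\mathcal S_{13}(z_1+z_2)$. *)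

theory Defs
  imports "HOL-Analysis.Analysis" "HOL-Library.Poly_Mapping" "HOL-Library.FuncSet"
    "HOL-Computational_Algebra.Formal_Laurent_Series"
begin

section \<open>Modules over complex power series in h\<close>

text \<open>The parameter h is \<^term>\<open>fps_X :: complex fps\<close>.\<close>

class hmodule = ab_group_add +
  fixes hscale :: "complex fps \<Rightarrow> 'a \<Rightarrow> 'a"  (infixr \<open>*\<^sub>h\<close> 75)
  assumes hscale_right_distrib: "a *\<^sub>h (x + y) = a *\<^sub>h x + a *\<^sub>h y"
    and hscale_left_distrib: "(a + b) *\<^sub>h x = a *\<^sub>h x + b *\<^sub>h x"
    and hscale_hscale: "a *\<^sub>h (b *\<^sub>h x) = (a * b) *\<^sub>h x"
    and hscale_one: "1 *\<^sub>h x = x"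

global_interpretation hmod: module "hscale :: complex fps \<Rightarrow> 'a \<Rightarrow> 'a::hmodule"
  by unfold_locales (simp_all add: hscale_right_distrib hscale_left_distrib hscale_hscale hscale_one)

abbreviation hlinear :: "('a::hmodule \<Rightarrow> 'b::hmodule) \<Rightarrow> bool"
  where "hlinear \<equiv> module_hom hscale hscale"

definition hpow :: "nat \<Rightarrow> 'a::hmodule set"
  where "hpow n = range (hscale (fps_X ^ n))"

lemma hpow_zero: "0 \<in> hpow n"
  unfolding hpow_def by (rule range_eqI[of _ _ 0]) simp

lemma hpow_add: "x \<in> hpow n \<Longrightarrow> y \<in> hpow n \<Longrightarrow> x + y \<in> hpow n"
  unfolding hpow_def by (auto simp flip: hscale_right_distrib)

lemma hpow_scale:
  assumes "x \<in> hpow n"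
  shows "a *\<^sub>h x \<in> hpow n"
proof -
  from assms obtain y where "x = fps_X ^ n *\<^sub>h y" unfolding hpow_def by auto
  then have "a *\<^sub>h x = fps_X ^ n *\<^sub>h (a *\<^sub>h y)" by (simp add: hscale_hscale mult.commute)
  then show ?thesis unfolding hpow_def by (rule range_eqI)
qed

lemma hpow_uminus: "x \<in> hpow n \<Longrightarrow> - x \<in> hpow n"
  using hpow_scale[of x n "- 1"] by simp

lemma hpow_diff: "x \<in> hpow n \<Longrightarrow> y \<in> hpow n \<Longrightarrow> x - y \<in> hpow n"
  using hpow_add[of x n "- y"] hpow_uminus[of y n] by simp

definition hcauchy :: "(nat \<Rightarrow> 'a::hmodule) \<Rightarrow> bool"
  where "hcauchy s \<longleftrightarrow> (\<forall>n. s (Suc n) - s n \<in> hpow n)"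

definition topologically_free :: "'a::hmodule itself \<Rightarrow> bool"
  where "topologically_free _ \<longleftrightarrow>
    (\<forall>a (x::'a). a *\<^sub>h x = 0 \<longrightarrow> a = 0 \<or> x = 0) \<and>
    (\<Inter>n. hpow n) = {0::'a} \<and>
    (\<forall>s::nat \<Rightarrow> 'a. hcauchy s \<longrightarrow> (\<exists>x. \<forall>n. s n - x \<in> hpow n))"

text \<open>Unconditional h-adic summation; it determines the value when the module is separated.\<close>

definition has_hsum :: "('i \<Rightarrow> 'a::hmodule) \<Rightarrow> 'i set \<Rightarrow> 'a \<Rightarrow> bool"
  where "has_hsum f A x \<longleftrightarrow>
    (\<forall>n. \<exists>F. finite F \<and> F \<subseteq> A \<and>
      (\<forall>F'. finite F' \<and> F \<subseteq> F' \<and> F' \<subseteq> A \<longrightarrow> sum f F' - x \<in> hpow n))"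

definition hsum :: "('i \<Rightarrow> 'a::hmodule) \<Rightarrow> 'i set \<Rightarrow> 'a"
  where "hsum f A = (THE x. has_hsum f A x)"


section \<open>Completed tensor products\<close>

text \<open>The algebraic tensor product is the free module on pairs modulo \<open>tens_null\<close>.\<close>

inductive_set tens_null :: "(('a::hmodule \<times> 'b::hmodule) \<Rightarrow>\<^sub>0 complex fps) set" where
  add_left: "Poly_Mapping.single (x + x', y) 1 - Poly_Mapping.single (x, y) 1
    - Poly_Mapping.single (x', y) 1 \<in> tens_null"
| add_right: "Poly_Mapping.single (x, y + y') 1 - Poly_Mapping.single (x, y) 1
    - Poly_Mapping.single (x, y') 1 \<in> tens_null"
| scale_left: "Poly_Mapping.single (a *\<^sub>h x, y) 1 - Poly_Mapping.single (x, y) a \<in> tens_null"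
| scale_right: "Poly_Mapping.single (x, a *\<^sub>h y) 1 - Poly_Mapping.single (x, y) a \<in> tens_null"
| zero: "0 \<in> tens_null"
| plus: "p \<in> tens_null \<Longrightarrow> q \<in> tens_null \<Longrightarrow> p + q \<in> tens_null"
| scale: "p \<in> tens_null \<Longrightarrow> Poly_Mapping.map ((*) a) p \<in> tens_null"

lemma lookup_pm_scale:
  "Poly_Mapping.lookup (Poly_Mapping.map ((*) a) p) k = (a :: complex fps) * Poly_Mapping.lookup p k"
  by (simp add: Poly_Mapping.map.rep_eq when_def)

lemma pm_scale_minus_one: "Poly_Mapping.map ((*) (- 1 :: complex fps)) p = - p"
  by (rule poly_mapping_eqI) (simp add: lookup_pm_scale)

lemma tens_null_uminus: "p \<in> tens_null \<Longrightarrow> - p \<in> tens_null"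
  using tens_null.scale[of p "- 1"] by (simp add: pm_scale_minus_one)

lemma tens_null_diff: "p \<in> tens_null \<Longrightarrow> q \<in> tens_null \<Longrightarrow> p - q \<in> tens_null"
  using tens_null.plus[of p "- q"] tens_null_uminus[of q] by simp

quotient_type (overloaded) ('a, 'b) atensor =
  "(('a::hmodule \<times> 'b::hmodule) \<Rightarrow>\<^sub>0 complex fps)" / "\<lambda>p q. p - q \<in> tens_null"
proof (rule equivpI)
  show "reflp (\<lambda>p q :: ('a \<times> 'b) \<Rightarrow>\<^sub>0 complex fps. p - q \<in> tens_null)"
    by (auto intro!: reflpI tens_null.zero)
  show "symp (\<lambda>p q :: ('a \<times> 'b) \<Rightarrow>\<^sub>0 complex fps. p - q \<in> tens_null)"
    by (rule sympI) (metis tens_null_uminus minus_diff_eq)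
  show "transp (\<lambda>p q :: ('a \<times> 'b) \<Rightarrow>\<^sub>0 complex fps. p - q \<in> tens_null)"
    by (rule transpI) (use tens_null.plus in fastforce)
qed

instantiation atensor :: (hmodule, hmodule) hmodule
begin

lift_definition zero_atensor :: "('a, 'b) atensor" is 0 .

lift_definition plus_atensor :: "('a, 'b) atensor \<Rightarrow> ('a, 'b) atensor \<Rightarrow> ('a, 'b) atensor"
  is "(+)" by (simp add: add_diff_add tens_null.plus)

lift_definition uminus_atensor :: "('a, 'b) atensor \<Rightarrow> ('a, 'b) atensor"
  is uminus by (simp only: minus_diff_minus tens_null_uminus)

lift_definition minus_atensor :: "('a, 'b) atensor \<Rightarrow> ('a, 'b) atensor \<Rightarrow> ('a, 'b) atensor"
  is "(-)"
proof -
  fix p p' q q' :: "('a \<times> 'b) \<Rightarrow>\<^sub>0 complex fps"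
  assume "p - p' \<in> tens_null" "q - q' \<in> tens_null"
  then have "(p - p') - (q - q') \<in> tens_null" by (rule tens_null_diff)
  then show "p - q - (p' - q') \<in> tens_null" by (simp add: algebra_simps)
qed

lift_definition hscale_atensor :: "complex fps \<Rightarrow> ('a, 'b) atensor \<Rightarrow> ('a, 'b) atensor"
  is "\<lambda>a. Poly_Mapping.map ((*) a)"
proof -
  fix a and p q :: "('a \<times> 'b) \<Rightarrow>\<^sub>0 complex fps"
  assume "p - q \<in> tens_null"
  then have "Poly_Mapping.map ((*) a) (p - q) \<in> tens_null" by (rule tens_null.scale)
  moreover have "Poly_Mapping.map ((*) a) (p - q)
      = Poly_Mapping.map ((*) a) p - Poly_Mapping.map ((*) a) q"
    by (rule poly_mapping_eqI) (simp add: lookup_pm_scale lookup_minus algebra_simps)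
  ultimately show "Poly_Mapping.map ((*) a) p - Poly_Mapping.map ((*) a) q \<in> tens_null" by simp
qed

instance
proof
  fix a b :: "complex fps" and x y z :: "('a, 'b) atensor"
  have eqI: "p = q \<Longrightarrow> p - q \<in> tens_null" for p q :: "('a \<times> 'b) \<Rightarrow>\<^sub>0 complex fps"
    by (simp add: tens_null.zero)
  show "x + y + z = x + (y + z)" by transfer (rule eqI, simp add: algebra_simps)
  show "x + y = y + x" by transfer (rule eqI, simp add: algebra_simps)
  show "0 + x = x" by transfer (rule eqI, simp)
  show "- x + x = 0" by transfer (rule eqI, simp)
  show "x - y = x + - y" by transfer (rule eqI, simp)
  show "a *\<^sub>h (x + y) = a *\<^sub>h x + a *\<^sub>h y"
    by transfer (rule eqI, rule poly_mapping_eqI, simp add: lookup_pm_scale lookup_add algebra_simps)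
  show "(a + b) *\<^sub>h x = a *\<^sub>h x + b *\<^sub>h x"
    by transfer (rule eqI, rule poly_mapping_eqI, simp add: lookup_pm_scale lookup_add algebra_simps)
  show "a *\<^sub>h (b *\<^sub>h x) = (a * b) *\<^sub>h x"
    by transfer (rule eqI, rule poly_mapping_eqI, simp add: lookup_pm_scale algebra_simps)
  show "1 *\<^sub>h x = x"
    by transfer (rule eqI, rule poly_mapping_eqI, simp add: lookup_pm_scale)
qed

end

lift_definition apure :: "'a::hmodule \<Rightarrow> 'b::hmodule \<Rightarrow> ('a, 'b) atensor"
  is "\<lambda>x y. Poly_Mapping.single (x, y) 1" .

text \<open>The h-adic completion, i.e. the inverse limit of the quotients by \<open>hpow n\<close>: the entry \<open>s n\<close>
  of a sequence only matters modulo \<open>hpow n\<close>.\<close>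

quotient_type (overloaded) 'a hcompletion = "nat \<Rightarrow> 'a::hmodule" / partial:
  "\<lambda>s t. hcauchy s \<and> hcauchy t \<and> (\<forall>n. s n - t n \<in> hpow n)"
proof (rule part_equivpI)
  show "\<exists>s::nat \<Rightarrow> 'a. hcauchy s \<and> hcauchy s \<and> (\<forall>n. s n - s n \<in> hpow n)"
    by (rule exI[of _ "\<lambda>_. 0"]) (simp add: hcauchy_def hpow_zero)
  show "symp (\<lambda>s t :: nat \<Rightarrow> 'a. hcauchy s \<and> hcauchy t \<and> (\<forall>n. s n - t n \<in> hpow n))"
    by (rule sympI) (metis hpow_uminus minus_diff_eq)
  show "transp (\<lambda>s t :: nat \<Rightarrow> 'a. hcauchy s \<and> hcauchy t \<and> (\<forall>n. s n - t n \<in> hpow n))"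
    by (rule transpI) (use hpow_add in fastforce)
qed

lemma hcauchy_zero: "hcauchy (\<lambda>_. 0)"
  by (simp add: hcauchy_def hpow_zero)

lemma hcauchy_add: "hcauchy s \<Longrightarrow> hcauchy t \<Longrightarrow> hcauchy (\<lambda>n. s n + t n)"
  unfolding hcauchy_def by (simp add: add_diff_add hpow_add)

lemma hcauchy_scale: "hcauchy s \<Longrightarrow> hcauchy (\<lambda>n. a *\<^sub>h s n)"
  unfolding hcauchy_def by (simp add: hpow_scale flip: hmod.scale_right_diff_distrib)

lemma hcauchy_uminus: "hcauchy s \<Longrightarrow> hcauchy (\<lambda>n. - s n)"
  using hcauchy_scale[of s "- 1"] by simp

lemma hcauchy_diff: "hcauchy s \<Longrightarrow> hcauchy t \<Longrightarrow> hcauchy (\<lambda>n. s n - t n)"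
  using hcauchy_add[of s "\<lambda>n. - t n"] hcauchy_uminus[of t] by simp

instantiation hcompletion :: (hmodule) hmodule
begin

lift_definition zero_hcompletion :: "'a hcompletion" is "\<lambda>_. 0"
  by (simp add: hcauchy_zero hpow_zero)

lift_definition plus_hcompletion :: "'a hcompletion \<Rightarrow> 'a hcompletion \<Rightarrow> 'a hcompletion"
  is "\<lambda>s t n. s n + t n"
  by (simp add: hcauchy_add hpow_add add_diff_add)

lift_definition uminus_hcompletion :: "'a hcompletion \<Rightarrow> 'a hcompletion"
  is "\<lambda>s n. - s n"
  by (metis hcauchy_uminus hpow_uminus minus_diff_minus)

lift_definition minus_hcompletion :: "'a hcompletion \<Rightarrow> 'a hcompletion \<Rightarrow> 'a hcompletion"
  is "\<lambda>s t n. s n - t n"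
proof -
  fix s s' t t' :: "nat \<Rightarrow> 'a"
  assume 1: "hcauchy s \<and> hcauchy s' \<and> (\<forall>n. s n - s' n \<in> hpow n)"
    and 2: "hcauchy t \<and> hcauchy t' \<and> (\<forall>n. t n - t' n \<in> hpow n)"
  have "s n - t n - (s' n - t' n) \<in> hpow n" for n
  proof -
    have "(s n - s' n) - (t n - t' n) \<in> hpow n"
      using 1 2 by (simp add: hpow_diff)
    then show ?thesis by (simp add: algebra_simps)
  qed
  moreover have "hcauchy (\<lambda>n. s n - t n)" "hcauchy (\<lambda>n. s' n - t' n)"
    using 1 2 by (simp_all add: hcauchy_diff)
  ultimately show "hcauchy (\<lambda>n. s n - t n) \<and> hcauchy (\<lambda>n. s' n - t' n) \<and>
      (\<forall>n. s n - t n - (s' n - t' n) \<in> hpow n)"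
    by simp
qed

lift_definition hscale_hcompletion :: "complex fps \<Rightarrow> 'a hcompletion \<Rightarrow> 'a hcompletion"
  is "\<lambda>a s n. a *\<^sub>h s n"
  by (simp add: hcauchy_scale hpow_scale flip: hmod.scale_right_diff_distrib)

instance
proof
  fix a b :: "complex fps" and x y z :: "'a hcompletion"
  show "x + y + z = x + (y + z)"
    by transfer (simp add: hcauchy_add hpow_zero algebra_simps)
  show "x + y = y + x"
    by transfer (simp add: hcauchy_add hpow_zero algebra_simps)
  show "0 + x = x"
    by transfer (simp add: hpow_zero)
  show "- x + x = 0"
    by transfer (simp add: hcauchy_zero hpow_zero)
  show "x - y = x + - y"
    by transfer (simp add: hcauchy_diff hpow_zero)
  show "a *\<^sub>h (x + y) = a *\<^sub>h x + a *\<^sub>h y"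
    by transfer (simp add: hcauchy_scale hcauchy_add hpow_zero hscale_right_distrib)
  show "(a + b) *\<^sub>h x = a *\<^sub>h x + b *\<^sub>h x"
    by transfer (simp add: hcauchy_scale hcauchy_add hpow_zero hscale_left_distrib)
  show "a *\<^sub>h (b *\<^sub>h x) = (a * b) *\<^sub>h x"
    by transfer (simp add: hcauchy_scale hpow_zero)
  show "1 *\<^sub>h x = x"
    by transfer (simp add: hpow_zero)
qed

end

lift_definition hembed :: "'a::hmodule \<Rightarrow> 'a hcompletion" is "\<lambda>x _. x"
  by (simp add: hcauchy_def hpow_zero)

type_synonym ('a, 'b) ctensor = "('a, 'b) atensor hcompletion"

definition tensor :: "'a::hmodule \<Rightarrow> 'b::hmodule \<Rightarrow> ('a, 'b) ctensor"  (infixl \<open>\<otimes>\<close> 70)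
  where "x \<otimes> y = hembed (apure x y)"

text \<open>The linear maps induced by a bilinear, respectively trilinear map. They exist uniquely if the
  target is complete and separated.\<close>

definition lift2 :: "('a::hmodule \<Rightarrow> 'b::hmodule \<Rightarrow> 'c::hmodule) \<Rightarrow> ('a, 'b) ctensor \<Rightarrow> 'c"
  where "lift2 f = (THE L. hlinear L \<and> (\<forall>x y. L (x \<otimes> y) = f x y))"

definition lift3 ::
    "('a::hmodule \<Rightarrow> 'b::hmodule \<Rightarrow> 'c::hmodule \<Rightarrow> 'd::hmodule) \<Rightarrow> (('a, 'b) ctensor, 'c) ctensor \<Rightarrow> 'd"
  where "lift3 f = lift2 (\<lambda>t z. lift2 (\<lambda>x y. f x y z) t)"

type_synonym 'a tensor2 = "('a, 'a) ctensor"
type_synonym 'a tensor3 = "('a tensor2, 'a) ctensor"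


section \<open>Formal series\<close>

text \<open>A series is its coefficient function on exponents: \<open>f k\<close> is the coefficient of \<open>z\<^sup>k\<close> in a
  one-variable series, \<open>f (k, l)\<close> that of \<open>z\<^sub>1\<^sup>k z\<^sub>2\<^sup>l\<close>. An operator-valued series \<open>F\<close> stands for
  \<open>x \<mapsto> (\<Sum>k. F k x z\<^sup>k)\<close>.\<close>

definition in_laurent :: "(int \<Rightarrow> 'a::hmodule) \<Rightarrow> bool"
  where "in_laurent f \<longleftrightarrow> (\<forall>n. \<exists>K. \<forall>k<K. f k \<in> hpow n)"

definition in_negative :: "(int \<Rightarrow> 'a::hmodule) \<Rightarrow> bool"
  where "in_negative f \<longleftrightarrow> in_laurent f \<and> (\<forall>k>0. f k = 0)"

text \<open>Membership in the completed tensor product of a topologically free module with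
  \<open>\<complex>((z))[[h]]\<close>: modulo every power of h, the series is a finite sum of \<open>w\<^sub>i g\<^sub>i(z)\<close>. This is
  stronger than \<^const>\<open>in_laurent\<close>.\<close>

definition in_tensor_laurent :: "(int \<Rightarrow> 'a::hmodule) \<Rightarrow> bool"
  where "in_tensor_laurent f \<longleftrightarrow>
    (\<forall>n. \<exists>m (w :: nat \<Rightarrow> 'a) (g :: nat \<Rightarrow> complex fls).
      \<forall>k. f k - (\<Sum>i<m. fps_const (fls_nth (g i) k) *\<^sub>h w i) \<in> hpow n)"

text \<open>The coefficient of \<open>x\<^sup>k y\<^sup>l\<close> in \<open>(x + y)\<^sup>k\<^sup>+\<^sup>l\<close>, respectively \<open>(x - y)\<^sup>k\<^sup>+\<^sup>l\<close>, expanded in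
  nonnegative powers of \<open>y\<close>.\<close>

definition plus_coeff :: "int \<Rightarrow> int \<Rightarrow> complex fps"
  where "plus_coeff k l = (if l < 0 then 0 else fps_const (of_int (k + l) gchoose nat l))"

definition minus_coeff :: "int \<Rightarrow> int \<Rightarrow> complex fps"
  where "minus_coeff k l = (- 1) ^ nat l * plus_coeff k l"

definition at_fst :: "(int \<Rightarrow> 'a \<Rightarrow> 'b::hmodule) \<Rightarrow> int \<times> int \<Rightarrow> 'a \<Rightarrow> 'b"
  where "at_fst F = (\<lambda>(k, l) x. if l = 0 then F k x else 0)"

definition at_snd :: "(int \<Rightarrow> 'a \<Rightarrow> 'b::hmodule) \<Rightarrow> int \<times> int \<Rightarrow> 'a \<Rightarrow> 'b"
  where "at_snd F = (\<lambda>(k, l) x. if k = 0 then F l x else 0)"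

definition at_plus :: "(int \<Rightarrow> 'a \<Rightarrow> 'b::hmodule) \<Rightarrow> int \<times> int \<Rightarrow> 'a \<Rightarrow> 'b"
  where "at_plus F = (\<lambda>(k, l) x. plus_coeff k l *\<^sub>h F (k + l) x)"

definition at_minus :: "(int \<Rightarrow> 'a \<Rightarrow> 'b::hmodule) \<Rightarrow> int \<times> int \<Rightarrow> 'a \<Rightarrow> 'b"
  where "at_minus F = (\<lambda>(k, l) x. minus_coeff k l *\<^sub>h F (k + l) x)"

definition at_neg :: "(int \<Rightarrow> 'a \<Rightarrow> 'b::hmodule) \<Rightarrow> int \<Rightarrow> 'a \<Rightarrow> 'b"
  where "at_neg F = (\<lambda>k x. if even k then F k x else - F k x)"

definition monomial :: "int \<Rightarrow> int \<Rightarrow> 'a \<Rightarrow> 'a::hmodule"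
  where "monomial r = (\<lambda>k x. if k = r then x else 0)"

text \<open>The composition \<open>F G\<close> of operator-valued series.\<close>

definition series_comp ::
    "('e::ab_group_add \<Rightarrow> 'b \<Rightarrow> 'c::hmodule) \<Rightarrow> ('e \<Rightarrow> 'a \<Rightarrow> 'b) \<Rightarrow> 'e \<Rightarrow> 'a \<Rightarrow> 'c"  (infixr \<open>\<odot>\<close> 75)
  where "(F \<odot> G) = (\<lambda>k x. hsum (\<lambda>j. F j (G (k - j) x)) UNIV)"


section \<open>Quantum vertex algebras\<close>

definition on12 :: "(int \<Rightarrow> 'a tensor2 \<Rightarrow> 'a tensor2) \<Rightarrow> int \<Rightarrow> 'a::hmodule tensor3 \<Rightarrow> 'a tensor3"
  where "on12 S = (\<lambda>k. lift3 (\<lambda>x y z. S k (x \<otimes> y) \<otimes> z))"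

definition on13 :: "(int \<Rightarrow> 'a tensor2 \<Rightarrow> 'a tensor2) \<Rightarrow> int \<Rightarrow> 'a::hmodule tensor3 \<Rightarrow> 'a tensor3"
  where "on13 S = (\<lambda>k. lift3 (\<lambda>x y z. lift2 (\<lambda>x' z'. x' \<otimes> y \<otimes> z') (S k (x \<otimes> z))))"

definition on23 :: "(int \<Rightarrow> 'a tensor2 \<Rightarrow> 'a tensor2) \<Rightarrow> int \<Rightarrow> 'a::hmodule tensor3 \<Rightarrow> 'a tensor3"
  where "on23 S = (\<lambda>k. lift3 (\<lambda>x y z. lift2 (\<lambda>y' z'. x \<otimes> y' \<otimes> z') (S k (y \<otimes> z))))"

definition on21 :: "(int \<Rightarrow> 'a tensor2 \<Rightarrow> 'a tensor2) \<Rightarrow> int \<Rightarrow> 'a::hmodule tensor2 \<Rightarrow> 'a tensor2"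
  where "on21 S = (\<lambda>k t. lift2 (\<lambda>x y. y \<otimes> x) (S k (lift2 (\<lambda>x y. y \<otimes> x) t)))"

text \<open>\<open>Y k t\<close> is the coefficient of \<open>z\<^sup>k\<close> in \<open>Y(z) t\<close>, so the mode usually written \<open>u\<^sub>r v\<close> is
  \<open>Y (- r - 1) (u \<otimes> v)\<close>.\<close>

definition vop :: "(int \<Rightarrow> 'a tensor2 \<Rightarrow> 'a) \<Rightarrow> 'a::hmodule \<Rightarrow> int \<Rightarrow> 'a \<Rightarrow> 'a"
  where "vop Y u = (\<lambda>k v. Y k (u \<otimes> v))"

definition weak_associativity :: "(int \<Rightarrow> 'a::hmodule tensor2 \<Rightarrow> 'a) \<Rightarrow> bool"
  where "weak_associativity Y \<longleftrightarrow>
    (\<forall>u v w n. \<exists>s::nat. \<forall>e.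
      (at_plus (monomial (int s)) \<odot> at_plus (vop Y u) \<odot> at_snd (vop Y v)) e w -
      (at_plus (monomial (int s)) \<odot> (\<lambda>(k, l). vop Y (vop Y u k v) l)) e w \<in> hpow n)"

definition vacuum_axioms :: "(int \<Rightarrow> 'a::hmodule tensor2 \<Rightarrow> 'a) \<Rightarrow> 'a \<Rightarrow> bool"
  where "vacuum_axioms Y vac \<longleftrightarrow>
    (\<forall>v k. vop Y vac k v = (if k = 0 then v else 0)) \<and>
    (\<forall>v. (\<forall>k<0. vop Y v k vac = 0) \<and> vop Y v 0 vac = v)"

definition yang_baxter :: "(int \<Rightarrow> 'a::hmodule tensor2 \<Rightarrow> 'a tensor2) \<Rightarrow> bool"
  where "yang_baxter S \<longleftrightarrow>
    at_fst (on12 S) \<odot> at_plus (on13 S) \<odot> at_snd (on23 S) =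
    at_snd (on23 S) \<odot> at_plus (on13 S) \<odot> at_fst (on12 S)"

definition unitarity :: "(int \<Rightarrow> 'a::hmodule tensor2 \<Rightarrow> 'a tensor2) \<Rightarrow> bool"
  where "unitarity S \<longleftrightarrow>
    on21 S \<odot> at_neg S = monomial 0 \<and> at_neg S \<odot> on21 S = monomial 0"

definition shift_condition ::
    "(int \<Rightarrow> 'a::hmodule tensor2 \<Rightarrow> 'a) \<Rightarrow> 'a \<Rightarrow> (int \<Rightarrow> 'a tensor2 \<Rightarrow> 'a tensor2) \<Rightarrow> bool"
  where "shift_condition Y vac S \<longleftrightarrow>
    (let D1 = lift2 (\<lambda>v w. vop Y v 1 vac \<otimes> w)
     in \<forall>k t. D1 (S k t) - S k (D1 t) = - (fps_const (of_int (k + 1)) *\<^sub>h S (k + 1) t))"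

definition S_locality ::
    "(int \<Rightarrow> 'a::hmodule tensor2 \<Rightarrow> 'a) \<Rightarrow> (int \<Rightarrow> 'a tensor2 \<Rightarrow> 'a tensor2) \<Rightarrow> bool"
  where "S_locality Y S \<longleftrightarrow>
    (\<forall>u v n. \<exists>r::nat. \<forall>w e.
      (at_minus (monomial (int r)) \<odot> (\<lambda>(k, l). lift3 (\<lambda>x y z. vop Y x k (vop Y y l z)))
         \<odot> at_minus (\<lambda>k w. S k (u \<otimes> v) \<otimes> w)) e w -
      (at_minus (monomial (int r)) \<odot> (\<lambda>(k, l) w. vop Y v l (vop Y u k w))) e w \<in> hpow n)"

definition hexagon ::
    "(int \<Rightarrow> 'a::hmodule tensor2 \<Rightarrow> 'a) \<Rightarrow> (int \<Rightarrow> 'a tensor2 \<Rightarrow> 'a tensor2) \<Rightarrow> bool"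
  where "hexagon Y S \<longleftrightarrow>
    (let Y1 = (\<lambda>k. lift2 (\<lambda>t w. Y k t \<otimes> w))
     in at_fst S \<odot> at_snd Y1 = at_snd Y1 \<odot> at_fst (on23 S) \<odot> at_plus (on13 S))"

definition quantum_vertex_algebra ::
    "(int \<Rightarrow> 'a::hmodule tensor2 \<Rightarrow> 'a) \<Rightarrow> 'a \<Rightarrow> (int \<Rightarrow> 'a tensor2 \<Rightarrow> 'a tensor2) \<Rightarrow> bool"
  where "quantum_vertex_algebra Y vac S \<longleftrightarrow>
    topologically_free TYPE('a) \<and>
    (\<forall>k. hlinear (Y k)) \<and> (\<forall>t. in_laurent (\<lambda>k. Y k t)) \<and>
    weak_associativity Y \<and>
    vacuum_axioms Y vac \<and>
    (\<forall>k. hlinear (S k)) \<and> (\<forall>t. in_tensor_laurent (\<lambda>k. S k t)) \<and>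
    (\<forall>k t. S k t - monomial 0 k t \<in> hpow 1) \<and>
    yang_baxter S \<and> unitarity S \<and> shift_condition Y vac S \<and> S_locality Y S \<and> hexagon Y S"


section \<open>The series S\<close>

text \<open>Below, \<open>N = CARD('n)\<close>, and a pair \<open>(i, j)\<close> of type \<^typ>\<open>'n \<times> 'n\<close> stands for the matrix unit
  \<open>e\<^sub>i\<^sub>j\<close>. Operators on the twofold tensor square of \<open>\<complex>\<^sup>N\<close> are matrices indexed by \<^typ>\<open>'n \<times> 'n\<close>;
  the coefficient of \<open>e\<^sub>a\<^sub>b \<otimes> e\<^sub>c\<^sub>d\<close> in \<open>A\<close> is \<open>A $ (a, c) $ (b, d)\<close>. The
  identities defining \<open>G\<close> are in the variable \<open>t = h/u\<close>, with \<open>C\<close> the polynomial variable.\<close>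

type_synonym 'n rmatrix = "complex poly fps ^ ('n \<times> 'n) ^ ('n \<times> 'n)"

definition munit :: "'n \<Rightarrow> 'n \<Rightarrow> 'a::zero_neq_one ^ 'n ^ 'n"
  where "munit i j = (\<chi> k l. if k = i \<and> l = j then 1 else 0)"

definition kron :: "'a::times ^ 'n ^ 'n \<Rightarrow> 'a ^ 'n ^ 'n \<Rightarrow> 'a ^ ('n \<times> 'n) ^ ('n \<times> 'n)"
  where "kron A B = (\<chi> p q. A $ fst p $ fst q * B $ snd p $ snd q)"

definition permP :: "('n::finite) rmatrix"
  where "permP = (\<Sum>i\<in>UNIV. \<Sum>j\<in>UNIV. kron (munit i j) (munit j i))"

text \<open>\<open>R(u)\<close> as a function of \<open>q = h/u\<close>.\<close>

definition Rmat :: "complex poly fps \<Rightarrow> ('n::finite) rmatrix"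
  where "Rmat q = mat 1 - mat q ** permP"

text \<open>\<open>h / (- u - h C) = - (\<Sum>k. (- C)\<^sup>k t\<^sup>k\<^sup>+\<^sup>1)\<close>.\<close>

definition shifted_arg :: "complex poly fps"
  where "shifted_arg = Abs_fps (\<lambda>k. if k = 0 then 0 else - ((- [:0, 1:]) ^ (k - 1)))"

definition GRR :: "complex poly fps \<Rightarrow> ('n::finite) rmatrix"
  where "GRR G = mat G ** Rmat fps_X ** Rmat shifted_arg"

definition partial_trace1 :: "'a::comm_monoid_add ^ ('n \<times> 'n) ^ ('n \<times> 'n) \<Rightarrow> 'a ^ 'n ^ ('n::finite)"
  where "partial_trace1 A = (\<chi> c d. \<Sum>a\<in>UNIV. A $ (a, c) $ (a, d))"

definition partial_trace2 :: "'a::comm_monoid_add ^ ('n \<times> 'n) ^ ('n \<times> 'n) \<Rightarrow> 'a ^ 'n ^ ('n::finite)"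
  where "partial_trace2 A = (\<chi> a b. \<Sum>c\<in>UNIV. A $ (a, c) $ (b, c))"

definition Gseries :: "'n::finite itself \<Rightarrow> complex poly fps"
  where "Gseries _ = (THE G.
    partial_trace1 (GRR G - mat 1 :: 'n rmatrix) = 0 \<and>
    partial_trace2 (GRR G - mat 1 :: 'n rmatrix) = 0)"

text \<open>\<open>Sser c e f m\<close> is the coefficient of \<open>u\<^sup>m\<close> in the component of \<open>S(u, c)\<close> at \<open>e \<otimes> f\<close>; the
  monomial \<open>h\<^sup>-\<^sup>2 t\<^sup>k\<close> is \<open>h\<^sup>k\<^sup>-\<^sup>2 u\<^sup>-\<^sup>k\<close>, and the terms with \<open>k < 2\<close> vanish.\<close>

definition Sser :: "complex \<Rightarrow> 'n::finite \<times> 'n \<Rightarrow> 'n \<times> 'n \<Rightarrow> int \<Rightarrow> complex fps"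
  where "Sser c e f m =
    (if m > - 2 then 0
     else let A = GRR (Gseries TYPE('n)) - mat 1 :: 'n rmatrix; k = nat (- m)
       in fps_const (poly (fps_nth (A $ (fst e, fst f) $ (snd e, snd f)) k) c) * fps_X ^ (k - 2))"

definition Tser :: "complex \<Rightarrow> 'n::finite \<times> 'n \<Rightarrow> 'n \<times> 'n \<Rightarrow> int \<Rightarrow> complex fps"
  where "Tser c e f m = Sser c e f m - (- 1) ^ nat \<bar>m\<bar> * Sser c e f m"


section \<open>The algebra\<close>

text \<open>The variable with key \<open>((i, j), r)\<close> is \<open>x\<^sub>i\<^sub>j\<^sup>(\<^sup>-\<^sup>r\<^sup>-\<^sup>1\<^sup>)\<close>, with \<open>r \<ge> 0\<close>.\<close>

type_synonym 'n xpoly = "((('n \<times> 'n) \<times> nat) \<Rightarrow>\<^sub>0 nat) \<Rightarrow>\<^sub>0 complex"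

definition xvar :: "'n \<times> 'n \<Rightarrow> nat \<Rightarrow> 'n xpoly fps"
  where "xvar e r = fps_const (Poly_Mapping.single (Poly_Mapping.single (e, r) 1) 1)"

text \<open>The smallest h-adically closed ideal containing the traces; the last clause is closedness.\<close>

inductive_set trace_ideal :: "('n::finite) xpoly fps set" where
  gen: "(\<Sum>i\<in>UNIV. xvar (i, i) r) \<in> trace_ideal"
| zero: "0 \<in> trace_ideal"
| plus: "p \<in> trace_ideal \<Longrightarrow> q \<in> trace_ideal \<Longrightarrow> p + q \<in> trace_ideal"
| mult: "p \<in> trace_ideal \<Longrightarrow> a * p \<in> trace_ideal"
| limit: "(\<And>n. \<exists>q a. q \<in> trace_ideal \<and> p - q = fps_X ^ n * a) \<Longrightarrow> p \<in> trace_ideal"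

lemma trace_ideal_uminus: "p \<in> trace_ideal \<Longrightarrow> - p \<in> trace_ideal"
  using trace_ideal.mult[of p "- 1"] by simp

lemma trace_ideal_diff: "p \<in> trace_ideal \<Longrightarrow> q \<in> trace_ideal \<Longrightarrow> p - q \<in> trace_ideal"
  using trace_ideal.plus[of p "- q"] trace_ideal_uminus[of q] by simp

lemma lookup_mult_zero_key:
  fixes p q :: "'n xpoly"
  shows "Poly_Mapping.lookup (p * q) 0 = Poly_Mapping.lookup p 0 * Poly_Mapping.lookup q 0"
proof -
  have key: "0 = l + k \<longleftrightarrow> l = 0 \<and> k = 0" for l k :: "(('n \<times> 'n) \<times> nat) \<Rightarrow>\<^sub>0 nat"
    by (auto simp: poly_mapping_eq_iff fun_eq_iff lookup_add)
  have "(\<Sum>k. Poly_Mapping.lookup q k when 0 = l + k)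
      = (Poly_Mapping.lookup q 0 when l = 0)" for l
    by (cases "l = 0") (simp_all add: key)
  then show ?thesis
    by (simp add: lookup_mult mult_when)
qed

lemma trace_ideal_constant_term:
  fixes p :: "'n::finite xpoly fps"
  shows "p \<in> trace_ideal \<Longrightarrow> Poly_Mapping.lookup (fps_nth p 0) 0 = 0"
proof (induction rule: trace_ideal.induct)
  case (gen r)
  have "(0 :: (('n \<times> 'n) \<times> nat) \<Rightarrow>\<^sub>0 nat) \<noteq> Poly_Mapping.single k (Suc 0)" for k
    by (metis lookup_single_eq lookup_zero nat.distinct(1))
  then have "Poly_Mapping.single k (Suc 0) \<noteq> (0 :: (('n \<times> 'n) \<times> nat) \<Rightarrow>\<^sub>0 nat)" for k
    by metis
  then show ?case
    by (simp add: xvar_def fps_sum_nth lookup_sum lookup_single when_def)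
next
  case (limit p)
  then obtain q a where "Poly_Mapping.lookup (fps_nth q 0) 0 = 0" "p - q = fps_X ^ 1 * a"
    by blast
  then have "Poly_Mapping.lookup (fps_nth (p - q) 0) 0 = 0" by simp
  with \<open>Poly_Mapping.lookup (fps_nth q 0) 0 = 0\<close> show ?case
    by (simp add: lookup_minus)
qed (simp_all add: lookup_add lookup_mult_zero_key)

quotient_type (overloaded) 'n Hplus = "('n::finite) xpoly fps" / "\<lambda>p q. p - q \<in> trace_ideal"
proof (rule equivpI)
  show "reflp (\<lambda>p q :: 'n xpoly fps. p - q \<in> trace_ideal)"
    by (auto intro!: reflpI trace_ideal.zero)
  show "symp (\<lambda>p q :: 'n xpoly fps. p - q \<in> trace_ideal)"
    by (rule sympI) (metis trace_ideal_uminus minus_diff_eq)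
  show "transp (\<lambda>p q :: 'n xpoly fps. p - q \<in> trace_ideal)"
    by (rule transpI) (use trace_ideal.plus in fastforce)
qed

instantiation Hplus :: (finite) comm_ring_1
begin

lift_definition zero_Hplus :: "'a Hplus" is 0 .
lift_definition one_Hplus :: "'a Hplus" is 1 .

lift_definition plus_Hplus :: "'a Hplus \<Rightarrow> 'a Hplus \<Rightarrow> 'a Hplus" is "(+)"
  by (simp add: add_diff_add trace_ideal.plus)

lift_definition uminus_Hplus :: "'a Hplus \<Rightarrow> 'a Hplus" is uminus
  by (simp only: minus_diff_minus trace_ideal_uminus)

lift_definition minus_Hplus :: "'a Hplus \<Rightarrow> 'a Hplus \<Rightarrow> 'a Hplus" is "(-)"
proof -
  fix p p' q q' :: "'a xpoly fps"
  assume "p - p' \<in> trace_ideal" "q - q' \<in> trace_ideal"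
  then have "(p - p') - (q - q') \<in> trace_ideal" by (rule trace_ideal_diff)
  then show "p - q - (p' - q') \<in> trace_ideal" by (simp add: algebra_simps)
qed

lift_definition times_Hplus :: "'a Hplus \<Rightarrow> 'a Hplus \<Rightarrow> 'a Hplus" is "(*)"
proof -
  fix p p' q q' :: "'a xpoly fps"
  assume "p - p' \<in> trace_ideal" "q - q' \<in> trace_ideal"
  then have "q * (p - p') + p' * (q - q') \<in> trace_ideal"
    by (intro trace_ideal.plus trace_ideal.mult)
  then show "p * q - p' * q' \<in> trace_ideal" by (simp add: algebra_simps)
qed

instance
proof
  fix a b c :: "'a Hplus"
  have eqI: "p = q \<Longrightarrow> p - q \<in> trace_ideal" for p q :: "'a xpoly fps"
    by (simp add: trace_ideal.zero)
  show "a * b * c = a * (b * c)" by transfer (rule eqI, simp add: mult.assoc)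
  show "a * b = b * a" by transfer (rule eqI, simp add: mult.commute)
  show "1 * a = a" by transfer (rule eqI, simp)
  show "a + b + c = a + (b + c)" by transfer (rule eqI, simp add: add.assoc)
  show "a + b = b + a" by transfer (rule eqI, simp add: add.commute)
  show "0 + a = a" by transfer (rule eqI, simp)
  show "- a + a = 0" by transfer (rule eqI, simp)
  show "a - b = a + - b" by transfer (rule eqI, simp)
  show "(a + b) * c = a * c + b * c" by transfer (rule eqI, simp add: distrib_right)
  show "(0 :: 'a Hplus) \<noteq> 1"
  proof transfer
    show "(0 :: 'a xpoly fps) - 1 \<notin> trace_ideal"
      using trace_ideal_constant_term[of "0 - 1 :: 'a xpoly fps"]
      by (auto simp: lookup_minus)
  qed
qed

end

instantiation Hplus :: (finite) hmodule
begin

lift_definition hscale_Hplus :: "complex fps \<Rightarrow> 'a Hplus \<Rightarrow> 'a Hplus"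
  is "\<lambda>a p. Abs_fps (\<lambda>k. Poly_Mapping.single 0 (fps_nth a k)) * p"
  by (metis right_diff_distrib trace_ideal.mult)

instance
proof
  let ?C = "\<lambda>a :: complex fps. Abs_fps (\<lambda>k. Poly_Mapping.single 0 (fps_nth a k)) :: 'a xpoly fps"
  fix a b :: "complex fps" and x y :: "'a Hplus"
  have eqI: "p = q \<Longrightarrow> p - q \<in> trace_ideal" for p q :: "'a xpoly fps"
    by (simp add: trace_ideal.zero)
  have add: "?C (a + b) = ?C a + ?C b" for a b
    by (rule fps_ext) (simp add: single_add)
  have sum: "Poly_Mapping.single 0 (sum f A) = (\<Sum>i\<in>A. Poly_Mapping.single 0 (f i))"
    for f :: "nat \<Rightarrow> complex" and A
    by (induction A rule: infinite_finite_induct) (simp_all add: single_add)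
  have mult: "?C (a * b) = ?C a * ?C b" for a b
    by (rule fps_ext) (simp add: fps_mult_nth sum mult_single)
  have one: "?C 1 = 1"
    by (rule fps_ext) simp
  show "a *\<^sub>h (x + y) = a *\<^sub>h x + a *\<^sub>h y"
    by transfer (rule eqI, simp add: distrib_left)
  show "(a + b) *\<^sub>h x = a *\<^sub>h x + b *\<^sub>h x"
    by transfer (rule eqI, subst add, rule distrib_right)
  show "a *\<^sub>h (b *\<^sub>h x) = (a * b) *\<^sub>h x"
    by transfer (rule eqI, simp only: mult mult.assoc)
  show "1 *\<^sub>h x = x"
    by transfer (rule eqI, simp only: one mult_1)
qed

end

lift_definition Hvar :: "'n::finite \<times> 'n \<Rightarrow> nat \<Rightarrow> 'n Hplus" is xvar .


section \<open>The operators and the braiding\<close>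

text \<open>Elements of n-fold tensor powers of \<open>End \<complex>\<^sup>N\<close> with coefficients in series in variables \<open>u\<^sub>l\<close>,
  \<open>l \<in> A\<close>, are given by their components: \<open>es l\<close> is the matrix unit in the l-th tensor factor and
  \<open>ks l\<close> the exponent of \<open>u\<^sub>l\<close>. In all products below the operators act on distinct tensor factors,
  so that the component of a product is the product of the components.\<close>

definition xplus :: "'n::finite \<times> 'n \<Rightarrow> int \<Rightarrow> 'n Hplus"
  where "xplus e k = (if k < 0 then 0 else Hvar e (nat k))"

definition xplus_prod :: "nat set \<Rightarrow> (nat \<Rightarrow> 'n::finite \<times> 'n) \<Rightarrow> (nat \<Rightarrow> int) \<Rightarrow> 'n Hplus"
  where "xplus_prod A es ks = (\<Prod>l\<in>A. xplus (es l) (ks l))"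

text \<open>The coefficient of \<open>u\<^sub>p\<^sup>k\<^sub>p u\<^sub>q\<^sup>k\<^sub>q\<close> in \<open>S\<^sub>p\<^sub>q(u\<^sub>p - u\<^sub>q)\<close>.\<close>

definition Sdiff ::
    "complex \<Rightarrow> (nat \<Rightarrow> 'n::finite \<times> 'n) \<Rightarrow> (nat \<Rightarrow> int) \<Rightarrow> nat \<times> nat \<Rightarrow> complex fps"
  where "Sdiff c es ks = (\<lambda>(p, q). minus_coeff (ks p) (ks q) * Sser c (es p) (es q) (ks p + ks q))"

definition xminus :: "complex \<Rightarrow> 'n::finite \<times> 'n \<Rightarrow> int \<Rightarrow> 'n Hplus \<Rightarrow> 'n Hplus"
  where "xminus c = (THE X.
    (\<forall>e k. hlinear (X e k)) \<and>
    (\<forall>e v. in_negative (\<lambda>k. X e k v)) \<and>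
    (\<forall>e v. X e 0 v = 0) \<and>
    (\<forall>e k. X e k 1 = 0) \<and>
    (\<forall>n\<ge>1. \<forall>es ks. X (es 0) (ks 0) (xplus_prod {1..n} es ks) =
       - (\<Sum>j=1..n. Sdiff c es ks (0, j) *\<^sub>h xplus_prod ({1..n} - {j}) es ks)))"

definition xop :: "complex \<Rightarrow> 'n::finite \<times> 'n \<Rightarrow> int \<Rightarrow> 'n Hplus \<Rightarrow> 'n Hplus"
  where "xop c e k v = xplus e k * v + xminus c e k v"

definition coords :: "nat \<times> nat \<Rightarrow> nat set"
  where "coords = (\<lambda>(p, q). {p, q})"

definition pairings :: "nat \<Rightarrow> nat \<Rightarrow> (nat \<times> nat) set set"
  where "pairings n k = {i. i \<subseteq> {(p, q). p \<in> {1..n} \<and> q \<in> {1..n} \<and> p < q} \<and> card i = k \<and>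
    pairwise (\<lambda>a b. coords a \<inter> coords b = {}) i}"

definition bipairings :: "nat \<Rightarrow> nat \<Rightarrow> nat \<Rightarrow> (nat \<times> nat) set set"
  where "bipairings n m k = {i. i \<subseteq> {1..n} \<times> {n+1..n+m} \<and> card i = k \<and>
    pairwise (\<lambda>a b. coords a \<inter> coords b = {}) i}"

definition xop_prod ::
    "complex \<Rightarrow> nat set \<Rightarrow> (nat \<Rightarrow> 'n::finite \<times> 'n) \<Rightarrow> (nat \<Rightarrow> int) \<Rightarrow> 'n Hplus \<Rightarrow> 'n Hplus"
  where "xop_prod c A es ks = foldr (\<lambda>l. xop c (es l) (ks l)) (sorted_list_of_set A)"

definition xbracket ::
    "complex \<Rightarrow> nat \<Rightarrow> (nat \<Rightarrow> 'n::finite \<times> 'n) \<Rightarrow> (nat \<Rightarrow> int) \<Rightarrow> 'n Hplus \<Rightarrow> 'n Hplus"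
  where "xbracket c n es ks v =
    (\<Sum>k=0..n div 2. \<Sum>i\<in>pairings n k.
      (\<Prod>pq\<in>i. Sdiff c es ks pq) *\<^sub>h xop_prod c ({1..n} - \<Union>(coords ` i)) es ks v)"

text \<open>The coefficient of \<open>z\<^sup>a u\<^sub>1\<^sup>b\<^sup>1 \<dots> u\<^sub>n\<^sup>b\<^sup>n\<close> in the series obtained from \<^const>\<open>xbracket\<close> by
  substituting \<open>z + u\<^sub>l\<close> for the l-th variable: the term with exponents \<open>ks\<close> contributes
  \<open>(z + u\<^sub>1)\<^sup>k\<^sup>1 \<dots> (z + u\<^sub>n)\<^sup>k\<^sup>n\<close>.\<close>

definition xbracket_shift ::
    "complex \<Rightarrow> nat \<Rightarrow> (nat \<Rightarrow> 'n::finite \<times> 'n) \<Rightarrow> int \<Rightarrow> (nat \<Rightarrow> int) \<Rightarrow> 'n Hplus \<Rightarrow> 'n Hplus"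
  where "xbracket_shift c n es a bs v =
    hsum (\<lambda>ks. (\<Prod>l\<in>{1..n}. plus_coeff (ks l - bs l) (bs l)) *\<^sub>h xbracket c n es ks v)
      {ks \<in> {1..n} \<rightarrow>\<^sub>E UNIV. (\<Sum>l\<in>{1..n}. ks l - bs l) = a}"

text \<open>The coefficient of \<open>z\<^sup>a u\<^sub>p\<^sup>k\<^sub>p u\<^sub>q\<^sup>k\<^sub>q\<close> in \<open>T\<^sub>p\<^sub>q(z + u\<^sub>p - u\<^sub>q)\<close>, obtained by substituting
  \<open>w = u\<^sub>p - u\<^sub>q\<close> in \<open>T(z + w)\<close>; here \<open>u\<^sub>n\<^sub>+\<^sub>j\<close> is the variable \<open>v\<^sub>j\<close>. It
  vanishes unless both \<open>k\<^sub>p\<close> and \<open>k\<^sub>q\<close> are nonnegative.\<close>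

definition Tshift ::
    "complex \<Rightarrow> (nat \<Rightarrow> 'n::finite \<times> 'n) \<Rightarrow> (nat \<Rightarrow> int) \<Rightarrow> nat \<times> nat \<Rightarrow> int \<Rightarrow> complex fps"
  where "Tshift c es ks = (\<lambda>(p, q) a.
    plus_coeff a (ks p + ks q) * minus_coeff (ks p) (ks q) *
    Tser c (es p) (es q) (a + ks p + ks q))"

text \<open>In the sum over \<open>\<alpha>\<close>, \<open>\<alpha> pq\<close> is the exponent of \<open>z\<close> taken from the factor \<open>T\<^sub>p\<^sub>q\<close>.\<close>

definition braiding :: "complex \<Rightarrow> int \<Rightarrow> ('n::finite) Hplus tensor2 \<Rightarrow> 'n Hplus tensor2"
  where "braiding c = (THE S.
    (\<forall>k. hlinear (S k)) \<and>
    (\<forall>t. in_negative (\<lambda>k. S k t)) \<and>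
    (\<forall>n m es ks a. S a (xplus_prod {1..n} es ks \<otimes> xplus_prod {n+1..n+m} es ks) =
      (\<Sum>k=0..min m n. \<Sum>i\<in>bipairings n m k.
        hsum (\<lambda>\<alpha>. (\<Prod>pq\<in>i. Tshift c es ks pq (\<alpha> pq)) *\<^sub>h
            (xplus_prod ({1..n} - \<Union>(coords ` i)) es ks \<otimes>
             xplus_prod ({n+1..n+m} - \<Union>(coords ` i)) es ks))
          {\<alpha> \<in> i \<rightarrow>\<^sub>E UNIV. (\<Sum>pq\<in>i. \<alpha> pq) = a})))"

end

theory Submission
  imports Defs
begin

text \<open>Monomials in the generators span a dense submodule, so everything is determined by its values on
  them. Both \<open>Y\<close> and the braiding come from one construction: a family of operator-valued series
  \<open>L p\<close> in which a generator of \<open>p\<close> is replaced by a creation part \<open>A\<close>, applied last, plus an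
  annihilation part \<open>B\<close>, applied first, where \<open>B\<close> is a derivation with scalar values on generators
  (given by \<open>- S\<close> for \<open>Y\<close> and by \<open>T\<close> for the braiding). The \<open>A\<close>'s commute and the \<open>B\<close>'s commute,
  so \<open>L\<close> is well defined, and a generator can be moved through \<open>L p\<close> at the cost of scalars. All axioms
  are proved by induction on the number of generators, using multinomial identities for the
  coefficients of \<open>S(z + u - v)\<close>. In weak associativity and in locality the two sides satisfy the
  same recursion except for the direction in which \<open>(x \<plusminus> y)\<^sup>q\<close> with \<open>q < 0\<close> is expanded; only finitely
  many \<open>q\<close> matter modulo a power of h, so a large power of \<open>x \<plusminus> y\<close> removes the difference. Finally,
  Wick's theorem identifies the normally ordered products \<open>L p\<close> with the bracket \<open>x\<^sub>[\<^sub>n\<^sub>]\<close>.\<close>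

section \<open>Summation in complete modules\<close>

text \<open>Every series is handled through its coefficients, so each axiom becomes an identity
  between infinite multiple sums. The recurring obstacle is the interchange of summations; it is
  licensed by showing that a family indexed by pairs has only finitely many nonzero terms modulo
  each power of h. These bounds come from two sources: the coefficient of z^m in S is divisible by
  h^(-m-2), and a vector is h-adically close to a polynomial in finitely many generators. The
  derivations commute with one another because their values on generators are scalars, and they pass
  to the quotient by the traces because S is traceless in both tensor factors. Locality rests on
  T(z) = S(z) - S(-z): in Y(u,x)Y(v,y)w a generator of u is contracted with v through -S, the
  braiding adds T, and -S(z) + T(z) = -S(-z) is the contraction found when the two fields stand in
  the opposite order, S being symmetric in its tensor factors. This symmetry and the oddness of T
  also give unitarity. The Yang-Baxter equation holds because the three operators commute
  coefficient by coefficient.\<close>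

class hcomplete = hmodule +
  assumes hseparated_raw: "(\<And>n. x \<in> range (hscale (fps_X ^ n))) \<Longrightarrow> x = 0"
    and hcauchy_convergent_raw: "(\<And>n. s (Suc n) - s n \<in> range (hscale (fps_X ^ n)))
      \<Longrightarrow> \<exists>x. \<forall>n. s n - x \<in> range (hscale (fps_X ^ n))"

lemma hseparated: "(\<And>n. x \<in> hpow n) \<Longrightarrow> x = (0::'a::hcomplete)"
  using hseparated_raw unfolding hpow_def by blast

lemma hseparated_eq: "(\<And>n. x - y \<in> hpow n) \<Longrightarrow> x = (y::'a::hcomplete)"
  using hseparated[of "x - y"] by simp

lemma hcauchy_convergent: "hcauchy s \<Longrightarrow> \<exists>x::'a::hcomplete. \<forall>n. s n - x \<in> hpow n"
  using hcauchy_convergent_raw[of s] unfolding hpow_def hcauchy_def by blast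

lemma hpow_0 [simp]: "x \<in> hpow 0"
  unfolding hpow_def by (simp add: hscale_one)

lemma hpow_antimono: "x \<in> hpow n \<Longrightarrow> m \<le> n \<Longrightarrow> x \<in> hpow m"
proof -
  assume "x \<in> hpow n" "m \<le> n"
  then obtain y where "x = fps_X ^ n *\<^sub>h y" unfolding hpow_def by auto
  with \<open>m \<le> n\<close> have "x = fps_X ^ m *\<^sub>h (fps_X ^ (n - m) *\<^sub>h y)"
    by (simp add: hscale_hscale flip: power_add)
  then show ?thesis unfolding hpow_def by (rule range_eqI)
qed

lemma hpow_X: "fps_X ^ n *\<^sub>h x \<in> hpow n"
  unfolding hpow_def by blast

lemma hpow_X_mult: "x \<in> hpow n \<Longrightarrow> fps_X ^ m *\<^sub>h x \<in> hpow (m + n)"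
  unfolding hpow_def by (auto simp: hscale_hscale power_add)

lemma hpow_dvd: "fps_X ^ n dvd a \<Longrightarrow> a *\<^sub>h x \<in> hpow n"
  by (auto simp: dvd_def hpow_X simp flip: hscale_hscale)

lemma hpow_sum: "(\<And>i. i \<in> A \<Longrightarrow> f i \<in> hpow n) \<Longrightarrow> sum f A \<in> hpow n"
  by (induction A rule: infinite_finite_induct) (auto intro: hpow_zero hpow_add)

lemma hpow_add_iff: "x \<in> hpow n \<Longrightarrow> x + y \<in> hpow n \<longleftrightarrow> y \<in> hpow n"
  using hpow_add[of x n y] hpow_diff[of "x + y" n x] by auto

lemma hpow_diff_sym: "x - y \<in> hpow n \<longleftrightarrow> y - x \<in> hpow n"
  using hpow_uminus[of "x - y" n] hpow_uminus[of "y - x" n] by auto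

lemma hpow_diff_trans: "x - y \<in> hpow n \<Longrightarrow> y - z \<in> hpow n \<Longrightarrow> x - z \<in> hpow n"
  using hpow_add[of "x - y" n "y - z"] by simp

lemma hpow_diff_cong: "x - y \<in> hpow n \<Longrightarrow> x \<in> hpow n \<longleftrightarrow> y \<in> hpow n"
  using hpow_add_iff[of "x - y" n y] by simp

section \<open>Linear maps over the power series in h\<close>

named_theorems hlin

lemma hlinearI:
  "(\<And>x y. f (x + y) = f x + f y) \<Longrightarrow> (\<And>a x. f (a *\<^sub>h x) = a *\<^sub>h f x) \<Longrightarrow> hlinear f"
  by (intro module_hom.intro module_hom_axioms.intro hmod.module_axioms) auto

lemma hlinear_add: "hlinear f \<Longrightarrow> f (x + y) = f x + f y"
  by (rule module_hom.add)

lemma hlinear_scale: "hlinear f \<Longrightarrow> f (a *\<^sub>h x) = a *\<^sub>h f x"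
  by (rule module_hom.scale)

lemma hlinear_zero [simp]: "hlinear f \<Longrightarrow> f 0 = 0"
  by (rule module_hom.zero)

lemma hlinear_diff: "hlinear f \<Longrightarrow> f (x - y) = f x - f y"
  by (rule module_hom.diff)

lemma hlinear_uminus: "hlinear f \<Longrightarrow> f (- x) = - f x"
  by (rule module_hom.neg)

lemma hlinear_sum: "hlinear f \<Longrightarrow> f (sum g A) = (\<Sum>i\<in>A. f (g i))"
  by (rule module_hom.sum)

lemma hlinear_hpow: "hlinear f \<Longrightarrow> x \<in> hpow n \<Longrightarrow> f x \<in> hpow n"
  unfolding hpow_def by (auto simp: hlinear_scale)

lemma hlinear_id [hlin]: "hlinear (\<lambda>x. x)"
  by (rule hlinearI) auto

lemma hlinear_0 [hlin]: "hlinear (\<lambda>x. 0)"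
  by (rule hlinearI) auto

lemma hlinear_plus [hlin]: "hlinear f \<Longrightarrow> hlinear g \<Longrightarrow> hlinear (\<lambda>x. f x + g x)"
  by (rule hlinearI) (simp_all add: hlinear_add hlinear_scale hscale_right_distrib)

lemma hlinear_neg [hlin]: "hlinear f \<Longrightarrow> hlinear (\<lambda>x. - f x)"
  by (rule hlinearI) (simp_all add: hlinear_add hlinear_scale)

lemma hlinear_minus [hlin]: "hlinear f \<Longrightarrow> hlinear g \<Longrightarrow> hlinear (\<lambda>x. f x - g x)"
  using hlinear_plus[of f "\<lambda>x. - g x"] hlinear_neg[of g] by simp

lemma hlinear_hscale [hlin]: "hlinear f \<Longrightarrow> hlinear (\<lambda>x. a *\<^sub>h f x)"
  by (rule hlinearI) (simp_all add: hlinear_add hlinear_scale hscale_right_distrib hscale_hscale mult.commute)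

lemma hlinear_if [hlin]: "hlinear f \<Longrightarrow> hlinear g \<Longrightarrow> hlinear (\<lambda>x. if P then f x else g x)"
  by (cases P) auto

lemma hlinear_Sum [hlin]: "(\<And>i. i \<in> A \<Longrightarrow> hlinear (f i)) \<Longrightarrow> hlinear (\<lambda>x. \<Sum>i\<in>A. f i x)"
  by (induction A rule: infinite_finite_induct) (auto intro: hlin)

lemma hlinear_compose: "hlinear g \<Longrightarrow> hlinear f \<Longrightarrow> hlinear (\<lambda>x. g (f x))"
  by (rule hlinearI) (simp_all add: hlinear_add hlinear_scale)

text \<open>A criterion for summability in which no value of the sum occurs; it visibly passes to
  subfamilies, to dominated families and through linear maps.\<close>

definition hnull :: "('i \<Rightarrow> 'a::hmodule) \<Rightarrow> 'i set \<Rightarrow> bool"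
  where "hnull f A \<longleftrightarrow> (\<forall>n. finite {i \<in> A. f i \<notin> hpow n})"

lemma hnullD: "hnull f A \<Longrightarrow> finite {i \<in> A. f i \<notin> hpow n}"
  unfolding hnull_def by blast

lemma hnull_dominated:
  assumes "hnull f A" "\<And>i n. i \<in> A \<Longrightarrow> f i \<in> hpow n \<Longrightarrow> g i \<in> hpow n"
  shows "hnull g A"
  unfolding hnull_def
proof
  fix n
  have "{i \<in> A. g i \<notin> hpow n} \<subseteq> {i \<in> A. f i \<notin> hpow n}" using assms(2) by auto
  then show "finite {i \<in> A. g i \<notin> hpow n}" by (rule finite_subset) (rule hnullD[OF assms(1)])
qed

lemma hnull_cong: "(\<And>i. i \<in> A \<Longrightarrow> f i = g i) \<Longrightarrow> hnull f A \<longleftrightarrow> hnull g A"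
  using hnull_dominated[of f A g] hnull_dominated[of g A f] by auto

lemma hnull_finite_support: "finite {i \<in> A. f i \<noteq> 0} \<Longrightarrow> hnull f A"
  unfolding hnull_def by (rule allI, rule finite_subset[of _ "{i \<in> A. f i \<noteq> 0}"]) (auto simp: hpow_zero)

lemma hnull_zero [simp]: "hnull (\<lambda>_. 0) A"
  by (rule hnull_finite_support) simp

lemma hnull_linear: "hlinear L \<Longrightarrow> hnull f A \<Longrightarrow> hnull (\<lambda>i. L (f i)) A"
  by (erule hnull_dominated) (rule hlinear_hpow)

lemma hnull_scale: "hnull f A \<Longrightarrow> hnull (\<lambda>i. c i *\<^sub>h f i) A"
  by (erule hnull_dominated) (rule hpow_scale)

lemma hnull_add:
  assumes "hnull f A" "hnull g A" shows "hnull (\<lambda>i. f i + g i) A"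
  unfolding hnull_def
proof
  fix n
  have "{i \<in> A. f i + g i \<notin> hpow n} \<subseteq> {i \<in> A. f i \<notin> hpow n} \<union> {i \<in> A. g i \<notin> hpow n}"
    using hpow_add by auto
  then show "finite {i \<in> A. f i + g i \<notin> hpow n}"
    by (rule finite_subset) (simp add: hnullD[OF assms(1)] hnullD[OF assms(2)])
qed

lemma hnull_uminus: "hnull f A \<Longrightarrow> hnull (\<lambda>i. - f i) A"
  by (erule hnull_dominated) (rule hpow_uminus)

lemma hnull_diff: "hnull f A \<Longrightarrow> hnull g A \<Longrightarrow> hnull (\<lambda>i. f i - g i) A"
  using hnull_add[of f A "\<lambda>i. - g i"] hnull_uminus[of g A] by simp

lemma hnull_inj:
  assumes "hnull f B" "inj_on p A" "p ` A \<subseteq> B"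
  shows "hnull (\<lambda>i. f (p i)) A"
  unfolding hnull_def
proof
  fix n
  have "p ` {i \<in> A. f (p i) \<notin> hpow n} \<subseteq> {i \<in> B. f i \<notin> hpow n}" using assms(3) by auto
  then have "finite (p ` {i \<in> A. f (p i) \<notin> hpow n})" by (rule finite_subset) (rule hnullD[OF assms(1)])
  then show "finite {i \<in> A. f (p i) \<notin> hpow n}"
    by (rule finite_imageD) (rule inj_on_subset[OF assms(2)], blast)
qed

lemma hnull_bij: "bij_betw p A B \<Longrightarrow> hnull f B \<longleftrightarrow> hnull (\<lambda>i. f (p i)) A"
proof
  assume p: "bij_betw p A B" and h: "hnull (\<lambda>i. f (p i)) A"
  have "hnull (\<lambda>i. f (p (inv_into A p i))) B"
    by (rule hnull_inj[OF h]) (use p in \<open>auto simp: bij_betw_def inj_on_inv_into inv_into_into\<close>)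
  then show "hnull f B"
    using p by (subst hnull_cong[of B f "\<lambda>i. f (p (inv_into A p i))"]) (auto simp: bij_betw_inv_into_right)
qed (auto intro: hnull_inj simp: bij_betw_def)

text \<open>Modulo \<open>hpow n\<close> finitely many rows survive, each with finitely many
  surviving entries. Nullity of every row alone would not bound the set of rows, hence the first
  assumption.\<close>

lemma hnull_Sigma:
  assumes "\<And>n. finite {i \<in> A. \<exists>j\<in>B i. f i j \<notin> hpow n}" "\<And>i. i \<in> A \<Longrightarrow> hnull (f i) (B i)"
  shows "hnull (\<lambda>(i, j). f i j) (Sigma A B)"
  unfolding hnull_def
proof
  fix n
  have "{x \<in> Sigma A B. (case x of (i, j) \<Rightarrow> f i j) \<notin> hpow n}
      \<subseteq> Sigma {i \<in> A. \<exists>j\<in>B i. f i j \<notin> hpow n} (\<lambda>i. {j \<in> B i. f i j \<notin> hpow n})"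
    by auto
  moreover have "finite \<dots>"
    by (intro finite_SigmaI assms(1) hnullD assms(2)) auto
  ultimately show "finite {x \<in> Sigma A B. (case x of (i, j) \<Rightarrow> f i j) \<notin> hpow n}"
    by (rule finite_subset)
qed

lemma hnull_SigmaD:
  assumes "hnull (\<lambda>(i, j). f i j) (Sigma A B)" "i \<in> A"
  shows "hnull (f i) (B i)"
  using hnull_inj[OF assms(1), of "\<lambda>j. (i, j)" "B i"] assms(2) by (auto simp: inj_on_def)

section \<open>Values of unconditional sums and their interchange\<close>

abbreviation (input) hsum_all :: "('i \<Rightarrow> 'a::hmodule) \<Rightarrow> 'a"  (binder \<open>HSUM \<close> 10)
  where "hsum_all f \<equiv> hsum f UNIV"

lemma has_hsum_unique: "has_hsum f A x \<Longrightarrow> has_hsum f A y \<Longrightarrow> x = (y::'a::hcomplete)"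
proof (rule hseparated_eq)
  fix n
  assume "has_hsum f A x" "has_hsum f A y"
  then obtain F G where F: "finite F" "F \<subseteq> A" "\<And>F'. finite F' \<Longrightarrow> F \<subseteq> F' \<Longrightarrow> F' \<subseteq> A \<Longrightarrow> sum f F' - x \<in> hpow n"
    and G: "finite G" "G \<subseteq> A" "\<And>F'. finite F' \<Longrightarrow> G \<subseteq> F' \<Longrightarrow> F' \<subseteq> A \<Longrightarrow> sum f F' - y \<in> hpow n"
    unfolding has_hsum_def by (metis (no_types))
  have "sum f (F \<union> G) - x \<in> hpow n" "sum f (F \<union> G) - y \<in> hpow n"
    using F(1,2) G(1,2) by (auto intro: F(3) G(3))
  then show "x - y \<in> hpow n" using hpow_diff_sym hpow_diff_trans by blast
qed

lemma hsum_eqI: "has_hsum f A x \<Longrightarrow> hsum f A = (x::'a::hcomplete)"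
  unfolding hsum_def by (rule the_equality, assumption, rule has_hsum_unique)

lemma sum_diff_hpow:
  assumes "finite F" "finite G" "\<And>i. i \<in> (F - G) \<union> (G - F) \<Longrightarrow> f i \<in> hpow n"
  shows "sum f F - sum f G \<in> hpow n"
proof -
  have "sum f F - sum f G = sum f (F - G) - sum f (G - F)"
    using sum.Int_Diff[OF assms(1), of f G] sum.Int_Diff[OF assms(2), of f F]
    by (simp add: Int_commute)
  then show ?thesis using assms(3) by (auto intro!: hpow_diff hpow_sum)
qed

lemma has_hsumI:
  assumes "\<And>n. \<exists>F. finite F \<and> F \<subseteq> A \<and> (\<forall>i\<in>A - F. f i \<in> hpow n) \<and> sum f F - x \<in> hpow n"
  shows "has_hsum f A x"
  unfolding has_hsum_def
proof
  fix n
  obtain F where F: "finite F" "F \<subseteq> A" "\<forall>i\<in>A - F. f i \<in> hpow n" "sum f F - x \<in> hpow n"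
    using assms by blast
  have "sum f F' - x \<in> hpow n" if "finite F'" "F \<subseteq> F'" "F' \<subseteq> A" for F'
    using sum_diff_hpow[of F' F f n] that F hpow_diff_trans by blast
  then show "\<exists>F. finite F \<and> F \<subseteq> A \<and> (\<forall>F'. finite F' \<and> F \<subseteq> F' \<and> F' \<subseteq> A \<longrightarrow> sum f F' - x \<in> hpow n)"
    using F by blast
qed

text \<open>Passing from \<open>S n\<close> to \<open>S (Suc n)\<close> adds only terms of
  \<open>hpow n\<close>, so the finite sums over the sets \<open>S n\<close> form a Cauchy sequence,
  and its limit is the value.\<close>

lemma has_hsum_hsum:
  assumes "hnull f A" shows "has_hsum f A (hsum f A :: 'a::hcomplete)"
proof -
  define S where "S n = {i \<in> A. f i \<notin> hpow n}" for n
  have fin: "finite (S n)" for n using assms by (auto simp: S_def hnullD)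
  have "hcauchy (\<lambda>n. sum f (S n))"
    unfolding hcauchy_def
  proof
    fix n
    show "sum f (S (Suc n)) - sum f (S n) \<in> hpow n"
      by (rule sum_diff_hpow) (use fin hpow_antimono[of _ "Suc n" n] in \<open>auto simp: S_def\<close>)
  qed
  then obtain x where "\<forall>n. sum f (S n) - x \<in> hpow n" using hcauchy_convergent by blast
  then have "\<exists>F. finite F \<and> F \<subseteq> A \<and> (\<forall>i\<in>A - F. f i \<in> hpow n) \<and> sum f F - x \<in> hpow n" for n
    by (intro exI[of _ "S n"]) (use fin in \<open>auto simp: S_def\<close>)
  then have "has_hsum f A x" by (rule has_hsumI)
  then show ?thesis using hsum_eqI[of f A x] by simp
qed

lemma hsum_approx:
  assumes "hnull f A" "finite F" "F \<subseteq> A" "\<And>i. i \<in> A - F \<Longrightarrow> f i \<in> hpow n"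
  shows "(hsum f A :: 'a::hcomplete) - sum f F \<in> hpow n"
proof -
  obtain G where G: "finite G" "G \<subseteq> A"
    "\<And>F'. finite F' \<Longrightarrow> G \<subseteq> F' \<Longrightarrow> F' \<subseteq> A \<Longrightarrow> sum f F' - hsum f A \<in> hpow n"
    using has_hsum_hsum[OF assms(1)] unfolding has_hsum_def by (metis (no_types))
  have "sum f (F \<union> G) - sum f F \<in> hpow n"
    by (rule sum_diff_hpow) (use assms G in auto)
  moreover have "sum f (F \<union> G) - hsum f A \<in> hpow n" using assms(2,3) G(1,2) by (intro G(3)) auto
  ultimately show ?thesis using hpow_diff_sym hpow_diff_trans by blast
qed

lemma hsum_eqI':
  assumes "\<And>n. \<exists>F. finite F \<and> F \<subseteq> A \<and> (\<forall>i\<in>A - F. f i \<in> hpow n) \<and> sum f F - x \<in> hpow n"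
  shows "hsum f A = (x :: 'a::hcomplete)"
  using has_hsumI[OF assms] by (rule hsum_eqI)

lemma hsum_hpow:
  assumes "hnull f A" "\<And>i. i \<in> A \<Longrightarrow> f i \<in> hpow n"
  shows "(hsum f A :: 'a::hcomplete) \<in> hpow n"
  using hsum_approx[OF assms(1), of "{}" n] assms(2) by simp

lemma hsum_cong: "A = B \<Longrightarrow> (\<And>i. i \<in> B \<Longrightarrow> f i = g i) \<Longrightarrow> hsum f A = hsum g B"
proof -
  assume "A = B" and eq: "\<And>i. i \<in> B \<Longrightarrow> f i = g i"
  have "sum f F = sum g F" if "F \<subseteq> B" for F using that eq by (intro sum.cong) auto
  then have "has_hsum f B = has_hsum g B"
    unfolding has_hsum_def by (simp cong: conj_cong imp_cong)
  then show ?thesis unfolding hsum_def \<open>A = B\<close> by simp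
qed

lemma hsum_finite: "finite A \<Longrightarrow> hsum f A = (sum f A :: 'a::hcomplete)"
  by (rule hsum_eqI') (auto intro!: exI[of _ A] hpow_zero)

lemma hsum_finite_support:
  assumes "finite F" "F \<subseteq> A" "\<And>i. i \<in> A - F \<Longrightarrow> f i = 0"
  shows "hsum f A = (sum f F :: 'a::hcomplete)"
  by (rule hsum_eqI') (use assms in \<open>auto intro!: exI[of _ F] hpow_zero\<close>)

lemma hsum_zero [simp]: "hsum (\<lambda>_. 0) A = (0 :: 'a::hcomplete)"
  using hsum_finite_support[of "{}" A "\<lambda>_. 0 :: 'a"] by simp

lemma hsum_zeroI: "(\<And>i. i \<in> A \<Longrightarrow> f i = 0) \<Longrightarrow> hsum f A = (0 :: 'a::hcomplete)"
  using hsum_cong[of A A f "\<lambda>_. 0"] by simp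

lemma hsum_single:
  assumes "i \<in> A" "\<And>j. j \<in> A \<Longrightarrow> j \<noteq> i \<Longrightarrow> f j = 0"
  shows "hsum f A = (f i :: 'a::hcomplete)"
  using hsum_finite_support[of "{i}" A f] assms by auto

lemma hsum_add:
  assumes "hnull f A" "hnull g A"
  shows "hsum (\<lambda>i. f i + g i) A = hsum f A + (hsum g A :: 'a::hcomplete)"
proof (rule hsum_eqI')
  fix n
  let ?F = "{i \<in> A. f i \<notin> hpow n} \<union> {i \<in> A. g i \<notin> hpow n}"
  have fin: "finite ?F" using assms by (auto dest: hnullD)
  have "hsum f A - sum f ?F \<in> hpow n" "hsum g A - sum g ?F \<in> hpow n"
    using assms fin by (auto intro!: hsum_approx)
  then have "(hsum f A - sum f ?F) + (hsum g A - sum g ?F) \<in> hpow n" by (rule hpow_add)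
  then have "(sum (\<lambda>i. f i + g i) ?F) - (hsum f A + hsum g A) \<in> hpow n"
    by (subst hpow_diff_sym) (simp add: sum.distrib algebra_simps)
  then show "\<exists>F. finite F \<and> F \<subseteq> A \<and> (\<forall>i\<in>A - F. f i + g i \<in> hpow n) \<and>
      (\<Sum>i\<in>F. f i + g i) - (hsum f A + hsum g A) \<in> hpow n"
    using fin by (intro exI[of _ ?F]) (auto intro: hpow_add)
qed

lemma hsum_linear:
  assumes "hlinear (L :: 'a::hcomplete \<Rightarrow> 'b::hcomplete)" "hnull f A"
  shows "L (hsum f A) = hsum (\<lambda>i. L (f i)) A"
proof (rule hsum_eqI'[symmetric])
  fix n
  let ?F = "{i \<in> A. f i \<notin> hpow n}"
  have "hsum f A - sum f ?F \<in> hpow n" using assms by (auto intro!: hsum_approx dest: hnullD)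
  then have "L (hsum f A - sum f ?F) \<in> hpow n" by (rule hlinear_hpow[OF assms(1)])
  then have "(\<Sum>i\<in>?F. L (f i)) - L (hsum f A) \<in> hpow n"
    by (subst hpow_diff_sym) (simp add: hlinear_diff[OF assms(1)] hlinear_sum[OF assms(1)])
  then show "\<exists>F. finite F \<and> F \<subseteq> A \<and> (\<forall>i\<in>A - F. L (f i) \<in> hpow n) \<and>
      (\<Sum>i\<in>F. L (f i)) - L (hsum f A) \<in> hpow n"
    using hnullD[OF assms(2)] by (intro exI[of _ ?F]) (auto intro: hlinear_hpow[OF assms(1)])
qed

lemma hsum_scale: "hnull f A \<Longrightarrow> a *\<^sub>h hsum f A = hsum (\<lambda>i. a *\<^sub>h f i) (A :: 'i set)"
  for f :: "'i \<Rightarrow> 'a::hcomplete"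
  by (rule hsum_linear) (auto intro: hlin)

lemma hsum_uminus: "hnull f A \<Longrightarrow> - hsum f A = hsum (\<lambda>i. - f i :: 'a::hcomplete) A"
  by (rule hsum_linear) (auto intro: hlin)

lemma hsum_diff:
  "hnull f A \<Longrightarrow> hnull g A \<Longrightarrow> hsum (\<lambda>i. f i - g i) A = hsum f A - (hsum g A :: 'a::hcomplete)"
  using hsum_add[of f A "\<lambda>i. - g i"] hnull_uminus[of g A] by (simp add: hsum_uminus)

lemma has_hsum_bij:
  assumes p: "bij_betw p A B" and f: "has_hsum f B x"
  shows "has_hsum (\<lambda>i. f (p i)) A x"
  unfolding has_hsum_def
proof
  fix n
  obtain F where F: "finite F" "F \<subseteq> B" "\<And>F'. finite F' \<Longrightarrow> F \<subseteq> F' \<Longrightarrow> F' \<subseteq> B \<Longrightarrow> sum f F' - x \<in> hpow n"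
    using f unfolding has_hsum_def by (metis (no_types))
  have inj: "inj_on p A" and img: "p ` A = B" using p by (auto simp: bij_betw_def)
  obtain G where G: "finite G" "G \<subseteq> A" "F = p ` G"
    using F(1,2) unfolding img[symmetric] by (rule finite_subset_image[elim_format]) blast
  have "(\<Sum>i\<in>F'. f (p i)) - x \<in> hpow n" if "finite F'" "G \<subseteq> F'" "F' \<subseteq> A" for F'
  proof -
    have "(\<Sum>i\<in>F'. f (p i)) = sum f (p ` F')"
      using inj_on_subset[OF inj that(3)] by (simp add: sum.reindex)
    moreover have "sum f (p ` F') - x \<in> hpow n"
      by (rule F(3)) (use that G img in auto)
    ultimately show ?thesis by simp
  qed
  then show "\<exists>F. finite F \<and> F \<subseteq> A \<and>
      (\<forall>F'. finite F' \<and> F \<subseteq> F' \<and> F' \<subseteq> A \<longrightarrow> (\<Sum>i\<in>F'. f (p i)) - x \<in> hpow n)"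
    using G by (intro exI[of _ G]) blast
qed

text \<open>The predicates \<open>has_hsum\<close> of the two families coincide, so both sides are
  the same definite description whether or not the sum converges.\<close>

lemma hsum_bij:
  assumes p: "bij_betw p A B"
  shows "hsum f B = (hsum (\<lambda>i. f (p i)) A :: 'a::hcomplete)"
proof -
  have "has_hsum f B x" if "has_hsum (\<lambda>i. f (p i)) A x" for x
  proof -
    have "has_hsum (\<lambda>i. f (p (inv_into A p i))) B x"
      using has_hsum_bij[OF bij_betw_inv_into[OF p] that] .
    moreover have "f (p (inv_into A p i)) = f i" if "i \<in> B" for i
      using that p by (simp add: bij_betw_inv_into_right)
    ultimately show ?thesis
      unfolding has_hsum_def by (smt (verit, best) subsetD sum.cong)
  qed
  then have "has_hsum f B = has_hsum (\<lambda>i. f (p i)) A"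
    using has_hsum_bij[OF p] by blast
  then show ?thesis unfolding hsum_def by simp
qed

text \<open>Fubini: modulo \<open>hpow n\<close> both sides are the finite sum over the surviving
  pairs \<open>N n\<close>; a row that does not meet \<open>N n\<close> sums to an element of
  \<open>hpow n\<close>.\<close>

lemma hsum_Sigma:
  assumes "hnull (\<lambda>(i, j). f i j) (Sigma A B)"
  shows "hsum (\<lambda>i. hsum (f i) (B i)) A = (hsum (\<lambda>(i, j). f i j) (Sigma A B) :: 'a::hcomplete)"
    and "hnull (\<lambda>i. hsum (f i) (B i)) A"
proof -
  have fib: "hnull (f i) (B i)" if "i \<in> A" for i using hnull_SigmaD[OF assms that] .
  define N where "N n = {x \<in> Sigma A B. (case x of (i, j) \<Rightarrow> f i j) \<notin> hpow n}" for n
  define G where "G n i = {j \<in> B i. f i j \<notin> hpow n}" for n i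
  have fin: "finite (N n)" for n using hnullD[OF assms] unfolding N_def .
  have mem: "(i, j) \<in> N n \<longleftrightarrow> i \<in> A \<and> j \<in> G n i" for i j n
    by (auto simp: N_def G_def)
  have fst: "i \<in> fst ` N n \<longleftrightarrow> i \<in> A \<and> G n i \<noteq> {}" for i n
  proof
    assume "i \<in> fst ` N n"
    then obtain j where "(i, j) \<in> N n" by force
    then show "i \<in> A \<and> G n i \<noteq> {}" using mem by blast
  next
    assume "i \<in> A \<and> G n i \<noteq> {}"
    then obtain j where "(i, j) \<in> N n" using mem by blast
    then show "i \<in> fst ` N n" by (rule image_eqI[rotated]) simp
  qed
  have fG: "finite (G n i)" if "i \<in> A" for i n using hnullD[OF fib[OF that]] unfolding G_def .
  have out: "hsum (f i) (B i) \<in> hpow n" if "i \<in> A" "i \<notin> fst ` N n" for i n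
  proof (rule hsum_hpow[OF fib[OF that(1)]])
    fix j assume "j \<in> B i"
    with that fst show "f i j \<in> hpow n" by (auto simp: G_def)
  qed
  show "hnull (\<lambda>i. hsum (f i) (B i)) A"
    unfolding hnull_def
  proof
    fix n
    have "{i \<in> A. hsum (f i) (B i) \<notin> hpow n} \<subseteq> fst ` N n"
    proof
      fix i assume "i \<in> {i \<in> A. hsum (f i) (B i) \<notin> hpow n}"
      with out[of i n] show "i \<in> fst ` N n" by blast
    qed
    then show "finite {i \<in> A. hsum (f i) (B i) \<notin> hpow n}"
      by (rule finite_subset) (rule finite_imageI[OF fin])
  qed
  show "hsum (\<lambda>i. hsum (f i) (B i)) A = hsum (\<lambda>(i, j). f i j) (Sigma A B)"
  proof (rule hsum_eqI')
    fix n
    let ?F = "fst ` N n"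
    have FA: "?F \<subseteq> A" using fst by blast
    have finF: "finite ?F" using fin by simp
    have fGF: "\<forall>i\<in>?F. finite (G n i)" using fG FA by blast
    have 1: "(\<Sum>i\<in>?F. hsum (f i) (B i)) - (\<Sum>i\<in>?F. sum (f i) (G n i)) \<in> hpow n"
      unfolding sum_subtractf[symmetric]
    proof (rule hpow_sum)
      fix i assume "i \<in> ?F"
      then have "i \<in> A" using FA by blast
      show "hsum (f i) (B i) - sum (f i) (G n i) \<in> hpow n"
        by (rule hsum_approx[OF fib[OF \<open>i \<in> A\<close>] fG[OF \<open>i \<in> A\<close>]]) (auto simp: G_def)
    qed
    have "Sigma ?F (G n) = N n"
    proof (rule set_eqI)
      fix x show "x \<in> Sigma ?F (G n) \<longleftrightarrow> x \<in> N n"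
        by (cases x) (simp only: mem_Sigma_iff mem fst, blast)
    qed
    then have 2: "(\<Sum>i\<in>?F. sum (f i) (G n i)) = sum (\<lambda>(i, j). f i j) (N n)"
      by (simp add: sum.Sigma[OF finF fGF])
    have "N n \<subseteq> Sigma A B" by (auto simp: N_def)
    then have "hsum (\<lambda>(i, j). f i j) (Sigma A B) - sum (\<lambda>(i, j). f i j) (N n) \<in> hpow n"
      by (rule hsum_approx[OF assms fin]) (auto simp: N_def)
    then have "sum (\<lambda>(i, j). f i j) (N n) - hsum (\<lambda>(i, j). f i j) (Sigma A B) \<in> hpow n"
      by (subst hpow_diff_sym)
    with 1 have "(\<Sum>i\<in>?F. hsum (f i) (B i)) - hsum (\<lambda>(i, j). f i j) (Sigma A B) \<in> hpow n"
      unfolding 2 by (rule hpow_diff_trans)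
    then show "\<exists>F. finite F \<and> F \<subseteq> A \<and> (\<forall>i\<in>A - F. hsum (f i) (B i) \<in> hpow n) \<and>
       (\<Sum>i\<in>F. hsum (f i) (B i)) - hsum (\<lambda>(i, j). f i j) (Sigma A B) \<in> hpow n"
      using finF FA out by (intro exI[of _ ?F]) blast
  qed
qed

lemma bij_betw_swap: "bij_betw prod.swap (A \<times> B) (B \<times> A)"
  by (rule bij_betw_byWitness[of _ prod.swap]) auto

lemma hnull_swap: "hnull (\<lambda>(i, j). f i j) (A \<times> B) \<longleftrightarrow> hnull (\<lambda>(j, i). f i j) (B \<times> A)"
  by (subst hnull_bij[OF bij_betw_swap[of A B]]) (rule hnull_cong, auto)

lemma hsum_swap:
  assumes "hnull (\<lambda>(i, j). f i j) (A \<times> B)"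
  shows "hsum (\<lambda>i. hsum (\<lambda>j. f i j) B) A = (hsum (\<lambda>j. hsum (\<lambda>i. f i j) A) B :: 'a::hcomplete)"
proof -
  have "hnull (\<lambda>(j, i). f i j) (B \<times> A)" using assms hnull_swap by blast
  then have "hsum (\<lambda>j. hsum (\<lambda>i. f i j) A) B = hsum (\<lambda>(j, i). f i j) (B \<times> A)"
    by (rule hsum_Sigma)
  also have "\<dots> = hsum (\<lambda>(i, j). f i j) (A \<times> B)"
    by (subst hsum_bij[OF bij_betw_swap[of A B]]) (rule hsum_cong, auto)
  also have "\<dots> = hsum (\<lambda>i. hsum (\<lambda>j. f i j) B) A"
    using assms by (rule hsum_Sigma(1)[symmetric])
  finally show ?thesis ..
qed

lemma hsum_sum:
  assumes "\<And>i. i \<in> F \<Longrightarrow> hnull (f i) A"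
  shows "hsum (\<lambda>x. \<Sum>i\<in>F. f i x) A = (\<Sum>i\<in>F. hsum (f i) A :: 'a::hcomplete)"
    and "hnull (\<lambda>x. \<Sum>i\<in>F. f i x) A"
  using assms by (induction F rule: infinite_finite_induct) (auto simp: hsum_add hnull_add)

lemma hlinear_hsum [hlin]:
  assumes "\<And>i. i \<in> A \<Longrightarrow> hlinear (F i)" "\<And>x. hnull (\<lambda>i. F i x) A"
  shows "hlinear (\<lambda>x. hsum (\<lambda>i. F i x) A :: 'b::hcomplete)"
proof (rule hlinearI)
  fix x y and a :: "complex fps"
  show "hsum (\<lambda>i. F i (x + y)) A = hsum (\<lambda>i. F i x) A + hsum (\<lambda>i. F i y) A"
    using assms by (subst hsum_add[symmetric]) (auto intro!: hsum_cong simp: hlinear_add)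
  show "hsum (\<lambda>i. F i (a *\<^sub>h x)) A = a *\<^sub>h hsum (\<lambda>i. F i x) A"
    using assms by (subst hsum_scale) (auto intro!: hsum_cong simp: hlinear_scale)
qed

lemma hsum_shift: "(HSUM i. f (i + k)) = (hsum f UNIV :: 'a::hcomplete)"
  for k :: "'e::ab_group_add"
  using hsum_bij[of "\<lambda>i. i + k" UNIV UNIV f] by (simp add: bij_betw_def inj_on_def surj_plus_right flip: add.commute[of k])

lemma hnull_shift: "hnull (\<lambda>i. f (i + k)) UNIV \<longleftrightarrow> hnull f UNIV"
  for k :: "'e::ab_group_add"
  using hnull_bij[of "\<lambda>i. i + k" UNIV UNIV f] by (simp add: bij_betw_def inj_on_def surj_plus_right flip: add.commute[of k])

section \<open>Completions and tensor products\<close>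

lemma hrefl: "hcauchy s \<Longrightarrow> hcauchy s \<and> hcauchy s \<and> (\<forall>n. s n - s n \<in> hpow n)"
  by (simp add: hpow_zero)

lemma hcompletion_obtain:
  obtains s where "hcauchy s" "x = abs_hcompletion s"
proof -
  have "\<exists>s. hcauchy s \<and> x = abs_hcompletion s"
    by (induction x rule: hcompletion.abs_induct) auto
  then show ?thesis using that by blast
qed

lemma abs_hcompletion_eq:
  "hcauchy s \<Longrightarrow> hcauchy t \<Longrightarrow> abs_hcompletion s = abs_hcompletion t \<longleftrightarrow> (\<forall>n. s n - t n \<in> hpow n)"
  using Quotient3_rel[OF Quotient3_hcompletion, of s t] by (auto simp: hpow_zero)

lemma hcauchy_diff_hpow:
  assumes "hcauchy s" shows "s (n + k) - s n \<in> hpow n"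
proof (induction k)
  case (Suc k)
  have "s (Suc (n + k)) - s (n + k) \<in> hpow (n + k)" using assms unfolding hcauchy_def by blast
  then have "s (Suc (n + k)) - s (n + k) \<in> hpow n" by (rule hpow_antimono) simp
  then show ?case using Suc by (auto dest: hpow_diff_trans)
qed (simp add: hpow_zero)

lemma hcauchy_diff_hpow': "hcauchy s \<Longrightarrow> n \<le> m \<Longrightarrow> s m - s n \<in> hpow n"
  using hcauchy_diff_hpow[of s n "m - n"] by simp

text \<open>Divisibility by \<open>h^n\<close> in the completion is read off from entry
  \<open>n\<close> of a representative; separation and completeness of the completion both reduce to
  this.\<close>

lemma abs_hcompletion_hpow:
  assumes s: "hcauchy s"
  shows "abs_hcompletion s \<in> hpow n \<longleftrightarrow> s n \<in> hpow n"
proof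
  assume "abs_hcompletion s \<in> hpow n"
  then obtain y where y: "abs_hcompletion s = fps_X ^ n *\<^sub>h y" unfolding hpow_def by auto
  obtain t where t: "hcauchy t" "y = abs_hcompletion t" by (rule hcompletion_obtain)
  have "abs_hcompletion s = abs_hcompletion (\<lambda>k. fps_X ^ n *\<^sub>h t k)"
    using y t hscale_hcompletion.abs_eq[OF hrefl[OF t(1)]] by simp
  then have "s n - fps_X ^ n *\<^sub>h t n \<in> hpow n"
    using abs_hcompletion_eq[OF s hcauchy_scale[OF t(1)]] by blast
  then show "s n \<in> hpow n" using hpow_diff_cong hpow_X by blast
next
  assume "s n \<in> hpow n"
  then obtain y0 where y0: "s n = fps_X ^ n *\<^sub>h y0" unfolding hpow_def by auto
  have "\<forall>m. \<exists>y. s (Suc m) - s m = fps_X ^ m *\<^sub>h y"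
    using s unfolding hcauchy_def hpow_def by blast
  then obtain d where d: "\<And>m. s (Suc m) - s m = fps_X ^ m *\<^sub>h d m" by metis
  \<comment> \<open>The module may have torsion, so a quotient of \<open>s (n + k)\<close> by
    \<open>h^n\<close> is not unique. Assembling it from chosen quotients of \<open>s n\<close> and
    of the successive differences makes \<open>t\<close> a Cauchy sequence.\<close>
  define t where "t k = y0 + (\<Sum>j<k. fps_X ^ j *\<^sub>h d (n + j))" for k
  have t: "fps_X ^ n *\<^sub>h t k = s (n + k)" for k
  proof (induction k)
    case (Suc k)
    have "fps_X ^ n *\<^sub>h t (Suc k) = fps_X ^ n *\<^sub>h t k + fps_X ^ (n + k) *\<^sub>h d (n + k)"
      by (simp add: t_def hscale_right_distrib hscale_hscale power_add add.assoc)
    then show ?case using Suc d[of "n + k"] by (simp add: algebra_simps)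
  qed (simp add: t_def y0)
  have ct: "hcauchy t" unfolding hcauchy_def by (simp add: t_def hpow_X)
  have "s k - fps_X ^ n *\<^sub>h t k \<in> hpow k" for k
    unfolding t using hcauchy_diff_hpow'[OF s, of k "n + k"] by (subst hpow_diff_sym) simp
  then have "abs_hcompletion s = abs_hcompletion (\<lambda>k. fps_X ^ n *\<^sub>h t k)"
    using abs_hcompletion_eq[OF s hcauchy_scale[OF ct]] by blast
  also have "\<dots> = fps_X ^ n *\<^sub>h abs_hcompletion t"
    by (rule hscale_hcompletion.abs_eq[OF hrefl[OF ct], symmetric])
  finally show "abs_hcompletion s \<in> hpow n" by (simp add: hpow_X)
qed

lemma abs_hcompletion_diff:
  "hcauchy s \<Longrightarrow> hcauchy t \<Longrightarrow> abs_hcompletion s - abs_hcompletion t = abs_hcompletion (\<lambda>n. s n - t n)"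
  by (rule minus_hcompletion.abs_eq) (rule hrefl, assumption)+

instance hcompletion :: (hmodule) hcomplete
proof
  fix x :: "'a hcompletion"
  assume "\<And>n. x \<in> range (hscale (fps_X ^ n))"
  then have x: "x \<in> hpow n" for n unfolding hpow_def .
  obtain s where s: "hcauchy s" "x = abs_hcompletion s" by (rule hcompletion_obtain)
  then have "s n \<in> hpow n" for n using x abs_hcompletion_hpow by blast
  then show "x = 0"
    using s hcauchy_zero abs_hcompletion_eq[of s "\<lambda>_. 0"] by (simp add: zero_hcompletion_def)
next
  fix X :: "nat \<Rightarrow> 'a hcompletion"
  assume "\<And>n. X (Suc n) - X n \<in> range (hscale (fps_X ^ n))"
  then have X: "X (Suc n) - X n \<in> hpow n" for n unfolding hpow_def .
  have "\<forall>n. \<exists>s. hcauchy s \<and> X n = abs_hcompletion s" by (metis hcompletion_obtain)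
  then obtain s where s: "\<And>n. hcauchy (s n)" "\<And>n. X n = abs_hcompletion (s n)" by metis
  \<comment> \<open>The diagonal represents the limit, because entry \<open>n\<close> of a
    representative matters only modulo \<open>hpow n\<close>.\<close>
  define y where "y n = s n n" for n
  have cy: "hcauchy y" unfolding hcauchy_def
  proof
    fix n
    have "s (Suc n) (Suc n) - s (Suc n) n \<in> hpow n" using s(1) unfolding hcauchy_def by blast
    moreover have "s (Suc n) n - s n n \<in> hpow n"
      using X[of n] abs_hcompletion_hpow[OF hcauchy_diff[OF s(1) s(1)]]
      by (simp add: s(2) abs_hcompletion_diff[OF s(1) s(1)])
    ultimately show "y (Suc n) - y n \<in> hpow n" unfolding y_def by (rule hpow_diff_trans)
  qed
  have "X n - abs_hcompletion y \<in> hpow n" for n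
    using abs_hcompletion_hpow[OF hcauchy_diff[OF s(1) cy]]
    by (simp add: s(2) abs_hcompletion_diff[OF s(1) cy] y_def hpow_zero)
  then show "\<exists>x. \<forall>n. X n - x \<in> range (hscale (fps_X ^ n))" unfolding hpow_def by blast
qed

lemma hlinear_hembed: "hlinear hembed"
proof (rule hlinearI)
  have c: "hcauchy (\<lambda>_. x)" for x :: 'a by (simp add: hcauchy_def hpow_zero)
  fix x y :: 'a and a
  show "hembed (x + y) = hembed x + hembed y"
    by (simp add: hembed.abs_eq plus_hcompletion.abs_eq[OF hrefl[OF c] hrefl[OF c]])
  show "hembed (a *\<^sub>h x) = a *\<^sub>h hembed x"
    by (simp add: hembed.abs_eq hscale_hcompletion.abs_eq[OF hrefl[OF c]])
qed

lemma hembed_dense: "\<exists>y. x - hembed y \<in> hpow n"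
proof -
  obtain s where s: "hcauchy s" "x = abs_hcompletion s" by (rule hcompletion_obtain)
  have c: "hcauchy (\<lambda>_. s n)" by (simp add: hcauchy_def hpow_zero)
  have "x - hembed (s n) \<in> hpow n"
    using abs_hcompletion_hpow[OF hcauchy_diff[OF s(1) c], of n]
    by (simp add: s(2) hembed.abs_eq abs_hcompletion_diff[OF s(1) c] hpow_zero)
  then show ?thesis ..
qed

lemma hcauchy_linear: "hlinear L \<Longrightarrow> hcauchy s \<Longrightarrow> hcauchy (\<lambda>n. L (s n))"
  unfolding hcauchy_def by (simp add: hlinear_hpow flip: hlinear_diff)

lemma hcompletion_lift:
  fixes L :: "'a::hmodule \<Rightarrow> 'b::hcomplete"
  assumes L: "hlinear L"
  shows "\<exists>F. hlinear F \<and> (\<forall>x. F (hembed x) = L x)"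
proof -
  \<comment> \<open>The value at \<open>x\<close> is tied to all approximations of \<open>x\<close>
    from the dense image at once, so linearity can afterwards be checked on arbitrary
    approximations.\<close>
  have "\<exists>y. \<forall>n z. x - hembed z \<in> hpow n \<longrightarrow> y - L z \<in> hpow n" for x
  proof -
    obtain s where s: "hcauchy s" "x = abs_hcompletion s" by (rule hcompletion_obtain)
    obtain y where y: "\<And>n. L (s n) - y \<in> hpow n"
      using hcauchy_convergent[OF hcauchy_linear[OF L s(1)]] by blast
    have "y - L z \<in> hpow n" if "x - hembed z \<in> hpow n" for n z
    proof -
      have c: "hcauchy (\<lambda>_. z)" by (simp add: hcauchy_def hpow_zero)
      have "s n - z \<in> hpow n"
        using that abs_hcompletion_hpow[OF hcauchy_diff[OF s(1) c], of n]
        by (simp add: s(2) hembed.abs_eq abs_hcompletion_diff[OF s(1) c])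
      then have "L (s n) - L z \<in> hpow n" using hlinear_hpow[OF L] by (simp flip: hlinear_diff[OF L])
      moreover have "y - L (s n) \<in> hpow n" using y by (subst hpow_diff_sym)
      ultimately show ?thesis using hpow_diff_trans by blast
    qed
    then show ?thesis by blast
  qed
  then obtain F where F: "\<And>x n z. x - hembed z \<in> hpow n \<Longrightarrow> F x - L z \<in> hpow n" by metis
  have eq: "F x = y" if "\<And>n z. x - hembed z \<in> hpow n \<Longrightarrow> y - L z \<in> hpow n" for x y
  proof (rule hseparated_eq)
    fix n
    obtain z where z: "x - hembed z \<in> hpow n" using hembed_dense by blast
    have "L z - y \<in> hpow n" using that[OF z] by (subst hpow_diff_sym)
    with F[OF z] show "F x - y \<in> hpow n" by (rule hpow_diff_trans)
  qed
  have near: "\<exists>z'. x - hembed z' \<in> hpow n" for x :: "'a hcompletion" and n by (rule hembed_dense)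
  have Lclose: "L z - L z' \<in> hpow n" if "x - hembed z \<in> hpow n" "x - hembed z' \<in> hpow n" for x z z' n
  proof -
    have "F x - L z \<in> hpow n" "F x - L z' \<in> hpow n" using F that by auto
    then show ?thesis using hpow_diff_sym hpow_diff_trans by blast
  qed
  have "hlinear F"
  proof (rule hlinearI)
    fix x y and a
    show "F (x + y) = F x + F y"
    proof (rule eq)
      fix n z assume z: "x + y - hembed z \<in> hpow n"
      obtain u where u: "x - hembed u \<in> hpow n" using near by blast
      obtain v where v: "y - hembed v \<in> hpow n" using near by blast
      have "(x - hembed u) + (y - hembed v) \<in> hpow n" using u v by (rule hpow_add)
      then have "x + y - hembed (u + v) \<in> hpow n"
        by (simp add: hlinear_add[OF hlinear_hembed] algebra_simps)
      then have 1: "L (u + v) - L z \<in> hpow n" using Lclose z by blast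
      have "(F x - L u) + (F y - L v) \<in> hpow n" using F[OF u] F[OF v] by (rule hpow_add)
      then have "F x + F y - L (u + v) \<in> hpow n" by (simp add: hlinear_add[OF L] algebra_simps)
      then show "F x + F y - L z \<in> hpow n" using 1 by (rule hpow_diff_trans)
    qed
    show "F (a *\<^sub>h x) = a *\<^sub>h F x"
    proof (rule eq)
      fix n z assume z: "a *\<^sub>h x - hembed z \<in> hpow n"
      obtain u where u: "x - hembed u \<in> hpow n" using near by blast
      have "a *\<^sub>h (x - hembed u) \<in> hpow n" using u by (rule hpow_scale)
      then have "a *\<^sub>h x - hembed (a *\<^sub>h u) \<in> hpow n"
        by (simp add: hlinear_scale[OF hlinear_hembed] hmod.scale_right_diff_distrib)
      then have 1: "L (a *\<^sub>h u) - L z \<in> hpow n" using Lclose z by blast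
      have "a *\<^sub>h (F x - L u) \<in> hpow n" using F[OF u] by (rule hpow_scale)
      then have "a *\<^sub>h F x - L (a *\<^sub>h u) \<in> hpow n"
        by (simp add: hlinear_scale[OF L] hmod.scale_right_diff_distrib)
      then show "a *\<^sub>h F x - L z \<in> hpow n" using 1 by (rule hpow_diff_trans)
    qed
  qed
  moreover have "F (hembed x) = L x" for x
  proof (rule eq)
    fix n z assume "hembed x - hembed z \<in> hpow n"
    then show "L x - L z \<in> hpow n" by (rule Lclose[of "hembed x", rotated]) (simp add: hpow_zero)
  qed
  ultimately show ?thesis by blast
qed

section \<open>Universal property of the tensor product and density of pure tensors\<close>

definition pm_eval :: "('k \<Rightarrow> 'c \<Rightarrow> 'm::comm_monoid_add) \<Rightarrow> ('k \<Rightarrow>\<^sub>0 'c::zero) \<Rightarrow> 'm"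
  where "pm_eval g p = (\<Sum>k\<in>Poly_Mapping.keys p. g k (Poly_Mapping.lookup p k))"

lemma pm_eval_superset:
  assumes "\<And>k. g k 0 = 0" "finite A" "Poly_Mapping.keys p \<subseteq> A"
  shows "pm_eval g p = (\<Sum>k\<in>A. g k (Poly_Mapping.lookup p k))"
  unfolding pm_eval_def using assms by (intro sum.mono_neutral_left) (auto simp: in_keys_iff)

lemma pm_eval_add:
  assumes "\<And>k. g k 0 = 0" "\<And>k a b. g k (a + b) = g k a + g k b"
  shows "pm_eval g (p + q) = pm_eval g p + pm_eval g q"
proof -
  let ?A = "Poly_Mapping.keys p \<union> Poly_Mapping.keys q"
  have "pm_eval g r = (\<Sum>k\<in>?A. g k (Poly_Mapping.lookup r k))" if "Poly_Mapping.keys r \<subseteq> ?A" for r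
    using assms(1) that by (intro pm_eval_superset) auto
  from this[of "p + q"] this[of p] this[of q] show ?thesis
    using keys_add[of p q] by (simp add: lookup_add assms(2) sum.distrib)
qed

lemma pm_eval_single: "(\<And>k. g k 0 = 0) \<Longrightarrow> pm_eval g (Poly_Mapping.single k a) = g k a"
  by (subst pm_eval_superset[of _ "{k}"]) auto

lemma pm_eval_zero [simp]: "pm_eval g 0 = 0"
  by (simp add: pm_eval_def)

lemma pm_induct [case_names zero single plus]:
  assumes "P 0" "\<And>k a. P (Poly_Mapping.single k a)" "\<And>p q. P p \<Longrightarrow> P q \<Longrightarrow> P (p + q)"
  shows "P (p :: 'k \<Rightarrow>\<^sub>0 'c::comm_monoid_add)"
proof (induction p rule: update_induct)
  case const
  show ?case by (rule assms(1))
next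
  case (update f k v)
  have "Poly_Mapping.update k v f = f + Poly_Mapping.single k v"
    using update(1) by (intro poly_mapping_eqI) (auto simp: lookup_update lookup_add lookup_single when_def in_keys_iff)
  then show ?case using update assms by simp
qed

definition hbilinear :: "('a::hmodule \<Rightarrow> 'b::hmodule \<Rightarrow> 'c::hmodule) \<Rightarrow> bool"
  where "hbilinear f \<longleftrightarrow> (\<forall>y. hlinear (\<lambda>x. f x y)) \<and> (\<forall>x. hlinear (f x))"

lemma hbilinearI: "(\<And>y. hlinear (\<lambda>x. f x y)) \<Longrightarrow> (\<And>x. hlinear (\<lambda>y. f x y)) \<Longrightarrow> hbilinear f"
  unfolding hbilinear_def by simp

text \<open>Evaluation of formal combinations by \<open>f\<close> kills \<open>tens_null\<close>, by
  induction over its generation, and hence factors through the quotient.\<close>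

lemma atensor_lift:
  fixes f :: "'a::hmodule \<Rightarrow> 'b::hmodule \<Rightarrow> 'c::hmodule"
  assumes f: "hbilinear f"
  shows "\<exists>L. hlinear L \<and> (\<forall>x y. L (apure x y) = f x y)"
proof -
  have f1: "hlinear (\<lambda>x. f x y)" and f2: "hlinear (f x)" for x y
    using f unfolding hbilinear_def by auto
  define g where "g k a = a *\<^sub>h f (fst k) (snd k)" for k a
  have g0: "g k 0 = 0" and ga: "g k (a + b) = g k a + g k b" for k a b
    by (simp_all add: g_def hscale_left_distrib)
  define ev where "ev = pm_eval g"
  have ev_add: "ev (p + q) = ev p + ev q" for p q
    unfolding ev_def by (rule pm_eval_add) (rule g0, rule ga)
  have ev_single: "ev (Poly_Mapping.single k a) = g k a" for k a
    unfolding ev_def by (rule pm_eval_single) (rule g0)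
  have ev_diff: "ev (p - q) = ev p - ev q" for p q
    using ev_add[of "p - q" q] by simp
  have ev_scale: "ev (Poly_Mapping.map ((*) a) p) = a *\<^sub>h ev p" for a p
  proof -
    have "Poly_Mapping.keys (Poly_Mapping.map ((*) a) p) \<subseteq> Poly_Mapping.keys p"
      by (auto simp: in_keys_iff lookup_pm_scale)
    then have "ev (Poly_Mapping.map ((*) a) p) = (\<Sum>k\<in>Poly_Mapping.keys p. g k (a * Poly_Mapping.lookup p k))"
      unfolding ev_def by (subst pm_eval_superset[of g "Poly_Mapping.keys p"]) (simp_all add: lookup_pm_scale g0)
    then show ?thesis
      by (simp add: ev_def pm_eval_def g_def hscale_hscale hmod.scale_sum_right)
  qed
  have ev0: "ev 0 = 0" by (simp add: ev_def)
  have null: "ev p = 0" if "p \<in> tens_null" for p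
    using that
    by (induction rule: tens_null.induct)
      (simp_all add: ev_diff ev_add ev_single ev_scale g_def hlinear_add[OF f1] hlinear_scale[OF f1]
        hlinear_add[OF f2] hlinear_scale[OF f2] ev0)
  define L where "L t = ev (rep_atensor t)" for t
  have L: "L (abs_atensor p) = ev p" for p
  proof -
    have "rep_atensor (abs_atensor p) - p \<in> tens_null"
      using Quotient3_abs_rep[OF Quotient3_atensor] atensor.abs_eq_iff by blast
    then have "ev (rep_atensor (abs_atensor p)) - ev p = 0" using null ev_diff by metis
    then show ?thesis unfolding L_def by simp
  qed
  have "hlinear L"
  proof (rule hlinearI)
    fix s t and a
    show "L (s + t) = L s + L t"
      by (induction s rule: atensor.abs_induct, induction t rule: atensor.abs_induct)
        (simp add: plus_atensor.abs_eq L ev_add)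
    show "L (a *\<^sub>h s) = a *\<^sub>h L s"
      by (induction s rule: atensor.abs_induct) (simp add: hscale_atensor.abs_eq L ev_scale)
  qed
  moreover have "L (apure x y) = f x y" for x y
    by (simp add: apure.abs_eq L ev_single g_def)
  ultimately show ?thesis by blast
qed

lemma hbilinear_apure: "hbilinear apure"
proof (intro hbilinearI hlinearI)
  fix x x' :: 'a and y y' :: 'b and a
  have d: "abs_atensor p - abs_atensor q = abs_atensor (p - q)" for p q :: "('a \<times> 'b) \<Rightarrow>\<^sub>0 complex fps"
    by (rule minus_atensor.abs_eq)
  have z: "abs_atensor p = 0" if "p \<in> tens_null" for p :: "('a \<times> 'b) \<Rightarrow>\<^sub>0 complex fps"
    using that by (simp add: zero_atensor_def atensor.abs_eq_iff)
  have "apure (x + x') y - apure x y - apure x' y = 0"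
    unfolding apure.abs_eq d by (rule z) (rule tens_null.add_left)
  then show "apure (x + x') y = apure x y + apure x' y" by (simp add: algebra_simps)
  have "apure x (y + y') - apure x y - apure x y' = 0"
    unfolding apure.abs_eq d by (rule z) (rule tens_null.add_right)
  then show "apure x (y + y') = apure x y + apure x y'" by (simp add: algebra_simps)
  have m: "a *\<^sub>h apure x y = abs_atensor (Poly_Mapping.single (x, y) a)"
    by (simp add: apure.abs_eq hscale_atensor.abs_eq)
  have "apure (a *\<^sub>h x) y - a *\<^sub>h apure x y = 0"
    unfolding m unfolding apure.abs_eq d by (rule z) (rule tens_null.scale_left)
  then show "apure (a *\<^sub>h x) y = a *\<^sub>h apure x y" by simp
  have "apure x (a *\<^sub>h y) - a *\<^sub>h apure x y = 0"
    unfolding m unfolding apure.abs_eq d by (rule z) (rule tens_null.scale_right)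
  then show "apure x (a *\<^sub>h y) = a *\<^sub>h apure x y" by simp
qed

lemma hbilinear1: "hbilinear f \<Longrightarrow> hlinear (\<lambda>x. f x y)"
  and hbilinear2: "hbilinear f \<Longrightarrow> hlinear (\<lambda>y. f x y)"
  unfolding hbilinear_def by auto

lemma hlinear_tensor1 [hlin]: "hlinear f \<Longrightarrow> hlinear (\<lambda>x. f x \<otimes> y)"
  unfolding tensor_def
  by (rule hlinear_compose[OF hlinear_hembed hlinear_compose[OF hbilinear1[OF hbilinear_apure], of f]])

lemma hlinear_tensor2 [hlin]: "hlinear f \<Longrightarrow> hlinear (\<lambda>y. x \<otimes> f y)"
  unfolding tensor_def
  by (rule hlinear_compose[OF hlinear_hembed hlinear_compose[OF hbilinear2[OF hbilinear_apure], of f]])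

lemma atensor_induct [case_names pure plus]:
  assumes "\<And>x y. P (apure x y)" "\<And>s t. P s \<Longrightarrow> P t \<Longrightarrow> P (s + t)"
  shows "P t"
proof (induction t rule: atensor.abs_induct)
  fix p show "P (abs_atensor p)"
  proof (induction p rule: pm_induct)
    case zero
    have "apure 0 0 = (0 :: ('a, 'b) atensor)"
      by (rule hlinear_zero[OF hbilinear1[OF hbilinear_apure]])
    then show ?case using assms(1)[of 0 0] by (simp add: zero_atensor_def)
  next
    case (single k a)
    have "abs_atensor (Poly_Mapping.single k a) = a *\<^sub>h apure (fst k) (snd k)"
      by (simp add: apure.abs_eq hscale_atensor.abs_eq)
    also have "\<dots> = apure (a *\<^sub>h fst k) (snd k)"
      by (simp add: hlinear_scale[OF hbilinear1[OF hbilinear_apure]])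
    finally show ?case using assms(1) by simp
  next
    case (plus p q)
    then show ?case using assms(2) plus_atensor.abs_eq by metis
  qed
qed

text \<open>Pure tensors span only a dense submodule. The case \<open>hpow\<close> absorbs the
  error, so the principle serves for properties that are insensitive to \<open>hpow n\<close>, such
  as congruence of two linear maps modulo \<open>hpow n\<close>.\<close>

lemma tensor_induct_mod [case_names pure plus hpow]:
  assumes "\<And>x y. P (x \<otimes> y)" "\<And>s t. P s \<Longrightarrow> P t \<Longrightarrow> P (s + t)" "\<And>t. t \<in> hpow n \<Longrightarrow> P t"
  shows "P t"
proof -
  obtain a where a: "t - hembed a \<in> hpow n" using hembed_dense by blast
  have "P (hembed a)"
  proof (induction a rule: atensor_induct)
    case (pure x y)
    show ?case using assms(1) unfolding tensor_def .
  next
    case (plus s t)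
    then show ?case using assms(2) by (simp add: hlinear_add[OF hlinear_hembed])
  qed
  then have "P (hembed a + (t - hembed a))" by (rule assms(2)[OF _ assms(3)[OF a]])
  then show ?thesis by simp
qed

lemma tensor_eqI:
  assumes "hlinear F" "hlinear G" "\<And>x y. F (x \<otimes> y) = G (x \<otimes> y)"
  shows "F t = (G t :: 'c::hcomplete)"
proof (rule hseparated_eq)
  fix n
  show "F t - G t \<in> hpow n"
  proof (induction t rule: tensor_induct_mod[where n = n])
    case (pure x y)
    show ?case by (simp add: assms(3) hpow_zero)
  next
    case (plus s t)
    then have "(F s - G s) + (F t - G t) \<in> hpow n" by (rule hpow_add)
    then show ?case
      by (simp add: hlinear_add[OF assms(1)] hlinear_add[OF assms(2)] algebra_simps)
  next
    case (hpow t)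
    then show ?case
      by (metis hpow_diff hlinear_hpow[OF assms(1)] hlinear_hpow[OF assms(2)])
  qed
qed

lemma tensor3_eqI:
  assumes "hlinear F" "hlinear G" "\<And>x y z. F (x \<otimes> y \<otimes> z) = G (x \<otimes> y \<otimes> z)"
  shows "F t = (G t :: 'd::hcomplete)"
proof (rule tensor_eqI[OF assms(1,2)])
  fix s z
  show "F (s \<otimes> z) = G (s \<otimes> z)"
    by (rule tensor_eqI[OF hlinear_compose[OF assms(1) hlinear_tensor1[OF hlinear_id]]
          hlinear_compose[OF assms(2) hlinear_tensor1[OF hlinear_id]] assms(3)])
qed

lemma lift2:
  fixes f :: "'a::hmodule \<Rightarrow> 'b::hmodule \<Rightarrow> 'c::hcomplete"
  assumes "hbilinear f"
  shows "hlinear (lift2 f)" and "lift2 f (x \<otimes> y) = f x y"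
proof -
  obtain L where L: "hlinear L" "\<And>x y. L (apure x y) = f x y" using atensor_lift[OF assms] by blast
  obtain F where F: "hlinear F" "\<And>x. F (hembed x) = L x" using hcompletion_lift[OF L(1)] by blast
  have Ft: "F (x \<otimes> y) = f x y" for x y by (simp only: tensor_def F(2) L(2))
  have "lift2 f = F"
    unfolding lift2_def
  proof (rule the_equality)
    show "hlinear F \<and> (\<forall>x y. F (x \<otimes> y) = f x y)" using F(1) Ft by blast
    fix G assume G: "hlinear G \<and> (\<forall>x y. G (x \<otimes> y) = f x y)"
    show "G = F"
    proof
      fix t show "G t = F t"
        by (rule tensor_eqI[OF conjunct1[OF G] F(1)]) (simp only: conjunct2[OF G, rule_format] Ft)
    qed
  qed
  then show "hlinear (lift2 f)" "lift2 f (x \<otimes> y) = f x y" using F(1) Ft by simp_all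
qed

lemma lift3:
  fixes f :: "'a::hmodule \<Rightarrow> 'b::hmodule \<Rightarrow> 'c::hmodule \<Rightarrow> 'd::hcomplete"
  assumes "\<And>y z. hlinear (\<lambda>x. f x y z)" "\<And>x z. hlinear (\<lambda>y. f x y z)" "\<And>x y. hlinear (\<lambda>z. f x y z)"
  shows "hlinear (lift3 f)" and "lift3 f (x \<otimes> y \<otimes> z) = f x y z"
proof -
  have b: "hbilinear (\<lambda>x y. f x y z)" for z by (intro hbilinearI assms)
  have "hbilinear (\<lambda>t z. lift2 (\<lambda>x y. f x y z) t)"
  proof (intro hbilinearI hlinearI)
    fix z z' t a
    show "lift2 (\<lambda>x y. f x y (z + z')) t = lift2 (\<lambda>x y. f x y z) t + lift2 (\<lambda>x y. f x y z') t"
      by (rule tensor_eqI[OF lift2(1)[OF b] hlinear_plus[OF lift2(1)[OF b] lift2(1)[OF b]]])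
        ((subst lift2(2)[OF b])+, rule hlinear_add[OF assms(3)])
    show "lift2 (\<lambda>x y. f x y (a *\<^sub>h z)) t = a *\<^sub>h lift2 (\<lambda>x y. f x y z) t"
      by (rule tensor_eqI[OF lift2(1)[OF b] hlinear_hscale[OF lift2(1)[OF b]]])
        ((subst lift2(2)[OF b])+, rule hlinear_scale[OF assms(3)])
  qed (simp_all add: hlinear_add[OF lift2(1)[OF b]] hlinear_scale[OF lift2(1)[OF b]])
  from lift2[OF this] show "hlinear (lift3 f)" "lift3 f (x \<otimes> y \<otimes> z) = f x y z"
    unfolding lift3_def by (simp_all add: lift2[OF b])
qed

text \<open>Finiteness of the exceptional set modulo \<open>hpow n\<close> is inherited by sums and
  is trivial on \<open>hpow n\<close>, so pure tensors suffice.\<close>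

lemma hnull_tensor:
  assumes "\<And>i. hlinear (F i)" "\<And>x y. hnull (\<lambda>i. F i (x \<otimes> y)) A"
  shows "hnull (\<lambda>i. F i t) A"
  unfolding hnull_def
proof
  fix n
  show "finite {i \<in> A. F i t \<notin> hpow n}"
  proof (induction t rule: tensor_induct_mod[where n = n])
    case (pure x y)
    show ?case using assms(2) by (rule hnullD)
  next
    case (plus s t)
    have "{i \<in> A. F i (s + t) \<notin> hpow n} \<subseteq> {i \<in> A. F i s \<notin> hpow n} \<union> {i \<in> A. F i t \<notin> hpow n}"
      using hpow_add by (auto simp: hlinear_add[OF assms(1)])
    then show ?case by (rule finite_subset) (simp add: plus)
  next
    case (hpow t)
    then show ?case by (simp add: hlinear_hpow[OF assms(1)])
  qed
qed

section \<open>The algebra as a complete module\<close>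

lemma fps_const_sum: "fps_const (sum f A) = (\<Sum>i\<in>A. fps_const (f i))"
  by (induction A rule: infinite_finite_induct) (simp_all flip: fps_const_add)

lemma trace_ideal_sum: "(\<And>i. i \<in> A \<Longrightarrow> f i \<in> trace_ideal) \<Longrightarrow> sum f A \<in> trace_ideal"
  by (induction A rule: infinite_finite_induct) (auto intro: trace_ideal.zero trace_ideal.plus)

definition tracevar :: "nat \<Rightarrow> 'n::finite xpoly"
  where "tracevar r = (\<Sum>i\<in>UNIV. Poly_Mapping.single (Poly_Mapping.single ((i, i), r) 1) 1)"

lemma sum_xvar: "(\<Sum>i\<in>UNIV. xvar (i, i) r) = fps_const (tracevar r)"
  by (simp add: xvar_def tracevar_def fps_const_sum)

text \<open>The generators do not involve h. Together with \<open>trace_idealI\<close> this shows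
  that membership in the closed ideal is decided coefficient by coefficient in h, which is what
  makes the quotient torsion-free.\<close>

lemma trace_ideal_nth: "p \<in> trace_ideal \<Longrightarrow> fps_const (fps_nth p k) \<in> trace_ideal"
proof (induction arbitrary: k rule: trace_ideal.induct)
  case (gen r)
  show ?case
  proof (cases "k = 0")
    case True
    then show ?thesis using trace_ideal.gen[of r] unfolding sum_xvar by simp
  next
    case False
    then show ?thesis unfolding sum_xvar by (simp add: trace_ideal.zero)
  qed
next
  case zero
  show ?case by (simp add: trace_ideal.zero)
next
  case (plus p q)
  then show ?case by (simp add: trace_ideal.plus flip: fps_const_add)
next
  case (mult p a)
  have "fps_const (fps_nth (a * p) k) = (\<Sum>i=0..k. fps_const (fps_nth a i) * fps_const (fps_nth p (k - i)))"
    by (simp add: fps_mult_nth fps_const_sum)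
  then show ?case using mult by (simp add: trace_ideal_sum trace_ideal.mult del: fps_const_mult)
next
  case (limit p)
  obtain q a where q: "\<And>k. fps_const (fps_nth q k) \<in> trace_ideal" "p - q = fps_X ^ Suc k * a"
    using limit(1)[of "Suc k"] by blast
  have "fps_nth (p - q) k = 0" unfolding q(2) by (simp add: fps_X_power_mult_nth del: power_Suc)
  then show ?case using q(1)[of k] by simp
qed

lemma fps_truncate: "p = (\<Sum>i<n. fps_X ^ i * fps_const (fps_nth p i)) + fps_X ^ n * fps_shift n (p :: 'a::comm_ring_1 fps)"
proof (induction n)
  case (Suc n)
  have "fps_shift n p = fps_const (fps_nth p n) + fps_X * fps_shift (Suc n) p"
  proof (rule fps_ext)
    fix k show "fps_nth (fps_shift n p) k = fps_nth (fps_const (fps_nth p n) + fps_X * fps_shift (Suc n) p) k"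
      by (cases k) simp_all
  qed
  then have "fps_X ^ n * fps_shift n p =
      fps_X ^ n * fps_const (fps_nth p n) + fps_X ^ Suc n * fps_shift (Suc n) p"
    by (simp only: distrib_left power_Suc2 mult.assoc)
  then show ?case using Suc by (simp only: sum.lessThan_Suc add.assoc)
qed simp

lemma trace_idealI:
  assumes "\<And>k. fps_const (fps_nth p k) \<in> trace_ideal" shows "p \<in> trace_ideal"
proof (rule trace_ideal.limit)
  fix n
  have "(\<Sum>i<n. fps_X ^ i * fps_const (fps_nth p i)) \<in> trace_ideal"
    by (intro trace_ideal_sum trace_ideal.mult assms)
  moreover have "p - (\<Sum>i<n. fps_X ^ i * fps_const (fps_nth p i)) = fps_X ^ n * fps_shift n p"
    using fps_truncate[of p n] by (simp add: algebra_simps)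
  ultimately show "\<exists>q a. q \<in> trace_ideal \<and> p - q = fps_X ^ n * a" by blast
qed

definition fpsC :: "complex fps \<Rightarrow> 'n::finite xpoly fps"
  where "fpsC a = Abs_fps (\<lambda>k. Poly_Mapping.single 0 (fps_nth a k))"

lemma fpsC_X: "fpsC (fps_X ^ n) = fps_X ^ n"
  by (rule fps_ext) (simp add: fpsC_def fps_X_power_nth)

lemma fpsC_const: "fpsC (fps_const c) = fps_const (Poly_Mapping.single 0 c)"
  by (rule fps_ext) (simp add: fpsC_def)

lemma hscale_abs: "a *\<^sub>h abs_Hplus p = abs_Hplus (fpsC a * p)"
  unfolding fpsC_def by (rule hscale_Hplus.abs_eq)

lemma hscale_abs_X: "fps_X ^ n *\<^sub>h abs_Hplus p = abs_Hplus (fps_X ^ n * p)"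
  by (simp add: hscale_abs fpsC_X)

lemma abs_Hplus_eq_0: "abs_Hplus p = 0 \<longleftrightarrow> p \<in> trace_ideal"
  by (simp add: zero_Hplus_def Hplus.abs_eq_iff)

lemma abs_Hplus_hpow: "abs_Hplus p \<in> hpow n \<longleftrightarrow> (\<exists>q. p - fps_X ^ n * q \<in> trace_ideal)"
proof
  assume "abs_Hplus p \<in> hpow n"
  then obtain y where y: "abs_Hplus p = fps_X ^ n *\<^sub>h y" unfolding hpow_def by auto
  obtain q where "y = abs_Hplus q" by (induction y rule: Hplus.abs_induct) auto
  then show "\<exists>q. p - fps_X ^ n * q \<in> trace_ideal"
    using y by (auto simp: hscale_abs_X Hplus.abs_eq_iff)
next
  assume "\<exists>q. p - fps_X ^ n * q \<in> trace_ideal"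
  then obtain q where "abs_Hplus p = fps_X ^ n *\<^sub>h abs_Hplus q"
    by (auto simp: hscale_abs_X Hplus.abs_eq_iff)
  then show "abs_Hplus p \<in> hpow n" by (simp add: hpow_X)
qed

lemma Hplus_obtain: obtains p where "x = abs_Hplus p"
  by (induction x rule: Hplus.abs_induct) auto

text \<open>A nonzero scalar is a unit times a power of h, and dividing by a power of h only shifts
  coefficients, which \<open>trace_ideal_nth\<close> permits.\<close>

lemma Hplus_torsion_free:
  fixes x :: "'n::finite Hplus"
  assumes "a *\<^sub>h x = 0" "a \<noteq> 0"
  shows "x = 0"
proof -
  define b where "b = fps_shift (subdegree a) a"
  have a: "a = b * fps_X ^ subdegree a" unfolding b_def by (rule subdegree_decompose)
  have "fps_nth b 0 \<noteq> 0" using assms(2) by (simp add: b_def)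
  then have "inverse b * b = 1" by (rule inverse_mult_eq_1)
  then have "inverse b * a = fps_X ^ subdegree a" using a by (metis mult.assoc mult_1)
  then have "fps_X ^ subdegree a *\<^sub>h x = 0"
    using assms(1) by (metis hscale_hscale hmod.scale_zero_right)
  moreover obtain p where p: "x = abs_Hplus p" by (rule Hplus_obtain)
  ultimately have *: "fps_X ^ subdegree a * p \<in> trace_ideal" by (simp add: hscale_abs_X abs_Hplus_eq_0)
  have "fps_const (fps_nth p k) \<in> trace_ideal" for k
    using trace_ideal_nth[OF *, of "k + subdegree a"] by (simp add: fps_X_power_mult_nth)
  then show ?thesis unfolding p abs_Hplus_eq_0 by (rule trace_idealI)
qed

instance Hplus :: (finite) hcomplete
proof
  fix x :: "'a Hplus"
  assume "\<And>n. x \<in> range (hscale (fps_X ^ n))"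
  then have x: "x \<in> hpow n" for n unfolding hpow_def .
  obtain p where p: "x = abs_Hplus p" by (rule Hplus_obtain)
  have "p \<in> trace_ideal"
  proof (rule trace_ideal.limit)
    fix n
    obtain q where "p - fps_X ^ n * q \<in> trace_ideal" using x[of n] unfolding p abs_Hplus_hpow by blast
    then show "\<exists>q a. q \<in> trace_ideal \<and> p - q = fps_X ^ n * a"
      by (intro exI[of _ "p - fps_X ^ n * q"] exI[of _ q]) simp
  qed
  then show "x = 0" by (simp add: p abs_Hplus_eq_0)
next
  fix s :: "nat \<Rightarrow> 'a Hplus"
  assume "\<And>n. s (Suc n) - s n \<in> range (hscale (fps_X ^ n))"
  then have s: "s (Suc n) - s n \<in> hpow n" for n unfolding hpow_def .
  have "\<forall>n. \<exists>p. s n = abs_Hplus p" by (metis Hplus_obtain)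
  then obtain p where p: "\<And>n. s n = abs_Hplus (p n)" by metis
  have "\<forall>n. \<exists>d. p (Suc n) - p n - fps_X ^ n * d \<in> trace_ideal"
    using s unfolding p minus_Hplus.abs_eq abs_Hplus_hpow by blast
  then obtain d where d: "\<And>n. p (Suc n) - p n - fps_X ^ n * d n \<in> trace_ideal" by metis
  \<comment> \<open>\<open>T n\<close> is the sum of \<open>h^i d (n + i)\<close> over all
    \<open>i\<close>, computed coefficientwise. So \<open>T 0\<close> contains all corrections and
    differs from its \<open>n\<close>-th partial sum by a multiple of \<open>h^n\<close>.\<close>
  define T where "T n = Abs_fps (\<lambda>k. \<Sum>i\<le>k. fps_nth (d (n + i)) (k - i))" for n
  have T: "T n = d n + fps_X * T (Suc n)" for n
  proof (rule fps_ext)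
    fix k show "fps_nth (T n) k = fps_nth (d n + fps_X * T (Suc n)) k"
      by (cases k) (simp_all add: T_def sum.atMost_Suc_shift del: sum.atMost_Suc)
  qed
  have T0: "T 0 = (\<Sum>i<n. fps_X ^ i * d i) + fps_X ^ n * T n" for n
  proof (induction n)
    case (Suc n)
    then show ?case using T[of n] by (simp add: algebra_simps)
  qed simp
  have tel: "p n - (p 0 + (\<Sum>i<n. fps_X ^ i * d i)) \<in> trace_ideal" for n
  proof (induction n)
    case (Suc n)
    have "(p n - (p 0 + (\<Sum>i<n. fps_X ^ i * d i))) + (p (Suc n) - p n - fps_X ^ n * d n) \<in> trace_ideal"
      using Suc d by (rule trace_ideal.plus)
    then show ?case by (simp add: algebra_simps)
  qed (simp add: trace_ideal.zero)
  have "s n - abs_Hplus (p 0 + T 0) \<in> hpow n" for n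
    unfolding p minus_Hplus.abs_eq abs_Hplus_hpow
    using tel[of n] by (intro exI[of _ "- T n"]) (simp add: T0[of n] algebra_simps)
  then show "\<exists>x. \<forall>n. s n - x \<in> range (hscale (fps_X ^ n))" unfolding hpow_def by blast
qed

lemma topologically_free_Hplus: "topologically_free TYPE('n::finite Hplus)"
  unfolding topologically_free_def
proof (intro conjI allI impI)
  show "(\<Inter>n. hpow n) = {0 :: 'n Hplus}" using hseparated hpow_zero by auto
qed (use Hplus_torsion_free hcauchy_convergent in blast)+

lemma Hplus_scale_mult: "(a *\<^sub>h x) * y = a *\<^sub>h (x * (y :: 'n::finite Hplus))"
proof -
  obtain p where p: "x = abs_Hplus p" by (rule Hplus_obtain)
  obtain q where q: "y = abs_Hplus q" by (rule Hplus_obtain)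
  show ?thesis unfolding p q by (simp add: hscale_abs times_Hplus.abs_eq mult.assoc)
qed

lemma Hplus_mult_scale: "x * (a *\<^sub>h y) = a *\<^sub>h (x * (y :: 'n::finite Hplus))"
  by (metis Hplus_scale_mult mult.commute)

lemma hlinear_times [hlin]: "hlinear f \<Longrightarrow> hlinear (\<lambda>p. x * (f p :: 'n::finite Hplus))"
  by (rule hlinearI) (simp_all add: hlinear_add hlinear_scale distrib_left Hplus_mult_scale)

lemma hlinear_times2 [hlin]: "hlinear f \<Longrightarrow> hlinear (\<lambda>p. (f p :: 'n::finite Hplus) * x)"
  by (rule hlinearI) (simp_all add: hlinear_add hlinear_scale distrib_right Hplus_scale_mult)

section \<open>Monomials of the algebra and linear maps prescribed on them\<close>

definition Hmon :: "((('n::finite \<times> 'n) \<times> nat) \<Rightarrow>\<^sub>0 nat) \<Rightarrow> 'n Hplus"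
  where "Hmon m = abs_Hplus (fps_const (Poly_Mapping.single m 1))"

lemma abs_Hplus_monomial: "abs_Hplus (fps_const (Poly_Mapping.single m c)) = fps_const c *\<^sub>h Hmon m"
  by (simp add: Hmon_def hscale_abs fpsC_const fps_const_mult mult_single)

text \<open>The only relations between monomials are multiples of the traces. The extension from
  polynomials to power series in h is the limit of \<open>part\<close>, which is where completeness
  of the target enters.\<close>

lemma Hplus_lift:
  fixes f :: "((('n::finite \<times> 'n) \<times> nat) \<Rightarrow>\<^sub>0 nat) \<Rightarrow> 'm::hcomplete"
  assumes tr: "\<And>m r. (\<Sum>i\<in>UNIV. f (m + Poly_Mapping.single ((i, i), r) 1)) = 0"
  shows "\<exists>L :: 'n Hplus \<Rightarrow> 'm. hlinear L \<and> (\<forall>m. L (Hmon m) = f m)"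
proof -
  define g where "g m c = fps_const c *\<^sub>h f m" for m c
  have g0: "g m 0 = 0" and ga: "g m (c + d) = g m c + g m d" for m c d
    by (simp_all add: g_def hscale_left_distrib flip: fps_const_add)
  define ev :: "'n xpoly \<Rightarrow> 'm" where "ev = pm_eval g"
  have ev_add: "ev (p + q) = ev p + ev q" for p q
    unfolding ev_def by (rule pm_eval_add) (rule g0, rule ga)
  have ev_single: "ev (Poly_Mapping.single m c) = g m c" for m c
    unfolding ev_def by (rule pm_eval_single) (rule g0)
  have ev_0: "ev 0 = 0" by (simp add: ev_def)
  have ev_sum: "ev (sum h A) = (\<Sum>i\<in>A. ev (h i))" for h :: "'x \<Rightarrow> _" and A
    by (induction A rule: infinite_finite_induct) (simp_all add: ev_0 ev_add)
  have ev_scale: "ev (Poly_Mapping.single 0 c * p) = fps_const c *\<^sub>h ev p" for c p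
    by (induction p rule: pm_induct)
      (simp_all add: ev_0 ev_add ev_single distrib_left mult_single g_def hscale_hscale hscale_right_distrib)
  have ev_trace: "ev (p * tracevar r) = 0" for p r
  proof (induction p rule: pm_induct)
    case (single m c)
    have "ev (Poly_Mapping.single m c * tracevar r) =
        (\<Sum>i\<in>UNIV. fps_const c *\<^sub>h f (m + Poly_Mapping.single ((i, i), r) 1))"
      by (simp add: tracevar_def sum_distrib_left mult_single ev_sum ev_single g_def)
    also have "\<dots> = fps_const c *\<^sub>h (\<Sum>i\<in>UNIV. f (m + Poly_Mapping.single ((i, i), r) 1))"
      by (rule hmod.scale_sum_right[symmetric])
    finally show ?case by (simp only: tr hmod.scale_zero_right)
  qed (simp_all add: ev_0 ev_add distrib_right)
  define part where "part P n = (\<Sum>k<n. fps_X ^ k *\<^sub>h ev (fps_nth P k))" for P n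
  have "\<exists>y. \<forall>n. part P n - y \<in> hpow n" for P
    by (rule hcauchy_convergent) (simp add: hcauchy_def part_def hpow_X)
  then obtain Lin where Lin: "\<And>P n. part P n - Lin P \<in> hpow n" by metis
  have LinI: "Lin P = y" if "\<And>n. y - part P n \<in> hpow n" for P y
    by (rule hseparated_eq, subst hpow_diff_sym) (rule hpow_diff_trans[OF that Lin])
  have Lin': "Lin P - part P n \<in> hpow n" for P n using Lin by (subst hpow_diff_sym)
  have Lin_add: "Lin (P + Q) = Lin P + Lin Q" for P Q
  proof (rule LinI)
    fix n
    have "(Lin P - part P n) + (Lin Q - part Q n) \<in> hpow n" using Lin' Lin' by (rule hpow_add)
    then show "Lin P + Lin Q - part (P + Q) n \<in> hpow n"
      by (simp add: part_def ev_add hscale_right_distrib sum.distrib algebra_simps)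
  qed
  have Lin_X: "Lin (fps_X * P) = fps_X *\<^sub>h Lin P" for P
  proof (rule LinI)
    fix n
    show "fps_X *\<^sub>h Lin P - part (fps_X * P) n \<in> hpow n"
    proof (cases n)
      case (Suc m)
      have "part (fps_X * P) n = fps_X *\<^sub>h part P m"
        unfolding part_def Suc by (subst sum.lessThan_Suc_shift)
          (simp add: ev_0 hmod.scale_sum_right hscale_hscale)
      then show ?thesis
        using hpow_X_mult[OF Lin'[of P m], of 1] Suc by (simp add: hmod.scale_right_diff_distrib)
    qed simp
  qed
  have Lin_const: "Lin (fps_const (Poly_Mapping.single 0 c) * P) = fps_const c *\<^sub>h Lin P" for c P
  proof (rule LinI)
    fix n
    have "part (fps_const (Poly_Mapping.single 0 c) * P) n = fps_const c *\<^sub>h part P n"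
      by (simp add: part_def ev_scale ev_scale[unfolded mult.commute[of "Poly_Mapping.single 0 c" for c]]
          hmod.scale_sum_right hscale_hscale mult.commute)
    then show "fps_const c *\<^sub>h Lin P - part (fps_const (Poly_Mapping.single 0 c) * P) n \<in> hpow n"
      using hpow_scale[OF Lin'[of P n], of "fps_const c"] by (simp add: hmod.scale_right_diff_distrib)
  qed
  have Lin_Xn: "Lin (fps_X ^ n * P) = fps_X ^ n *\<^sub>h Lin P" for n P
  proof (induction n)
    case (Suc n)
    have "Lin (fps_X ^ Suc n * P) = fps_X *\<^sub>h Lin (fps_X ^ n * P)"
      by (simp only: power_Suc mult.assoc Lin_X)
    then show ?case using Suc by simp
  qed simp
  \<comment> \<open>Induction on \<open>n\<close> for all scalars at once: removing the constant
    coefficient of \<open>a\<close> leaves a multiple of h, which gains one power.\<close>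
  have Lin_scale: "Lin (fpsC a * P) = a *\<^sub>h Lin P" for a P
  proof (rule hseparated_eq)
    fix n
    show "Lin (fpsC a * P) - a *\<^sub>h Lin P \<in> hpow n"
    proof (induction n arbitrary: a)
      case (Suc n)
      define b where "b = fps_shift 1 a"
      have a: "a = fps_const (fps_nth a 0) + fps_X * b"
        using fps_truncate[of a 1] by (simp add: b_def)
      have Ca: "fpsC a = fps_const (Poly_Mapping.single 0 (fps_nth a 0)) + fps_X * (fpsC b :: 'n xpoly fps)"
      proof (rule fps_ext)
        fix k show "fps_nth (fpsC a) k = fps_nth (fps_const (Poly_Mapping.single 0 (fps_nth a 0)) + fps_X * (fpsC b :: 'n xpoly fps)) k"
          by (cases k) (simp_all add: fpsC_def b_def)
      qed
      have "Lin (fpsC a * P) = fps_const (fps_nth a 0) *\<^sub>h Lin P + fps_X *\<^sub>h Lin (fpsC b * P)"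
        unfolding Ca distrib_right Lin_add Lin_const mult.assoc Lin_X ..
      moreover have "a *\<^sub>h Lin P = fps_const (fps_nth a 0) *\<^sub>h Lin P + fps_X *\<^sub>h (b *\<^sub>h Lin P)"
        by (subst a) (simp only: hscale_left_distrib hscale_hscale)
      ultimately have "Lin (fpsC a * P) - a *\<^sub>h Lin P = fps_X ^ 1 *\<^sub>h (Lin (fpsC b * P) - b *\<^sub>h Lin P)"
        by (simp add: hmod.scale_right_diff_distrib)
      then show ?case using hpow_X_mult[OF Suc[of b], of 1] by simp
    qed simp
  qed
  have Lin_0: "Lin 0 = 0" using Lin_add[of 0 0] by simp
  have Lin_diff: "Lin (P - Q) = Lin P - Lin Q" for P Q using Lin_add[of "P - Q" Q] by simp
  \<comment> \<open>The multiplier \<open>a\<close> is built into the claim so that closure under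
    multiplication is immediate by associativity.\<close>
  have null: "Lin (a * P) = 0" if "P \<in> trace_ideal" for a P
    using that
  proof (induction arbitrary: a rule: trace_ideal.induct)
    case (gen r)
    have "ev (fps_nth (a * fps_const (tracevar r)) k) = 0" for k by (simp add: ev_trace)
    then have "part (a * fps_const (tracevar r)) n = 0" for n by (simp add: part_def)
    then show ?case unfolding sum_xvar by (intro LinI) (simp add: hpow_zero)
  next
    case (plus p q)
    then show ?case by (simp add: distrib_left Lin_add)
  next
    case (mult p b)
    then show ?case by (simp flip: mult.assoc)
  next
    case (limit p)
    show ?case
    proof (rule hseparated)
      fix n
      obtain q b where q: "\<And>a. Lin (a * q) = 0" "p - q = fps_X ^ n * b" using limit(1)[of n] by blast
      have "p = q + fps_X ^ n * b" using q(2) by (simp add: algebra_simps)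
      then have "a * p = a * q + fps_X ^ n * (a * b)" by (simp add: algebra_simps)
      then show "Lin (a * p) \<in> hpow n" by (simp add: Lin_add q(1) Lin_Xn hpow_X)
    qed
  qed (simp add: Lin_0)
  define L where "L x = Lin (rep_Hplus x)" for x
  have L: "L (abs_Hplus P) = Lin P" for P
  proof -
    have "rep_Hplus (abs_Hplus P) - P \<in> trace_ideal"
      using Quotient3_abs_rep[OF Quotient3_Hplus] Hplus.abs_eq_iff by blast
    then have "Lin (rep_Hplus (abs_Hplus P) - P) = 0" using null[of _ 1] by simp
    then show ?thesis by (simp add: L_def Lin_diff)
  qed
  have "hlinear L"
  proof (rule hlinearI)
    fix x y :: "'n Hplus" and a :: "complex fps"
    obtain p where p: "x = abs_Hplus p" by (rule Hplus_obtain)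
    obtain q where q: "y = abs_Hplus q" by (rule Hplus_obtain)
    show "L (x + y) = L x + L y" by (simp add: p q plus_Hplus.abs_eq L Lin_add)
    show "L (a *\<^sub>h x) = a *\<^sub>h L x" by (simp add: p hscale_abs L Lin_scale)
  qed
  moreover have "L (Hmon m) = f m" for m
    unfolding Hmon_def L
  proof (rule LinI)
    fix n
    show "f m - part (fps_const (Poly_Mapping.single m 1)) n \<in> hpow n"
    proof (cases n)
      case (Suc k)
      have "part (fps_const (Poly_Mapping.single m 1)) n = f m"
        unfolding part_def Suc
        by (subst sum.lessThan_Suc_shift) (simp add: ev_0 ev_single g_def hscale_one)
      then show ?thesis by (simp add: hpow_zero)
    qed simp
  qed
  ultimately show ?thesis by blast
qed

definition mon :: "'g list \<Rightarrow> ('g \<Rightarrow>\<^sub>0 nat)"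
  where "mon xs = sum_list (map (\<lambda>g. Poly_Mapping.single g 1) xs)"

lemma mon_simps [simp]: "mon [] = 0" "mon (g # xs) = Poly_Mapping.single g 1 + mon xs"
  "mon (xs @ ys) = mon xs + mon ys"
  by (simp_all add: mon_def)

lemma mon_surj: "\<exists>xs. mon xs = m"
proof (induction m rule: pm_induct)
  case zero
  show ?case by (rule exI[of _ "[]"]) simp
next
  case (single k a)
  have "mon (replicate a k) = Poly_Mapping.single k a"
    by (induction a) (simp_all flip: single_add)
  then show ?case ..
next
  case (plus p q)
  then show ?case by (metis mon_simps(3))
qed

lemma lookup_mon: "Poly_Mapping.lookup (mon xs) g = count (mset xs) g"
  by (induction xs) (auto simp: lookup_add lookup_single when_def)

lemma mon_eq_iff: "mon xs = mon ys \<longleftrightarrow> mset xs = mset ys"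
  by (auto simp: multiset_eq_iff lookup_mon[symmetric] intro: poly_mapping_eqI)

text \<open>The head of one list is moved to the front of the other past its predecessors.
  Commutation is demanded only on states satisfying the invariant \<open>C\<close>.\<close>

lemma foldr_permute:
  assumes "C s" "\<And>g s. C s \<Longrightarrow> C (\<Phi> g s)" "\<And>g g' s. C s \<Longrightarrow> \<Phi> g (\<Phi> g' s) = \<Phi> g' (\<Phi> g s)"
    "mset xs = mset ys"
  shows "foldr \<Phi> xs s = foldr \<Phi> ys s"
  using assms(4)
proof (induction xs arbitrary: ys)
  case (Cons x xs)
  have C: "C (foldr \<Phi> zs s)" for zs by (induction zs) (simp_all add: assms(1,2))
  have move: "foldr \<Phi> as (\<Phi> x (foldr \<Phi> bs s)) = \<Phi> x (foldr \<Phi> (as @ bs) s)" for as bs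
  proof (induction as)
    case (Cons a as)
    have "foldr \<Phi> (a # as) (\<Phi> x (foldr \<Phi> bs s)) = \<Phi> a (\<Phi> x (foldr \<Phi> (as @ bs) s))" using Cons by simp
    also have "\<dots> = \<Phi> x (\<Phi> a (foldr \<Phi> (as @ bs) s))" by (rule assms(3)[OF C])
    finally show ?case by simp
  qed simp
  have "x \<in> set ys" using Cons.prems by (metis list.set_intros(1) set_mset_mset)
  then obtain as bs where ys: "ys = as @ x # bs" by (meson split_list)
  then have "mset xs = mset (as @ bs)" using Cons.prems by simp
  from Cons.IH[OF this] show ?case by (simp add: ys move del: foldr_append) (simp add: move[simplified])
qed simp

definition plist :: "(('n::finite \<times> 'n) \<times> nat) list \<Rightarrow> 'n Hplus"
  where "plist xs = prod_list (map (\<lambda>g. Hvar (fst g) (snd g)) xs)"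

lemma plist_simps [simp]: "plist [] = 1" "plist (g # xs) = Hvar (fst g) (snd g) * plist xs"
  by (simp_all add: plist_def)

lemma Hmon_mon: "Hmon (mon xs) = plist xs"
proof (induction xs)
  case Nil
  show ?case by (simp add: Hmon_def one_Hplus_def)
next
  case (Cons g xs)
  have "Hmon (mon (g # xs)) = Hvar (fst g) (snd g) * Hmon (mon xs)"
    by (simp add: Hmon_def Hvar.abs_eq times_Hplus.abs_eq xvar_def mult_single)
  then show ?case using Cons by simp
qed

text \<open>Recursion on the generators of a monomial: each generator updates a state, commuting
  updates make the order immaterial, and the trace relation has to be checked for a single update
  only. The state may carry more than the value \<open>ev\<close>, for instance a pair or a whole
  series of operators.\<close>

lemma Hplus_rec:
  fixes \<Phi> :: "('n::finite \<times> 'n) \<times> nat \<Rightarrow> 's \<Rightarrow> 's" and ev :: "'s \<Rightarrow> 'i \<Rightarrow> 'm::hcomplete"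
  assumes C: "C s" "\<And>g s. C s \<Longrightarrow> C (\<Phi> g s)"
    and comm: "\<And>g g' s. C s \<Longrightarrow> \<Phi> g (\<Phi> g' s) = \<Phi> g' (\<Phi> g s)"
    and tr: "\<And>s r i. C s \<Longrightarrow> (\<Sum>j\<in>UNIV. ev (\<Phi> ((j, j), r) s) i) = 0"
  shows "\<exists>L. (\<forall>i. hlinear (\<lambda>p. L p i)) \<and> (\<forall>xs i. L (plist xs) i = ev (foldr \<Phi> xs s) i)"
proof -
  define st where "st m = foldr \<Phi> (SOME xs. mon xs = m) s" for m
  have st: "st (mon xs) = foldr \<Phi> xs s" for xs
  proof -
    have "mon (SOME ys. mon ys = mon xs) = mon xs" by (rule someI) simp
    then show ?thesis
      unfolding st_def using C comm by (intro foldr_permute[where C = C]) (auto simp: mon_eq_iff)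
  qed
  have Cf: "C (foldr \<Phi> xs s)" for xs by (induction xs) (simp_all add: C)
  have "\<exists>L. hlinear L \<and> (\<forall>m. L (Hmon m) = ev (st m) i)" for i
  proof (rule Hplus_lift)
    fix m :: "(('n \<times> 'n) \<times> nat) \<Rightarrow>\<^sub>0 nat" and r :: nat
    obtain xs where m: "m = mon xs" using mon_surj by metis
    have "st (m + Poly_Mapping.single ((j, j), r) 1) = \<Phi> ((j, j), r) (foldr \<Phi> xs s)" for j
      using st[of "((j, j), r) # xs"] by (simp add: m add.commute)
    then show "(\<Sum>j\<in>UNIV. ev (st (m + Poly_Mapping.single ((j, j), r) 1)) i) = 0"
      by (simp only: tr[OF Cf])
  qed
  then obtain L where "\<And>i. hlinear (L i)" "\<And>i m. L i (Hmon m) = ev (st m) i" by metis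
  then show ?thesis by (intro exI[of _ "\<lambda>p i. L i p"]) (simp flip: Hmon_mon st)
qed

text \<open>Truncation in h: modulo \<open>hpow n\<close> every element is a finite combination of
  monomials.\<close>

lemma Hplus_induct_plist [case_names plist plus scale hpow]:
  assumes "\<And>xs. P (plist xs)" "\<And>u v. P u \<Longrightarrow> P v \<Longrightarrow> P (u + v)" "\<And>a u. P u \<Longrightarrow> P (a *\<^sub>h u)"
    "\<And>u. u \<in> hpow n \<Longrightarrow> P (u :: 'n::finite Hplus)"
  shows "P u"
proof -
  have mono: "P (Hmon m)" for m using assms(1) mon_surj Hmon_mon by metis
  have const: "P (abs_Hplus (fps_const p))" for p
  proof (induction p rule: pm_induct)
    case zero
    show ?case using assms(3)[OF mono, of 0 0] by (simp add: zero_Hplus_def)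
  next
    case (single m c)
    show ?case unfolding abs_Hplus_monomial by (rule assms(3)[OF mono])
  next
    case (plus p q)
    then show ?case using assms(2) by (simp add: plus_Hplus.abs_eq flip: fps_const_add) (metis plus_Hplus.abs_eq)
  qed
  obtain p where p: "u = abs_Hplus p" by (rule Hplus_obtain)
  have "P (abs_Hplus (\<Sum>i<k. fps_X ^ i * fps_const (fps_nth p i)))" for k
  proof (induction k)
    case 0
    show ?case using const[of 0] by simp
  next
    case (Suc k)
    show ?case
      using assms(2)[OF Suc assms(3)[OF const, of "fps_X ^ k" "fps_nth p k"]]
      by (simp add: hscale_abs_X plus_Hplus.abs_eq)
  qed
  then have "P (abs_Hplus (\<Sum>i<n. fps_X ^ i * fps_const (fps_nth p i)) + fps_X ^ n *\<^sub>h abs_Hplus (fps_shift n p))"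
    by (rule assms(2)) (rule assms(4)[OF hpow_X])
  moreover have "abs_Hplus (\<Sum>i<n. fps_X ^ i * fps_const (fps_nth p i)) + fps_X ^ n *\<^sub>h abs_Hplus (fps_shift n p) = u"
    unfolding p hscale_abs_X plus_Hplus.abs_eq by (subst (3) fps_truncate[of p n]) (rule refl)
  ultimately show ?thesis by simp
qed

lemma xplus_Hvar: "r \<ge> 0 \<Longrightarrow> xplus e r = Hvar e (nat r)" "xplus e (int k) = Hvar e k"
  by (simp_all add: xplus_def)

lemma xplus_neg [simp]: "r < 0 \<Longrightarrow> xplus e r = 0"
  by (simp add: xplus_def)

lemma Hplus_induct_mod [case_names one times plus scale hpow]:
  assumes "P 1" "\<And>e r u. r \<ge> 0 \<Longrightarrow> P u \<Longrightarrow> P (xplus e r * u)"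
    "\<And>u v. P u \<Longrightarrow> P v \<Longrightarrow> P (u + v)" "\<And>a u. P u \<Longrightarrow> P (a *\<^sub>h u)"
    "\<And>u. u \<in> hpow n \<Longrightarrow> P (u :: 'n::finite Hplus)"
  shows "P u"
proof (induction u rule: Hplus_induct_plist[where n = n])
  case (plist xs)
  show ?case
  proof (induction xs)
    case (Cons g xs)
    then show ?case using assms(2)[of "int (snd g)" "plist xs" "fst g"] by (simp add: xplus_Hvar)
  qed (simp add: assms(1))
qed (use assms in auto)

text \<open>The index \<open>i\<close> ranges over parameters that change in the induction.\<close>

lemma Hplus_eqI:
  fixes F G :: "'i \<Rightarrow> 'n::finite Hplus \<Rightarrow> 'm::hcomplete"
  assumes "\<And>i. hlinear (F i)" "\<And>i. hlinear (G i)" "\<And>i. F i 1 = G i 1"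
    "\<And>e r u i. r \<ge> 0 \<Longrightarrow> (\<And>i. F i u = G i u) \<Longrightarrow> F i (xplus e r * u) = G i (xplus e r * u)"
  shows "F i u = G i u"
proof (rule hseparated_eq)
  have pl: "F i (plist xs) = G i (plist xs)" for xs i
  proof (induction xs arbitrary: i)
    case (Cons g xs)
    then show ?case using assms(4)[of "int (snd g)" "plist xs" i "fst g"] by (simp add: xplus_Hvar)
  qed (simp add: assms(3))
  fix n
  show "F i u - G i u \<in> hpow n"
  proof (induction u rule: Hplus_induct_plist[where n = n])
    case (plist xs)
    show ?case by (simp add: pl hpow_zero)
  next
    case (plus u v)
    then have "(F i u - G i u) + (F i v - G i v) \<in> hpow n" by (rule hpow_add)
    then show ?case by (simp add: hlinear_add[OF assms(1)] hlinear_add[OF assms(2)] algebra_simps)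
  next
    case (scale a u)
    then have "a *\<^sub>h (F i u - G i u) \<in> hpow n" by (rule hpow_scale)
    then show ?case
      by (simp add: hlinear_scale[OF assms(1)] hlinear_scale[OF assms(2)] hmod.scale_right_diff_distrib)
  next
    case (hpow u)
    then show ?case by (metis hpow_diff hlinear_hpow[OF assms(1)] hlinear_hpow[OF assms(2)])
  qed
qed

section \<open>Binomial expansions\<close>

lemma plus_coeff_nat: "plus_coeff k (int l) = fps_const (of_int (k + int l) gchoose l)"
  by (simp add: plus_coeff_def)

lemma plus_coeff_neg [simp]: "l < 0 \<Longrightarrow> plus_coeff k l = 0"
  by (simp add: plus_coeff_def)

lemma minus_coeff_neg [simp]: "l < 0 \<Longrightarrow> minus_coeff k l = 0"
  by (simp add: minus_coeff_def)

lemma minus_coeff_nat: "minus_coeff k (int l) = fps_const ((-1) ^ l * (of_int (k + int l) gchoose l))"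
proof -
  have "(-1 :: complex fps) ^ l = fps_const ((-1) ^ l)"
    by (metis fps_const_1_eq_1 fps_const_neg fps_const_power)
  then show ?thesis by (simp add: minus_coeff_def plus_coeff_nat)
qed

lemma plus_coeff_int: "plus_coeff (int m - int l) (int l) = fps_const (of_nat (m choose l))"
proof -
  have "(of_int (int m - int l + int l) :: complex) = of_nat m" by simp
  then show ?thesis unfolding plus_coeff_nat by (simp only: binomial_gbinomial)
qed

lemma plus_coeff_0_right [simp]: "plus_coeff k 0 = 1"
  by (simp add: plus_coeff_def)

lemma plus_coeff_0_left [simp]: "r \<ge> 0 \<Longrightarrow> plus_coeff 0 r = 1"
  using plus_coeff_int[of "nat r" "nat r"] by simp

lemma minus_coeff_0 [simp]: "minus_coeff k 0 = 1"
  by (simp add: minus_coeff_def)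

text \<open>A nonnegative power of \<open>x + y\<close> is a polynomial, so negative powers of
  \<open>x\<close> do not occur in it.\<close>

lemma plus_coeff_vanish:
  assumes "k < 0" "k + l \<ge> 0" shows "plus_coeff k l = 0"
proof -
  have "k = int (nat (k + l)) - int (nat l)" "l = int (nat l)" "nat (k + l) < nat l"
    using assms by auto
  then show ?thesis using plus_coeff_int[of "nat (k + l)" "nat l"] by (simp add: binomial_eq_0)
qed

lemma minus_coeff_vanish: "k < 0 \<Longrightarrow> k + l \<ge> 0 \<Longrightarrow> minus_coeff k l = 0"
  by (simp add: minus_coeff_def plus_coeff_vanish)

text \<open>Both sides are the coefficient of \<open>x^a y^b z^c\<close> in
  \<open>(x + y + z)^(a + b + c)\<close>, expanded in nonnegative powers of \<open>y\<close> and
  \<open>z\<close>, bracketed as \<open>x + (y + z)\<close> and as \<open>(x + y) + z\<close>. Most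
  kernel identities below are instances of this associativity.\<close>

lemma plus_coeff_multinomial:
  "plus_coeff a (b + c) * plus_coeff b c = plus_coeff (a + b) c * plus_coeff a b"
proof (cases "c < 0")
  case True
  then show ?thesis by simp
next
  case c: False
  show ?thesis
  proof (cases "b < 0")
    case True
    then show ?thesis
      using c plus_coeff_vanish[of b c] by (cases "b + c < 0") simp_all
  next
    case False
    with c obtain m n where mn: "b = int m" "c = int n" by (metis not_less zero_le_imp_eq_int)
    have "plus_coeff a (b + c) * plus_coeff b c =
        fps_const ((of_int (a + b + c) gchoose (m + n)) * (of_nat (m + n) gchoose n))"
      using plus_coeff_nat[of a "m + n"] plus_coeff_nat[of b n] by (simp add: mn add.assoc)
    also have "\<dots> = fps_const ((of_int (a + b + c) gchoose n) * (of_int (a + b) gchoose m))"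
      by (subst gbinomial_trinomial_revision) (simp_all add: mn)
    also have "\<dots> = plus_coeff (a + b) c * plus_coeff a b"
      by (simp add: mn plus_coeff_nat)
    finally show ?thesis .
  qed
qed

lemma minus_one_power_nat_add: "b \<ge> 0 \<Longrightarrow> c \<ge> 0 \<Longrightarrow> (-1 :: 'a::comm_ring_1) ^ nat (b + c) = (-1) ^ nat b * (-1) ^ nat c"
  by (simp add: nat_add_distrib power_add)

text \<open>The derivatives of \<open>(x + y)^(j + r)\<close> in \<open>x\<close> and in
  \<open>y\<close> agree; compare coefficients of \<open>x^(j - 1) y^r\<close>.\<close>

lemma plus_coeff_absorb: "r \<ge> 0 \<Longrightarrow> of_int j * plus_coeff j r = of_int (r + 1) * plus_coeff (j - 1) (r + 1)"
proof -
  assume "r \<ge> 0"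
  then obtain n where r: "r = int n" by (metis zero_le_imp_eq_int)
  have "of_int (j + r) * (of_int (j + r) gchoose n) =
      of_nat n * (of_int (j + r) gchoose n) + of_nat (Suc n) * ((of_int (j + r) :: complex) gchoose Suc n)"
    by (rule gbinomial_mult_1)
  then have "of_int j * ((of_int (j + r) :: complex) gchoose n) = of_nat (Suc n) * (of_int (j + r) gchoose Suc n)"
    by (simp add: r algebra_simps)
  moreover have "plus_coeff (j - 1) (r + 1) = fps_const (of_int (j + r) gchoose Suc n)"
    using plus_coeff_nat[of "j - 1" "Suc n"] by (simp add: r add.commute)
  moreover have "(of_int k :: complex fps) = fps_const (of_int k)" for k by (rule fps_of_int[symmetric])
  ultimately show ?thesis by (simp add: r plus_coeff_nat add.commute)
qed

text \<open>A Cauchy product of one-sided sequences. The vector \<open>x\<close> is present because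
  \<open>hsum\<close> is evaluated in complete modules and the scalars are not declared to be
  one.\<close>

lemma hsum_conv:
  fixes f g :: "int \<Rightarrow> complex fps" and x :: "'a::hcomplete"
  assumes f: "\<And>j. j < 0 \<Longrightarrow> f j = 0" and g: "\<And>j. j < 0 \<Longrightarrow> g j = 0"
    and fg: "\<And>n. (\<Sum>k\<in>{0..n}. f (int k) * g (int (n - k))) = w (int n)" and w: "\<And>j. j < 0 \<Longrightarrow> w j = 0"
  shows "(HSUM j. (f j * g (c - j)) *\<^sub>h x) = w c *\<^sub>h x"
proof (cases "c < 0")
  case True
  have "f j * g (c - j) = 0" for j using f[of j] g[of "c - j"] True by (cases "j < 0") auto
  then have "(f j * g (c - j)) *\<^sub>h x = 0" for j by (simp only: hmod.scale_zero_left)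
  then show ?thesis by (simp only: w[OF True] hsum_zero hmod.scale_zero_left)
next
  case False
  then obtain n where c: "c = int n" by (metis not_less zero_le_imp_eq_int)
  have z: "f j * g (c - j) = 0" if "j \<notin> int ` {0..n}" for j
  proof (cases "j < 0")
    case False
    then obtain k where "j = int k" by (metis not_less zero_le_imp_eq_int)
    with that have "c - j < 0" unfolding c by auto
    then show ?thesis using g by simp
  qed (simp add: f)
  have "(HSUM j. (f j * g (c - j)) *\<^sub>h x) = (\<Sum>j\<in>int ` {0..n}. (f j * g (c - j)) *\<^sub>h x)"
    by (rule hsum_finite_support) (auto simp: z)
  also have "\<dots> = (\<Sum>k\<in>{0..n}. (f (int k) * g (int (n - k))) *\<^sub>h x)"
    by (subst sum.reindex) (auto simp: c of_nat_diff)
  also have "\<dots> = w c *\<^sub>h x"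
    by (simp only: hmod.scale_sum_left[symmetric] fg c)
  finally show ?thesis .
qed

text \<open>The law \<open>(1 + y)^n (1 + y)^m = (1 + y)^(n + m)\<close>, read off at
  \<open>y^c\<close>.\<close>

lemma plus_coeff_Vandermonde:
  "(HSUM j. (plus_coeff (n - j) j * plus_coeff (m - (c - j)) (c - j)) *\<^sub>h x)
    = plus_coeff (n + m - c) c *\<^sub>h (x :: 'a::hcomplete)"
proof (rule hsum_conv[where g = "\<lambda>j. plus_coeff (m - j) j" and w = "\<lambda>j. plus_coeff (n + m - j) j"])
  fix l :: nat
  have "(\<Sum>k\<in>{0..l}. plus_coeff (n - int k) (int k) * plus_coeff (m - int (l - k)) (int (l - k)))
      = fps_const (\<Sum>k\<in>{0..l}. (of_int n gchoose k) * (of_int m gchoose (l - k)))"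
    unfolding plus_coeff_nat by (simp add: fps_const_sum)
  then show "(\<Sum>k\<in>{0..l}. plus_coeff (n - int k) (int k) * plus_coeff (m - int (l - k)) (int (l - k)))
      = plus_coeff (n + m - int l) (int l)"
    by (simp add: gbinomial_Vandermonde plus_coeff_nat)
qed auto

lemma minus_coeff_Vandermonde:
  "(HSUM j. (minus_coeff (n - j) j * minus_coeff (m - (c - j)) (c - j)) *\<^sub>h x)
    = minus_coeff (n + m - c) c *\<^sub>h (x :: 'a::hcomplete)"
proof (rule hsum_conv[where g = "\<lambda>j. minus_coeff (m - j) j" and w = "\<lambda>j. minus_coeff (n + m - j) j"])
  fix l :: nat
  have "(-1) ^ k * (of_int n gchoose k) * ((-1) ^ (l - k) * (of_int m gchoose (l - k))) =
      (-1) ^ l * ((of_int n gchoose k) * ((of_int m :: complex) gchoose (l - k)))" if "k \<le> l" for k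
  proof -
    have "(-1 :: complex) ^ l = (-1) ^ k * (-1) ^ (l - k)" using that by (simp flip: power_add)
    then show ?thesis by simp
  qed
  then have "(\<Sum>k\<in>{0..l}. (-1) ^ k * (of_int n gchoose k) * ((-1) ^ (l - k) * (of_int m gchoose (l - k)))) =
      (-1) ^ l * (\<Sum>k\<in>{0..l}. (of_int n gchoose k) * ((of_int m :: complex) gchoose (l - k)))"
    unfolding sum_distrib_left by (intro sum.cong refl) simp
  then have "(\<Sum>k\<in>{0..l}. minus_coeff (n - int k) (int k) * minus_coeff (m - int (l - k)) (int (l - k)))
      = fps_const ((-1) ^ l * (\<Sum>k\<in>{0..l}. (of_int n gchoose k) * (of_int m gchoose (l - k))))"
    unfolding minus_coeff_nat fps_const_mult diff_add_cancel by (simp only: fps_const_sum[symmetric])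
  then show "(\<Sum>k\<in>{0..l}. minus_coeff (n - int k) (int k) * minus_coeff (m - int (l - k)) (int (l - k)))
      = minus_coeff (n + m - int l) (int l)"
    by (simp add: gbinomial_Vandermonde minus_coeff_nat)
qed auto

text \<open>The numbers \<open>plus_coeff k i\<close> are the coefficients of
  \<open>(1 - y)^(-k - 1)\<close>, so this is
  \<open>(1 - y)^p (1 - y)^(-k - 1) = (1 - y)^(-(k - p) - 1)\<close>. It expresses that
  \<open>(x - y)^p\<close> becomes \<open>z^p\<close> under the substitution
  \<open>x = z + y\<close>.\<close>

lemma plus_minus_coeff_Vandermonde:
  "(HSUM i. (minus_coeff (p - i) i * plus_coeff k (c - i)) *\<^sub>h x)
    = plus_coeff (k - p) c *\<^sub>h (x :: 'a::hcomplete)"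
proof (rule hsum_conv[where g = "\<lambda>j. plus_coeff k j" and w = "\<lambda>j. plus_coeff (k - p) j"])
  fix l :: nat
  have neg: "(of_int (k + int j) :: complex) gchoose j = (-1) ^ j * (of_int (- k - 1) gchoose j)" for k :: int and j
    by (subst gbinomial_negated_upper) (simp add: algebra_simps)
  have "(-1) ^ i * (of_int p gchoose i) * (of_int (k + int (l - i)) gchoose (l - i)) =
      (-1) ^ l * ((of_int p gchoose i) * ((of_int (- k - 1) :: complex) gchoose (l - i)))" if "i \<le> l" for i
  proof -
    have "(-1 :: complex) ^ l = (-1) ^ i * (-1) ^ (l - i)" using that by (simp flip: power_add)
    then show ?thesis unfolding neg by simp
  qed
  then have "(\<Sum>i\<in>{0..l}. (-1) ^ i * (of_int p gchoose i) * (of_int (k + int (l - i)) gchoose (l - i))) =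
      (-1) ^ l * (\<Sum>i\<in>{0..l}. (of_int p gchoose i) * ((of_int (- k - 1) :: complex) gchoose (l - i)))"
    unfolding sum_distrib_left by (intro sum.cong refl) simp
  then have "(\<Sum>i\<in>{0..l}. minus_coeff (p - int i) (int i) * plus_coeff k (int (l - i)))
      = fps_const ((-1) ^ l * (\<Sum>i\<in>{0..l}. (of_int p gchoose i) * (of_int (- k - 1) gchoose (l - i))))"
    unfolding minus_coeff_nat plus_coeff_nat fps_const_mult diff_add_cancel by (simp only: fps_const_sum[symmetric])
  also have "\<dots> = plus_coeff (k - p) (int l)"
  proof -
    have "of_int p + of_int (- k - 1) = (of_int (- (k - p) - 1) :: complex)" by simp
    then show ?thesis unfolding gbinomial_Vandermonde plus_coeff_nat neg[of "k - p"] by (simp only:)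
  qed
  finally show "(\<Sum>i\<in>{0..l}. minus_coeff (p - int i) (int i) * plus_coeff k (int (l - i)))
      = plus_coeff (k - p) (int l)" .
qed auto

section \<open>The series S\<close>

lemma permP_nth: "(permP :: ('n::finite) rmatrix) $ p $ q = (if q = prod.swap p then 1 else 0)"
proof -
  have "(permP :: 'n rmatrix) $ p $ q =
      (\<Sum>i\<in>UNIV. \<Sum>j\<in>UNIV. if i = fst p \<and> j = snd p then (if q = (j, i) then 1 else 0) else 0)"
    unfolding permP_def sum_component
    by (intro sum.cong refl) (auto simp: kron_def munit_def prod_eq_iff)
  also have "\<dots> = (\<Sum>i\<in>UNIV. if i = fst p then (\<Sum>j\<in>UNIV. if j = snd p then (if q = (j, i) then 1 else 0) else 0) else 0)"
    by (intro sum.cong refl) auto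
  also have "\<dots> = (if q = prod.swap p then 1 else 0)"
    by (simp add: sum.delta prod.swap_def)
  finally show ?thesis .
qed

lemma mat_times_nth: "(mat x ** A) $ p $ q = x * (A :: 'a::comm_semiring_1 ^ 'm ^ ('k::finite)) $ p $ q"
proof -
  have "(mat x ** A) $ p $ q = (\<Sum>k\<in>UNIV. if k = p then x * A $ k $ q else 0)"
    unfolding matrix_matrix_mult_def mat_def by (simp only: vec_lambda_beta) (rule sum.cong, auto)
  then show ?thesis by simp
qed

lemma Rmat_nth: "(Rmat x :: ('n::finite) rmatrix) $ p $ q =
    (if p = q then 1 else 0) - x * (if q = prod.swap p then 1 else 0)"
  unfolding Rmat_def by (simp add: mat_times_nth permP_nth) (simp add: mat_def)

text \<open>P squares to the identity, so a product of two R-matrices is again a combination of the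
  identity and P.\<close>

lemma Rmat_times_nth: "(Rmat x ** Rmat y :: ('n::finite) rmatrix) $ p $ q =
    (1 + x * y) * (if p = q then 1 else 0) - (x + y) * (if q = prod.swap p then 1 else 0)"
proof -
  have e: "((if p = r then 1 else 0) - x * (if r = prod.swap p then 1 else 0)) * Rmat y $ r $ q =
      (if r = p then Rmat y $ r $ q else 0) - (if r = prod.swap p then x * Rmat y $ r $ q else 0)" for r
    by (auto simp: algebra_simps)
  have "(Rmat x ** Rmat y :: 'n rmatrix) $ p $ q =
      (\<Sum>r\<in>UNIV. ((if p = r then 1 else 0) - x * (if r = prod.swap p then 1 else 0)) * Rmat y $ r $ q)"
    unfolding matrix_matrix_mult_def by (simp only: vec_lambda_beta Rmat_nth[of x])
  also have "\<dots> = Rmat y $ p $ q - x * Rmat y $ (prod.swap p) $ q"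
    unfolding e sum_subtractf by simp
  also have "\<dots> = (1 + x * y) * (if p = q then 1 else 0) - (x + y) * (if q = prod.swap p then 1 else 0)"
  proof -
    have "q = prod.swap (prod.swap p) \<longleftrightarrow> p = q" "prod.swap p = q \<longleftrightarrow> q = prod.swap p" by auto
    then show ?thesis unfolding Rmat_nth by (simp only:) (simp add: algebra_simps)
  qed
  finally show ?thesis .
qed

lemma GRR_nth: "(GRR G :: ('n::finite) rmatrix) $ p $ q =
    G * ((1 + fps_X * shifted_arg) * (if p = q then 1 else 0) -
      (fps_X + shifted_arg) * (if q = prod.swap p then 1 else 0))"
  unfolding GRR_def by (simp only: matrix_mul_assoc[symmetric] mat_times_nth Rmat_times_nth)

context
  fixes N :: "complex poly fps" and F :: "complex poly fps"
  defines "N \<equiv> of_nat (CARD('n::finite))"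
    and "F \<equiv> N * (1 + fps_X * shifted_arg) - (fps_X + shifted_arg)"
begin

text \<open>A partial trace sends the identity to N times the identity and P to the identity, so
  both trace conditions amount to the scalar equation \<open>G * F = N\<close>.\<close>

lemma partial_traces:
  "partial_trace1 (GRR G - mat 1 :: 'n rmatrix) = mat (G * F - N)"
  "partial_trace2 (GRR G - mat 1 :: 'n rmatrix) = mat (G * F - N)"
proof -
  have 1: "(\<Sum>a\<in>UNIV. (GRR G - mat 1 :: 'n rmatrix) $ (a, c) $ (a, d)) = (if c = d then G * F - N else 0)" for c d
  proof -
    have "(GRR G - mat 1 :: 'n rmatrix) $ (a, c) $ (a, d) =
        (if c = d then G * (1 + fps_X * shifted_arg) - 1 else 0)
        - (if a = c then if c = d then G * (fps_X + shifted_arg) else 0 else 0)" for a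
      by (auto simp: GRR_nth mat_def algebra_simps)
    then have "(\<Sum>a\<in>UNIV. (GRR G - mat 1 :: 'n rmatrix) $ (a, c) $ (a, d)) =
        (\<Sum>a\<in>UNIV. (if c = d then G * (1 + fps_X * shifted_arg) - 1 else 0)
        - (if a = c then if c = d then G * (fps_X + shifted_arg) else 0 else 0))"
      by (rule sum.cong[OF refl])
    also have "\<dots> = (if c = d then G * F - N else 0)"
      by (simp add: sum_subtractf F_def N_def algebra_simps)
    finally show ?thesis .
  qed
  have 2: "(\<Sum>c\<in>UNIV. (GRR G - mat 1 :: 'n rmatrix) $ (a, c) $ (b, c)) = (if a = b then G * F - N else 0)" for a b
  proof -
    have "(GRR G - mat 1 :: 'n rmatrix) $ (a, c) $ (b, c) =
        (if a = b then G * (1 + fps_X * shifted_arg) - 1 else 0)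
        - (if c = a then if a = b then G * (fps_X + shifted_arg) else 0 else 0)" for c
      by (auto simp: GRR_nth mat_def algebra_simps)
    then have "(\<Sum>c\<in>UNIV. (GRR G - mat 1 :: 'n rmatrix) $ (a, c) $ (b, c)) =
        (\<Sum>c\<in>UNIV. (if a = b then G * (1 + fps_X * shifted_arg) - 1 else 0)
        - (if c = a then if a = b then G * (fps_X + shifted_arg) else 0 else 0))"
      by (rule sum.cong[OF refl])
    also have "\<dots> = (if a = b then G * F - N else 0)"
      by (simp add: sum_subtractf F_def N_def algebra_simps)
    finally show ?thesis .
  qed
  show "partial_trace1 (GRR G - mat 1 :: 'n rmatrix) = mat (G * F - N)"
    unfolding partial_trace1_def mat_def vec_eq_iff using 1 by (simp add: mat_def)
  show "partial_trace2 (GRR G - mat 1 :: 'n rmatrix) = mat (G * F - N)"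
    unfolding partial_trace2_def mat_def vec_eq_iff using 2 by (simp add: mat_def)
qed

text \<open>\<open>F\<close> has the invertible constant coefficient N, so the scalar equation has
  exactly one solution and the definite description in \<open>Gseries\<close> denotes it.\<close>

lemma Gseries_trace:
  "partial_trace1 (GRR (Gseries TYPE('n)) - mat 1 :: 'n rmatrix) = 0"
  "partial_trace2 (GRR (Gseries TYPE('n)) - mat 1 :: 'n rmatrix) = 0"
proof -
  have "fps_nth F 0 * [:1 / of_nat (CARD('n)):] = 1"
    by (simp add: F_def N_def shifted_arg_def fps_of_nat[symmetric] of_nat_poly one_pCons)
  then have inv: "F * fps_right_inverse F [:1 / of_nat (CARD('n)):] = 1" by (rule fps_right_inverse)
  define Fi where "Fi = fps_right_inverse F [:1 / of_nat (CARD('n)):]"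
  have "\<exists>!G. G * F - N = 0"
  proof (rule ex1I)
    show "N * Fi * F - N = 0" using inv by (simp add: Fi_def mult.assoc mult.commute[of _ F])
    fix G assume "G * F - N = 0"
    then have "G * F * Fi = N * Fi" by simp
    then show "G = N * Fi" using inv by (simp add: Fi_def mult.assoc)
  qed
  moreover have "mat x = (0 :: complex poly fps ^ 'n ^ 'n) \<longleftrightarrow> x = 0" for x
    by (auto simp: mat_def vec_eq_iff)
  ultimately have "\<exists>!G. partial_trace1 (GRR G - mat 1 :: 'n rmatrix) = 0 \<and> partial_trace2 (GRR G - mat 1 :: 'n rmatrix) = 0"
    unfolding partial_traces by simp
  from theI'[OF this] show "partial_trace1 (GRR (Gseries TYPE('n)) - mat 1 :: 'n rmatrix) = 0"
    "partial_trace2 (GRR (Gseries TYPE('n)) - mat 1 :: 'n rmatrix) = 0"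
    unfolding Gseries_def by auto
qed

end

lemma Sser_trace1: "(\<Sum>i\<in>UNIV. Sser c (i, i) (f :: 'n::finite \<times> 'n) m) = 0"
proof (cases "m > - 2")
  case False
  let ?A = "GRR (Gseries TYPE('n)) - mat 1 :: 'n rmatrix"
  have "(\<Sum>i\<in>UNIV. ?A $ (i, fst f) $ (i, snd f)) = 0"
    using Gseries_trace(1)[where 'n = 'n] by (simp add: partial_trace1_def vec_eq_iff)
  then have "(\<Sum>i\<in>UNIV. poly (fps_nth (?A $ (i, fst f) $ (i, snd f)) k) c) = 0" for k
    by (metis (no_types) fps_sum_nth poly_sum fps_zero_nth poly_0)
  then show ?thesis
    using False by (simp add: Sser_def Let_def flip: sum_distrib_right fps_const_sum)
qed (simp add: Sser_def)

lemma Sser_trace2: "(\<Sum>i\<in>UNIV. Sser c (e :: 'n::finite \<times> 'n) (i, i) m) = 0"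
proof (cases "m > - 2")
  case False
  let ?A = "GRR (Gseries TYPE('n)) - mat 1 :: 'n rmatrix"
  have "(\<Sum>i\<in>UNIV. ?A $ (fst e, i) $ (snd e, i)) = 0"
    using Gseries_trace(2)[where 'n = 'n] by (simp add: partial_trace2_def vec_eq_iff)
  then have "(\<Sum>i\<in>UNIV. poly (fps_nth (?A $ (fst e, i) $ (snd e, i)) k) c) = 0" for k
    by (metis (no_types) fps_sum_nth poly_sum fps_zero_nth poly_0)
  then show ?thesis
    using False by (simp add: Sser_def Let_def flip: sum_distrib_right fps_const_sum)
qed (simp add: Sser_def)

text \<open>S is a combination of the identity and P, and both are invariant under exchange of the
  tensor factors.\<close>

lemma Sser_sym: "Sser c e f m = Sser c f (e :: 'n::finite \<times> 'n) m"
proof -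
  let ?A = "GRR (Gseries TYPE('n)) - mat 1 :: 'n rmatrix"
  have "?A $ (fst e, fst f) $ (snd e, snd f) = ?A $ (fst f, fst e) $ (snd f, snd e)"
  proof -
    have m: "mat 1 $ p $ q = (if p = q then 1 else (0 :: complex poly fps))" for p q :: "'n \<times> 'n"
      by (simp add: mat_def)
    have "((fst e, fst f) = (snd e, snd f)) = ((fst f, fst e) = (snd f, snd e))"
      "((snd e, snd f) = prod.swap (fst e, fst f)) = ((snd f, snd e) = prod.swap (fst f, fst e))"
      by auto
    then show ?thesis by (simp only: vector_minus_component GRR_nth m)
  qed
  then show ?thesis unfolding Sser_def Let_def by (simp only:)
qed

lemma Sser_high: "m > - 2 \<Longrightarrow> Sser c e f m = 0"
  by (simp add: Sser_def)

lemma Sser_dvd: "fps_X ^ nat (- m - 2) dvd Sser c e f m"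
proof (cases "m > - 2")
  case False
  then have "nat (- m) - 2 = nat (- m - 2)" by simp
  then show ?thesis using False by (simp add: Sser_def Let_def)
qed (simp add: Sser_def)

text \<open>The common interface of -S and T: tracelessness lets contractions pass to the quotient
  by the traces, and the support and divisibility clauses make their coefficients h-adically
  null.\<close>

definition pairing_kernel :: "('n::finite \<times> 'n \<Rightarrow> 'n \<times> 'n \<Rightarrow> int \<Rightarrow> complex fps) \<Rightarrow> bool"
  where "pairing_kernel \<sigma> \<longleftrightarrow>
    (\<forall>f m. (\<Sum>i\<in>UNIV. \<sigma> (i, i) f m) = 0) \<and> (\<forall>e m. (\<Sum>i\<in>UNIV. \<sigma> e (i, i) m) = 0) \<and>
    (\<forall>e f m. m > - 2 \<longrightarrow> \<sigma> e f m = 0) \<and> (\<forall>e f m. fps_X ^ nat (- m - 2) dvd \<sigma> e f m)"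

lemma pairing_kernelD:
  assumes "pairing_kernel \<sigma>"
  shows "(\<Sum>i\<in>UNIV. \<sigma> (i, i) f m) = 0" "(\<Sum>i\<in>UNIV. \<sigma> e (i, i) m) = 0"
    "m > - 2 \<Longrightarrow> \<sigma> e f m = 0" "fps_X ^ nat (- m - 2) dvd \<sigma> e f m"
  using assms unfolding pairing_kernel_def by blast+

lemma pairing_kernel_S: "pairing_kernel (\<lambda>e f m. - Sser c e f m)"
  unfolding pairing_kernel_def by (simp add: sum_negf Sser_trace1 Sser_trace2 Sser_high Sser_dvd)

lemma pairing_kernel_T: "pairing_kernel (Tser c)"
  unfolding pairing_kernel_def Tser_def
  by (simp add: sum_subtractf Sser_trace1 Sser_trace2 Sser_high Sser_dvd dvd_diff dvd_mult flip: sum_distrib_left)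

text \<open>The only exponent at which S need not be divisible by h is -2, and there T vanishes
  because -2 is even. This is why the braiding is 1 + O(h).\<close>

lemma Tser_dvd: "fps_X dvd Tser c e f m"
proof (cases "m < - 2")
  case True
  then have "(fps_X :: complex fps) ^ 1 dvd fps_X ^ nat (- m - 2)" by (intro le_imp_power_dvd) simp
  then have "fps_X dvd Sser c e f m" using Sser_dvd[of m c e f] dvd_trans by fastforce
  then show ?thesis unfolding Tser_def by (intro dvd_diff dvd_mult)
next
  case False
  then consider "m = - 2" | "m > - 2" by linarith
  then show ?thesis
  proof cases
    case 1
    then have "nat \<bar>m\<bar> = 2" by simp
    then have "Tser c e f m = Sser c e f m - (-1) ^ 2 * Sser c e f m" unfolding Tser_def by (simp only:)
    then show ?thesis by simp
  next
    case 2
    then show ?thesis by (simp add: Tser_def Sser_high)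
  qed
qed

section \<open>Derivations\<close>

text \<open>The form of \<open>hnull_Sigma\<close> in which one null family \<open>g\<close>
  controls all rows; typically \<open>g\<close> consists of the coefficients of an annihilation
  operator on a fixed vector.\<close>

lemma hnull_pairI:
  assumes "\<And>i. hnull (f i) UNIV" "hnull g UNIV" "\<And>i j n. g i \<in> hpow n \<Longrightarrow> f i j \<in> hpow n"
  shows "hnull (\<lambda>(i, j). f i j) UNIV"
proof -
  have "finite {i \<in> UNIV. \<exists>j\<in>UNIV. f i j \<notin> hpow n}" for n
    by (rule finite_subset[OF _ hnullD[OF assms(2), of n]]) (use assms(3) in blast)
  from hnull_Sigma[of UNIV "\<lambda>_. UNIV" f, OF this assms(1)] show ?thesis by simp
qed

lemma hnull_pair_swap: "hnull (\<lambda>(i, j). f i j) UNIV \<longleftrightarrow> hnull (\<lambda>(j, i). f i j) UNIV"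
  using hnull_swap[of f UNIV UNIV] by simp

lemma hsum_swap_UNIV:
  assumes "hnull (\<lambda>(i, j). f i j) UNIV"
  shows "(HSUM i. (HSUM j. f i j)) = ((HSUM j. (HSUM i. f i j)) :: 'a::hcomplete)"
  using hsum_swap[of f UNIV UNIV] assms by simp

lemma hnull_hsum_pair:
  assumes "hnull (\<lambda>(i, j). f i j) UNIV"
  shows "hnull (\<lambda>i. hsum (f i) UNIV :: 'a::hcomplete) UNIV" "hnull (f i) UNIV"
proof -
  have s: "hnull (\<lambda>(i, j). f i j) (UNIV \<times> UNIV)" using assms by simp
  show "hnull (\<lambda>i. hsum (f i) UNIV) UNIV" by (rule hsum_Sigma(2)[OF s])
  show "hnull (f i) UNIV" by (rule hnull_SigmaD[OF s]) simp
qed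

lemma Hplus_plist_eqI:
  assumes "hlinear F" "hlinear G" "\<And>xs. F (plist xs) = G (plist xs)"
  shows "F u = (G u :: 'm::hcomplete)"
proof (rule hseparated_eq)
  fix n
  show "F u - G u \<in> hpow n"
  proof (induction u rule: Hplus_induct_plist[where n = n])
    case (plist xs)
    show ?case by (simp add: assms(3) hpow_zero)
  next
    case (plus u v)
    then have "(F u - G u) + (F v - G v) \<in> hpow n" by (rule hpow_add)
    then show ?case by (simp add: hlinear_add[OF assms(1)] hlinear_add[OF assms(2)] algebra_simps)
  next
    case (scale a u)
    then have "a *\<^sub>h (F u - G u) \<in> hpow n" by (rule hpow_scale)
    then show ?case
      by (simp add: hlinear_scale[OF assms(1)] hlinear_scale[OF assms(2)] hmod.scale_right_diff_distrib)
  next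
    case (hpow u)
    then show ?case by (metis hpow_diff hlinear_hpow[OF assms(1)] hlinear_hpow[OF assms(2)])
  qed
qed

lemma Hplus_eqI1:
  fixes F G :: "'n::finite Hplus \<Rightarrow> 'm::hcomplete"
  assumes "hlinear F" "hlinear G" "F 1 = G 1"
    "\<And>e r u. r \<ge> 0 \<Longrightarrow> F u = G u \<Longrightarrow> F (xplus e r * u) = G (xplus e r * u)"
  shows "F u = G u"
  using Hplus_eqI[where F = "\<lambda>_ :: unit. F" and G = "\<lambda>_. G" and u = u] assms by auto

lemma sum_xplus_trace: "(\<Sum>i\<in>UNIV. xplus (i, i) k :: 'n::finite Hplus) = 0"
proof (cases "k < 0")
  case False
  have "(\<Sum>i\<in>UNIV. Hvar (i, i) r) = abs_Hplus (\<Sum>i\<in>UNIV. xvar ((i, i) :: 'n \<times> 'n) r)" for r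
  proof -
    have "(\<Sum>i\<in>A. Hvar (i, i) r) = abs_Hplus (\<Sum>i\<in>A. xvar ((i, i) :: 'n \<times> 'n) r)" if "finite A" for A
      using that by (induction A rule: finite_induct)
        (simp_all add: zero_Hplus_def Hvar.abs_eq plus_Hplus.abs_eq)
    then show ?thesis by simp
  qed
  then have "(\<Sum>i\<in>UNIV. Hvar ((i, i) :: 'n \<times> 'n) r) = 0" for r
    by (simp add: abs_Hplus_eq_0 trace_ideal.gen)
  then show ?thesis using False by (simp add: xplus_def)
qed simp

text \<open>The conditions that scalars \<open>\<kappa> e s\<close> must satisfy to be the values of
  a derivation on the generators: \<open>xplus e s\<close> is 0 for negative \<open>s\<close>, and
  the traces are 0.\<close>

definition tracefree :: "('n::finite \<times> 'n \<Rightarrow> int \<Rightarrow> complex fps) \<Rightarrow> bool"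
  where "tracefree \<kappa> \<longleftrightarrow> (\<forall>e s. s < 0 \<longrightarrow> \<kappa> e s = 0) \<and> (\<forall>s. (\<Sum>i\<in>UNIV. \<kappa> (i, i) s) = 0)"

lemma tracefree_0: "tracefree (\<lambda>e s. 0)"
  by (simp add: tracefree_def)

lemma tracefree_add: "tracefree \<kappa> \<Longrightarrow> tracefree \<mu> \<Longrightarrow> tracefree (\<lambda>e s. \<kappa> e s + \<mu> e s)"
  by (simp add: tracefree_def sum.distrib)

lemma tracefree_diff: "tracefree \<kappa> \<Longrightarrow> tracefree \<mu> \<Longrightarrow> tracefree (\<lambda>e s. \<kappa> e s - \<mu> e s)"
  by (simp add: tracefree_def sum_subtractf)

lemma tracefree_scale: "tracefree \<kappa> \<Longrightarrow> tracefree (\<lambda>e s. a * \<kappa> e s)"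
  by (simp add: tracefree_def flip: sum_distrib_left)

lemma tracefree_sum: "(\<And>i. i \<in> A \<Longrightarrow> tracefree (\<kappa> i)) \<Longrightarrow> tracefree (\<lambda>e s. \<Sum>i\<in>A. \<kappa> i e s)"
  by (induction A rule: infinite_finite_induct) (auto simp: tracefree_0 tracefree_add)

definition is_derv :: "('n::finite \<times> 'n \<Rightarrow> int \<Rightarrow> complex fps) \<Rightarrow> ('n Hplus \<Rightarrow> 'n Hplus) \<Rightarrow> bool"
  where "is_derv \<kappa> D \<longleftrightarrow> hlinear D \<and> D 1 = 0 \<and>
    (\<forall>e s u. D (xplus e s * u) = xplus e s * D u + \<kappa> e s *\<^sub>h u)"

definition derv :: "('n::finite \<times> 'n \<Rightarrow> int \<Rightarrow> complex fps) \<Rightarrow> 'n Hplus \<Rightarrow> 'n Hplus"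
  where "derv \<kappa> = (SOME D. is_derv \<kappa> D)"

text \<open>The state is a monomial together with its derivative, as in a computation over dual
  numbers; the updates commute because the values on generators are scalars.\<close>

lemma derv_exists:
  fixes \<kappa> :: "'n::finite \<times> 'n \<Rightarrow> int \<Rightarrow> complex fps"
  assumes tf: "tracefree \<kappa>"
  shows "\<exists>D. is_derv \<kappa> D"
proof -
  define \<Phi> :: "('n \<times> 'n) \<times> nat \<Rightarrow> 'n Hplus \<times> 'n Hplus \<Rightarrow> 'n Hplus \<times> 'n Hplus" where
    "\<Phi> g x = (Hvar (fst g) (snd g) * fst x, Hvar (fst g) (snd g) * snd x + \<kappa> (fst g) (int (snd g)) *\<^sub>h fst x)" for g x
  have tr: "(\<Sum>j\<in>UNIV. snd (\<Phi> ((j, j), r) x)) = 0" for r x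
  proof -
    have "(\<Sum>j\<in>UNIV. snd (\<Phi> ((j, j), r) x)) =
        (\<Sum>j\<in>UNIV. xplus (j, j) (int r)) * snd x + (\<Sum>j\<in>UNIV. \<kappa> (j, j) (int r)) *\<^sub>h fst x"
      by (simp add: \<Phi>_def sum.distrib sum_distrib_right hmod.scale_sum_left xplus_Hvar)
    then show ?thesis using tf by (simp add: sum_xplus_trace tracefree_def)
  qed
  have "\<exists>L. (\<forall>i. hlinear (\<lambda>p. L p i)) \<and> (\<forall>xs (i :: unit). L (plist xs) i = snd (foldr \<Phi> xs (1, 0)))"
    by (rule Hplus_rec[where C = "\<lambda>_. True" and ev = "\<lambda>x _. snd x"])
      (simp_all add: tr, simp add: \<Phi>_def algebra_simps Hplus_mult_scale hscale_right_distrib)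
  then obtain L where L: "\<And>i. hlinear (\<lambda>p. L p i)" "\<And>xs i. L (plist xs) (i :: unit) = snd (foldr \<Phi> xs (1, 0))"
    by blast
  define D where "D p = L p ()" for p
  have D: "hlinear D" unfolding D_def by (rule L(1))
  have fst: "fst (foldr \<Phi> xs (1, 0)) = plist xs" for xs
    by (induction xs) (simp_all add: \<Phi>_def)
  have Dp: "D (xplus e (int r) * plist xs) = xplus e (int r) * D (plist xs) + \<kappa> e (int r) *\<^sub>h plist xs" for e r xs
    using L(2)[of "(e, r) # xs" "()"] L(2)[of xs "()"] by (simp add: D_def xplus_Hvar \<Phi>_def fst)
  have "D (xplus e s * u) = xplus e s * D u + \<kappa> e s *\<^sub>h u" for e s u
  proof (cases "s < 0")
    case True
    then have "\<kappa> e s = 0" using tf unfolding tracefree_def by blast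
    with True show ?thesis by (simp add: hlinear_zero[OF D])
  next
    case False
    then obtain r where s: "s = int r" by (metis not_less zero_le_imp_eq_int)
    show ?thesis unfolding s
      by (rule Hplus_plist_eqI[of "\<lambda>u. D (xplus e (int r) * u)"])
        (intro hlinear_compose[OF D hlinear_times[OF hlinear_id]]
          hlinear_plus hlinear_times D hlinear_hscale hlinear_id Dp)+
  qed
  moreover have "D 1 = 0" using L(2)[of "[]" "()"] by (simp add: D_def)
  ultimately show ?thesis using D unfolding is_derv_def by blast
qed

lemma derv:
  assumes "tracefree \<kappa>"
  shows "hlinear (derv \<kappa>)" "derv \<kappa> 1 = 0" "derv \<kappa> (xplus e s * u) = xplus e s * derv \<kappa> u + \<kappa> e s *\<^sub>h u"
proof -
  have "is_derv \<kappa> (derv \<kappa>)" unfolding derv_def by (rule someI_ex[OF derv_exists[OF assms]])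
  then show "hlinear (derv \<kappa>)" "derv \<kappa> 1 = 0"
    "derv \<kappa> (xplus e s * u) = xplus e s * derv \<kappa> u + \<kappa> e s *\<^sub>h u"
    unfolding is_derv_def by blast+
qed

lemma hlinear_derv: "tracefree \<kappa> \<Longrightarrow> hlinear f \<Longrightarrow> hlinear (\<lambda>x. derv \<kappa> (f x))"
  by (rule hlinear_compose[OF derv(1)])

lemma derv_unique:
  assumes "tracefree \<kappa>" "hlinear D" "D 1 = 0" "\<And>e s u. s \<ge> 0 \<Longrightarrow> D (xplus e s * u) = xplus e s * D u + \<kappa> e s *\<^sub>h u"
  shows "derv \<kappa> u = D u"
  by (rule Hplus_eqI1[OF derv(1)[OF assms(1)] assms(2)]) (simp_all add: derv[OF assms(1)] assms(3,4))

text \<open>The scalar value on a generator is not differentiated again, so both composites obey the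
  same recursion on generators.\<close>

lemma derv_commute:
  assumes "tracefree \<kappa>" "tracefree \<mu>"
  shows "derv \<kappa> (derv \<mu> u) = derv \<mu> (derv \<kappa> u)"
  by (rule Hplus_eqI1[OF hlinear_derv[OF assms(1) derv(1)[OF assms(2)]] hlinear_derv[OF assms(2) derv(1)[OF assms(1)]]])
    (simp_all add: derv[OF assms(1)] derv[OF assms(2)] hlinear_zero[OF derv(1)[OF assms(1)]]
      hlinear_zero[OF derv(1)[OF assms(2)]] hlinear_add[OF derv(1)[OF assms(1)]] hlinear_add[OF derv(1)[OF assms(2)]]
      hlinear_scale[OF derv(1)[OF assms(1)]] hlinear_scale[OF derv(1)[OF assms(2)]])

lemma derv_0: "derv (\<lambda>e s. 0) u = 0"
  by (rule derv_unique[OF tracefree_0 hlinear_0]) auto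

lemma derv_add:
  assumes "tracefree \<kappa>" "tracefree \<mu>"
  shows "derv (\<lambda>e s. \<kappa> e s + \<mu> e s) u = derv \<kappa> u + derv \<mu> u"
  by (rule derv_unique[OF tracefree_add[OF assms] hlinear_plus[OF derv(1)[OF assms(1)] derv(1)[OF assms(2)]]])
    (simp_all add: derv[OF assms(1)] derv[OF assms(2)] distrib_left hscale_left_distrib)

lemma derv_scale:
  assumes "tracefree \<kappa>"
  shows "derv (\<lambda>e s. a * \<kappa> e s) u = a *\<^sub>h derv \<kappa> u"
  by (rule derv_unique[OF tracefree_scale[OF assms] hlinear_hscale[OF derv(1)[OF assms]]])
    (simp_all add: derv[OF assms] Hplus_mult_scale hscale_right_distrib hscale_hscale)

lemma derv_sum:
  "(\<And>i. i \<in> A \<Longrightarrow> tracefree (\<kappa> i)) \<Longrightarrow> derv (\<lambda>e s. \<Sum>i\<in>A. \<kappa> i e s) u = (\<Sum>i\<in>A. derv (\<kappa> i) u)"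
  by (induction A rule: infinite_finite_induct) (simp_all add: derv_0 derv_add tracefree_sum)

lemma derv_hpow:
  assumes "tracefree \<kappa>" "\<And>e s. fps_X ^ n dvd \<kappa> e s"
  shows "derv \<kappa> u \<in> hpow n"
proof (induction u rule: Hplus_induct_mod[where n = n])
  case one
  show ?case by (simp add: derv[OF assms(1)] hpow_zero)
next
  case (times e r u)
  show ?case unfolding derv(3)[OF assms(1)]
    by (intro hpow_add hlinear_hpow[OF hlinear_times[OF hlinear_id]] times hpow_dvd assms(2))
next
  case (plus u v)
  then show ?case by (simp add: hlinear_add[OF derv(1)[OF assms(1)]] hpow_add)
next
  case (scale a u)
  then show ?case by (simp add: hlinear_scale[OF derv(1)[OF assms(1)]] hpow_scale)
next
  case (hpow u)
  then show ?case by (rule hlinear_hpow[OF derv(1)[OF assms(1)]])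
qed

text \<open>Modulo \<open>hpow n\<close> only finitely many generators occur in \<open>u\<close>, so
  only the values there matter. The set \<open>F\<close> is the same for all indices
  \<open>i\<close>, which turns pointwise smallness of the values into nullity of the family of
  derivatives.\<close>

lemma derv_finite_dependence:
  fixes \<kappa> :: "'i \<Rightarrow> 'n::finite \<times> 'n \<Rightarrow> int \<Rightarrow> complex fps"
  assumes tf: "\<And>i. tracefree (\<kappa> i)"
  shows "\<exists>F. finite F \<and> (\<forall>i. (\<forall>(e, s)\<in>F. fps_X ^ n dvd \<kappa> i e s) \<longrightarrow> derv (\<kappa> i) u \<in> hpow n)"
proof (induction u rule: Hplus_induct_mod[where n = n])
  case one
  show ?case by (rule exI[of _ "{}"]) (simp add: derv[OF tf] hpow_zero)
next
  case (times e r u)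
  then obtain F where F: "finite F" "\<And>i. \<forall>(e, s)\<in>F. fps_X ^ n dvd \<kappa> i e s \<Longrightarrow> derv (\<kappa> i) u \<in> hpow n" by blast
  have "derv (\<kappa> i) (xplus e r * u) \<in> hpow n" if "\<forall>(e, s)\<in>insert (e, r) F. fps_X ^ n dvd \<kappa> i e s" for i
    unfolding derv(3)[OF tf]
    by (intro hpow_add hlinear_hpow[OF hlinear_times[OF hlinear_id]] F(2) hpow_dvd) (use that in auto)
  then show ?case using F(1) by (intro exI[of _ "insert (e, r) F"]) blast
next
  case (plus u v)
  then obtain F G where "finite F" "\<And>i. \<forall>(e, s)\<in>F. fps_X ^ n dvd \<kappa> i e s \<Longrightarrow> derv (\<kappa> i) u \<in> hpow n"
    "finite G" "\<And>i. \<forall>(e, s)\<in>G. fps_X ^ n dvd \<kappa> i e s \<Longrightarrow> derv (\<kappa> i) v \<in> hpow n" by blast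
  then show ?case
    by (intro exI[of _ "F \<union> G"]) (auto simp: hlinear_add[OF derv(1)[OF tf]] intro: hpow_add)
next
  case (scale a u)
  then show ?case by (metis hlinear_scale[OF derv(1)[OF tf]] hpow_scale)
next
  case (hpow u)
  then show ?case by (intro exI[of _ "{}"]) (simp add: hlinear_hpow[OF derv(1)[OF tf]])
qed

lemma hnull_derv:
  assumes tf: "\<And>i. tracefree (\<kappa> i)" and fin: "\<And>e s n. finite {i. \<not> fps_X ^ n dvd \<kappa> i e s}"
  shows "hnull (\<lambda>i. derv (\<kappa> i) u) UNIV"
  unfolding hnull_def
proof
  fix n
  obtain F where F: "finite F" "\<And>i. \<forall>(e, s)\<in>F. fps_X ^ n dvd \<kappa> i e s \<Longrightarrow> derv (\<kappa> i) u \<in> hpow n"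
    using derv_finite_dependence[where \<kappa> = \<kappa> and n = n and u = u, OF tf] by auto
  have "{i \<in> UNIV. derv (\<kappa> i) u \<notin> hpow n} \<subseteq> (\<Union>x\<in>F. {i. \<not> fps_X ^ n dvd \<kappa> i (fst x) (snd x)})"
  proof
    fix i assume "i \<in> {i \<in> UNIV. derv (\<kappa> i) u \<notin> hpow n}"
    then have "\<not> (\<forall>(e, s)\<in>F. fps_X ^ n dvd \<kappa> i e s)" using F(2)[of i] by blast
    then obtain x where "x \<in> F" "\<not> fps_X ^ n dvd \<kappa> i (fst x) (snd x)" by (auto simp: split_def)
    then show "i \<in> (\<Union>x\<in>F. {i. \<not> fps_X ^ n dvd \<kappa> i (fst x) (snd x)})" by blast
  qed
  then show "finite {i \<in> UNIV. derv (\<kappa> i) u \<notin> hpow n}"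
    by (rule finite_subset) (rule finite_UN_I[OF F(1) fin])
qed

lemma finite_lower_bound: "finite J \<Longrightarrow> \<exists>K :: int. \<forall>j\<in>J. K \<le> f j"
  by (rule exI[of _ "Min (insert 0 (f ` J))"]) simp

lemma derv_low:
  assumes tf: "\<And>i :: int. tracefree (\<kappa> i)" and low: "\<And>e s n. \<exists>K. \<forall>i<K. fps_X ^ n dvd \<kappa> i e s"
  shows "\<exists>K. \<forall>i<K. derv (\<kappa> i) u \<in> hpow n"
proof -
  obtain F where F: "finite F" "\<And>i. \<forall>(e, s)\<in>F. fps_X ^ n dvd \<kappa> i e s \<Longrightarrow> derv (\<kappa> i) u \<in> hpow n"
    using derv_finite_dependence[where \<kappa> = \<kappa> and n = n and u = u, OF tf] by auto
  obtain k where k: "\<And>e s i. i < k e s \<Longrightarrow> fps_X ^ n dvd \<kappa> i e s" using low[of n] by metis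
  obtain K where K: "\<forall>x\<in>F. K \<le> (case x of (e, s) \<Rightarrow> k e s)" using finite_lower_bound[OF F(1)] by blast
  have "derv (\<kappa> i) u \<in> hpow n" if "i < K" for i
  proof (rule F(2), rule ballI)
    fix x assume "x \<in> F"
    then have "i < k (fst x) (snd x)" using K that by (force simp: split_def)
    then show "case x of (e, s) \<Rightarrow> fps_X ^ n dvd \<kappa> i e s" using k by (simp add: split_def)
  qed
  then show ?thesis by blast
qed

text \<open>The component at \<open>e \<otimes> f\<close> of the coefficient of \<open>z\<^sup>j u\<^sup>r v\<^sup>s\<close> in \<open>\<sigma>(z + u - v)\<close>.\<close>

definition ker :: "('n::finite \<times> 'n \<Rightarrow> 'n \<times> 'n \<Rightarrow> int \<Rightarrow> complex fps) \<Rightarrow>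
    'n \<times> 'n \<Rightarrow> int \<Rightarrow> int \<Rightarrow> 'n \<times> 'n \<Rightarrow> int \<Rightarrow> complex fps"
  where "ker \<sigma> e r j = (\<lambda>f s. plus_coeff j r * minus_coeff (j + r) s * \<sigma> e f (j + r + s))"

text \<open>For \<open>\<sigma> = negS c\<close> this is the coefficient of \<open>z^j u^r\<close>
  in the annihilation operator \<open>x^-(z + u)\<close>; for \<open>\<sigma> = Tser c\<close> it is
  the contraction occurring in the braiding.\<close>

definition dop :: "('n::finite \<times> 'n \<Rightarrow> 'n \<times> 'n \<Rightarrow> int \<Rightarrow> complex fps) \<Rightarrow>
    'n \<times> 'n \<Rightarrow> int \<Rightarrow> int \<Rightarrow> 'n Hplus \<Rightarrow> 'n Hplus"
  where "dop \<sigma> e r j = derv (ker \<sigma> e r j)"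

lemma ker_vanish:
  assumes "pairing_kernel \<sigma>" "j \<ge> 0 \<or> r < 0 \<or> s < 0" shows "ker \<sigma> e r j f s = 0"
proof -
  consider "r < 0" | "s < 0" | "j \<ge> 0" "r \<ge> 0" "s \<ge> 0" using assms(2) by linarith
  then show ?thesis by cases (simp_all add: ker_def pairing_kernelD(3)[OF assms(1)])
qed

lemma ker_dvd:
  assumes "pairing_kernel \<sigma>" "int n \<le> - (j + r + s) - 2"
  shows "fps_X ^ n dvd ker \<sigma> e r j f s"
proof -
  have "(fps_X :: complex fps) ^ n dvd fps_X ^ nat (- (j + r + s) - 2)"
    by (rule le_imp_power_dvd) (use assms(2) in linarith)
  also have "\<dots> dvd \<sigma> e f (j + r + s)" by (rule pairing_kernelD(4)[OF assms(1)])
  finally show ?thesis unfolding ker_def by (rule dvd_mult)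
qed

text \<open>The support condition bounds \<open>j\<close> from above, the growing divisibility by h
  bounds it from below.\<close>

lemma finite_ker:
  assumes "pairing_kernel \<sigma>"
  shows "finite {j. \<not> fps_X ^ n dvd ker \<sigma> e r j f s}"
proof (rule finite_subset)
  show "{j. \<not> fps_X ^ n dvd ker \<sigma> e r j f s} \<subseteq> {- int n - r - s - 2..0}"
  proof
    fix j assume "j \<in> {j. \<not> fps_X ^ n dvd ker \<sigma> e r j f s}"
    then have j: "\<not> fps_X ^ n dvd ker \<sigma> e r j f s" by simp
    have "j < 0" using j ker_vanish[OF assms, of j r s e f] by (cases "j < 0") auto
    moreover have "\<not> int n \<le> - (j + r + s) - 2" using j ker_dvd[OF assms] by blast
    ultimately show "j \<in> {- int n - r - s - 2..0}" by simp
  qed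
qed simp

lemma tracefree_ker: "pairing_kernel \<sigma> \<Longrightarrow> tracefree (ker \<sigma> e r j)"
  unfolding tracefree_def
  by (simp add: ker_vanish) (simp add: ker_def pairing_kernelD(2) flip: sum_distrib_left)

text \<open>Tracelessness in the first tensor factor, used when a generator of the right argument
  acts as a derivation on the left one.\<close>

lemma tracefree_ker1:
  assumes "pairing_kernel \<sigma>" shows "tracefree (\<lambda>e r. ker \<sigma> e r j f s)"
  unfolding tracefree_def
proof (intro conjI allI impI)
  fix r
  have "(\<Sum>i\<in>UNIV. ker \<sigma> (i, i) r j f s) =
      plus_coeff j r * minus_coeff (j + r) s * (\<Sum>i\<in>UNIV. \<sigma> (i, i) f (j + r + s))"
    by (simp add: ker_def sum_distrib_left)
  then show "(\<Sum>i\<in>UNIV. ker \<sigma> (i, i) r j f s) = 0" by (simp add: pairing_kernelD(1)[OF assms])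
qed (simp add: ker_vanish[OF assms])

context
  fixes \<sigma> :: "'n::finite \<times> 'n \<Rightarrow> 'n \<times> 'n \<Rightarrow> int \<Rightarrow> complex fps"
  assumes \<sigma>: "pairing_kernel \<sigma>"
begin

lemma hlinear_dop: "hlinear (dop \<sigma> e r j)"
  unfolding dop_def by (rule derv(1)[OF tracefree_ker[OF \<sigma>]])

lemma dop_one: "dop \<sigma> e r j 1 = 0"
  unfolding dop_def by (rule derv(2)[OF tracefree_ker[OF \<sigma>]])

lemma dop_times: "dop \<sigma> e r j (xplus f s * u) = xplus f s * dop \<sigma> e r j u + ker \<sigma> e r j f s *\<^sub>h u"
  unfolding dop_def by (rule derv(3)[OF tracefree_ker[OF \<sigma>]])

lemma dop_commute_derv: "tracefree \<kappa> \<Longrightarrow> dop \<sigma> e r j (derv \<kappa> u) = derv \<kappa> (dop \<sigma> e r j u)"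
  unfolding dop_def by (rule derv_commute[OF tracefree_ker[OF \<sigma>]])

lemma dop_vanish: "j \<ge> 0 \<or> r < 0 \<Longrightarrow> dop \<sigma> e r j u = 0"
proof -
  assume "j \<ge> 0 \<or> r < 0"
  then have "ker \<sigma> e r j = (\<lambda>f s. 0)" by (intro ext ker_vanish[OF \<sigma>]) blast
  then show ?thesis by (simp add: dop_def derv_0)
qed

lemma hnull_dop: "hnull (\<lambda>j. dop \<sigma> e r j u) UNIV"
  unfolding dop_def by (rule hnull_derv[OF tracefree_ker[OF \<sigma>] finite_ker[OF \<sigma>]])

lemma dop_trace: "(\<Sum>i\<in>UNIV. dop \<sigma> (i, i) r j u) = 0"
proof -
  have "(\<Sum>i\<in>UNIV. dop \<sigma> (i, i) r j u) = derv (\<lambda>f s. \<Sum>i\<in>UNIV. ker \<sigma> (i, i) r j f s) u"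
    unfolding dop_def by (rule derv_sum[symmetric]) (rule tracefree_ker[OF \<sigma>])
  also have "(\<lambda>f s. \<Sum>i\<in>UNIV. ker \<sigma> (i, i) r j f s) = (\<lambda>f s. 0)"
    using tracefree_ker1[OF \<sigma>] unfolding tracefree_def fun_eq_iff by blast
  finally show ?thesis by (simp add: derv_0)
qed

end

lemma dop_commute:
  "pairing_kernel \<sigma> \<Longrightarrow> pairing_kernel \<tau> \<Longrightarrow> dop \<sigma> e r j (dop \<tau> f s k u) = dop \<tau> f s k (dop \<sigma> e r j u)"
  unfolding dop_def by (rule derv_commute) (rule tracefree_ker, assumption)+

section \<open>Field-like families\<close>

lemma int_diff_commute: "k - j - i = k - i - (j :: int)"
  by simp

lemma in_laurentD: "in_laurent f \<Longrightarrow> \<exists>K. \<forall>k<K. f k \<in> hpow n"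
  unfolding in_laurent_def by blast

text \<open>The invariant under which the recursion for \<open>L\<close> runs: it guarantees that
  every sum formed in a step converges.\<close>

definition good_family :: "(int \<Rightarrow> 'a::hmodule \<Rightarrow> 'b::hmodule) \<Rightarrow> bool"
  where "good_family F \<longleftrightarrow> (\<forall>k. hlinear (F k)) \<and> (\<forall>q. in_laurent (\<lambda>k. F k q))"

text \<open>The family \<open>L p\<close> is the normally ordered product in which a generator \<open>x\<^sub>e\<^sup>(\<^sup>-\<^sup>r\<^sup>-\<^sup>1\<^sup>)\<close> is replaced by
  \<open>A e r\<close> acting from the left plus \<open>B e r\<close> acting from the right.\<close>

locale ext =
  fixes A :: "'n::finite \<times> 'n \<Rightarrow> int \<Rightarrow> int \<Rightarrow> 'm::hcomplete \<Rightarrow> 'm"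
    and B :: "'n \<times> 'n \<Rightarrow> int \<Rightarrow> int \<Rightarrow> 'n Hplus \<Rightarrow> 'n Hplus"
    and \<iota> :: "'n Hplus \<Rightarrow> 'm"
  assumes A_lin: "hlinear (A e r j)" and B_lin: "hlinear (B e r j)" and \<iota>_lin: "hlinear \<iota>"
    and A_comm: "A e r j (A f s k x) = A f s k (A e r j x)"
    and B_comm: "B e r j (B f s k u) = B f s k (B e r j u)"
    and A_neg: "j < 0 \<Longrightarrow> A e r j x = 0"
    and B_null: "hnull (\<lambda>j. B e r j u) UNIV"
    and A_trace: "(\<Sum>i\<in>UNIV. A (i, i) r j x) = 0" and B_trace: "(\<Sum>i\<in>UNIV. B (i, i) r j u) = 0"
    and A_r: "r < 0 \<Longrightarrow> A e r j x = 0" and B_r: "r < 0 \<Longrightarrow> B e r j u = 0"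
begin

definition step :: "'n \<times> 'n \<Rightarrow> int \<Rightarrow> (int \<Rightarrow> 'n Hplus \<Rightarrow> 'm) \<Rightarrow> int \<Rightarrow> 'n Hplus \<Rightarrow> 'm"
  where "step e r F k q = (HSUM j. A e r j (F (k - j) q) + F (k - j) (B e r j q))"

lemma A_hpow: "x \<in> hpow n \<Longrightarrow> A e r j x \<in> hpow n"
  by (rule hlinear_hpow[OF A_lin])

lemma hnull_A:
  assumes "in_laurent f" shows "hnull (\<lambda>j. A e r j (f (k - j))) UNIV"
  unfolding hnull_def
proof
  fix n
  obtain K where K: "\<And>k. k < K \<Longrightarrow> f k \<in> hpow n" using in_laurentD[OF assms] by blast
  have "{j \<in> UNIV. A e r j (f (k - j)) \<notin> hpow n} \<subseteq> {0..k - K}"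
  proof
    fix j assume "j \<in> {j \<in> UNIV. A e r j (f (k - j)) \<notin> hpow n}"
    then have j: "A e r j (f (k - j)) \<notin> hpow n" by simp
    then have "j \<ge> 0" using A_neg[of j e r] hpow_zero by (cases "j < 0") auto
    moreover have "\<not> k - j < K" using j K A_hpow by blast
    ultimately show "j \<in> {0..k - K}" by simp
  qed
  then show "finite {j \<in> UNIV. A e r j (f (k - j)) \<notin> hpow n}" by (rule finite_subset) simp
qed

lemma hnull_B: "(\<And>k. hlinear (F k)) \<Longrightarrow> hnull (\<lambda>j. F (k - j) (B e r j q)) UNIV"
  by (rule hnull_dominated[OF B_null[of e r q]]) (rule hlinear_hpow)

lemma good_lin: "good_family F \<Longrightarrow> hlinear (F k)"
  and good_laurent: "good_family F \<Longrightarrow> in_laurent (\<lambda>k. F k q)"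
  unfolding good_family_def by auto

lemma hnull_step:
  assumes "good_family F"
  shows "hnull (\<lambda>j. A e r j (F (k - j) q)) UNIV" "hnull (\<lambda>j. F (k - j) (B e r j q)) UNIV"
    "hnull (\<lambda>j. A e r j (F (k - j) q) + F (k - j) (B e r j q)) UNIV"
proof -
  show 1: "hnull (\<lambda>j. A e r j (F (k - j) q)) UNIV"
    by (rule hnull_A[where f = "\<lambda>k. F k q"]) (rule good_laurent[OF assms])
  show 2: "hnull (\<lambda>j. F (k - j) (B e r j q)) UNIV"
    by (rule hnull_B) (rule good_lin[OF assms])
  show "hnull (\<lambda>j. A e r j (F (k - j) q) + F (k - j) (B e r j q)) UNIV"
    using 1 2 by (rule hnull_add)
qed

lemma hpow_B_finite: "finite {j. B e r j q \<notin> hpow n}"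
  using hnullD[OF B_null[of e r q], of n] by simp

text \<open>Only finitely many \<open>B e r j q\<close> lie outside \<open>hpow n\<close>, so their
  individual lower bounds combine into one that is uniform in \<open>j\<close>.\<close>

lemma laurent_B:
  assumes F: "\<And>k. hlinear (F k)" and K: "\<And>q. \<exists>K. \<forall>k<K. F k q \<in> hpow n"
  shows "\<exists>K. \<forall>k<K. \<forall>j. F (k - j) (B e r j q) \<in> hpow n"
proof -
  obtain Kf where Kf: "\<And>q k. k < Kf q \<Longrightarrow> F k q \<in> hpow n" using K by metis
  obtain K where K: "\<forall>j\<in>{j. B e r j q \<notin> hpow n}. K \<le> Kf (B e r j q) + j"
    using finite_lower_bound[OF hpow_B_finite[of e r q n], of "\<lambda>j. Kf (B e r j q) + j"] by blast
  have "F (k - j) (B e r j q) \<in> hpow n" if "k < K" for k j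
  proof (cases "B e r j q \<in> hpow n")
    case True
    then show ?thesis by (rule hlinear_hpow[OF F])
  next
    case False
    then have "K \<le> Kf (B e r j q) + j" using K by simp
    with that show ?thesis by (intro Kf) linarith
  qed
  then show ?thesis by blast
qed

lemma good_step:
  assumes "good_family F" shows "good_family (step e r F)"
  unfolding good_family_def
proof (intro conjI allI)
  fix k
  show "hlinear (step e r F k)"
    unfolding step_def
    by (intro hlinear_hsum hnull_step[OF assms] hlinear_plus hlinear_compose[OF A_lin]
        hlinear_compose[OF good_lin[OF assms] B_lin] good_lin[OF assms])
next
  fix q
  show "in_laurent (\<lambda>k. step e r F k q)"
    unfolding in_laurent_def
  proof
    fix n
    obtain K1 where K1: "\<And>k. k < K1 \<Longrightarrow> F k q \<in> hpow n"
      using in_laurentD[OF good_laurent[OF assms]] by blast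
    obtain K2 where K2: "\<forall>k<K2. \<forall>j. F (k - j) (B e r j q) \<in> hpow n"
      using laurent_B[of F n e r q] good_lin[OF assms] in_laurentD[OF good_laurent[OF assms]] by blast
    have "step e r F k q \<in> hpow n" if k: "k < min K1 K2" for k
      unfolding step_def
    proof (rule hsum_hpow[OF hnull_step(3)[OF assms]])
      fix j
      have "A e r j (F (k - j) q) \<in> hpow n"
      proof (cases "j < 0")
        case False
        then show ?thesis using k by (intro A_hpow K1) simp
      qed (simp add: A_neg hpow_zero)
      then show "A e r j (F (k - j) q) + F (k - j) (B e r j q) \<in> hpow n"
        using K2 k by (intro hpow_add) auto
    qed
    then show "\<exists>K. \<forall>k<K. step e r F k q \<in> hpow n" by blast
  qed
qed

lemma A_hsum: "hnull f UNIV \<Longrightarrow> A e r j (hsum f UNIV) = (HSUM i. A e r j (f i))"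
  by (rule hsum_linear[OF A_lin])

text \<open>Two steps give the four orders AA, AB, BA and BB of creation and annihilation. Nullity
  on pairs is needed since the two summations are about to be interchanged.\<close>

lemma step_step:
  assumes F: "good_family F"
  defines "T \<equiv> \<lambda>e r f s k q j i. A e r j (A f s i (F (k - j - i) q)) + A e r j (F (k - j - i) (B f s i q))
    + (A f s i (F (k - j - i) (B e r j q)) + F (k - j - i) (B f s i (B e r j q)))"
  shows "step e r (step f s F) k q = (HSUM j. hsum (T e r f s k q j) UNIV)"
    and "hnull (\<lambda>(j, i). T e r f s k q j i) UNIV"
proof -
  note nF = hnull_step[OF F]
  have "A e r j (step f s F (k - j) q) + step f s F (k - j) (B e r j q) = hsum (T e r f s k q j) UNIV" for j
  proof -
    have "A e r j (step f s F (k - j) q) =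
        (HSUM i. A e r j (A f s i (F (k - j - i) q)) + A e r j (F (k - j - i) (B f s i q)))"
      unfolding step_def by (subst A_hsum[OF nF(3)]) (simp only: hlinear_add[OF A_lin])
    moreover have "hnull (\<lambda>i. A e r j (A f s i (F (k - j - i) q)) + A e r j (F (k - j - i) (B f s i q))) UNIV"
      by (intro hnull_add hnull_linear[OF A_lin] nF)
    ultimately show ?thesis
      unfolding T_def step_def by (subst hsum_add) (auto intro: nF)
  qed
  then show "step e r (step f s F) k q = (HSUM j. hsum (T e r f s k q j) UNIV)"
    unfolding step_def[of e r] by (intro hsum_cong) auto
  have n1: "hnull (\<lambda>(j, i). A e r j (A f s i (F (k - j - i) q))) UNIV"
    unfolding hnull_def
  proof
    fix n
    obtain K where K: "\<And>k. k < K \<Longrightarrow> F k q \<in> hpow n"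
      using in_laurentD[OF good_laurent[OF F]] by blast
    have "{x \<in> UNIV. (case x of (j, i) \<Rightarrow> A e r j (A f s i (F (k - j - i) q))) \<notin> hpow n}
        \<subseteq> {0..k - K} \<times> {0..k - K}"
    proof (clarsimp)
      fix j i assume h: "A e r j (A f s i (F (k - j - i) q)) \<notin> hpow n"
      have "j \<ge> 0" using h A_neg[of j e r] hpow_zero by (cases "j < 0") auto
      moreover have "i \<ge> 0"
        using h A_neg[of i f s] hpow_zero hlinear_zero[OF A_lin] by (cases "i < 0") auto
      moreover have "\<not> k - j - i < K" using h K A_hpow by blast
      ultimately show "0 \<le> j \<and> j \<le> k - K \<and> 0 \<le> i \<and> i \<le> k - K" by linarith
    qed
    then show "finite {x \<in> UNIV. (case x of (j, i) \<Rightarrow> A e r j (A f s i (F (k - j - i) q))) \<notin> hpow n}"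
      by (rule finite_subset) simp
  qed
  have n2: "hnull (\<lambda>(j, i). A e r j (F (k - j - i) (B f s i q))) UNIV"
  proof (subst hnull_pair_swap, rule hnull_pairI)
    show "hnull (\<lambda>j. A e r j (F (k - j - i) (B f s i q))) UNIV" for i
      using hnull_step(1)[OF F, of e r "k - i" "B f s i q"] by (simp add: algebra_simps)
    show "hnull (\<lambda>i. B f s i q) UNIV" by (rule B_null)
  qed (intro A_hpow hlinear_hpow[OF good_lin[OF F]])
  have n3: "hnull (\<lambda>(j, i). A f s i (F (k - j - i) (B e r j q))) UNIV"
    by (rule hnull_pairI[OF hnull_step(1)[OF F] B_null[of e r q]]) (intro A_hpow hlinear_hpow[OF good_lin[OF F]])
  have n4: "hnull (\<lambda>(j, i). F (k - j - i) (B f s i (B e r j q))) UNIV"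
    by (rule hnull_pairI[OF hnull_step(2)[OF F] B_null[of e r q]])
      (rule hlinear_hpow[OF good_lin[OF F]], rule hlinear_hpow[OF B_lin])
  show "hnull (\<lambda>(j, i). T e r f s k q j i) UNIV"
    using hnull_add[OF hnull_add[OF n1 n2] hnull_add[OF n3 n4]] unfolding T_def by (simp add: split_def)
qed

text \<open>By \<open>A_comm\<close> and \<open>B_comm\<close> the double sum of
  \<open>step_step\<close> is symmetric under exchanging the two generators together with their
  summation indices; a mixed term has only one possible order of \<open>A\<close> and
  \<open>B\<close>.\<close>

lemma step_commute:
  assumes F: "good_family F" shows "step e r (step f s F) = step f s (step e r F)"
proof (intro ext)
  fix k q
  note S = step_step[OF F]
  show "step e r (step f s F) k q = step f s (step e r F) k q"
    unfolding S(1)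
    by (subst hsum_swap_UNIV[OF S(2)[of e r f s k q]], (rule hsum_cong[OF refl])+)
      (simp add: A_comm[of e r _ f s] B_comm[of f s _ e r] int_diff_commute[of k] add_ac)
qed

lemma step_trace:
  assumes F: "good_family F" shows "(\<Sum>i\<in>UNIV. step (i, i) r F k q) = 0"
proof -
  have "(\<Sum>i\<in>UNIV. step (i, i) r F k q) =
      (HSUM j. \<Sum>i\<in>UNIV. A (i, i) r j (F (k - j) q) + F (k - j) (B (i, i) r j q))"
    unfolding step_def by (rule hsum_sum(1)[symmetric]) (rule hnull_step(3)[OF F])
  also have "\<dots> = 0"
    by (rule hsum_zeroI)
      (simp add: sum.distrib A_trace B_trace hlinear_zero[OF good_lin[OF F]] flip: hlinear_sum[OF good_lin[OF F]])
  finally show ?thesis .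
qed

definition base :: "int \<Rightarrow> 'n Hplus \<Rightarrow> 'm"
  where "base k q = (if k = 0 then \<iota> q else 0)"

lemma good_base: "good_family base"
  unfolding good_family_def
proof (intro conjI allI)
  fix k show "hlinear (base k)" unfolding base_def by (cases "k = 0") (auto intro: \<iota>_lin hlinear_0)
  fix q show "in_laurent (\<lambda>k. base k q)"
    unfolding in_laurent_def by (intro allI exI[of _ 0]) (auto simp: base_def hpow_zero)
qed

abbreviation fold_step :: "(('n \<times> 'n) \<times> nat) list \<Rightarrow> int \<Rightarrow> 'n Hplus \<Rightarrow> 'm"
  where "fold_step xs \<equiv> foldr (\<lambda>g. step (fst g) (int (snd g))) xs base"

lemma L_exists: "\<exists>L. (\<forall>k q. hlinear (\<lambda>p. L p k q)) \<and> (\<forall>xs k q. L (plist xs) k q = fold_step xs k q)"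
proof -
  have "\<exists>L. (\<forall>i. hlinear (\<lambda>p. L p i)) \<and> (\<forall>xs i. L (plist xs) i = (\<lambda>F (k, q). F k q) (fold_step xs) i)"
    by (rule Hplus_rec[where C = good_family])
      (auto simp: good_base good_step step_commute step_trace)
  then obtain L where "\<And>i. hlinear (\<lambda>p. L p i)" "\<And>xs i. L (plist xs) i = (\<lambda>F (k, q). F k q) (fold_step xs) i" by blast
  then show ?thesis by (intro exI[of _ "\<lambda>p k q. L p (k, q)"]) auto
qed

definition L :: "'n Hplus \<Rightarrow> int \<Rightarrow> 'n Hplus \<Rightarrow> 'm"
  where "L = (SOME L. (\<forall>k q. hlinear (\<lambda>p. L p k q)) \<and> (\<forall>xs k q. L (plist xs) k q = fold_step xs k q))"

lemma L_lin1: "hlinear (\<lambda>p. L p k q)" and L_plist: "L (plist xs) k q = fold_step xs k q"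
  using someI_ex[OF L_exists] unfolding L_def[symmetric] by auto

lemma good_fold: "good_family (fold_step xs)"
  by (induction xs) (simp_all add: good_base good_step)

lemma L_lin2: "hlinear (L p k)"
proof (rule hlinearI)
  fix x y a
  show "L p k (x + y) = L p k x + L p k y"
    by (rule Hplus_plist_eqI[OF L_lin1 hlinear_plus[OF L_lin1 L_lin1]])
      (simp only: L_plist hlinear_add[OF good_lin[OF good_fold]])
  show "L p k (a *\<^sub>h x) = a *\<^sub>h L p k x"
    by (rule Hplus_plist_eqI[OF L_lin1 hlinear_hscale[OF L_lin1]])
      (simp only: L_plist hlinear_scale[OF good_lin[OF good_fold]])
qed

lemma L_laurent: "in_laurent (\<lambda>k. L p k q)"
  unfolding in_laurent_def
proof
  fix n
  show "\<exists>K. \<forall>k<K. L p k q \<in> hpow n"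
  proof (induction p rule: Hplus_induct_plist[where n = n])
    case (plist xs)
    show ?case unfolding L_plist by (rule in_laurentD[OF good_laurent[OF good_fold]])
  next
    case (plus u v)
    then obtain K K' where "\<forall>k<K. L u k q \<in> hpow n" "\<forall>k<K'. L v k q \<in> hpow n" by blast
    then show ?case by (intro exI[of _ "min K K'"]) (simp add: hlinear_add[OF L_lin1] hpow_add)
  next
    case (scale a u)
    then show ?case by (metis hlinear_scale[OF L_lin1] hpow_scale)
  next
    case (hpow u)
    then show ?case using hlinear_hpow[OF L_lin1] by blast
  qed
qed

lemma good_L: "good_family (L p)"
  unfolding good_family_def using L_lin2 L_laurent by blast

lemma L_one: "L 1 k q = (if k = 0 then \<iota> q else 0)"
  using L_plist[of "[]"] by (simp add: base_def)

lemma hlinear_step: "hlinear (\<lambda>p. step e r (L p) k q)"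
  unfolding step_def
  by (intro hlinear_hsum hnull_step[OF good_L] hlinear_plus hlinear_compose[OF A_lin L_lin1] L_lin1)

lemma L_step: "L (xplus e r * p) k q = step e r (L p) k q"
proof (cases "r < 0")
  case True
  then have "step e r (L p) k q = 0" unfolding step_def by (simp add: A_r B_r hlinear_zero[OF L_lin2])
  then show ?thesis using True by (simp add: hlinear_zero[OF L_lin1])
next
  case False
  then obtain n where r: "r = int n" by (metis not_less zero_le_imp_eq_int)
  have *: "L (xplus e r * plist xs) k q = step e r (L (plist xs)) k q" for xs
  proof -
    have "L (plist xs) = fold_step xs" by (intro ext) (rule L_plist)
    moreover have "xplus e r * plist xs = plist ((e, n) # xs)" by (simp add: r xplus_Hvar)
    ultimately show ?thesis by (simp only: L_plist) (simp add: r)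
  qed
  have "hlinear (\<lambda>p. L (xplus e r * p) k q)"
    by (rule hlinear_compose[OF L_lin1 hlinear_times[OF hlinear_id]])
  then show ?thesis using hlinear_step * by (rule Hplus_plist_eqI)
qed

lemmas hnull_L = hnull_step[OF good_L]

lemma L_step_sum: "L (xplus e r * p) k q =
    (HSUM j. A e r j (L p (k - j) q)) + (HSUM j. L p (k - j) (B e r j q))"
  unfolding L_step step_def by (rule hsum_add[OF hnull_L(1,2)])

text \<open>The derivatives of a monomial are combinations of finitely many smaller monomials, and
  \<open>\<kappa>\<close> enters only through scalar coefficients. So one lower bound on the
  exponents serves all derivations, which makes sums convergent in which derivation and exponent
  vary together.\<close>

lemma L_uniform: "\<exists>K. \<forall>m<K. \<forall>\<kappa>. tracefree \<kappa> \<longrightarrow> L (derv \<kappa> p) m q \<in> hpow n"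
proof (induction p arbitrary: q rule: Hplus_induct_mod[where n = n])
  case one
  show ?case by (auto simp: derv(2) hlinear_zero[OF L_lin1] hpow_zero)
next
  case (times e r u)
  have *: "\<exists>K. \<forall>m<K. \<forall>\<kappa>. tracefree \<kappa> \<longrightarrow> L (derv \<kappa> u) m q \<in> hpow n" for q by (rule times(2))
  obtain Kf where Kf: "\<And>q m \<kappa>. m < Kf q \<Longrightarrow> tracefree \<kappa> \<Longrightarrow> L (derv \<kappa> u) m q \<in> hpow n"
    using * by metis
  obtain K where K: "\<forall>j\<in>{j. B e r j q \<notin> hpow n}. K \<le> Kf (B e r j q) + j"
    using finite_lower_bound[OF hpow_B_finite[of e r q n], of "\<lambda>j. Kf (B e r j q) + j"] by blast
  obtain K0 where K0: "\<And>m. m < K0 \<Longrightarrow> L u m q \<in> hpow n" using in_laurentD[OF L_laurent] by blast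
  have "L (derv \<kappa> (xplus e r * u)) m q \<in> hpow n" if m: "m < min K0 (min (Kf q) K)" and tf: "tracefree \<kappa>" for m \<kappa>
  proof -
    have "L (derv \<kappa> (xplus e r * u)) m q = step e r (L (derv \<kappa> u)) m q + \<kappa> e r *\<^sub>h L u m q"
      by (simp add: derv(3)[OF tf] hlinear_add[OF L_lin1] hlinear_scale[OF L_lin1] L_step)
    moreover have "\<kappa> e r *\<^sub>h L u m q \<in> hpow n" using m by (intro hpow_scale K0) simp
    moreover have "step e r (L (derv \<kappa> u)) m q \<in> hpow n"
      unfolding step_def
    proof (rule hsum_hpow[OF hnull_L(3)])
      fix j
      have "A e r j (L (derv \<kappa> u) (m - j) q) \<in> hpow n"
      proof (cases "j < 0")
        case False
        then show ?thesis using m by (intro A_hpow Kf tf) simp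
      qed (simp add: A_neg hpow_zero)
      moreover have "L (derv \<kappa> u) (m - j) (B e r j q) \<in> hpow n"
      proof (cases "B e r j q \<in> hpow n")
        case True
        then show ?thesis by (rule hlinear_hpow[OF L_lin2])
      next
        case False
        then have "K \<le> Kf (B e r j q) + j" using K by simp
        then show ?thesis using m by (intro Kf tf) linarith
      qed
      ultimately show "A e r j (L (derv \<kappa> u) (m - j) q) + L (derv \<kappa> u) (m - j) (B e r j q) \<in> hpow n"
        by (rule hpow_add)
    qed
    ultimately show ?thesis by (simp add: hpow_add)
  qed
  then show ?case by blast
next
  case (plus u v)
  obtain K where K: "\<forall>m<K. \<forall>\<kappa>. tracefree \<kappa> \<longrightarrow> L (derv \<kappa> u) m q \<in> hpow n" using plus(1) by blast
  obtain K' where K': "\<forall>m<K'. \<forall>\<kappa>. tracefree \<kappa> \<longrightarrow> L (derv \<kappa> v) m q \<in> hpow n" using plus(2) by blast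
  show ?case
  proof (intro exI[of _ "min K K'"] allI impI)
    fix m :: int and \<kappa> :: "'n \<times> 'n \<Rightarrow> int \<Rightarrow> complex fps"
    assume "m < min K K'" and tf: "tracefree \<kappa>"
    then show "L (derv \<kappa> (u + v)) m q \<in> hpow n"
      unfolding hlinear_add[OF derv(1)[OF tf]] hlinear_add[OF L_lin1] using K K' by (intro hpow_add) auto
  qed
next
  case (scale a u)
  obtain K where K: "\<forall>m<K. \<forall>\<kappa>. tracefree \<kappa> \<longrightarrow> L (derv \<kappa> u) m q \<in> hpow n" using scale by blast
  show ?case
  proof (intro exI[of _ K] allI impI)
    fix m :: int and \<kappa> :: "'n \<times> 'n \<Rightarrow> int \<Rightarrow> complex fps"
    assume "m < K" and tf: "tracefree \<kappa>"
    then show "L (derv \<kappa> (a *\<^sub>h u)) m q \<in> hpow n"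
      unfolding hlinear_scale[OF derv(1)[OF tf]] hlinear_scale[OF L_lin1] using K by (intro hpow_scale) auto
  qed
next
  case (hpow u)
  have "L (derv \<kappa> u) m q \<in> hpow n" if "tracefree \<kappa>" for \<kappa> and m :: int
    by (rule hlinear_hpow[OF L_lin1 hlinear_hpow[OF derv(1)[OF that] hpow]])
  then show ?case by blast
qed

context
  fixes v :: "int \<Rightarrow> 'n \<times> 'n \<Rightarrow> int \<Rightarrow> complex fps"
  assumes tf: "\<And>i. tracefree (v i)" and low: "\<And>e s n. \<exists>K. \<forall>i<K. fps_X ^ n dvd v i e s"
begin

lemma hnull_L_derv: "hnull (\<lambda>i. L (derv (v i) p) (k - i) q) UNIV"
  unfolding hnull_def
proof
  fix n
  obtain K where K: "\<And>m \<kappa>. m < K \<Longrightarrow> tracefree \<kappa> \<Longrightarrow> L (derv \<kappa> p) m q \<in> hpow n"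
    using L_uniform by blast
  obtain K' where K': "\<And>i. i < K' \<Longrightarrow> derv (v i) p \<in> hpow n" using derv_low[OF tf low] by blast
  have "{i \<in> UNIV. L (derv (v i) p) (k - i) q \<notin> hpow n} \<subseteq> {K'..k - K}"
  proof clarsimp
    fix i assume i: "L (derv (v i) p) (k - i) q \<notin> hpow n"
    have "\<not> k - i < K" using i K tf by blast
    moreover have "\<not> i < K'" using i K' hlinear_hpow[OF L_lin1] by blast
    ultimately show "K' \<le> i \<and> i \<le> k - K" by simp
  qed
  then show "finite {i \<in> UNIV. L (derv (v i) p) (k - i) q \<notin> hpow n}" by (rule finite_subset) simp
qed

lemma hnull_A_L_derv: "hnull (\<lambda>(j, i). A e r j (L (derv (v i) p) (k - j - i) q)) UNIV"
  unfolding hnull_def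
proof
  fix n
  obtain K where K: "\<And>m \<kappa>. m < K \<Longrightarrow> tracefree \<kappa> \<Longrightarrow> L (derv \<kappa> p) m q \<in> hpow n"
    using L_uniform by blast
  obtain K' where K': "\<And>i. i < K' \<Longrightarrow> derv (v i) p \<in> hpow n" using derv_low[OF tf low] by blast
  have "{x \<in> UNIV. (case x of (j, i) \<Rightarrow> A e r j (L (derv (v i) p) (k - j - i) q)) \<notin> hpow n}
      \<subseteq> {0..k - K - K'} \<times> {K'..k - K}"
  proof clarsimp
    fix j i assume i: "A e r j (L (derv (v i) p) (k - j - i) q) \<notin> hpow n"
    have "j \<ge> 0" using i A_neg[of j e r] hpow_zero by (cases "j < 0") auto
    moreover have "\<not> k - j - i < K" using i K tf A_hpow by blast
    moreover have "\<not> i < K'" using i K' hlinear_hpow[OF L_lin1] A_hpow by blast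
    ultimately show "0 \<le> j \<and> j \<le> k - K - K' \<and> K' \<le> i \<and> i \<le> k - K" by linarith
  qed
  then show "finite {x \<in> UNIV. (case x of (j, i) \<Rightarrow> A e r j (L (derv (v i) p) (k - j - i) q)) \<notin> hpow n}"
    by (rule finite_subset) simp
qed

lemma hlinear_L_derv: "hlinear (\<lambda>p. (HSUM i. L (derv (v i) p) (k - i) q))"
  by (intro hlinear_hsum hnull_L_derv hlinear_compose[OF L_lin1 derv(1)[OF tf]])

end

text \<open>Operators whose commutators with all \<open>A\<close> and \<open>B\<close> are scalars are moved through \<open>L p\<close> at the
  cost of a derivation acting on \<open>p\<close>.\<close>

lemma intertwine:
  assumes W: "hlinear W" and W': "hlinear W'"
    and WA: "\<And>e r j x. W (A e r j x) = A e r j (W x) + \<mu> j e r *\<^sub>h x"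
    and BW: "\<And>e r j u. B e r j (W' u) = W' (B e r j u) + \<nu> j e r *\<^sub>h u"
    and base: "\<And>q. W (\<iota> q) = \<iota> (W' q)"
    and tf\<mu>: "\<And>i. tracefree (\<mu> i)" and tf\<nu>: "\<And>i. tracefree (\<nu> i)"
    and low\<mu>: "\<And>e s n. \<exists>K. \<forall>i<K. fps_X ^ n dvd \<mu> i e s"
    and low\<nu>: "\<And>e s n. \<exists>K. \<forall>i<K. fps_X ^ n dvd \<nu> i e s"
  shows "W (L p k q) = L p k (W' q) + (HSUM i. L (derv (\<lambda>e r. \<mu> i e r - \<nu> i e r) p) (k - i) q)"
proof -
  define v where "v i = (\<lambda>e r. \<mu> i e r - \<nu> i e r)" for i
  have tf: "tracefree (v i)" for i unfolding v_def by (rule tracefree_diff[OF tf\<mu> tf\<nu>])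
  have low: "\<exists>K. \<forall>i<K. fps_X ^ n dvd v i e s" for e s n
  proof -
    obtain K K' where "\<forall>i<K. fps_X ^ n dvd \<mu> i e s" "\<forall>i<K'. fps_X ^ n dvd \<nu> i e s"
      using low\<mu>[of n e s] low\<nu>[of n e s] by blast
    then show ?thesis unfolding v_def by (intro exI[of _ "min K K'"]) (simp add: dvd_diff)
  qed
  note nv = hnull_L_derv[OF tf low]
  have hnull_scalar: "hnull (\<lambda>j. w j *\<^sub>h L p (k - j) q) UNIV" if low': "\<And>n. \<exists>K. \<forall>i<K. fps_X ^ n dvd w i" for w :: "int \<Rightarrow> complex fps" and p q and k :: int
    unfolding hnull_def
  proof
    fix n
    obtain K where K: "\<And>i. i < K \<Longrightarrow> fps_X ^ n dvd w i" using low'[of n] by blast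
    obtain K' where K': "\<And>m. m < K' \<Longrightarrow> L p m q \<in> hpow n" using in_laurentD[OF L_laurent] by blast
    have "{j \<in> UNIV. w j *\<^sub>h L p (k - j) q \<notin> hpow n} \<subseteq> {K..k - K'}"
    proof clarsimp
      fix j assume j: "w j *\<^sub>h L p (k - j) q \<notin> hpow n"
      have "\<not> j < K" using j K hpow_dvd by blast
      moreover have "\<not> k - j < K'" using j K' hpow_scale by blast
      ultimately show "K \<le> j \<and> j \<le> k - K'" by simp
    qed
    then show "finite {j \<in> UNIV. w j *\<^sub>h L p (k - j) q \<notin> hpow n}" by (rule finite_subset) simp
  qed
  define R where "R p k q = L p k (W' q) + (HSUM i. L (derv (v i) p) (k - i) q)" for p k q
  have "W (L p k q) = R p k q"
  proof (rule Hplus_eqI[where i = "(k, q)" and F = "\<lambda>(k, q) p. W (L p k q)" and G = "\<lambda>(k, q) p. R p k q", simplified])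
    show "hlinear ((\<lambda>(k, q) p. W (L p k q)) i)" for i
      by (cases i) (simp add: hlinear_compose[OF W L_lin1])
    show "hlinear ((\<lambda>(k, q) p. R p k q) i)" for i
      unfolding R_def by (cases i) (simp add: hlinear_plus[OF L_lin1 hlinear_L_derv[OF tf low]])
    show "(case i of (k, q) \<Rightarrow> \<lambda>p. W (L p k q)) 1 = (case i of (k, q) \<Rightarrow> \<lambda>p. R p k q) 1" for i
      by (cases i) (simp add: L_one R_def derv(2)[OF tf] hlinear_zero[OF L_lin1] base hlinear_zero[OF W])
  next
    fix e r u and i :: "int \<times> 'n Hplus"
    assume IH': "\<And>i. (case i of (k, q) \<Rightarrow> \<lambda>p. W (L p k q)) u = (case i of (k, q) \<Rightarrow> \<lambda>p. R p k q) u"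
    then have IH: "W (L u k q) = R u k q" for k q using IH'[of "(k, q)"] by simp
    obtain k q where i: "i = (k, q)" by (cases i)
    \<comment> \<open>\<open>E\<close> collects the terms with \<open>W' q\<close>, \<open>D\<close>
      the correction terms. Summing \<open>D\<close> over \<open>j\<close> first gives the step for
      \<open>derv (v i) u\<close>, and with the scalar terms \<open>v j e r\<close> this is the
      Leibniz rule for the derivative of \<open>xplus e r * u\<close>.\<close>
    define E where "E j = A e r j (L u (k - j) (W' q)) + L u (k - j) (B e r j (W' q))" for j
    define D where "D j i = A e r j (L (derv (v i) u) (k - j - i) q) + L (derv (v i) u) (k - j - i) (B e r j q)" for j i
    have nD: "hnull (\<lambda>(j, i). D j i) UNIV"
    proof -
      have "hnull (\<lambda>(j, i). L (derv (v i) u) (k - j - i) (B e r j q)) UNIV"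
        by (rule hnull_pairI[OF nv B_null[of e r q]]) (rule hlinear_hpow[OF L_lin2])
      from hnull_add[OF hnull_A_L_derv[OF tf low] this] show ?thesis by (simp add: D_def split_def)
    qed
    have nE: "hnull E UNIV" unfolding E_def by (rule hnull_L(3))
    have nU: "hnull (\<lambda>j. v j e r *\<^sub>h L u (k - j) q) UNIV" by (rule hnull_scalar) (rule low)
    have "W (L (xplus e r * u) k q) = (HSUM j. E j + v j e r *\<^sub>h L u (k - j) q + hsum (D j) UNIV)"
      unfolding L_step step_def
    proof (subst hsum_linear[OF W hnull_L(3)], rule hsum_cong[OF refl])
      fix j
      have "A e r j (HSUM i. L (derv (v i) u) (k - j - i) q) =
          (HSUM i. A e r j (L (derv (v i) u) (k - j - i) q))"
        by (rule A_hsum) (rule nv)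
      moreover have "L u (k - j) (W' (B e r j q)) = L u (k - j) (B e r j (W' q)) - \<nu> j e r *\<^sub>h L u (k - j) q"
        by (simp add: BW hlinear_add[OF L_lin2] hlinear_scale[OF L_lin2])
      moreover have "hsum (D j) UNIV = (HSUM i. A e r j (L (derv (v i) u) (k - j - i) q))
          + (HSUM i. L (derv (v i) u) (k - j - i) (B e r j q))"
        unfolding D_def by (rule hsum_add[OF hnull_linear[OF A_lin nv] nv])
      ultimately show "W (A e r j (L u (k - j) q) + L u (k - j) (B e r j q)) =
          E j + v j e r *\<^sub>h L u (k - j) q + hsum (D j) UNIV"
        by (simp add: hlinear_add[OF W] WA IH R_def hlinear_add[OF A_lin] E_def v_def hmod.scale_left_diff_distrib)
    qed
    also have "\<dots> = hsum E UNIV + (HSUM j. v j e r *\<^sub>h L u (k - j) q) + (HSUM j. hsum (D j) UNIV)"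
      by (subst hsum_add[OF hnull_add[OF nE nU] hnull_hsum_pair(1)[OF nD]], subst hsum_add[OF nE nU]) (rule refl)
    also have "hsum E UNIV = L (xplus e r * u) k (W' q)"
      unfolding E_def L_step step_def ..
    also have "(HSUM j. hsum (D j) UNIV) = (HSUM i. (HSUM j. D j i))"
      by (rule hsum_swap_UNIV[OF nD])
    also have "L (xplus e r * u) k (W' q) + (HSUM j. v j e r *\<^sub>h L u (k - j) q)
        + (HSUM i. (HSUM j. D j i)) = R (xplus e r * u) k q"
    proof -
      have nD': "hnull (\<lambda>(i, j). D j i) UNIV" using nD by (subst hnull_pair_swap)
      have "L (derv (v i) (xplus e r * u)) (k - i) q = v i e r *\<^sub>h L u (k - i) q + (HSUM j. D j i)" for i
        by (simp add: derv(3)[OF tf] hlinear_add[OF L_lin1] hlinear_scale[OF L_lin1] L_step step_def D_def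
            int_diff_commute[of k i])
      then have "(HSUM i. L (derv (v i) (xplus e r * u)) (k - i) q) =
          (HSUM j. v j e r *\<^sub>h L u (k - j) q) + (HSUM i. (HSUM j. D j i))"
        by (simp add: hsum_add[OF nU hnull_hsum_pair(1)[OF nD']])
      then show ?thesis by (simp add: R_def add.assoc)
    qed
    finally show "(case i of (k, q) \<Rightarrow> \<lambda>p. W (L p k q)) (xplus e r * u) = (case i of (k, q) \<Rightarrow> \<lambda>p. R p k q) (xplus e r * u)"
      by (simp add: i)
  qed
  then show ?thesis unfolding R_def v_def .
qed

end

section \<open>The fields and the braiding\<close>

definition sl1 :: "('a::hmodule \<Rightarrow> 'a) \<Rightarrow> ('a, 'b::hmodule) ctensor \<Rightarrow> ('a, 'b) ctensor"
  where "sl1 f = lift2 (\<lambda>x y. f x \<otimes> y)"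

definition sl2 :: "('b::hmodule \<Rightarrow> 'b) \<Rightarrow> ('a::hmodule, 'b) ctensor \<Rightarrow> ('a, 'b) ctensor"
  where "sl2 f = lift2 (\<lambda>x y. x \<otimes> f y)"

lemma sl1: "hlinear f \<Longrightarrow> hlinear (sl1 f)" "hlinear f \<Longrightarrow> sl1 f (x \<otimes> y) = f x \<otimes> y"
proof -
  assume "hlinear f"
  then have "hbilinear (\<lambda>x y. f x \<otimes> y)"
    by (intro hbilinearI hlinear_tensor1 hlinear_tensor2 hlinear_id)
  then show "hlinear (sl1 f)" "sl1 f (x \<otimes> y) = f x \<otimes> y" unfolding sl1_def by (rule lift2)+
qed

lemma sl2: "hlinear f \<Longrightarrow> hlinear (sl2 f)" "hlinear f \<Longrightarrow> sl2 f (x \<otimes> y) = x \<otimes> f y"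
proof -
  assume "hlinear f"
  then have "hbilinear (\<lambda>x y. x \<otimes> f y)"
    by (intro hbilinearI hlinear_tensor1 hlinear_tensor2 hlinear_id)
  then show "hlinear (sl2 f)" "sl2 f (x \<otimes> y) = x \<otimes> f y" unfolding sl2_def by (rule lift2)+
qed

lemma tensor_zero1: "0 \<otimes> y = 0" and tensor_zero2: "x \<otimes> 0 = 0"
  using hlinear_zero[OF hlinear_tensor1[OF hlinear_id]] hlinear_zero[OF hlinear_tensor2[OF hlinear_id]] by auto

lemma sl1_sl2:
  assumes "hlinear f" "hlinear g" shows "sl1 f (sl2 g t) = sl2 g (sl1 f t)"
  by (rule tensor_eqI[OF hlinear_compose[OF sl1(1)[OF assms(1)] sl2(1)[OF assms(2)]]
        hlinear_compose[OF sl2(1)[OF assms(2)] sl1(1)[OF assms(1)]]])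
    (simp add: sl1 sl2 assms)

lemma sl1_sl1:
  assumes "hlinear f" "hlinear g" shows "sl1 f (sl1 g t) = sl1 (\<lambda>x. f (g x)) t"
  by (rule tensor_eqI[OF hlinear_compose[OF sl1(1)[OF assms(1)] sl1(1)[OF assms(2)]]
        sl1(1)[OF hlinear_compose[OF assms]]])
    (simp add: sl1 assms hlinear_compose[OF assms])

lemma hnull_sl2:
  assumes "\<And>i. hlinear (f i)" "\<And>y. hnull (\<lambda>i. f i y) UNIV" shows "hnull (\<lambda>i. sl2 (f i) t) UNIV"
  by (rule hnull_tensor)
    (simp_all add: sl2 assms(1) hnull_linear[OF hlinear_tensor2[OF hlinear_id] assms(2)])

definition negS :: "complex \<Rightarrow> 'n::finite \<times> 'n \<Rightarrow> 'n \<times> 'n \<Rightarrow> int \<Rightarrow> complex fps"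
  where "negS c e f m = - Sser c e f m"

lemma pairing_negS: "pairing_kernel (negS c)"
  using pairing_kernel_S[of c] unfolding negS_def[abs_def] .

lemma hnull_in_laurent: "hnull f UNIV \<Longrightarrow> in_laurent f"
proof -
  assume f: "hnull f UNIV"
  have "\<exists>K. \<forall>k<K. f k \<in> hpow n" for n
  proof -
    obtain K where "\<forall>j\<in>{k. f k \<notin> hpow n}. K \<le> j"
      using finite_lower_bound[of "{k. f k \<notin> hpow n}" "\<lambda>k. k"] hnullD[OF f, of n] by auto
    then show ?thesis by (intro exI[of _ K]) force
  qed
  then show ?thesis unfolding in_laurent_def by blast
qed

text \<open>The coefficient of \<open>z^j u^r\<close> in multiplication by
  \<open>x^+(z + u)\<close>.\<close>

definition YA :: "'n::finite \<times> 'n \<Rightarrow> int \<Rightarrow> int \<Rightarrow> 'n Hplus \<Rightarrow> 'n Hplus"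
  where "YA e r j x = plus_coeff j r *\<^sub>h (xplus e (j + r) * x)"

lemma hlinear_YA: "hlinear (YA e r j)"
  unfolding YA_def by (intro hlinear_hscale hlinear_times hlinear_id)

lemma YA_vanish: "j < 0 \<or> r < 0 \<Longrightarrow> YA e r j x = 0"
  unfolding YA_def using plus_coeff_vanish[of j r] by (cases "j + r < 0") auto

lemma YA_commute: "YA e r j (YA f s k x) = YA f s k (YA e r j x)"
  unfolding YA_def by (simp add: Hplus_mult_scale hscale_hscale mult_ac)

interpretation Yx: ext YA "dop (negS c)" "\<lambda>x. x" for c
proof (rule ext.intro)
  fix e f :: "'a \<times> 'a" and r s j k x
  show "YA e r j (YA f s k x) = YA f s k (YA e r j x)" by (rule YA_commute)
  show "(\<Sum>i\<in>UNIV. YA (i :: 'a, i) r j x) = 0"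
  proof -
    have "(\<Sum>i\<in>UNIV. YA (i :: 'a, i) r j x) = plus_coeff j r *\<^sub>h ((\<Sum>i\<in>UNIV. xplus (i, i) (j + r)) * x)"
      unfolding YA_def by (simp add: hmod.scale_sum_right sum_distrib_right)
    then show ?thesis by (simp add: sum_xplus_trace)
  qed
qed (simp_all add: hlinear_YA hlinear_dop[OF pairing_negS] hlinear_id dop_commute[OF pairing_negS pairing_negS]
    YA_vanish hnull_dop[OF pairing_negS] dop_trace[OF pairing_negS] dop_vanish[OF pairing_negS])

text \<open>In the braiding a generator that is not contracted stays in the first slot without any
  z, so the creation part is concentrated in exponent 0.\<close>

definition SA :: "'n::finite \<times> 'n \<Rightarrow> int \<Rightarrow> int \<Rightarrow> 'n Hplus tensor2 \<Rightarrow> 'n Hplus tensor2"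
  where "SA e r j t = (if j = 0 then sl1 ((*) (xplus e r)) t else 0)"

lemma hlinear_x: "hlinear ((*) (x :: 'n::finite Hplus))"
  by (rule hlinear_times[OF hlinear_id])

lemma sl1_commute:
  assumes "hlinear f" "hlinear g" "\<And>x. f (g x) = g (f x)" shows "sl1 f (sl1 g t) = sl1 g (sl1 f t)"
  by (simp add: sl1_sl1 assms)

lemma sl1_zero: "sl1 (\<lambda>x. 0) t = 0"
  by (rule tensor_eqI[OF sl1(1)[OF hlinear_0] hlinear_0]) (simp add: sl1 hlinear_0 tensor_zero1)

interpretation Sx: ext SA "dop (Tser c)" "\<lambda>q. 1 \<otimes> q" for c
proof (rule ext.intro)
  fix e f :: "'a \<times> 'a" and r s j k x
  show "hlinear (SA e r j)"
    by (cases "j = 0") (simp_all add: SA_def[abs_def] sl1(1)[OF hlinear_x] hlinear_0)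
  show "SA e r j (SA f s k x) = SA f s k (SA e r j x)"
    by (auto simp: SA_def hlinear_zero[OF sl1(1)[OF hlinear_x]] mult.left_commute intro!: sl1_commute hlinear_x)
  show "(\<Sum>i\<in>UNIV. SA (i :: 'a, i) r j x) = 0"
  proof (cases "j = 0")
    case True
    have "(\<Sum>i\<in>UNIV. sl1 ((*) (xplus (i :: 'a, i) r)) x) = 0"
      by (rule tensor_eqI[OF hlinear_Sum[OF sl1(1)[OF hlinear_x]] hlinear_0])
        (simp add: sl1 hlinear_x sum_xplus_trace tensor_zero1
          flip: hlinear_sum[OF hlinear_tensor1[OF hlinear_id]] sum_distrib_right)
    then show ?thesis using True by (simp add: SA_def)
  qed (simp add: SA_def)
  have "(*) 0 = (\<lambda>x :: 'a Hplus. 0)" by auto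
  then show "SA e r j x = 0" if "r < 0" using that sl1_zero[of x] by (simp add: SA_def)
qed (simp_all add: SA_def hlinear_dop[OF pairing_kernel_T] hlinear_tensor2[OF hlinear_id]
    dop_commute[OF pairing_kernel_T pairing_kernel_T]
    hnull_dop[OF pairing_kernel_T] dop_trace[OF pairing_kernel_T] dop_vanish[OF pairing_kernel_T])

definition Yv :: "complex \<Rightarrow> 'n::finite Hplus \<Rightarrow> int \<Rightarrow> 'n Hplus \<Rightarrow> 'n Hplus"
  where "Yv c = ext.L YA (dop (negS c)) (\<lambda>x. x)"

definition Sv :: "complex \<Rightarrow> 'n::finite Hplus \<Rightarrow> int \<Rightarrow> 'n Hplus \<Rightarrow> 'n Hplus tensor2"
  where "Sv c = ext.L SA (dop (Tser c)) (\<lambda>q. 1 \<otimes> q)"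

section \<open>Moving generators and derivations through fields and braiding\<close>

lemmas Y_lin1 = Yx.L_lin1[folded Yv_def]
  and Y_lin2 = Yx.L_lin2[folded Yv_def]
  and Y_laurent = Yx.L_laurent[folded Yv_def]
  and Y_one = Yx.L_one[folded Yv_def]
  and Y_step = Yx.L_step_sum[folded Yv_def]
  and Y_intertwine = Yx.intertwine[folded Yv_def]
  and Y_hnull = Yx.hnull_L[folded Yv_def]
  and Y_hnull_derv = Yx.hnull_L_derv[folded Yv_def]

lemmas S_lin1 = Sx.L_lin1[folded Sv_def]
  and S_lin2 = Sx.L_lin2[folded Sv_def]
  and S_laurent = Sx.L_laurent[folded Sv_def]
  and S_one = Sx.L_one[folded Sv_def]
  and S_step' = Sx.L_step_sum[folded Sv_def]
  and S_intertwine = Sx.intertwine[folded Sv_def]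
  and S_hnull = Sx.hnull_L[folded Sv_def]

lemma S_step: "Sv c (xplus e r * p) k q =
    sl1 ((*) (xplus e r)) (Sv c p k q) + (HSUM j. Sv c p (k - j) (dop (Tser c) e r j q))"
proof -
  have "(HSUM j. SA e r j (Sv c p (k - j) q)) = SA e r 0 (Sv c p (k - 0) q)"
    by (rule hsum_single) (auto simp: SA_def)
  then show ?thesis unfolding S_step' by (simp add: SA_def)
qed

text \<open>A derivation on the second slot commutes with creation, which acts on the first slot,
  and with the contractions, which are derivations themselves; so no scalars arise.\<close>

lemma S_derv2:
  assumes tf: "tracefree \<kappa>" shows "sl2 (derv \<kappa>) (Sv c p k q) = Sv c p k (derv \<kappa> q)"
proof -
  note d = derv(1)[OF tf]
  have "sl2 (derv \<kappa>) (Sv c p k q) = Sv c p k (derv \<kappa> q) +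
      (HSUM i. Sv c (derv (\<lambda>e r. (\<lambda>j e r. 0) i e r - (\<lambda>j e r. 0) i e r) p) (k - i) q)"
    by (rule S_intertwine[where \<mu> = "\<lambda>j e r. 0" and \<nu> = "\<lambda>j e r. 0"])
      (simp_all add: sl2(1)[OF d] d SA_def sl1_sl2[OF hlinear_x d, symmetric] hlinear_zero[OF sl2(1)[OF d]]
        dop_commute_derv[OF pairing_kernel_T tf] sl2(2)[OF d] tracefree_0)
  then show ?thesis by (simp add: derv_0 hlinear_zero[OF S_lin1])
qed

text \<open>\<open>S_intertwine\<close> is used with \<open>W' = 0\<close>: a derivation of the
  first slot kills the base vector and meets only the creation operators, which contribute the
  scalars \<open>\<kappa>\<close> in exponent 0.\<close>

lemma S_derv1:
  assumes tf: "tracefree \<kappa>" shows "sl1 (derv \<kappa>) (Sv c p k q) = Sv c (derv \<kappa> p) k q"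
proof -
  note d = derv(1)[OF tf]
  define \<mu> where "\<mu> j e r = (if j = 0 then \<kappa> e r else 0)" for j :: int and e r
  have x: "sl1 (derv \<kappa>) (sl1 ((*) (xplus e r)) t) = sl1 ((*) (xplus e r)) (sl1 (derv \<kappa>) t) + \<kappa> e r *\<^sub>h t"
    for e r and t :: "'a Hplus tensor2"
    by (rule tensor_eqI[OF hlinear_compose[OF sl1(1)[OF d] sl1(1)[OF hlinear_x]]
          hlinear_plus[OF hlinear_compose[OF sl1(1)[OF hlinear_x] sl1(1)[OF d]] hlinear_hscale[OF hlinear_id]]])
      (simp add: sl1 d hlinear_x derv(3)[OF tf] hlinear_add[OF hlinear_tensor1[OF hlinear_id]]
        hlinear_scale[OF hlinear_tensor1[OF hlinear_id]])
  have tf\<mu>: "tracefree (\<mu> i)" for i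
    using tf tracefree_0 by (cases "i = 0") (simp_all add: \<mu>_def[abs_def])
  have WA: "sl1 (derv \<kappa>) (SA e r j t) = SA e r j (sl1 (derv \<kappa>) t) + \<mu> j e r *\<^sub>h t" for e r j t
    by (cases "j = 0") (simp_all add: SA_def x \<mu>_def hlinear_zero[OF sl1(1)[OF d]])
  have low: "\<exists>K. \<forall>i<K. fps_X ^ n dvd \<mu> i e s" for n e s
    by (intro exI[of _ 0]) (simp add: \<mu>_def)
  have "sl1 (derv \<kappa>) (Sv c p k q) = Sv c p k ((\<lambda>q. 0) q) +
      (HSUM i. Sv c (derv (\<lambda>e r. \<mu> i e r - (\<lambda>j e r. 0) i e r) p) (k - i) q)"
    by (rule S_intertwine[where \<mu> = \<mu> and \<nu> = "\<lambda>j e r. 0"])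
      (simp_all add: sl1(1)[OF d] hlinear_0 WA
        hlinear_zero[OF hlinear_dop[OF pairing_kernel_T]] sl1(2)[OF d] derv(2)[OF tf] tensor_zero1 tensor_zero2
        tracefree_0 tf\<mu> low)
  also have "\<dots> = (HSUM i. Sv c (derv (\<mu> i) p) (k - i) q)"
    by (simp add: hlinear_zero[OF S_lin2])
  also have "\<dots> = Sv c (derv (\<mu> 0) p) (k - 0) q"
    by (rule hsum_single) (auto simp: \<mu>_def[abs_def] derv_0 hlinear_zero[OF S_lin1])
  finally show ?thesis by (simp add: \<mu>_def[abs_def])
qed

lemma ker_low:
  assumes "pairing_kernel \<sigma>" shows "\<exists>K. \<forall>i<K. fps_X ^ n dvd ker \<sigma> e r i f s"
  by (intro exI[of _ "- int n - r - s - 2"] allI impI ker_dvd[OF assms]) simp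

text \<open>A generator in the second slot commutes with creation in the first; its commutator with
  a contraction is the kernel, read here as a derivation acting on \<open>p\<close>.\<close>

lemma S_x2:
  "Sv c p k (xplus f s * q) = sl2 ((*) (xplus f s)) (Sv c p k q) +
     (HSUM i. Sv c (derv (\<lambda>e r. ker (Tser c) e r i f s) p) (k - i) q)"
proof -
  have tf: "tracefree (\<lambda>e r. ker (Tser c) e r i f s)" for i by (rule tracefree_ker1[OF pairing_kernel_T])
  have "sl2 ((*) (xplus f s)) (Sv c p k q) = Sv c p k (xplus f s * q) +
      (HSUM i. Sv c (derv (\<lambda>e r. (\<lambda>j e r. 0) i e r - (\<lambda>j e r. ker (Tser c) e r j f s) i e r) p) (k - i) q)"
    by (rule S_intertwine[where \<mu> = "\<lambda>j e r. 0" and \<nu> = "\<lambda>j e r. ker (Tser c) e r j f s"])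
      (simp_all add: sl2(1)[OF hlinear_x] hlinear_x SA_def sl1_sl2[OF hlinear_x hlinear_x, symmetric]
        hlinear_zero[OF sl2(1)[OF hlinear_x]] dop_times[OF pairing_kernel_T] sl2(2)[OF hlinear_x]
        tracefree_0 tf ker_low[OF pairing_kernel_T])
  moreover have "derv (\<lambda>e r. - ker (Tser c) e r i f s) p = - derv (\<lambda>e r. ker (Tser c) e r i f s) p" for i
    using derv_scale[OF tf, of "- 1" i p] by simp
  moreover have "hnull (\<lambda>i. Sv c (derv (\<lambda>e r. ker (Tser c) e r i f s) p) (k - i) q) UNIV"
    unfolding Sv_def by (rule Sx.hnull_L_derv[OF tf ker_low[OF pairing_kernel_T]])
  ultimately show ?thesis
    by (simp add: hlinear_uminus[OF S_lin1] flip: hsum_uminus)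
qed

text \<open>As for the braiding: creation operators commute with multiplication by
  \<open>xplus f s\<close>, and annihilation operators contract with it, which yields a derivation
  of \<open>p\<close>.\<close>

lemma Y_x:
  "Yv c p k (xplus f s * q) = xplus f s * Yv c p k q +
     (HSUM i. Yv c (derv (\<lambda>e r. ker (negS c) e r i f s) p) (k - i) q)"
  "hnull (\<lambda>i. Yv c (derv (\<lambda>e r. ker (negS c) e r i f s) p) (k - i) q) UNIV"
proof -
  have tf: "tracefree (\<lambda>e r. ker (negS c) e r i f s)" for i by (rule tracefree_ker1[OF pairing_negS])
  have "xplus f s * Yv c p k q = Yv c p k (xplus f s * q) +
      (HSUM i. Yv c (derv (\<lambda>e r. (\<lambda>j e r. 0) i e r - (\<lambda>j e r. ker (negS c) e r j f s) i e r) p) (k - i) q)"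
    by (rule Y_intertwine[where \<mu> = "\<lambda>j e r. 0" and \<nu> = "\<lambda>j e r. ker (negS c) e r j f s"])
      (simp_all add: hlinear_x YA_def dop_times[OF pairing_negS] Hplus_mult_scale mult.left_commute
        tracefree_0 tf ker_low[OF pairing_negS])
  moreover have "derv (\<lambda>e r. - ker (negS c) e r i f s) p = - derv (\<lambda>e r. ker (negS c) e r i f s) p" for i
    using derv_scale[OF tf, of "- 1" i p] by simp
  moreover show "hnull (\<lambda>i. Yv c (derv (\<lambda>e r. ker (negS c) e r i f s) p) (k - i) q) UNIV"
    by (rule Y_hnull_derv[OF tf ker_low[OF pairing_negS]])
  ultimately show "Yv c p k (xplus f s * q) = xplus f s * Yv c p k q +
     (HSUM i. Yv c (derv (\<lambda>e r. ker (negS c) e r i f s) p) (k - i) q)"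
    by (simp add: hlinear_uminus[OF Y_lin1] flip: hsum_uminus)
qed

lemma shift_vanish:
  assumes "tracefree \<kappa>" "i < 0 \<or> r < 0" shows "plus_coeff i r * \<kappa> e (i + r) = 0"
proof -
  consider "r < 0" | "i + r < 0" | "i < 0" "i + r \<ge> 0" using assms(2) by linarith
  then show ?thesis
  proof cases
    case 2
    then have "\<kappa> e (i + r) = 0" using assms(1) unfolding tracefree_def by blast
    then show ?thesis by simp
  qed (simp_all add: plus_coeff_vanish)
qed

lemma tracefree_shift:
  assumes "tracefree \<kappa>" shows "tracefree (\<lambda>e r. plus_coeff i r * \<kappa> e (i + r))"
  using assms shift_vanish[OF assms, of i] unfolding tracefree_def
  by (simp flip: sum_distrib_left)

text \<open>Applied to \<open>x^+(z + u)\<close>, the derivation returns its generating function of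
  values at \<open>z + u\<close>; the coefficient at \<open>z^i u^r\<close> is the shifted value
  displayed here.\<close>

lemma Y_derv:
  assumes tf: "tracefree \<kappa>"
  shows "derv \<kappa> (Yv c p k q) = Yv c p k (derv \<kappa> q) +
     (HSUM i. Yv c (derv (\<lambda>e r. plus_coeff i r * \<kappa> e (i + r)) p) (k - i) q)"
   "hnull (\<lambda>i. Yv c (derv (\<lambda>e r. plus_coeff i r * \<kappa> e (i + r)) p) (k - i) q) UNIV"
proof -
  have low: "\<exists>K. \<forall>i<K. fps_X ^ n dvd plus_coeff i r * \<kappa> e (i + r)" for n e r
    by (intro exI[of _ 0]) (simp add: shift_vanish[OF tf])
  have "derv \<kappa> (Yv c p k q) = Yv c p k (derv \<kappa> q) +
     (HSUM i. Yv c (derv (\<lambda>e r. (\<lambda>i e r. plus_coeff i r * \<kappa> e (i + r)) i e r - (\<lambda>j e r. 0) i e r) p) (k - i) q)"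
    by (rule Y_intertwine[where \<mu> = "\<lambda>i e r. plus_coeff i r * \<kappa> e (i + r)" and \<nu> = "\<lambda>j e r. 0"])
      (simp_all add: derv(1)[OF tf] YA_def derv(3)[OF tf] hlinear_scale[OF derv(1)[OF tf]] hscale_right_distrib
        dop_commute_derv[OF pairing_negS tf] tracefree_0 tracefree_shift[OF tf] low)
  then show "derv \<kappa> (Yv c p k q) = Yv c p k (derv \<kappa> q) +
     (HSUM i. Yv c (derv (\<lambda>e r. plus_coeff i r * \<kappa> e (i + r)) p) (k - i) q)" by simp
  show "hnull (\<lambda>i. Yv c (derv (\<lambda>e r. plus_coeff i r * \<kappa> e (i + r)) p) (k - i) q) UNIV"
    by (rule Y_hnull_derv[OF tracefree_shift[OF tf] low])
qed

definition Ym :: "complex \<Rightarrow> int \<Rightarrow> 'n::finite Hplus tensor2 \<Rightarrow> 'n Hplus"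
  where "Ym c k = lift2 (\<lambda>p q. Yv c p k q)"

definition Bm :: "complex \<Rightarrow> int \<Rightarrow> 'n::finite Hplus tensor2 \<Rightarrow> 'n Hplus tensor2"
  where "Bm c k = lift2 (\<lambda>p q. Sv c p k q)"

lemma Ym: "hlinear (Ym c k)" "Ym c k (p \<otimes> q) = Yv c p k q"
  using lift2[of "\<lambda>p q. Yv c p k q"] by (simp_all add: Ym_def hbilinearI Y_lin1 Y_lin2)

lemma Bm: "hlinear (Bm c k)" "Bm c k (p \<otimes> q) = Sv c p k q"
  using lift2[of "\<lambda>p q. Sv c p k q"] by (simp_all add: Bm_def hbilinearI S_lin1 S_lin2)

lemma in_laurent_tensor:
  assumes "\<And>k. hlinear (F k)" "\<And>x y. in_laurent (\<lambda>k. F k (x \<otimes> y))"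
  shows "in_laurent (\<lambda>k. F k t)"
  unfolding in_laurent_def
proof
  fix n
  show "\<exists>K. \<forall>k<K. F k t \<in> hpow n"
  proof (induction t rule: tensor_induct_mod[where n = n])
    case (pure x y)
    show ?case by (rule in_laurentD[OF assms(2)])
  next
    case (plus s t)
    then obtain K K' where "\<forall>k<K. F k s \<in> hpow n" "\<forall>k<K'. F k t \<in> hpow n" by blast
    then show ?case by (intro exI[of _ "min K K'"]) (simp add: hlinear_add[OF assms(1)] hpow_add)
  next
    case (hpow t)
    then show ?case using hlinear_hpow[OF assms(1)] by blast
  qed
qed

lemma Ym_laurent: "in_laurent (\<lambda>k. Ym c k t)"
  by (rule in_laurent_tensor) (simp_all add: Ym Y_laurent)

text \<open>T involves only negative powers of z, so contractions can only lower the
  exponent.\<close>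

lemma S_positive: "k > 0 \<Longrightarrow> Sv c p k q = 0"
proof -
  \<comment> \<open>The condition on \<open>k\<close> moves inside the claim so that the induction
    over \<open>p\<close> can treat all \<open>k\<close> and \<open>q\<close> as parameters.\<close>
  have "(if k > 0 then Sv c p k q else 0) = 0" for k q
  proof (rule Hplus_eqI[where i = "(k, q)" and F = "\<lambda>(k, q) p. if k > 0 then Sv c p k q else 0" and G = "\<lambda>_ _. 0", simplified])
    show "hlinear (case i of (k, q) \<Rightarrow> \<lambda>p. if 0 < k then Sv c p k q else 0)" for i
      by (cases i; cases "fst i > 0") (simp_all add: S_lin1 hlinear_0)
    show "hlinear (\<lambda>_. 0)" by (rule hlinear_0)
    show "(case i of (k, q) \<Rightarrow> \<lambda>p. if 0 < k then Sv c p k q else 0) 1 = 0" for i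
      by (cases i) (simp add: S_one)
  next
    fix e :: "'a \<times> 'a" and r and u :: "'a Hplus" and i :: "int \<times> 'a Hplus"
    assume IH: "\<And>i. (case i of (k, q) \<Rightarrow> \<lambda>p. if 0 < k then Sv c p k q else 0) u = 0"
    have IH: "Sv c u k q = 0" if "k > 0" for k q using IH[of "(k, q)"] that by simp
    have "Sv c (xplus e r * u) k q = 0" if "k > 0" for k q
    proof -
      have "Sv c u (k - j) (dop (Tser c) e r j q) = 0" for j
        using that IH by (cases "j \<ge> 0") (simp_all add: dop_vanish[OF pairing_kernel_T] hlinear_zero[OF S_lin2])
      then show ?thesis using that IH by (simp add: S_step hlinear_zero[OF sl1(1)[OF hlinear_x]])
    qed
    then show "(case i of (k, q) \<Rightarrow> \<lambda>p. if 0 < k then Sv c p k q else 0) (xplus e r * u) = 0"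
      by (cases i) simp
  qed
  then show "k > 0 \<Longrightarrow> Sv c p k q = 0" by (metis (full_types))
qed

lemma Bm_positive: "k > 0 \<Longrightarrow> Bm c k t = 0"
  by (rule tensor_eqI[OF Bm(1) hlinear_0]) (simp add: Bm S_positive)

lemma Bm_negative: "in_negative (\<lambda>k. Bm c k t)"
  unfolding in_negative_def
  using in_laurent_tensor[of "Bm c" t, OF Bm(1)] by (simp add: Bm S_laurent Bm_positive)

lemma hnull_negative: "in_negative f \<Longrightarrow> hnull f UNIV"
  unfolding hnull_def
proof
  fix n assume f: "in_negative f"
  then obtain K where K: "\<And>k. k < K \<Longrightarrow> f k \<in> hpow n"
    unfolding in_negative_def using in_laurentD by blast
  have "{k \<in> UNIV. f k \<notin> hpow n} \<subseteq> {K..0}"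
  proof clarsimp
    fix k assume k: "f k \<notin> hpow n"
    then show "K \<le> k \<and> k \<le> 0" using K[of k] f hpow_zero unfolding in_negative_def by (metis not_less)
  qed
  then show "finite {k \<in> UNIV. f k \<notin> hpow n}" by (rule finite_subset) simp
qed

text \<open>\<open>S_derv2\<close> pulls the contraction out of the braiding, so the braiding acts
  on the unchanged \<open>t\<close> in every correction term. In this form the rule can be iterated
  in operator identities.\<close>

lemma Bm_x1: "Bm c k (sl1 ((*) (xplus e r)) t) =
    sl1 ((*) (xplus e r)) (Bm c k t) + (HSUM j. sl2 (dop (Tser c) e r j) (Bm c (k - j) t))"
proof (rule tensor_eqI[OF hlinear_compose[OF Bm(1) sl1(1)[OF hlinear_x]]])
  have l: "hlinear (sl2 (dop (Tser c) e r j))" for j by (rule sl2(1)[OF hlinear_dop[OF pairing_kernel_T]])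
  have n: "hnull (\<lambda>j. sl2 (dop (Tser c) e r j) (Bm c (k - j) t)) UNIV" for t
  proof (rule hnull_finite_support)
    have "{j \<in> UNIV. sl2 (dop (Tser c) e r j) (Bm c (k - j) t) \<noteq> 0} \<subseteq> {k..0}"
    proof clarsimp
      fix j assume j: "sl2 (dop (Tser c) e r j) (Bm c (k - j) t) \<noteq> 0"
      have "\<not> k - j > 0" using j Bm_positive hlinear_zero[OF l] by metis
      moreover have "\<not> j > 0"
      proof
        assume "j > 0"
        then have "dop (Tser c) e r j = (\<lambda>u. 0)" by (intro ext dop_vanish[OF pairing_kernel_T]) simp
        moreover have "sl2 (\<lambda>u. 0) t = 0" for t :: "'a Hplus tensor2"
          by (rule tensor_eqI[OF sl2(1)[OF hlinear_0] hlinear_0]) (simp add: sl2 hlinear_0 tensor_zero2)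
        ultimately show False using j by simp
      qed
      ultimately show "k \<le> j \<and> j \<le> 0" by simp
    qed
    then show "finite {j \<in> UNIV. sl2 (dop (Tser c) e r j) (Bm c (k - j) t) \<noteq> 0}"
      by (rule finite_subset) simp
  qed
  show "hlinear (\<lambda>t. sl1 ((*) (xplus e r)) (Bm c k t) + (HSUM j. sl2 (dop (Tser c) e r j) (Bm c (k - j) t)))"
    by (intro hlinear_plus hlinear_hsum n hlinear_compose[OF l Bm(1)] hlinear_compose[OF sl1(1)[OF hlinear_x] Bm(1)])
  fix x y
  show "Bm c k (sl1 ((*) (xplus e r)) (x \<otimes> y)) = sl1 ((*) (xplus e r)) (Bm c k (x \<otimes> y)) +
      (HSUM j. sl2 (dop (Tser c) e r j) (Bm c (k - j) (x \<otimes> y)))"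
    by (simp add: sl1 hlinear_x Bm S_step dop_def S_derv2[OF tracefree_ker[OF pairing_kernel_T]])
qed

section \<open>Yang-Baxter equation, unitarity and shift condition\<close>

text \<open>Again an equality of the predicates \<open>has_hsum\<close>, valid whether or not the
  sum converges.\<close>

lemma hsum_restrict:
  assumes "B \<subseteq> A" "\<And>i. i \<in> A \<Longrightarrow> i \<notin> B \<Longrightarrow> f i = 0"
  shows "hsum f A = (hsum f B :: 'a::hcomplete)"
proof -
  have "has_hsum f A x \<longleftrightarrow> has_hsum f B x" for x
  proof
    assume h: "has_hsum f A x"
    show "has_hsum f B x"
      unfolding has_hsum_def
    proof
      fix n
      obtain F where F: "finite F" "F \<subseteq> A" "\<And>F'. finite F' \<Longrightarrow> F \<subseteq> F' \<Longrightarrow> F' \<subseteq> A \<Longrightarrow> sum f F' - x \<in> hpow n"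
        using h unfolding has_hsum_def by (metis (no_types))
      have "sum f F' - x \<in> hpow n" if F': "finite F'" "F \<inter> B \<subseteq> F'" "F' \<subseteq> B" for F'
      proof -
        have "\<forall>i\<in>(F' \<union> F) - F'. f i = 0" using F(2) F'(2) assms(2) by blast
        then have "sum f (F' \<union> F) = sum f F'"
          by (intro sum.mono_neutral_right) (use F(1) F'(1) in auto)
        moreover have "sum f (F' \<union> F) - x \<in> hpow n" by (rule F(3)) (use F F' assms(1) in auto)
        ultimately show ?thesis by simp
      qed
      then show "\<exists>F. finite F \<and> F \<subseteq> B \<and> (\<forall>F'. finite F' \<and> F \<subseteq> F' \<and> F' \<subseteq> B \<longrightarrow> sum f F' - x \<in> hpow n)"
        using F(1) by (intro exI[of _ "F \<inter> B"]) blast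
    qed
  next
    assume h: "has_hsum f B x"
    show "has_hsum f A x"
      unfolding has_hsum_def
    proof
      fix n
      obtain F where F: "finite F" "F \<subseteq> B" "\<And>F'. finite F' \<Longrightarrow> F \<subseteq> F' \<Longrightarrow> F' \<subseteq> B \<Longrightarrow> sum f F' - x \<in> hpow n"
        using h unfolding has_hsum_def by (metis (no_types))
      have "sum f F' - x \<in> hpow n" if F': "finite F'" "F \<subseteq> F'" "F' \<subseteq> A" for F'
      proof -
        have "\<forall>i\<in>F' - (F' \<inter> B). f i = 0" using F'(3) assms(2) by blast
        then have "sum f (F' \<inter> B) = sum f F'"
          by (intro sum.mono_neutral_left) (use F'(1) in auto)
        moreover have "sum f (F' \<inter> B) - x \<in> hpow n" by (rule F(3)) (use F F' in auto)
        ultimately show ?thesis by simp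
      qed
      then show "\<exists>F. finite F \<and> F \<subseteq> A \<and> (\<forall>F'. finite F' \<and> F \<subseteq> F' \<and> F' \<subseteq> A \<longrightarrow> sum f F' - x \<in> hpow n)"
        using F(1,2) assms(1) by (intro exI[of _ F]) blast
    qed
  qed
  then have "has_hsum f A = has_hsum f B" by (intro ext)
  then show ?thesis unfolding hsum_def by simp
qed

lemma hsum_inj:
  assumes "inj p" "\<And>i. i \<notin> range p \<Longrightarrow> f i = 0"
  shows "hsum f UNIV = ((HSUM i. f (p i)) :: 'a::hcomplete)"
proof -
  have "hsum f UNIV = hsum f (range p)" using assms(2) by (intro hsum_restrict) auto
  also have "\<dots> = (HSUM i. f (p i))" using assms(1) by (intro hsum_bij) (simp add: bij_betw_def)
  finally show ?thesis .
qed

text \<open>The left factor lives on exponents \<open>(a, 0)\<close>, which collapses the sum over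
  pairs to one over \<open>a\<close>.\<close>

lemma comp_at_fst: "(at_fst F \<odot> G) (k, l) x = ((HSUM a. F a (G (k - a, l) x)) :: 'a::hcomplete)"
  unfolding series_comp_def
  by (subst hsum_inj[where p = "\<lambda>a. (a, 0)"]) (auto simp: inj_def at_fst_def image_iff)

lemma comp_at_snd: "(at_snd F \<odot> G) (k, l) x = ((HSUM b. F b (G (k, l - b) x)) :: 'a::hcomplete)"
  unfolding series_comp_def
  by (subst hsum_inj[where p = "\<lambda>b. (0, b)"]) (auto simp: inj_def at_snd_def image_iff)

lemma comp_right_snd:
  assumes "\<And>e. F e 0 = 0"
  shows "(F \<odot> at_snd G) (k, l) x = ((HSUM b. F (k, b) (G (l - b) x)) :: 'a::hcomplete)"
  unfolding series_comp_def
  by (subst hsum_inj[where p = "\<lambda>b. (k, b)"]) (auto simp: inj_def at_snd_def image_iff assms)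

lemma comp_right_fst:
  assumes "\<And>e. F e 0 = 0"
  shows "(F \<odot> at_fst G) (k, l) x = ((HSUM a. F (a, l) (G (k - a) x)) :: 'a::hcomplete)"
  unfolding series_comp_def
  by (subst hsum_inj[where p = "\<lambda>a. (a, l)"]) (auto simp: inj_def at_fst_def image_iff assms)

section \<open>The braiding on pairs of slots of a threefold tensor product\<close>

definition ins :: "'a::hmodule \<Rightarrow> 'a tensor2 \<Rightarrow> 'a tensor3"
  where "ins y = lift2 (\<lambda>x z. x \<otimes> y \<otimes> z)"

definition pre :: "'a::hmodule \<Rightarrow> 'a tensor2 \<Rightarrow> 'a tensor3"
  where "pre x = lift2 (\<lambda>y z. x \<otimes> y \<otimes> z)"

lemma ins: "hlinear (ins y)" "ins y (x \<otimes> z) = x \<otimes> y \<otimes> z"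
proof -
  have "hbilinear (\<lambda>x z. x \<otimes> y \<otimes> z)" by (intro hbilinearI hlinear_tensor1 hlinear_tensor2 hlinear_id)
  then show "hlinear (ins y)" "ins y (x \<otimes> z) = x \<otimes> y \<otimes> z" unfolding ins_def by (rule lift2)+
qed

lemma pre: "hlinear (pre x)" "pre x (y \<otimes> z) = x \<otimes> y \<otimes> z"
proof -
  have "hbilinear (\<lambda>y z. x \<otimes> y \<otimes> z)" by (intro hbilinearI hlinear_tensor1 hlinear_tensor2 hlinear_id)
  then show "hlinear (pre x)" "pre x (y \<otimes> z) = x \<otimes> y \<otimes> z" unfolding pre_def by (rule lift2)+
qed

lemma hlinear_tensor12: "hlinear (\<lambda>y. x \<otimes> y \<otimes> z)"
  by (intro hlinear_tensor1 hlinear_tensor2 hlinear_id)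

lemma hlinear_ins: "hlinear (\<lambda>y. ins y t)"
proof (rule hlinearI)
  fix y y' a
  show "ins (y + y') t = ins y t + ins y' t"
    by (rule tensor_eqI[OF ins(1) hlinear_plus[OF ins(1) ins(1)]]) (simp only: ins hlinear_add[OF hlinear_tensor12])
  show "ins (a *\<^sub>h y) t = a *\<^sub>h ins y t"
    by (rule tensor_eqI[OF ins(1) hlinear_hscale[OF ins(1)]]) (simp only: ins hlinear_scale[OF hlinear_tensor12])
qed

lemma hlinear_tensor11: "hlinear (\<lambda>x. x \<otimes> y \<otimes> z)"
  by (intro hlinear_tensor1 hlinear_id)

lemma hlinear_pre: "hlinear (\<lambda>x. pre x t)"
proof (rule hlinearI)
  fix x x' a
  show "pre (x + x') t = pre x t + pre x' t"
    by (rule tensor_eqI[OF pre(1) hlinear_plus[OF pre(1) pre(1)]]) (simp only: pre hlinear_add[OF hlinear_tensor11])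
  show "pre (a *\<^sub>h x) t = a *\<^sub>h pre x t"
    by (rule tensor_eqI[OF pre(1) hlinear_hscale[OF pre(1)]]) (simp only: pre hlinear_scale[OF hlinear_tensor11])
qed

context
  fixes c :: complex
begin

abbreviation B12 :: "int \<Rightarrow> 'n::finite Hplus tensor3 \<Rightarrow> 'n Hplus tensor3" where "B12 \<equiv> on12 (Bm c)"
abbreviation B13 :: "int \<Rightarrow> 'n::finite Hplus tensor3 \<Rightarrow> 'n Hplus tensor3" where "B13 \<equiv> on13 (Bm c)"
abbreviation B23 :: "int \<Rightarrow> 'n::finite Hplus tensor3 \<Rightarrow> 'n Hplus tensor3" where "B23 \<equiv> on23 (Bm c)"

lemma B12: "hlinear (B12 k)" "B12 k (s \<otimes> z) = Bm c k s \<otimes> z"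
proof -
  have l: "hlinear (\<lambda>x. Bm c k (x \<otimes> y) \<otimes> z)" "hlinear (\<lambda>y. Bm c k (x \<otimes> y) \<otimes> z)" "hlinear (\<lambda>z. Bm c k (x \<otimes> y) \<otimes> z)"
    for x y z :: "'n::finite Hplus"
    by (intro hlinear_tensor1 hlinear_tensor2 hlinear_id hlinear_compose[OF Bm(1)])+
  show B: "hlinear (B12 k)" unfolding on12_def by (rule lift3(1)) (rule l)+
  show "B12 k (s \<otimes> z) = Bm c k s \<otimes> z"
    by (rule tensor_eqI[OF hlinear_compose[OF B hlinear_tensor1[OF hlinear_id]] hlinear_tensor1[OF Bm(1)]])
      (unfold on12_def, rule lift3(2), (rule l)+)
qed

lemma B13: "hlinear (B13 k)" "B13 k (x \<otimes> y \<otimes> z) = ins y (Bm c k (x \<otimes> z))"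
proof -
  have l: "hlinear (\<lambda>x. ins y (Bm c k (x \<otimes> z)))" "hlinear (\<lambda>y. ins y (Bm c k (x \<otimes> z)))" "hlinear (\<lambda>z. ins y (Bm c k (x \<otimes> z)))"
    for x y z :: "'n::finite Hplus"
    by (intro hlinear_ins hlinear_tensor1 hlinear_tensor2 hlinear_id hlinear_compose[OF Bm(1)] hlinear_compose[OF ins(1)])+
  show "hlinear (B13 k)" unfolding on13_def ins_def[symmetric] by (rule lift3(1)) (rule l)+
  show "B13 k (x \<otimes> y \<otimes> z) = ins y (Bm c k (x \<otimes> z))"
    unfolding on13_def ins_def[symmetric] by (rule lift3(2)) (rule l)+
qed

lemma B23: "hlinear (B23 k)" "B23 k (x \<otimes> y \<otimes> z) = pre x (Bm c k (y \<otimes> z))"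
proof -
  have l: "hlinear (\<lambda>x. pre x (Bm c k (y \<otimes> z)))" "hlinear (\<lambda>y. pre x (Bm c k (y \<otimes> z)))" "hlinear (\<lambda>z. pre x (Bm c k (y \<otimes> z)))"
    for x y z :: "'n::finite Hplus"
    by (intro hlinear_pre hlinear_tensor1 hlinear_tensor2 hlinear_id hlinear_compose[OF Bm(1)] hlinear_compose[OF pre(1)])+
  show "hlinear (B23 k)" unfolding on23_def pre_def[symmetric] by (rule lift3(1)) (rule l)+
  show "B23 k (x \<otimes> y \<otimes> z) = pre x (Bm c k (y \<otimes> z))"
    unfolding on23_def pre_def[symmetric] by (rule lift3(2)) (rule l)+
qed

lemma B_positive:
  assumes "k > 0" shows "B12 k t = 0" "B13 k t = 0" "B23 k t = 0"
proof -
  show "B12 k t = 0" by (rule tensor_eqI[OF B12(1) hlinear_0]) (simp add: B12 Bm_positive assms tensor_zero1)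
  show "B13 k t = 0" by (rule tensor3_eqI[OF B13(1) hlinear_0]) (simp add: B13 Bm_positive assms hlinear_zero[OF ins(1)])
  show "B23 k t = 0" by (rule tensor3_eqI[OF B23(1) hlinear_0]) (simp add: B23 Bm_positive assms hlinear_zero[OF pre(1)])
qed

text \<open>Neither factor has positive exponents, so at total exponent \<open>k\<close> only
  \<open>j\<close> between \<open>k\<close> and 0 contributes. The sums in the braiding identities
  are therefore finite outright.\<close>

lemma hnull_window:
  assumes "\<And>j t. j > 0 \<Longrightarrow> D j t = 0" "\<And>j. D j 0 = 0" "\<And>m. m > 0 \<Longrightarrow> G m = 0"
  shows "hnull (\<lambda>j :: int. D j (G (k - j))) UNIV"
proof (rule hnull_finite_support)
  have "{j \<in> UNIV. D j (G (k - j)) \<noteq> 0} \<subseteq> {k..0}"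
  proof clarsimp
    fix j assume j: "D j (G (k - j)) \<noteq> 0"
    have "\<not> j > 0" using j assms(1) by blast
    moreover have "\<not> k - j > 0" using j assms(2,3) by force
    ultimately show "k \<le> j \<and> j \<le> 0" by simp
  qed
  then show "finite {j \<in> UNIV. D j (G (k - j)) \<noteq> 0}" by (rule finite_subset) simp
qed

abbreviation \<tau> :: "'n::finite \<times> 'n \<Rightarrow> int \<Rightarrow> int \<Rightarrow> 'n Hplus \<Rightarrow> 'n Hplus" where "\<tau> \<equiv> dop (Tser c)"

lemmas \<tau>_lin = hlinear_dop[OF pairing_kernel_T, of c]

lemma sl2_zero: "sl2 (\<lambda>x. 0) t = 0"
  by (rule tensor_eqI[OF sl2(1)[OF hlinear_0] hlinear_0]) (simp add: sl2 hlinear_0 tensor_zero2)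

lemma \<tau>_positive: "j > 0 \<Longrightarrow> \<tau> e r j = (\<lambda>x. 0)"
  by (intro ext dop_vanish[OF pairing_kernel_T]) simp

abbreviation X1 :: "'n::finite \<times> 'n \<Rightarrow> int \<Rightarrow> 'n Hplus tensor3 \<Rightarrow> 'n Hplus tensor3"
  where "X1 e r \<equiv> sl1 (sl1 ((*) (xplus e r)))"

lemma X1: "hlinear (X1 e r)" "X1 e r (x \<otimes> y \<otimes> z) = (xplus e r * x) \<otimes> y \<otimes> z"
  by (simp_all add: sl1 hlinear_x)

lemma sl_zero: "sl2 (\<lambda>x. 0) = (\<lambda>t. 0)" "sl1 (\<lambda>x. 0) = (\<lambda>t. 0)"
  by (intro ext sl2_zero sl1_zero)+

lemma hnull_B2: "(\<And>m. m > 0 \<Longrightarrow> G m = 0) \<Longrightarrow> hnull (\<lambda>j. sl1 (sl2 (\<tau> e r j)) (G (k - j))) UNIV"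
  by (intro hnull_window) (simp_all add: \<tau>_positive sl_zero hlinear_zero[OF sl1(1)[OF sl2(1)[OF \<tau>_lin]]])

lemma hnull_B3: "(\<And>m. m > 0 \<Longrightarrow> G m = 0) \<Longrightarrow> hnull (\<lambda>j. sl2 (\<tau> e r j) (G (k - j))) UNIV"
  by (intro hnull_window) (simp_all add: \<tau>_positive sl2_zero hlinear_zero[OF sl2(1)[OF \<tau>_lin]])

text \<open>A generator of slot 1 is contracted by \<open>B12\<close> with slot 2 and by
  \<open>B13\<close> with slot 3, while \<open>B23\<close> lets it pass.\<close>

lemma B12_X: "B12 k (X1 e r t) = X1 e r (B12 k t) + (HSUM j. sl1 (sl2 (\<tau> e r j)) (B12 (k - j) t))"
proof (rule tensor_eqI[OF hlinear_compose[OF B12(1) X1(1)]])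
  show "hlinear (\<lambda>t. X1 e r (B12 k t) + (HSUM j. sl1 (sl2 (\<tau> e r j)) (B12 (k - j) t)))"
    by (intro hlinear_plus hlinear_hsum hnull_B2 hlinear_compose[OF X1(1) B12(1)]
        hlinear_compose[OF sl1(1)[OF sl2(1)[OF \<tau>_lin]] B12(1)] B_positive)
  fix s and z :: "'a Hplus"
  have n: "hnull (\<lambda>j. sl2 (\<tau> e r j) (Bm c (k - j) s)) UNIV" by (rule hnull_B3) (rule Bm_positive)
  have "(HSUM j. sl2 (\<tau> e r j) (Bm c (k - j) s)) \<otimes> z = (HSUM j. sl2 (\<tau> e r j) (Bm c (k - j) s) \<otimes> z)"
    by (rule hsum_linear[OF hlinear_tensor1[OF hlinear_id] n])
  then show "B12 k (X1 e r (s \<otimes> z)) = X1 e r (B12 k (s \<otimes> z)) +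
      (HSUM j. sl1 (sl2 (\<tau> e r j)) (B12 (k - j) (s \<otimes> z)))"
    by (simp add: sl1 sl1(1)[OF hlinear_x] B12 Bm_x1 hlinear_add[OF hlinear_tensor1[OF hlinear_id]]
        sl1(2)[OF sl2(1)[OF \<tau>_lin]])
qed

lemma ins_sl:
  assumes "hlinear f"
  shows "ins y (sl1 f t) = sl1 (sl1 f) (ins y t)" "ins y (sl2 f t) = sl2 f (ins y t)" "sl1 (sl2 f) (ins y t) = ins (f y) t"
    "pre x (sl1 f t) = sl1 (sl2 f) (pre x t)" "pre x (sl2 f t) = sl2 f (pre x t)" "sl1 (sl1 f) (pre x t) = pre (f x) t"
proof -
  note l = sl1(1)[OF assms] sl2(1)[OF assms]
  show "ins y (sl1 f t) = sl1 (sl1 f) (ins y t)"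
    by (rule tensor_eqI[OF hlinear_compose[OF ins(1) l(1)] hlinear_compose[OF sl1(1)[OF l(1)] ins(1)]]) (simp add: ins sl1 assms l)
  show "ins y (sl2 f t) = sl2 f (ins y t)"
    by (rule tensor_eqI[OF hlinear_compose[OF ins(1) l(2)] hlinear_compose[OF sl2(1)[OF assms] ins(1)]]) (simp add: ins sl2 assms l)
  show "sl1 (sl2 f) (ins y t) = ins (f y) t"
    by (rule tensor_eqI[OF hlinear_compose[OF sl1(1)[OF l(2)] ins(1)] ins(1)]) (simp add: ins sl1 sl2 assms l)
  show "pre x (sl1 f t) = sl1 (sl2 f) (pre x t)"
    by (rule tensor_eqI[OF hlinear_compose[OF pre(1) l(1)] hlinear_compose[OF sl1(1)[OF l(2)] pre(1)]]) (simp add: pre sl1 sl2 assms l)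
  show "pre x (sl2 f t) = sl2 f (pre x t)"
    by (rule tensor_eqI[OF hlinear_compose[OF pre(1) l(2)] hlinear_compose[OF sl2(1)[OF assms] pre(1)]]) (simp add: pre sl2 assms l)
  show "sl1 (sl1 f) (pre x t) = pre (f x) t"
    by (rule tensor_eqI[OF hlinear_compose[OF sl1(1)[OF l(1)] pre(1)] pre(1)]) (simp add: pre sl1 assms l)
qed

lemma B13_X: "B13 k (X1 e r t) = X1 e r (B13 k t) + (HSUM j. sl2 (\<tau> e r j) (B13 (k - j) t))"
proof (rule tensor3_eqI[OF hlinear_compose[OF B13(1) X1(1)]])
  show "hlinear (\<lambda>t. X1 e r (B13 k t) + (HSUM j. sl2 (\<tau> e r j) (B13 (k - j) t)))"
    by (intro hlinear_plus hlinear_hsum hnull_B3 hlinear_compose[OF X1(1) B13(1)]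
        hlinear_compose[OF sl2(1)[OF \<tau>_lin] B13(1)] B_positive)
  fix x y z
  have n: "hnull (\<lambda>j. sl2 (\<tau> e r j) (Bm c (k - j) (x \<otimes> z))) UNIV" by (rule hnull_B3) (rule Bm_positive)
  have "Bm c k ((xplus e r * x) \<otimes> z) = sl1 ((*) (xplus e r)) (Bm c k (x \<otimes> z)) +
      (HSUM j. sl2 (\<tau> e r j) (Bm c (k - j) (x \<otimes> z)))"
    using Bm_x1[of c k e r "x \<otimes> z"] by (simp add: sl1 hlinear_x)
  then show "B13 k (X1 e r (x \<otimes> y \<otimes> z)) = X1 e r (B13 k (x \<otimes> y \<otimes> z)) +
      (HSUM j. sl2 (\<tau> e r j) (B13 (k - j) (x \<otimes> y \<otimes> z)))"
    by (simp add: X1 B13 hlinear_add[OF ins(1)] hsum_linear[OF ins(1) n] ins_sl hlinear_x \<tau>_lin)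
qed

lemma B23_o1: "hlinear f \<Longrightarrow> B23 k (sl1 (sl1 f) t) = sl1 (sl1 f) (B23 k t)"
  by (rule tensor3_eqI[OF hlinear_compose[OF B23(1) sl1(1)[OF sl1(1)]] hlinear_compose[OF sl1(1)[OF sl1(1)] B23(1)]])
    (simp_all add: sl1 B23 ins_sl)

lemma B12_o3: "hlinear f \<Longrightarrow> B12 k (sl2 f t) = sl2 f (B12 k t)"
  by (rule tensor_eqI[OF hlinear_compose[OF B12(1) sl2(1)] hlinear_compose[OF sl2(1) B12(1)]]) (simp_all add: sl2 B12)

lemma B13_o2: "hlinear f \<Longrightarrow> B13 k (sl1 (sl2 f) t) = sl1 (sl2 f) (B13 k t)"
  by (rule tensor3_eqI[OF hlinear_compose[OF B13(1) sl1(1)[OF sl2(1)]] hlinear_compose[OF sl1(1)[OF sl2(1)] B13(1)]])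
    (simp_all add: sl1 sl2 B13 ins_sl)

lemma Bm_derv: "tracefree \<kappa> \<Longrightarrow> Bm c k (sl1 (derv \<kappa>) t) = sl1 (derv \<kappa>) (Bm c k t)"
  "tracefree \<kappa> \<Longrightarrow> Bm c k (sl2 (derv \<kappa>) t) = sl2 (derv \<kappa>) (Bm c k t)"
proof -
  assume tf: "tracefree \<kappa>"
  note d = derv(1)[OF tf]
  show "Bm c k (sl1 (derv \<kappa>) t) = sl1 (derv \<kappa>) (Bm c k t)"
    by (rule tensor_eqI[OF hlinear_compose[OF Bm(1) sl1(1)[OF d]] hlinear_compose[OF sl1(1)[OF d] Bm(1)]])
      (simp add: sl1 d Bm S_derv1[OF tf])
  show "Bm c k (sl2 (derv \<kappa>) t) = sl2 (derv \<kappa>) (Bm c k t)"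
    by (rule tensor_eqI[OF hlinear_compose[OF Bm(1) sl2(1)[OF d]] hlinear_compose[OF sl2(1)[OF d] Bm(1)]])
      (simp add: sl2 d Bm S_derv2[OF tf])
qed

lemma B23_derv:
  assumes tf: "tracefree \<kappa>"
  shows "B23 k (sl1 (sl2 (derv \<kappa>)) t) = sl1 (sl2 (derv \<kappa>)) (B23 k t)"
    "B23 k (sl2 (derv \<kappa>) t) = sl2 (derv \<kappa>) (B23 k t)"
proof -
  note d = derv(1)[OF tf]
  have *: "Bm c k (derv \<kappa> y \<otimes> z) = sl1 (derv \<kappa>) (Bm c k (y \<otimes> z))"
    "Bm c k (y \<otimes> derv \<kappa> z) = sl2 (derv \<kappa>) (Bm c k (y \<otimes> z))" for y z
    using Bm_derv[OF tf, of k "y \<otimes> z"] by (simp_all add: sl1 sl2 d)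
  show "B23 k (sl1 (sl2 (derv \<kappa>)) t) = sl1 (sl2 (derv \<kappa>)) (B23 k t)"
    by (rule tensor3_eqI[OF hlinear_compose[OF B23(1) sl1(1)[OF sl2(1)[OF d]]] hlinear_compose[OF sl1(1)[OF sl2(1)[OF d]] B23(1)]])
      (simp add: sl1 sl2 d B23 * ins_sl)
  show "B23 k (sl2 (derv \<kappa>) t) = sl2 (derv \<kappa>) (B23 k t)"
    by (rule tensor3_eqI[OF hlinear_compose[OF B23(1) sl2(1)[OF d]] hlinear_compose[OF sl2(1)[OF d] B23(1)]])
      (simp add: sl2 d B23 * ins_sl)
qed

lemmas \<tau>_derv = tracefree_ker[OF pairing_kernel_T, of c]

lemmas B23_\<tau> = B23_derv[OF \<tau>_derv, folded dop_def]

lemma tensor3_X_eqI: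
  fixes F G :: "'i \<Rightarrow> 'n::finite Hplus tensor3 \<Rightarrow> 'm::hcomplete"
  assumes "\<And>i. hlinear (F i)" "\<And>i. hlinear (G i)" "\<And>i y z. F i (1 \<otimes> y \<otimes> z) = G i (1 \<otimes> y \<otimes> z)"
    "\<And>e r t i. r \<ge> 0 \<Longrightarrow> (\<And>i. F i t = G i t) \<Longrightarrow> F i (X1 e r t) = G i (X1 e r t)"
  shows "F i t = G i t"
proof (rule tensor3_eqI[OF assms(1,2)])
  fix x y z
  show "F i (x \<otimes> y \<otimes> z) = G i (x \<otimes> y \<otimes> z)"
  proof (rule Hplus_eqI[where F = "\<lambda>i x. F i (x \<otimes> y \<otimes> z)" and G = "\<lambda>i x. G i (x \<otimes> y \<otimes> z)"])
    fix i and e :: "'n \<times> 'n" and r :: int and u :: "'n Hplus"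
    show "hlinear (\<lambda>x. F i (x \<otimes> y \<otimes> z))" "hlinear (\<lambda>x. G i (x \<otimes> y \<otimes> z))"
      by (intro hlinear_compose[OF assms(1)] hlinear_compose[OF assms(2)] hlinear_tensor11)+
    show "F i (1 \<otimes> y \<otimes> z) = G i (1 \<otimes> y \<otimes> z)" by (rule assms(3))
    assume "r \<ge> 0" "\<And>i. F i (u \<otimes> y \<otimes> z) = G i (u \<otimes> y \<otimes> z)"
    then show "F i ((xplus e r * u) \<otimes> y \<otimes> z) = G i ((xplus e r * u) \<otimes> y \<otimes> z)"
      using assms(4)[of r "u \<otimes> y \<otimes> z" i e] by (simp add: X1)
  qed
qed

lemma tensor3_X_eqI2:
  fixes F G :: "int \<Rightarrow> int \<Rightarrow> 'n::finite Hplus tensor3 \<Rightarrow> 'm::hcomplete"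
  assumes "\<And>a b. hlinear (F a b)" "\<And>a b. hlinear (G a b)" "\<And>a b y z. F a b (1 \<otimes> y \<otimes> z) = G a b (1 \<otimes> y \<otimes> z)"
    "\<And>e r t a b. (\<And>a b. F a b t = G a b t) \<Longrightarrow> F a b (X1 e r t) = G a b (X1 e r t)"
  shows "F a b t = G a b t"
proof -
  have "F (fst i) (snd i) t = G (fst i) (snd i) t" for i
  proof (rule tensor3_X_eqI[where F = "\<lambda>i. F (fst i) (snd i)" and G = "\<lambda>i. G (fst i) (snd i)"])
    fix e r t i assume IH: "\<And>i. F (fst i) (snd i) t = G (fst i) (snd i) t"
    have "F a b t = G a b t" for a b using IH[of "(a, b)"] by simp
    then show "F (fst i) (snd i) (X1 e r t) = G (fst i) (snd i) (X1 e r t)" by (rule assms(4))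
  qed (rule assms)+
  from this[of "(a, b)"] show ?thesis by simp
qed

lemma B_one: "B12 k (1 \<otimes> y \<otimes> z) = (if k = 0 then 1 \<otimes> y \<otimes> z else 0)"
  "B13 k (1 \<otimes> y \<otimes> z) = (if k = 0 then 1 \<otimes> y \<otimes> z else 0)"
  "B12 k (pre 1 s) = (if k = 0 then pre 1 s else 0)"
  "B13 k (pre 1 s) = (if k = 0 then pre 1 s else 0)"
proof -
  show 1: "B12 k (1 \<otimes> y \<otimes> z) = (if k = 0 then 1 \<otimes> y \<otimes> z else 0)"
    "B13 k (1 \<otimes> y \<otimes> z) = (if k = 0 then 1 \<otimes> y \<otimes> z else 0)" for y z
    by (simp_all add: B12 B13 Bm S_one tensor_zero1 hlinear_zero[OF ins(1)] ins)
  show "B12 k (pre 1 s) = (if k = 0 then pre 1 s else 0)"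
    by (rule tensor_eqI[OF hlinear_compose[OF B12(1) pre(1)] hlinear_if[OF pre(1) hlinear_0]]) (simp add: pre 1)
  show "B13 k (pre 1 s) = (if k = 0 then pre 1 s else 0)"
    by (rule tensor_eqI[OF hlinear_compose[OF B13(1) pre(1)] hlinear_if[OF pre(1) hlinear_0]]) (simp add: pre 1)
qed

text \<open>Moving a generator of slot 1 through either operator leaves a contraction on a slot that
  the other operator does not touch. With the next two lemmas, where derivations pass through
  \<open>B23\<close>, all three operators commute coefficientwise, and the Yang-Baxter equation is
  reduced to an interchange of sums.\<close>

lemma B12_B13: "B12 a (B13 b t) = B13 b (B12 a t)"
proof (rule tensor3_X_eqI2[where F = "\<lambda>a b t. B12 a (B13 b t)" and G = "\<lambda>a b t. B13 b (B12 a t)"])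
  fix e :: "'a \<times> 'a" and r a b :: int and t :: "'a Hplus tensor3"
  assume IH: "\<And>a b. B12 a (B13 b t) = B13 b (B12 a t)"
  have n2: "hnull (\<lambda>j. sl1 (sl2 (\<tau> e r j)) (B12 (a - j) t)) UNIV" for a t by (rule hnull_B2) (rule B_positive)
  have n3: "hnull (\<lambda>j. sl2 (\<tau> e r j) (B13 (b - j) t)) UNIV" for b t by (rule hnull_B3) (rule B_positive)
  have "B12 a (B13 b (X1 e r t)) = B12 a (X1 e r (B13 b t)) + (HSUM j. sl2 (\<tau> e r j) (B12 a (B13 (b - j) t)))"
    by (simp add: B13_X hlinear_add[OF B12(1)] hsum_linear[OF B12(1) n3] B12_o3 \<tau>_lin)
  moreover have "B13 b (B12 a (X1 e r t)) = B13 b (X1 e r (B12 a t)) + (HSUM j. sl1 (sl2 (\<tau> e r j)) (B13 b (B12 (a - j) t)))"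
    by (simp add: B12_X hlinear_add[OF B13(1)] hsum_linear[OF B13(1) n2] B13_o2 \<tau>_lin)
  ultimately show "B12 a (B13 b (X1 e r t)) = B13 b (B12 a (X1 e r t))"
    by (simp add: B12_X B13_X IH)
qed (simp_all add: hlinear_compose[OF B12(1) B13(1)] hlinear_compose[OF B13(1) B12(1)] B_one hlinear_zero[OF B12(1)] hlinear_zero[OF B13(1)])

lemma B12_B23: "B12 a (B23 b t) = B23 b (B12 a t)"
proof (rule tensor3_X_eqI2[where F = "\<lambda>a b t. B12 a (B23 b t)" and G = "\<lambda>a b t. B23 b (B12 a t)"])
  fix e :: "'a \<times> 'a" and r a b :: int and t :: "'a Hplus tensor3"
  assume IH: "\<And>a b. B12 a (B23 b t) = B23 b (B12 a t)"
  have n2: "hnull (\<lambda>j. sl1 (sl2 (\<tau> e r j)) (B12 (a - j) t)) UNIV" for a t by (rule hnull_B2) (rule B_positive)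
  have "B23 b (B12 a (X1 e r t)) = X1 e r (B23 b (B12 a t)) + (HSUM j. sl1 (sl2 (\<tau> e r j)) (B23 b (B12 (a - j) t)))"
    by (simp add: B12_X hlinear_add[OF B23(1)] hsum_linear[OF B23(1) n2] B23_o1 hlinear_x B23_\<tau>)
  then show "B12 a (B23 b (X1 e r t)) = B23 b (B12 a (X1 e r t))"
    by (simp add: B23_o1 hlinear_x B12_X IH)
qed (simp_all add: hlinear_compose[OF B12(1) B23(1)] hlinear_compose[OF B23(1) B12(1)] B_one B23 hlinear_zero[OF B23(1)])

lemma B13_B23: "B13 a (B23 b t) = B23 b (B13 a t)"
proof (rule tensor3_X_eqI2[where F = "\<lambda>a b t. B13 a (B23 b t)" and G = "\<lambda>a b t. B23 b (B13 a t)"])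
  fix e :: "'a \<times> 'a" and r a b :: int and t :: "'a Hplus tensor3"
  assume IH: "\<And>a b. B13 a (B23 b t) = B23 b (B13 a t)"
  have n3: "hnull (\<lambda>j. sl2 (\<tau> e r j) (B13 (a - j) t)) UNIV" for a t by (rule hnull_B3) (rule B_positive)
  have "B23 b (B13 a (X1 e r t)) = X1 e r (B23 b (B13 a t)) + (HSUM j. sl2 (\<tau> e r j) (B23 b (B13 (a - j) t)))"
    by (simp add: B13_X hlinear_add[OF B23(1)] hsum_linear[OF B23(1) n3] B23_o1 hlinear_x B23_\<tau>)
  then show "B13 a (B23 b (X1 e r t)) = B23 b (B13 a (X1 e r t))"
    by (simp add: B23_o1 hlinear_x B13_X IH)
qed (simp_all add: hlinear_compose[OF B13(1) B23(1)] hlinear_compose[OF B23(1) B13(1)] B_one B23 hlinear_zero[OF B23(1)])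

lemma at_plus_zero: "hlinear (F (fst e + snd e)) \<Longrightarrow> at_plus F e 0 = 0"
  by (cases e) (simp add: at_plus_def)

lemma yang_baxter_Bm: "yang_baxter (Bm c :: int \<Rightarrow> 'n::finite Hplus tensor2 \<Rightarrow> _)"
  unfolding yang_baxter_def
proof (intro ext, clarify)
  fix k l and t :: "'n Hplus tensor3"
  \<comment> \<open>The common summand of both sides: \<open>a\<close> is the exponent of
    \<open>z1\<close> taken from slots 12, and \<open>b\<close> the exponent of \<open>z2\<close>
    taken from the expansion in \<open>z1 + z2\<close> on slots 13.\<close>
  define W where "W a b = plus_coeff (k - a) b *\<^sub>h B12 a (B13 (k - a + b) (B23 (l - b) t))" for a b
  have z: "at_plus B13 e (0 :: 'n Hplus tensor3) = 0" for e by (rule at_plus_zero) (rule B13(1))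
  have supp: "k \<le> a \<and> a \<le> 0 \<and> 0 \<le> b \<and> b \<le> - k" if "W a b \<noteq> 0" for a b
  proof -
    have "\<not> a > 0" using that by (cases "a > 0") (simp_all add: W_def B_positive)
    moreover have "\<not> b < 0" using that by (cases "b < 0") (simp_all add: W_def)
    moreover have "\<not> k - a + b > 0" using that by (cases "k - a + b > 0") (simp_all add: W_def B_positive hlinear_zero[OF B12(1)])
    ultimately show ?thesis by linarith
  qed
  have n: "hnull (\<lambda>(a, b). W a b) UNIV"
    by (rule hnull_finite_support, rule finite_subset[of _ "{k..0} \<times> {0..- k}"]) (use supp in auto)
  have 1: "(at_fst B12 \<odot> at_plus B13 \<odot> at_snd B23) (k, l) t = (HSUM a. hsum (W a) UNIV)"
  proof -
    have "(at_plus B13 \<odot> at_snd B23) (k - a, l) t =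
        (HSUM b. plus_coeff (k - a) b *\<^sub>h B13 (k - a + b) (B23 (l - b) t))" for a
      unfolding comp_right_snd[where F = "at_plus B13", OF z] by (simp add: at_plus_def)
    moreover have "hnull (\<lambda>b. plus_coeff (k - a) b *\<^sub>h B13 (k - a + b) (B23 (l - b) t)) UNIV" for a
    proof (rule hnull_finite_support, rule finite_subset[of _ "{0..a - k}"])
      show "{b \<in> UNIV. plus_coeff (k - a) b *\<^sub>h B13 (k - a + b) (B23 (l - b) t) \<noteq> 0} \<subseteq> {0..a - k}"
      proof clarsimp
        fix b assume b: "plus_coeff (k - a) b *\<^sub>h B13 (k - a + b) (B23 (l - b) t) \<noteq> 0"
        have "\<not> b < 0" using b by (cases "b < 0") simp_all
        moreover have "\<not> k - a + b > 0" using b by (cases "k - a + b > 0") (simp_all add: B_positive)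
        ultimately show "0 \<le> b \<and> b \<le> a - k" by linarith
      qed
    qed simp
    ultimately show ?thesis
      unfolding comp_at_fst W_def by (simp add: hsum_linear[OF B12(1)] hlinear_scale[OF B12(1)])
  qed
  have 2: "(at_snd B23 \<odot> at_plus B13 \<odot> at_fst B12) (k, l) t = (HSUM b. (HSUM a. W a b))"
  proof -
    have inner: "(at_plus B13 \<odot> at_fst B12) (k, b) t =
        (HSUM a. plus_coeff (k - a) b *\<^sub>h B13 (k - a + b) (B12 a t))" for b
    proof -
      have "(at_plus B13 \<odot> at_fst B12) (k, b) t =
          (HSUM a. plus_coeff a b *\<^sub>h B13 (a + b) (B12 (k - a) t))"
        unfolding comp_right_fst[where F = "at_plus B13", OF z] by (simp add: at_plus_def)
      also have "\<dots> = (HSUM a. plus_coeff (k - a) b *\<^sub>h B13 (k - a + b) (B12 a t))"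
        by (subst hsum_bij[where p = "\<lambda>a. k - a" and A = UNIV])
          (auto intro: bij_betw_byWitness[where f' = "\<lambda>a. k - a"])
      finally show ?thesis .
    qed
    have ni: "hnull (\<lambda>a. plus_coeff (k - a) b *\<^sub>h B13 (k - a + b) (B12 a t)) UNIV" for b
    proof (rule hnull_finite_support, rule finite_subset[of _ "{k + b..0}"])
      show "{a \<in> UNIV. plus_coeff (k - a) b *\<^sub>h B13 (k - a + b) (B12 a t) \<noteq> 0} \<subseteq> {k + b..0}"
      proof clarsimp
        fix a assume b: "plus_coeff (k - a) b *\<^sub>h B13 (k - a + b) (B12 a t) \<noteq> 0"
        have "\<not> a > 0" using b by (cases "a > 0") (simp_all add: B_positive hlinear_zero[OF B13(1)])
        moreover have "\<not> k - a + b > 0" using b by (cases "k - a + b > 0") (simp_all add: B_positive)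
        ultimately show "k + b \<le> a \<and> a \<le> 0" by linarith
      qed
    qed simp
    have "B23 (l - b) (HSUM a. plus_coeff (k - a) b *\<^sub>h B13 (k - a + b) (B12 a t)) = (HSUM a. W a b)" for b
      unfolding hsum_linear[OF B23(1) ni] hlinear_scale[OF B23(1)]
      by (simp only: W_def B12_B13 B12_B23 B13_B23)
    then have "(HSUM b. B23 (l - b) (HSUM a. plus_coeff (k - a) b *\<^sub>h B13 (k - a + b) (B12 a t)))
        = (HSUM b. (HSUM a. W a b))" by simp
    moreover have "(at_snd B23 \<odot> at_plus B13 \<odot> at_fst B12) (k, l) t =
        (HSUM b. B23 (l - b) (HSUM a. plus_coeff (k - a) b *\<^sub>h B13 (k - a + b) (B12 a t)))"
      unfolding comp_at_snd inner
      by (subst hsum_bij[where p = "\<lambda>a. l - a" and A = UNIV])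
        (auto intro: bij_betw_byWitness[where f' = "\<lambda>a. l - a"])
    ultimately show ?thesis by simp
  qed
  show "(at_fst B12 \<odot> at_plus B13 \<odot> at_snd B23) (k, l) t = (at_snd B23 \<odot> at_plus B13 \<odot> at_fst B12) (k, l) t"
    unfolding 1 2 by (rule hsum_swap_UNIV[OF n])
qed

end

lemma S_right_one: "Sv c p k 1 = (if k = 0 then p \<otimes> 1 else 0)"
proof (rule Hplus_eqI[where i = k and F = "\<lambda>k p. Sv c p k 1" and G = "\<lambda>k p. if k = 0 then p \<otimes> 1 else 0"])
  fix i e r and u :: "'a Hplus"
  show "hlinear (\<lambda>p. Sv c p i (1 :: 'a Hplus))" by (rule S_lin1)
  show "hlinear (\<lambda>p :: 'a Hplus. if i = 0 then p \<otimes> 1 else 0)"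
    by (intro hlinear_if hlinear_tensor1 hlinear_id hlinear_0)
  show "Sv c 1 i 1 = (if i = 0 then 1 \<otimes> 1 else 0)" by (rule S_one)
  assume IH: "\<And>i. Sv c u i 1 = (if i = 0 then u \<otimes> 1 else 0)"
  show "Sv c (xplus e r * u) i 1 = (if i = 0 then (xplus e r * u) \<otimes> 1 else 0)"
    by (simp add: S_step IH dop_one[OF pairing_kernel_T] hlinear_zero[OF S_lin2] sl1 hlinear_x
        hlinear_zero[OF sl1(1)[OF hlinear_x]])
qed

section \<open>Unitarity of the braiding\<close>

definition flip :: "('a::hmodule, 'b::hmodule) ctensor \<Rightarrow> ('b, 'a) ctensor"
  where "flip = lift2 (\<lambda>x y. y \<otimes> x)"

lemma flip:
  fixes x :: "'a::hmodule" and y :: "'b::hmodule"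
  shows "hlinear (flip :: ('a, 'b) ctensor \<Rightarrow> _)" "flip (x \<otimes> y) = y \<otimes> x"
proof -
  have "hbilinear (\<lambda>(x :: 'a) (y :: 'b). y \<otimes> x)" by (intro hbilinearI hlinear_tensor1 hlinear_tensor2 hlinear_id)
  then show "hlinear (flip :: ('a, 'b) ctensor \<Rightarrow> _)" "flip (x \<otimes> y) = y \<otimes> x"
    unfolding flip_def by (rule lift2)+
qed

lemma flip_flip [simp]: "flip (flip t) = t"
  by (rule tensor_eqI[OF hlinear_compose[OF flip(1) flip(1)] hlinear_id]) (simp add: flip)

lemma flip_sl1: "hlinear f \<Longrightarrow> flip (sl1 f t) = sl2 f (flip t)"
  by (rule tensor_eqI[OF hlinear_compose[OF flip(1) sl1(1)] hlinear_compose[OF sl2(1) flip(1)]])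
    (simp_all add: flip sl1 sl2)

lemma flip_sl2: "hlinear f \<Longrightarrow> flip (sl2 f t) = sl1 f (flip t)"
  by (rule tensor_eqI[OF hlinear_compose[OF flip(1) sl2(1)] hlinear_compose[OF sl1(1) flip(1)]])
    (simp_all add: flip sl1 sl2)

definition sg :: "int \<Rightarrow> 'a \<Rightarrow> 'a::hmodule"
  where "sg k x = (if even k then x else - x)"

lemma hlinear_sg: "hlinear (sg k)"
  by (rule hlinearI) (simp_all add: sg_def)

lemma sg_simps: "sg k (sg l x) = sg (k + l) x" "sg (k - l) x = sg (k + l) x" "sg 0 x = x" "sg k 0 = 0"
  by (simp_all add: sg_def)

lemma sg_linear: "hlinear f \<Longrightarrow> f (sg k x) = sg k (f x)"
  by (simp add: sg_def hlinear_uminus)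

lemma plus_coeff_symmetric: "b \<ge> 0 \<Longrightarrow> c \<ge> 0 \<Longrightarrow> plus_coeff b c = plus_coeff c b"
proof -
  assume "b \<ge> 0" "c \<ge> 0"
  then obtain m n where "b = int m" "c = int n" by (metis zero_le_imp_eq_int)
  then show ?thesis
    using plus_coeff_int[of "m + n" n] plus_coeff_int[of "m + n" m] binomial_symmetric[of n "m + n"] by simp
qed

lemma Tser_even: "even m \<Longrightarrow> Tser c e f m = 0"
proof -
  assume "even m"
  then have "even (nat \<bar>m\<bar>)" by (simp add: even_nat_iff)
  then show ?thesis by (simp add: Tser_def)
qed

lemma ker_T_flip: "ker (Tser c) f s j e r = (if even j then - ker (Tser c) e r j f s else ker (Tser c) e r j f s)"
proof (cases "r < 0 \<or> s < 0 \<or> even (j + r + s)")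
  case True
  then consider "r < 0 \<or> s < 0" | "even (j + r + s)" by blast
  then show ?thesis
  proof cases
    case 1
    then show ?thesis by (auto simp: ker_vanish[OF pairing_kernel_T])
  next
    case 2
    then show ?thesis by (simp add: ker_def Tser_even add.commute add.left_commute)
  qed
next
  case False
  then have r: "r \<ge> 0" "s \<ge> 0" and odd: "odd (j + r + s)" by auto
  have T: "Tser c f e m = Tser c e f m" for m by (simp add: Tser_def Sser_sym[of c f e])
  have "plus_coeff j (r + s) * plus_coeff r s = plus_coeff (j + r) s * plus_coeff j r"
    "plus_coeff j (s + r) * plus_coeff s r = plus_coeff (j + s) r * plus_coeff j s"
    by (rule plus_coeff_multinomial)+
  then have p: "plus_coeff (j + s) r * plus_coeff j s = plus_coeff (j + r) s * plus_coeff j r"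
    using plus_coeff_symmetric[OF r] by (simp add: add.commute)
  have "even r \<longleftrightarrow> even (nat r)" "even s \<longleftrightarrow> even (nat s)" using r by (simp_all add: even_nat_iff)
  then have sgn: "(-1 :: complex fps) ^ nat r = (if even j then - ((-1) ^ nat s) else (-1) ^ nat s)"
    using odd by (auto simp: minus_one_power_iff)
  have "ker (Tser c) f s j e r = (-1) ^ nat r * (plus_coeff (j + s) r * plus_coeff j s) * Tser c e f (j + r + s)"
    by (simp add: ker_def minus_coeff_def T algebra_simps)
  also have "\<dots> = (if even j then - ker (Tser c) e r j f s else ker (Tser c) e r j f s)"
    unfolding p sgn by (simp add: ker_def minus_coeff_def algebra_simps)
  finally show ?thesis .
qed

text \<open>The derivation of the first slot coming from \<open>S_x2\<close> has its kernel read in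
  the opposite direction; \<open>ker_T_flip\<close> rewrites it as a signed contraction.\<close>

lemma Bm_x2: "Bm c k (sl2 ((*) (xplus e r)) t) = sl2 ((*) (xplus e r)) (Bm c k t) +
    (HSUM j. sl1 (\<lambda>x. - sg j (dop (Tser c) e r j x)) (Bm c (k - j) t))"
proof (rule tensor_eqI[OF hlinear_compose[OF Bm(1) sl2(1)[OF hlinear_x]]])
  have lin: "hlinear (\<lambda>x. - sg j (dop (Tser c) e r j x))" for j
    by (intro hlinear_neg hlinear_compose[OF hlinear_sg] hlinear_dop[OF pairing_kernel_T])
  have n: "hnull (\<lambda>j. sl1 (\<lambda>x. - sg j (dop (Tser c) e r j x)) (Bm c (k - j) t)) UNIV" for t
  proof (rule hnull_window)
    show "sl1 (\<lambda>x. - sg j (dop (Tser c) e r j x)) t = 0" if "j > 0" for j and t :: "'a Hplus tensor2"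
      using that by (simp add: \<tau>_positive sg_simps sl_zero)
  qed (simp_all add: hlinear_zero[OF sl1(1)[OF lin]] Bm_positive)
  show "hlinear (\<lambda>t. sl2 ((*) (xplus e r)) (Bm c k t) + (HSUM j. sl1 (\<lambda>x. - sg j (dop (Tser c) e r j x)) (Bm c (k - j) t)))"
    by (intro hlinear_plus hlinear_hsum n hlinear_compose[OF sl1(1)[OF lin] Bm(1)] hlinear_compose[OF sl2(1)[OF hlinear_x] Bm(1)])
  fix x y
  have k: "derv (\<lambda>f s. ker (Tser c) f s j e r) u = - sg j (dop (Tser c) e r j u)" for j u
  proof -
    have "derv (\<lambda>f s. (if even j then - 1 else 1) * ker (Tser c) e r j f s) u =
        (if even j then - 1 else 1) *\<^sub>h derv (ker (Tser c) e r j) u"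
      by (rule derv_scale[OF tracefree_ker[OF pairing_kernel_T]])
    moreover have "(\<lambda>f s. (if even j then - 1 else 1) * ker (Tser c) e r j f s) = (\<lambda>f s. ker (Tser c) f s j e r)"
      by (intro ext) (simp add: ker_T_flip[of c _ _ j e r])
    ultimately show ?thesis by (simp add: dop_def sg_def split: if_splits)
  qed
  have "Sv c (- sg j (dop (Tser c) e r j x)) (k - j) y = sl1 (\<lambda>x. - sg j (dop (Tser c) e r j x)) (Sv c x (k - j) y)" for j
    using S_derv1[of "\<lambda>f s. ker (Tser c) f s j e r" c x "k - j" y, OF tracefree_ker1[OF pairing_kernel_T]]
    unfolding k[abs_def] by simp
  then show "Bm c k (sl2 ((*) (xplus e r)) (x \<otimes> y)) = sl2 ((*) (xplus e r)) (Bm c k (x \<otimes> y)) +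
      (HSUM j. sl1 (\<lambda>x. - sg j (dop (Tser c) e r j x)) (Bm c (k - j) (x \<otimes> y)))"
    by (simp add: sl2 hlinear_x Bm S_x2 k)
qed

context
  fixes c :: complex
begin

abbreviation BF :: "int \<Rightarrow> 'n::finite Hplus tensor2 \<Rightarrow> 'n Hplus tensor2"
  where "BF k t \<equiv> flip (Bm c k (flip t))"

lemma BF_lin: "hlinear (BF k)"
  by (intro hlinear_compose[OF flip(1)] hlinear_compose[OF Bm(1)] flip(1))

lemma BF_positive: "k > 0 \<Longrightarrow> BF k t = 0"
  by (simp add: Bm_positive hlinear_zero[OF flip(1)])

lemma sg\<tau>_lin: "hlinear (\<lambda>x. - sg j (dop (Tser c) e r j x))"
  by (intro hlinear_neg hlinear_compose[OF hlinear_sg] hlinear_dop[OF pairing_kernel_T])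

lemma sg\<tau>_positive: "j > 0 \<Longrightarrow> (\<lambda>x. - sg j (dop (Tser c) e r j x)) = (\<lambda>x. 0)"
  by (simp add: \<tau>_positive sg_simps)

lemma hnull_sg\<tau>:
  "(\<And>m. m > 0 \<Longrightarrow> G m = 0) \<Longrightarrow> hnull (\<lambda>j. sl2 (\<lambda>x. - sg j (dop (Tser c) e r j x)) (G (k - j))) UNIV"
  by (rule hnull_window) (simp_all add: sg\<tau>_positive sl_zero hlinear_zero[OF sl2(1)[OF sg\<tau>_lin]])

lemma BF_x1: "BF k (sl1 ((*) (xplus e r)) t) = sl1 ((*) (xplus e r)) (BF k t) +
    (HSUM j. sl2 (\<lambda>x. - sg j (dop (Tser c) e r j x)) (BF (k - j) t))"
proof -
  have "hnull (\<lambda>j. sl1 (\<lambda>x. - sg j (dop (Tser c) e r j x)) (Bm c (k - j) (flip t))) UNIV"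
    by (rule hnull_window) (simp_all add: sg\<tau>_positive sl_zero hlinear_zero[OF sl1(1)[OF sg\<tau>_lin]] Bm_positive)
  then show ?thesis
    by (simp add: flip_sl1 flip_sl2 hlinear_x Bm_x2 hlinear_add[OF flip(1)] hsum_linear[OF flip(1)] sg\<tau>_lin)
qed

lemma sg_neg_sl2:
  fixes t :: "('a::hmodule, 'b::hmodule) ctensor"
  assumes f: "hlinear f"
  shows "sl2 (\<lambda>x. - sg j (f x)) t = - sg j (sl2 f t)"
proof -
  have l: "hlinear (\<lambda>x. - sg j (f x))" by (intro hlinear_neg hlinear_compose[OF hlinear_sg] f)
  show ?thesis
    by (rule tensor_eqI[OF sl2(1)[OF l] hlinear_neg[OF hlinear_compose[OF hlinear_sg sl2(1)[OF f]]]])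
      (simp add: sl2 l f hlinear_uminus[OF hlinear_tensor2[OF hlinear_id]] sg_linear[OF hlinear_tensor2[OF hlinear_id]])
qed

lemma sgB_x1: "sg k (Bm c k (sl1 ((*) (xplus e r)) t)) = sl1 ((*) (xplus e r)) (sg k (Bm c k t)) -
    (HSUM j. sl2 (\<lambda>x. - sg j (dop (Tser c) e r j x)) (sg (k - j) (Bm c (k - j) t)))"
proof -
  have n: "hnull (\<lambda>j. sl2 (dop (Tser c) e r j) (Bm c (k - j) t)) UNIV" by (rule hnull_B3) (rule Bm_positive)
  have "sl2 (\<lambda>x. - sg j (dop (Tser c) e r j x)) (sg (k - j) (Bm c (k - j) t)) = - sg k (sl2 (dop (Tser c) e r j) (Bm c (k - j) t))" for j
    by (simp add: sg_neg_sl2[OF hlinear_dop[OF pairing_kernel_T]] sg_linear[OF sl2(1)[OF hlinear_dop[OF pairing_kernel_T]]] sg_simps)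
      (simp add: sg_def)
  then show ?thesis
    by (simp add: Bm_x1 hlinear_add[OF hlinear_sg] sg_linear[OF sl1(1)[OF hlinear_x]]
        hsum_linear[OF hlinear_sg n] hsum_uminus[OF hnull_linear[OF hlinear_sg n], symmetric])
qed

text \<open>The coefficient of \<open>z^k\<close> in \<open>S_21(z) S(-z)\<close>.\<close>

definition U :: "int \<Rightarrow> 'n::finite Hplus tensor2 \<Rightarrow> 'n Hplus tensor2"
  where "U k t = (HSUM j. BF j (sg (k - j) (Bm c (k - j) t)))"

lemma sgB_lin: "hlinear (\<lambda>t. sg k (Bm c k t))"
  by (rule hlinear_compose[OF hlinear_sg Bm(1)])

lemma hnull_U: "hnull (\<lambda>j. BF j (sg (k - j) (Bm c (k - j) t))) UNIV"
  by (rule hnull_window[where D = "\<lambda>j. BF j" and G = "\<lambda>m. sg m (Bm c m t)"])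
    (simp_all add: BF_positive hlinear_zero[OF BF_lin] Bm_positive sg_simps hlinear_zero[OF flip(1)] hlinear_zero[OF Bm(1)])

lemma U_lin: "hlinear (U k)"
  unfolding U_def by (intro hlinear_hsum hnull_U hlinear_compose[OF BF_lin sgB_lin])

lemma BF_sg\<tau>: "BF k (sl2 (\<lambda>x. - sg j (dop (Tser c) e r j x)) t) = sl2 (\<lambda>x. - sg j (dop (Tser c) e r j x)) (BF k t)"
  by (simp add: sg_neg_sl2[OF hlinear_dop[OF pairing_kernel_T]] hlinear_uminus[OF flip(1)] hlinear_uminus[OF Bm(1)]
      sg_linear[OF flip(1)] sg_linear[OF Bm(1)] flip_sl2 flip_sl1 hlinear_dop[OF pairing_kernel_T]
      Bm_derv[OF tracefree_ker[OF pairing_kernel_T], folded dop_def])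

text \<open>A generator of slot 1 passes through \<open>S(-z)\<close> and through
  \<open>S_21(z)\<close> with contractions of opposite sign, so the composite commutes with
  it.\<close>

lemma U_x1: "U k (sl1 ((*) (xplus e r)) t) = sl1 ((*) (xplus e r)) (U k t)"
proof -
  define \<omega> :: "int \<Rightarrow> 'a Hplus tensor2 \<Rightarrow> 'a Hplus tensor2"
    where "\<omega> j = sl2 (\<lambda>x. - sg j (dop (Tser c) e r j x))" for j
  define G where "G m = sg m (Bm c m t)" for m
  have \<omega>: "hlinear (\<omega> j)" for j unfolding \<omega>_def by (rule sl2(1)[OF sg\<tau>_lin])
  have \<omega>p: "\<omega> j t = 0" if "j > 0" for j t using that by (simp add: \<omega>_def sg\<tau>_positive sl_zero)
  have Gp: "G m = 0" if "m > 0" for m using that by (simp add: G_def Bm_positive sg_simps)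
  define Z where "Z j i = \<omega> i (BF j (G (k - i - j)))" for j i
  have nZ: "hnull (\<lambda>(j, i). Z j i) UNIV"
  proof (rule hnull_finite_support, rule finite_subset[of _ "{k..0} \<times> {k..0}"])
    show "{x \<in> UNIV. (case x of (j, i) \<Rightarrow> Z j i) \<noteq> 0} \<subseteq> {k..0} \<times> {k..0}"
    proof clarsimp
      fix j i assume z: "Z j i \<noteq> 0"
      have "\<not> i > 0" using z by (cases "i > 0") (simp_all add: Z_def \<omega>p)
      moreover have "\<not> j > 0" using z by (cases "j > 0") (simp_all add: Z_def BF_positive hlinear_zero[OF \<omega>])
      moreover have "\<not> k - i - j > 0"
        using z by (cases "k - i - j > 0") (simp_all add: Z_def Gp hlinear_zero[OF \<omega>] hlinear_zero[OF BF_lin])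
      ultimately show "k \<le> j \<and> j \<le> 0 \<and> k \<le> i \<and> i \<le> 0" by linarith
    qed
  qed simp
  have nZ': "hnull (\<lambda>(i, j). Z j i) UNIV" using nZ by (subst hnull_pair_swap)
  \<comment> \<open>\<open>Z'\<close> and \<open>Z\<close> are the two families of contraction
    terms; they differ only by the shift of \<open>j\<close> by \<open>i\<close>, so their total
    sums cancel.\<close>
  define Z' where "Z' j i = \<omega> i (BF (j - i) (G (k - j)))" for j i
  have nG: "hnull (\<lambda>i. \<omega> i (G (m - i))) UNIV" for m
    unfolding \<omega>_def by (rule hnull_sg\<tau>) (rule Gp)
  have nB: "hnull (\<lambda>i. \<omega> i (BF (j - i) s)) UNIV" for j s
    unfolding \<omega>_def by (rule hnull_sg\<tau>) (rule BF_positive)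
  have "BF j (sg (k - j) (Bm c (k - j) (sl1 ((*) (xplus e r)) t))) =
      sl1 ((*) (xplus e r)) (BF j (G (k - j))) + hsum (Z' j) UNIV - hsum (Z j) UNIV" for j
  proof -
    have "sg (k - j) (Bm c (k - j) (sl1 ((*) (xplus e r)) t)) =
        sl1 ((*) (xplus e r)) (G (k - j)) - (HSUM i. \<omega> i (G (k - j - i)))"
      unfolding G_def \<omega>_def by (rule sgB_x1)
    moreover have "BF j (HSUM i. \<omega> i (G (k - j - i))) = hsum (Z j) UNIV"
      unfolding hsum_linear[OF BF_lin nG] unfolding Z_def \<omega>_def BF_sg\<tau> int_diff_commute[of k j] ..
    ultimately show ?thesis
      by (simp only: hlinear_diff[OF BF_lin] BF_x1 Z'_def[abs_def] \<omega>_def)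
  qed
  moreover have nZ'2: "hnull (\<lambda>(j, i). Z' j i) UNIV"
  proof -
    have "bij (\<lambda>(j, i). (j - i, i :: int))"
      by (rule bij_betw_byWitness[where f' = "\<lambda>(j, i). (j + i, i)"]) auto
    then show ?thesis using hnull_bij[of "\<lambda>(j, i). (j - i, i :: int)" UNIV UNIV "\<lambda>(j, i). Z j i"] nZ
      by (simp add: split_def Z_def Z'_def)
  qed
  moreover have "hnull (\<lambda>j. sl1 ((*) (xplus e r)) (BF j (G (k - j)))) UNIV"
    unfolding G_def by (rule hnull_linear[OF sl1(1)[OF hlinear_x] hnull_U])
  ultimately have "U k (sl1 ((*) (xplus e r)) t) = (HSUM j. sl1 ((*) (xplus e r)) (BF j (G (k - j))))
      + (HSUM j. hsum (Z' j) UNIV) - (HSUM j. hsum (Z j) UNIV)"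
    unfolding U_def by (simp add: hsum_add hsum_diff hnull_add hnull_hsum_pair(1)[OF nZ] hnull_hsum_pair(1)[OF nZ'2])
  moreover have "(HSUM j. hsum (Z' j) UNIV) = (HSUM j. hsum (Z j) UNIV)"
  proof -
    have "(HSUM j. Z' j i) = (HSUM j. Z j i)" for i
      using hsum_shift[of "\<lambda>j. Z' j i" i] by (simp add: Z_def Z'_def algebra_simps)
    then show ?thesis by (simp add: hsum_swap_UNIV[OF nZ'2] hsum_swap_UNIV[OF nZ])
  qed
  ultimately show ?thesis
    by (simp add: U_def G_def hsum_linear[OF sl1(1)[OF hlinear_x] hnull_U])
qed

lemma tensor_X_eqI:
  fixes F G :: "'i \<Rightarrow> 'n::finite Hplus tensor2 \<Rightarrow> 'm::hcomplete"
  assumes "\<And>i. hlinear (F i)" "\<And>i. hlinear (G i)" "\<And>i y. F i (1 \<otimes> y) = G i (1 \<otimes> y)"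
    "\<And>e r t i. r \<ge> 0 \<Longrightarrow> (\<And>i. F i t = G i t) \<Longrightarrow> F i (sl1 ((*) (xplus e r)) t) = G i (sl1 ((*) (xplus e r)) t)"
  shows "F i t = G i t"
proof (rule tensor_eqI[OF assms(1,2)])
  fix x y
  show "F i (x \<otimes> y) = G i (x \<otimes> y)"
  proof (rule Hplus_eqI[where F = "\<lambda>i x. F i (x \<otimes> y)" and G = "\<lambda>i x. G i (x \<otimes> y)"])
    fix i and e :: "'n \<times> 'n" and r :: int and u :: "'n Hplus"
    show "hlinear (\<lambda>x. F i (x \<otimes> y))" "hlinear (\<lambda>x. G i (x \<otimes> y))"
      by (intro hlinear_compose[OF assms(1)] hlinear_compose[OF assms(2)] hlinear_tensor1 hlinear_id)+
    show "F i (1 \<otimes> y) = G i (1 \<otimes> y)" by (rule assms(3))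
    assume "r \<ge> 0" "\<And>i. F i (u \<otimes> y) = G i (u \<otimes> y)"
    then show "F i ((xplus e r * u) \<otimes> y) = G i ((xplus e r * u) \<otimes> y)"
      using assms(4)[of r "u \<otimes> y" i e] by (simp add: sl1 hlinear_x)
  qed
qed

lemma U_id: "U k t = (if k = 0 then t else 0)"
proof (rule tensor_X_eqI[where F = U and G = "\<lambda>k t. if k = 0 then t else 0"])
  fix k e r and t :: "'a Hplus tensor2" and y :: "'a Hplus"
  show "hlinear (U k :: 'a Hplus tensor2 \<Rightarrow> _)" by (rule U_lin)
  show "hlinear (\<lambda>t. if k = 0 then t else 0 :: 'a Hplus tensor2)" by (intro hlinear_if hlinear_id hlinear_0)
  have "U k (1 \<otimes> y) = BF k (sg (k - k) (Bm c (k - k) (1 \<otimes> y)))"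
    unfolding U_def by (rule hsum_single) (auto simp: Bm S_one sg_simps hlinear_zero[OF BF_lin] hlinear_zero[OF flip(1)] hlinear_zero[OF Bm(1)])
  then show "U k (1 \<otimes> y) = (if k = 0 then 1 \<otimes> y else 0)"
    by (simp add: Bm S_one S_right_one sg_simps flip hlinear_zero[OF flip(1)])
  assume "\<And>k. U k t = (if k = 0 then t else 0)"
  then show "U k (sl1 ((*) (xplus e r)) t) = (if k = 0 then sl1 ((*) (xplus e r)) t else 0)"
    by (simp add: U_x1 hlinear_zero[OF sl1(1)[OF hlinear_x]])
qed

lemma unitarity_Bm: "unitarity (Bm c :: int \<Rightarrow> 'n::finite Hplus tensor2 \<Rightarrow> _)"
proof -
  have on21: "on21 (Bm c) k t = BF k t" for k and t :: "'n Hplus tensor2"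
    by (simp add: on21_def flip_def)
  have neg: "at_neg (Bm c) k t = sg k (Bm c k t)" for k and t :: "'n Hplus tensor2"
    by (simp add: at_neg_def sg_def)
  have 1: "(on21 (Bm c) \<odot> at_neg (Bm c)) k t = monomial 0 k t" for k and t :: "'n Hplus tensor2"
    using U_id[of k t] by (simp add: series_comp_def on21 neg U_def monomial_def)
  have 2: "(at_neg (Bm c) \<odot> on21 (Bm c)) k t = monomial 0 k t" for k and t :: "'n Hplus tensor2"
  proof -
    have "(at_neg (Bm c) \<odot> on21 (Bm c)) k t = (HSUM j. sg j (Bm c j (BF (k - j) t)))"
      by (simp add: series_comp_def on21 neg)
    \<comment> \<open>The opposite composite is the first one conjugated by the flip with z replaced
      by -z, which accounts for the sign \<open>sg k\<close>.\<close>
    also have "\<dots> = (HSUM j. sg k (flip (BF j (sg (k - j) (Bm c (k - j) (flip t))))))"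
      by (rule hsum_cong) (simp_all add: sg_linear[OF Bm(1)] sg_linear[OF flip(1)] sg_simps, simp add: sg_def)
    also have "\<dots> = sg k (flip (U k (flip t)))"
      unfolding U_def by (simp only: hsum_linear[OF flip(1) hnull_U] hsum_linear[OF hlinear_sg hnull_linear[OF flip(1) hnull_U]])
    also have "\<dots> = monomial 0 k t"
      by (simp add: U_id monomial_def sg_simps hlinear_zero[OF flip(1)])
    finally show ?thesis .
  qed
  show ?thesis unfolding unitarity_def by (intro conjI ext) (rule 1, rule 2)
qed

section \<open>Vacuum axioms and shift condition\<close>

lemma Y_right_one: "k \<le> 0 \<Longrightarrow> Yv c p k 1 = (if k = 0 then p else 0)"
proof -
  \<comment> \<open>Positive exponents are masked by 0, since nothing is claimed about them, and the
    induction can then run over all exponents.\<close>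
  have "(if k > 0 then 0 else Yv c p k 1) = (if k = 0 then p else 0)" for k and p :: "'a Hplus"
  proof (rule Hplus_eqI[where i = k and F = "\<lambda>k p. if k > 0 then 0 else Yv c p k 1" and G = "\<lambda>k p. if k = 0 then p else 0"])
    fix i and e :: "'a \<times> 'a" and r :: int and u :: "'a Hplus"
    show "hlinear (\<lambda>p :: 'a Hplus. if i > 0 then 0 else Yv c p i 1)" by (intro hlinear_if Y_lin1 hlinear_0)
    show "hlinear (\<lambda>p :: 'a Hplus. if i = 0 then p else 0)" by (intro hlinear_if hlinear_id hlinear_0)
    show "(if i > 0 then 0 else Yv c 1 i 1) = (if i = 0 then 1 :: 'a Hplus else 0)" by (simp add: Y_one)
    assume r: "r \<ge> 0" and IH: "\<And>i. (if i > 0 then 0 else Yv c u i 1) = (if i = 0 then u else 0)"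
    have IH: "Yv c u i 1 = (if i = 0 then u else 0)" if "i \<le> 0" for i using IH[of i] that by auto
    show "(if i > 0 then 0 else Yv c (xplus e r * u) i 1) = (if i = 0 then xplus e r * u else 0)"
    proof (cases "i > 0")
      case False
      have "(HSUM j. YA e r j (Yv c u (i - j) 1)) = YA e r 0 (Yv c u (i - 0) 1)"
      proof (rule hsum_single)
        fix j :: int assume "j \<noteq> 0"
        then show "YA e r j (Yv c u (i - j) 1) = 0"
          using IH[of "i - j"] False by (cases "j < 0") (auto simp: YA_vanish hlinear_zero[OF hlinear_YA])
      qed simp
      then show ?thesis
        using False r by (auto simp: Y_step dop_one[OF pairing_negS] hlinear_zero[OF Y_lin2] IH YA_def hscale_one)
    qed auto
  qed
  then show "k \<le> 0 \<Longrightarrow> Yv c p k 1 = (if k = 0 then p else 0)" by (metis not_less)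
qed

lemma vacuum_Ym: "vacuum_axioms (Ym c) (1 :: 'n::finite Hplus)"
  unfolding vacuum_axioms_def vop_def by (simp add: Ym Y_one Y_right_one)

definition Dop :: "'n::finite Hplus \<Rightarrow> 'n Hplus"
  where "Dop v = Yv c v 1 1"

lemma hlinear_Dop: "hlinear Dop"
  unfolding Dop_def by (rule Y_lin1)

lemma Dop_one: "Dop 1 = 0"
  by (simp add: Dop_def Y_one)

text \<open>Only \<open>j = 0\<close> and \<open>j = 1\<close> contribute: negative powers are
  absent from the creation field, and for larger \<open>j\<close> the remaining field would act on
  the vacuum with a negative exponent.\<close>

lemma Dop_times:
  assumes r: "r \<ge> 0"
  shows "Dop (xplus e r * p) = xplus e r * Dop p + of_int (r + 1) *\<^sub>h (xplus e (r + 1) * p)"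
proof -
  have "(HSUM j. YA e r j (Yv c p (1 - j) 1)) = (\<Sum>j\<in>{0, 1}. YA e r j (Yv c p (1 - j) 1))"
  proof (rule hsum_finite_support)
    fix j :: int assume "j \<in> UNIV - {0, 1}"
    then consider "j < 0" | "1 - j < 0" by force
    then show "YA e r j (Yv c p (1 - j) 1) = 0"
      by cases (simp_all add: YA_vanish Y_right_one hlinear_zero[OF hlinear_YA])
  qed auto
  moreover have "plus_coeff 1 r = of_int (r + 1)" using plus_coeff_absorb[OF r, of 1] r by simp
  ultimately show ?thesis
    using r by (simp add: Dop_def Y_step dop_one[OF pairing_negS] hlinear_zero[OF Y_lin2] YA_def Y_right_one hscale_one add.commute)
qed

text \<open>The kernel depends on z and u only through \<open>z + u\<close>, so its derivatives in z
  and in u agree.\<close>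

lemma ker_absorb:
  assumes "r \<ge> 0" shows "of_int j * ker \<sigma> e r j f s = of_int (r + 1) * ker \<sigma> e (r + 1) (j - 1) f s"
proof -
  have "of_int j * ker \<sigma> e r j f s = (of_int j * plus_coeff j r) * minus_coeff (j + r) s * \<sigma> e f (j + r + s)"
    unfolding ker_def by (simp only: mult.assoc)
  also have "\<dots> = of_int (r + 1) * ker \<sigma> e (r + 1) (j - 1) f s"
  proof -
    have "j - 1 + (r + 1) = j + r" by simp
    then show ?thesis unfolding plus_coeff_absorb[OF assms] ker_def by (simp only: mult.assoc)
  qed
  finally show ?thesis .
qed

lemma dop_absorb: "r \<ge> 0 \<Longrightarrow> of_int j *\<^sub>h dop (Tser c) e r j u = of_int (r + 1) *\<^sub>h dop (Tser c) e (r + 1) (j - 1) u"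
  unfolding dop_def derv_scale[OF tracefree_ker[OF pairing_kernel_T], symmetric] by (simp only: ker_absorb)

lemma Sv_null: "hnull (\<lambda>j. Sv c p (k - j) (dop (Tser c) e r j q)) UNIV"
  by (rule S_hnull(2))

text \<open>On a generator the translation operator raises \<open>r\<close>, which by
  \<open>dop_absorb\<close> amounts to differentiating the contraction in z. Splitting the factor
  \<open>k - j + 1\<close> as \<open>(k + 1) - j\<close> is the product rule that combines this with
  the induction hypothesis.\<close>

lemma shift_Sv: "sl1 Dop (Sv c p k q) = Sv c (Dop p) k q - of_int (k + 1) *\<^sub>h Sv c p (k + 1) q"
proof (rule Hplus_eqI[where i = "(k, q)" and F = "\<lambda>i p. sl1 Dop (Sv c p (fst i) (snd i))"
      and G = "\<lambda>i p. Sv c (Dop p) (fst i) (snd i) - of_int (fst i + 1) *\<^sub>h Sv c p (fst i + 1) (snd i)", simplified fst_conv snd_conv])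
  fix i :: "int \<times> 'a Hplus" and e :: "'a \<times> 'a" and r :: int and u :: "'a Hplus"
  note lD = sl1(1)[OF hlinear_Dop]
  obtain k q where i: "i = (k, q)" by (cases i)
  show "hlinear (\<lambda>p. sl1 Dop (Sv c p (fst i) (snd i)))" by (rule hlinear_compose[OF lD S_lin1])
  show "hlinear (\<lambda>p. Sv c (Dop p) (fst i) (snd i) - of_int (fst i + 1) *\<^sub>h Sv c p (fst i + 1) (snd i))"
    by (intro hlinear_minus hlinear_compose[OF S_lin1 hlinear_Dop] hlinear_hscale S_lin1)
  show "sl1 Dop (Sv c 1 (fst i) (snd i)) = Sv c (Dop 1) (fst i) (snd i) - of_int (fst i + 1) *\<^sub>h Sv c 1 (fst i + 1) (snd i)"
    by (simp add: S_one Dop_one hlinear_zero[OF S_lin1] sl1 hlinear_Dop tensor_zero1 hlinear_zero[OF lD] del: of_int_add)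
  assume r: "r \<ge> 0" and IH': "\<And>i. sl1 Dop (Sv c u (fst i) (snd i)) = Sv c (Dop u) (fst i) (snd i) - of_int (fst i + 1) *\<^sub>h Sv c u (fst i + 1) (snd i)"
  have IH: "sl1 Dop (Sv c u k q) = Sv c (Dop u) k q - of_int (k + 1) *\<^sub>h Sv c u (k + 1) q" for k q
    using IH'[of "(k, q)"] by simp
  let ?\<tau> = "\<lambda>r j. dop (Tser c) e r j q" and ?X = "\<lambda>r. sl1 ((*) (xplus e r))"
  have XD: "sl1 Dop (?X r t) = ?X r (sl1 Dop t) + of_int (r + 1) *\<^sub>h ?X (r + 1) t" for t :: "'a Hplus tensor2"
    by (rule tensor_eqI[OF hlinear_compose[OF lD sl1(1)[OF hlinear_x]]
          hlinear_plus[OF hlinear_compose[OF sl1(1)[OF hlinear_x] lD] hlinear_hscale[OF sl1(1)[OF hlinear_x]]]])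
      (simp add: sl1 hlinear_x hlinear_Dop Dop_times[OF r] hlinear_add[OF hlinear_tensor1[OF hlinear_id]]
        hlinear_scale[OF hlinear_tensor1[OF hlinear_id]])
  have n: "hnull (\<lambda>j. of_int (k - j + 1) *\<^sub>h Sv c u (k - j + 1) (?\<tau> r j)) UNIV"
    using hnull_scale[OF Sv_null[of u "k + 1" e r q], of "\<lambda>j. of_int (k - j + 1)"] by (simp add: algebra_simps)
  have nk: "hnull (\<lambda>j. Sv c u (k + 1 - j) (?\<tau> r j)) UNIV" by (rule Sv_null)
  have "(HSUM j. sl1 Dop (Sv c u (k - j) (?\<tau> r j))) =
      (HSUM j. Sv c (Dop u) (k - j) (?\<tau> r j)) - (HSUM j. of_int (k - j + 1) *\<^sub>h Sv c u (k - j + 1) (?\<tau> r j))"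
    unfolding IH by (rule hsum_diff[OF Sv_null n])
  moreover have "(HSUM j. of_int (k - j + 1) *\<^sub>h Sv c u (k - j + 1) (?\<tau> r j)) =
      of_int (k + 1) *\<^sub>h (HSUM j. Sv c u (k + 1 - j) (?\<tau> r j)) - of_int (r + 1) *\<^sub>h (HSUM j. Sv c u (k - j) (?\<tau> (r + 1) j))"
  proof -
    have "of_int (r + 1) *\<^sub>h (HSUM j. Sv c u (k - j) (?\<tau> (r + 1) j)) =
        (HSUM j. Sv c u (k - j) (of_int (r + 1) *\<^sub>h ?\<tau> (r + 1) j))"
      by (simp only: hsum_scale[OF Sv_null] hlinear_scale[OF S_lin2])
    also have "\<dots> = (HSUM j. Sv c u (k - (j - 1)) (of_int (r + 1) *\<^sub>h ?\<tau> (r + 1) (j - 1)))"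
      using hsum_shift[of "\<lambda>j. Sv c u (k - j) (of_int (r + 1) *\<^sub>h ?\<tau> (r + 1) j)" "- 1"] by simp
    also have "\<dots> = (HSUM j. of_int j *\<^sub>h Sv c u (k + 1 - j) (?\<tau> r j))"
      by (intro hsum_cong refl) (simp only: dop_absorb[OF r, symmetric] hlinear_scale[OF S_lin2], simp add: algebra_simps)
    finally have 1: "of_int (r + 1) *\<^sub>h (HSUM j. Sv c u (k - j) (?\<tau> (r + 1) j)) = \<dots>" .
    have "of_int (k - j + 1) *\<^sub>h Sv c u (k - j + 1) (?\<tau> r j) =
        of_int (k + 1) *\<^sub>h Sv c u (k + 1 - j) (?\<tau> r j) - of_int j *\<^sub>h Sv c u (k + 1 - j) (?\<tau> r j)" for j
    proof -
      have "k - j + 1 = k + 1 - j" by simp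
      moreover have "(of_int (k + 1 - j) :: complex fps) = of_int (k + 1) - of_int j" by simp
      ultimately show ?thesis by (simp only: hmod.scale_left_diff_distrib)
    qed
    then show ?thesis
      unfolding 1 by (simp only: hsum_diff[OF hnull_scale[OF nk] hnull_scale[OF nk]] hsum_scale[OF nk])
  qed
  ultimately show "sl1 Dop (Sv c (xplus e r * u) (fst i) (snd i)) =
      Sv c (Dop (xplus e r * u)) (fst i) (snd i) - of_int (fst i + 1) *\<^sub>h Sv c (xplus e r * u) (fst i + 1) (snd i)"
    unfolding i fst_conv snd_conv Dop_times[OF r] hlinear_add[OF S_lin1] hlinear_scale[OF S_lin1] S_step
      hlinear_add[OF lD] XD IH hsum_linear[OF lD Sv_null] hlinear_diff[OF sl1(1)[OF hlinear_x]]
      hlinear_scale[OF sl1(1)[OF hlinear_x]] hscale_right_distrib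
    by (simp only:) (simp add: algebra_simps)
qed

lemma shift_Bm: "shift_condition (Ym c) (1 :: 'n::finite Hplus) (Bm c)"
proof -
  have D1: "lift2 (\<lambda>v w. vop (Ym c) v 1 1 \<otimes> w) = sl1 (Dop :: 'n Hplus \<Rightarrow> _)"
    by (simp add: sl1_def vop_def Ym Dop_def)
  note lD = sl1(1)[OF hlinear_Dop]
  have "sl1 Dop (Bm c k t) - Bm c k (sl1 Dop t) = - (fps_const (of_int (k + 1)) *\<^sub>h Bm c (k + 1) t)" for k and t :: "'n Hplus tensor2"
    by (rule tensor_eqI[OF hlinear_minus[OF hlinear_compose[OF lD Bm(1)] hlinear_compose[OF Bm(1) lD]]
          hlinear_neg[OF hlinear_hscale[OF Bm(1)]]])
      (simp add: Bm sl1 hlinear_Dop shift_Sv fps_of_int del: of_int_add)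
  then show ?thesis unfolding shift_condition_def Let_def D1 by blast
qed

end

text \<open>Every contraction carries a factor T, which is divisible by h; without contractions the
  tensor is unchanged.\<close>

lemma Bm_mod_h: "Bm c k t - monomial 0 k t \<in> hpow 1"
proof (induction t rule: tensor_induct_mod[where n = 1])
  case (pure x y)
  have "\<forall>k y. Sv c x k y - (if k = 0 then x \<otimes> y else 0) \<in> hpow 1"
  proof (induction x rule: Hplus_induct_mod[where n = 1])
    case one
    show ?case by (simp add: S_one hpow_zero)
  next
    case (times e r u)
    show ?case
    proof (intro allI)
      fix k and y :: "'a Hplus"
      have "sl1 ((*) (xplus e r)) (Sv c u k y - (if k = 0 then u \<otimes> y else 0)) \<in> hpow 1"
        by (rule hlinear_hpow[OF sl1(1)[OF hlinear_x]]) (use times in blast)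
      moreover have "(HSUM j. Sv c u (k - j) (dop (Tser c) e r j y)) \<in> hpow 1"
      proof (rule hsum_hpow[OF S_hnull(2)], rule hlinear_hpow[OF S_lin2])
        fix j
        have "fps_X ^ 1 dvd ker (Tser c) e r j f s" for f s by (simp add: ker_def dvd_mult Tser_dvd)
        then show "dop (Tser c) e r j y \<in> hpow 1"
          unfolding dop_def by (rule derv_hpow[OF tracefree_ker[OF pairing_kernel_T]])
      qed
      ultimately have "sl1 ((*) (xplus e r)) (Sv c u k y - (if k = 0 then u \<otimes> y else 0)) +
          (HSUM j. Sv c u (k - j) (dop (Tser c) e r j y)) \<in> hpow 1" by (rule hpow_add)
      then show "Sv c (xplus e r * u) k y - (if k = 0 then (xplus e r * u) \<otimes> y else 0) \<in> hpow 1"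
        by (simp add: S_step hlinear_diff[OF sl1(1)[OF hlinear_x]] sl1 hlinear_x hlinear_zero[OF sl1(1)[OF hlinear_x]]
            diff_add_eq split: if_splits)
    qed
  next
    case (plus u v)
    show ?case
    proof (intro allI)
      fix k y
      have "(Sv c u k y - (if k = 0 then u \<otimes> y else 0)) + (Sv c v k y - (if k = 0 then v \<otimes> y else 0)) \<in> hpow 1"
        using plus by (intro hpow_add) blast+
      then show "Sv c (u + v) k y - (if k = 0 then (u + v) \<otimes> y else 0) \<in> hpow 1"
        by (simp add: hlinear_add[OF S_lin1] hlinear_add[OF hlinear_tensor1[OF hlinear_id]] algebra_simps split: if_splits)
    qed
  next
    case (scale a u)
    show ?case
    proof (intro allI)
      fix k y
      have "a *\<^sub>h (Sv c u k y - (if k = 0 then u \<otimes> y else 0)) \<in> hpow 1"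
        using scale by (intro hpow_scale) blast
      then show "Sv c (a *\<^sub>h u) k y - (if k = 0 then (a *\<^sub>h u) \<otimes> y else 0) \<in> hpow 1"
        by (simp add: hlinear_scale[OF S_lin1] hlinear_scale[OF hlinear_tensor1[OF hlinear_id]] hmod.scale_right_diff_distrib split: if_splits)
    qed
  next
    case (hpow u)
    then have "u \<otimes> y \<in> hpow 1" "Sv c u k y \<in> hpow 1" for k y
      using hlinear_hpow[OF hlinear_tensor1[OF hlinear_id]] hlinear_hpow[OF S_lin1] by blast+
    then show ?case by (auto intro!: hpow_diff hpow_zero)
  qed
  then show ?case by (simp add: Bm monomial_def)
next
  case (plus s t)
  then have "(Bm c k s - monomial 0 k s) + (Bm c k t - monomial 0 k t) \<in> hpow 1" by (rule hpow_add)
  then show ?case by (simp add: hlinear_add[OF Bm(1)] monomial_def algebra_simps split: if_splits)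
next
  case (hpow t)
  then show ?case by (auto simp: monomial_def intro!: hpow_diff hpow_zero hlinear_hpow[OF Bm(1)])
qed

lemma in_negative_tensor_laurent:
  assumes "in_negative f" shows "in_tensor_laurent f"
  unfolding in_tensor_laurent_def
proof
  fix n
  obtain K where K: "\<And>k. k < K \<Longrightarrow> f k \<in> hpow n"
    using assms in_laurentD unfolding in_negative_def by blast
  \<comment> \<open>The number of exponents in \<open>{K..0}\<close>, the only ones that survive
    modulo \<open>hpow n\<close>; the monomials \<open>z^(-i)\<close> with \<open>i < m\<close>
    serve as the functions \<open>g i\<close>.\<close>
  define m where "m = nat (1 - K)"
  have *: "f k - (\<Sum>i<m. fps_const (fls_nth (fls_X_intpow (- int i)) k) *\<^sub>h f (- int i)) \<in> hpow n" for k
  proof -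
    have e: "fps_const (fls_nth (fls_X_intpow (- int i) :: complex fls) k) *\<^sub>h f (- int i) = (if - int i = k then f k else 0)" for i
      by (auto simp: hscale_one)
    have "(\<Sum>i<m. fps_const (fls_nth (fls_X_intpow (- int i)) k) *\<^sub>h f (- int i)) = (\<Sum>i<m. if - int i = k then f k else 0)"
      unfolding e ..
    also have "\<dots> = (if K \<le> k \<and> k \<le> 0 then f k else 0)"
    proof (cases "k \<le> 0")
      case True
      then have "- int i = k \<longleftrightarrow> i = nat (- k)" for i by auto
      then show ?thesis using True by (simp add: m_def)
    next
      case False
      then have "- int i \<noteq> k" for i by auto
      then show ?thesis using False by simp
    qed
    finally have "(\<Sum>i<m. fps_const (fls_nth (fls_X_intpow (- int i)) k) *\<^sub>h f (- int i)) = (if K \<le> k \<and> k \<le> 0 then f k else 0)" .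
    then show ?thesis
      using K[of k] assms by (auto simp: in_negative_def hpow_zero)
  qed
  show "\<exists>m w (g :: nat \<Rightarrow> complex fls). \<forall>k. f k - (\<Sum>i<m. fps_const (fls_nth (g i) k) *\<^sub>h w i) \<in> hpow n"
    by (intro exI allI) (rule *)
qed

section \<open>The hexagon identity\<close>

context
  fixes c :: complex
begin

text \<open>Contraction with a generator of the last tensor slot, acting as a derivation on an
  earlier slot.\<close>

abbreviation (input) \<omega> :: "'n::finite \<times> 'n \<Rightarrow> int \<Rightarrow> int \<Rightarrow> 'n Hplus \<Rightarrow> 'n Hplus"
  where "\<omega> f s j \<equiv> derv (\<lambda>e r. ker (Tser c) e r j f s)"

lemmas \<omega>_tf = tracefree_ker1[OF pairing_kernel_T, of c]
lemmas \<omega>_lin = derv(1)[OF tracefree_ker1[OF pairing_kernel_T, of c]]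

lemma \<omega>_vanish: "j \<ge> 0 \<Longrightarrow> \<omega> f s j = (\<lambda>x. 0)"
proof -
  assume "j \<ge> 0"
  then have "(\<lambda>e r. ker (Tser c) e r j f s) = (\<lambda>e r. 0)" by (intro ext ker_vanish[OF pairing_kernel_T]) simp
  then show ?thesis by (intro ext) (simp add: derv_0)
qed

lemma hnull_\<omega>:
  fixes D :: "int \<Rightarrow> 'm::zero \<Rightarrow> 'm" and G :: "int \<Rightarrow> 'm \<Rightarrow> 'b::hmodule"
  assumes "\<And>m. m > 0 \<Longrightarrow> G m = (\<lambda>_. 0)" "\<And>m. G m 0 = 0"
    and "\<And>j. D j = (\<lambda>_. 0) \<or> j \<le> 0"
  shows "hnull (\<lambda>j. G (k - j) (D j t)) UNIV"
proof (rule hnull_finite_support, rule finite_subset[of _ "{k..0}"])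
  show "{j \<in> UNIV. G (k - j) (D j t) \<noteq> 0} \<subseteq> {k..0}"
  proof clarsimp
    fix j assume j: "G (k - j) (D j t) \<noteq> 0"
    then have "\<not> k - j > 0" using assms(1) by (cases "k - j > 0") auto
    moreover have "j \<le> 0" using j assms(2) assms(3)[of j] by auto
    ultimately show "k \<le> j \<and> j \<le> 0" by linarith
  qed
qed simp

lemma o_zero: "sl1 (sl1 (\<lambda>x. 0)) = (\<lambda>_. 0)" "sl1 (sl2 (\<lambda>x. 0)) = (\<lambda>_. 0)"
  by (simp_all add: sl_zero)

lemma B_positive': "m > 0 \<Longrightarrow> B13 c m = (\<lambda>_. 0)" "m > 0 \<Longrightarrow> B23 c m = (\<lambda>_. 0)"
  by (intro ext B_positive, assumption)+

lemma hnull_\<omega>1: "hnull (\<lambda>n. B13 c (m - n) (sl1 (sl1 (\<omega> f s n)) t)) UNIV"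
proof (rule hnull_\<omega>[where D = "\<lambda>n. sl1 (sl1 (\<omega> f s n))" and G = "B13 c"])
  show "sl1 (sl1 (\<omega> f s j)) = (\<lambda>_. 0) \<or> j \<le> 0" for j
    by (cases "j \<ge> 0") (simp_all add: \<omega>_vanish o_zero)
qed (simp_all add: B_positive' hlinear_zero[OF B13(1)])

lemma hnull_\<omega>2: "hnull (\<lambda>n. B23 c (m - n) (sl1 (sl2 (\<omega> f s n)) t)) UNIV"
proof (rule hnull_\<omega>[where D = "\<lambda>n. sl1 (sl2 (\<omega> f s n))" and G = "B23 c"])
  show "sl1 (sl2 (\<omega> f s j)) = (\<lambda>_. 0) \<or> j \<le> 0" for j
    by (cases "j \<ge> 0") (simp_all add: \<omega>_vanish o_zero)
qed (simp_all add: B_positive' hlinear_zero[OF B23(1)])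

lemma S_\<omega>_null: "hnull (\<lambda>i. Sv c (\<omega> f s i p) (k - i) q) UNIV"
  unfolding Sv_def by (rule Sx.hnull_L_derv[OF \<omega>_tf ker_low[OF pairing_kernel_T]])

abbreviation X3 :: "'n::finite \<times> 'n \<Rightarrow> int \<Rightarrow> 'n Hplus tensor3 \<Rightarrow> 'n Hplus tensor3"
  where "X3 f s \<equiv> sl2 ((*) (xplus f s))"

lemma B13_x3: "B13 c m (X3 f s t) = X3 f s (B13 c m t) + (HSUM n. B13 c (m - n) (sl1 (sl1 (\<omega> f s n)) t))"
proof (rule tensor3_eqI[OF hlinear_compose[OF B13(1) sl2(1)[OF hlinear_x]]])
  show "hlinear (\<lambda>t. X3 f s (B13 c m t) + (HSUM n. B13 c (m - n) (sl1 (sl1 (\<omega> f s n)) t)))"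
    by (intro hlinear_plus hlinear_hsum hnull_\<omega>1 hlinear_compose[OF sl2(1)[OF hlinear_x] B13(1)]
        hlinear_compose[OF B13(1) sl1(1)[OF sl1(1)[OF \<omega>_lin]]])
  fix x y z
  show "B13 c m (X3 f s (x \<otimes> y \<otimes> z)) = X3 f s (B13 c m (x \<otimes> y \<otimes> z)) +
      (HSUM n. B13 c (m - n) (sl1 (sl1 (\<omega> f s n)) (x \<otimes> y \<otimes> z)))"
    by (simp add: sl2 sl1 hlinear_x B13 Bm S_x2 hlinear_add[OF ins(1)] ins_sl hsum_linear[OF ins(1) S_\<omega>_null] \<omega>_lin)
qed

lemma B23_x3: "B23 c m (X3 f s t) = X3 f s (B23 c m t) + (HSUM n. B23 c (m - n) (sl1 (sl2 (\<omega> f s n)) t))"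
proof (rule tensor3_eqI[OF hlinear_compose[OF B23(1) sl2(1)[OF hlinear_x]]])
  show "hlinear (\<lambda>t. X3 f s (B23 c m t) + (HSUM n. B23 c (m - n) (sl1 (sl2 (\<omega> f s n)) t)))"
    by (intro hlinear_plus hlinear_hsum hnull_\<omega>2 hlinear_compose[OF sl2(1)[OF hlinear_x] B23(1)]
        hlinear_compose[OF B23(1) sl1(1)[OF sl2(1)[OF \<omega>_lin]]])
  fix x y z
  show "B23 c m (X3 f s (x \<otimes> y \<otimes> z)) = X3 f s (B23 c m (x \<otimes> y \<otimes> z)) +
      (HSUM n. B23 c (m - n) (sl1 (sl2 (\<omega> f s n)) (x \<otimes> y \<otimes> z)))"
    by (simp add: sl2 sl1 hlinear_x B23 Bm S_x2 hlinear_add[OF pre(1)] ins_sl hsum_linear[OF pre(1) S_\<omega>_null] \<omega>_lin)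
qed

definition Y1 :: "int \<Rightarrow> 'n::finite Hplus tensor3 \<Rightarrow> 'n Hplus tensor2"
  where "Y1 k = lift2 (\<lambda>t w. Ym c k t \<otimes> w)"

lemma Y1:
  fixes t :: "'n::finite Hplus tensor2"
  shows "hlinear (Y1 k :: 'n Hplus tensor3 \<Rightarrow> _)" "Y1 k (t \<otimes> w) = Ym c k t \<otimes> w"
proof -
  have "hbilinear (\<lambda>(t :: 'n Hplus tensor2) w. Ym c k t \<otimes> (w :: 'n Hplus))"
    by (intro hbilinearI hlinear_tensor1 hlinear_tensor2 hlinear_id Ym(1))
  then show "hlinear (Y1 k :: 'n Hplus tensor3 \<Rightarrow> _)" "Y1 k (t \<otimes> w) = Ym c k t \<otimes> w"
    unfolding Y1_def by (rule lift2)+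
qed

lemma Y1_X3: "Y1 k (X3 f s t) = sl2 ((*) (xplus f s)) (Y1 k t)"
  by (rule tensor_eqI[OF hlinear_compose[OF Y1(1) sl2(1)[OF hlinear_x]] hlinear_compose[OF sl2(1)[OF hlinear_x] Y1(1)]])
    (simp add: sl2 hlinear_x Y1)

definition W :: "int \<Rightarrow> int \<Rightarrow> int \<Rightarrow> 'n::finite Hplus tensor3 \<Rightarrow> 'n Hplus tensor2"
  where "W a b m t = Y1 b (B23 c a (B13 c m t))"

lemma W_lin: "hlinear (W a b m)"
  unfolding W_def by (intro hlinear_compose[OF Y1(1)] hlinear_compose[OF B23(1)] B13(1))

lemma W_vanish: "a > 0 \<or> m > 0 \<Longrightarrow> W a b m t = 0"
  by (auto simp: W_def B_positive hlinear_zero[OF B23(1)] hlinear_zero[OF Y1(1)])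

lemma W_x3: "W a b m (X3 f s t) = sl2 ((*) (xplus f s)) (W a b m t)
    + (HSUM i. W (a - i) b m (sl1 (sl2 (\<omega> f s i)) t))
    + (HSUM n. W a b (m - n) (sl1 (sl1 (\<omega> f s n)) t))"
proof -
  have "B23 c a (B13 c m (X3 f s t)) = X3 f s (B23 c a (B13 c m t))
      + (HSUM i. B23 c (a - i) (B13 c m (sl1 (sl2 (\<omega> f s i)) t)))
      + (HSUM n. B23 c a (B13 c (m - n) (sl1 (sl1 (\<omega> f s n)) t)))"
    unfolding B13_x3 hlinear_add[OF B23(1)] B23_x3 hsum_linear[OF B23(1) hnull_\<omega>1] B13_o2[OF \<omega>_lin] ..
  moreover have "hnull (\<lambda>i. B23 c (a - i) (B13 c m (sl1 (sl2 (\<omega> f s i)) t))) UNIV"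
    unfolding B13_o2[OF \<omega>_lin] by (rule hnull_\<omega>2)
  moreover have "hnull (\<lambda>n. B23 c a (B13 c (m - n) (sl1 (sl1 (\<omega> f s n)) t))) UNIV"
    by (rule hnull_linear[OF B23(1) hnull_\<omega>1])
  ultimately show ?thesis
    by (simp add: W_def hlinear_add[OF Y1(1)] hsum_linear[OF Y1(1)] Y1_X3)
qed

text \<open>The coefficient of \<open>z1^k z2^l\<close> on the right of the hexagon identity:
  \<open>a\<close> is the exponent of \<open>S_23\<close>, \<open>b\<close> that of Y, and the rest
  is taken from \<open>S_13(z1 + z2)\<close>.\<close>

definition HR :: "int \<Rightarrow> int \<Rightarrow> 'n::finite Hplus tensor3 \<Rightarrow> 'n Hplus tensor2"
  where "HR k l t = hsum (\<lambda>(a, b). plus_coeff (k - a) (l - b) *\<^sub>h W a b (k + l - a - b) t) UNIV"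

lemma HR_support:
  assumes "plus_coeff (k - a) (l - b) *\<^sub>h W a b (k + l - a - b) t \<noteq> 0"
  shows "k \<le> a \<and> a \<le> 0 \<and> k + l \<le> b \<and> b \<le> l"
proof -
  have "\<not> (a > 0 \<or> k + l - a - b > 0)" using assms W_vanish[of a "k + l - a - b"] by (metis hmod.scale_zero_right)
  moreover have "\<not> l - b < 0" using assms by (cases "l - b < 0") simp_all
  ultimately show ?thesis by linarith
qed

lemma HR_null: "hnull (\<lambda>(a, b). plus_coeff (k - a) (l - b) *\<^sub>h W a b (k + l - a - b) t) UNIV"
  by (rule hnull_finite_support, rule finite_subset[of _ "{k..0} \<times> {k + l..l}"]) (use HR_support[of k _ l _ t] in auto)

lemma HR_lin: "hlinear (HR k l)"
proof -
  have "hlinear (\<lambda>t :: 'a Hplus tensor3. case x of (a, b) \<Rightarrow> plus_coeff (k - a) (l - b) *\<^sub>h W a b (k + l - a - b) t)" for x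
    by (cases x) (simp add: hlinear_hscale[OF W_lin])
  then show ?thesis unfolding HR_def by (rule hlinear_hsum) (rule HR_null)
qed

lemma HR_vanish: "k > 0 \<Longrightarrow> HR k l t = 0"
  unfolding HR_def
  using HR_support[of k _ l _ t] by (intro hsum_zeroI) force

lemma o1_\<omega>_vanish: "j \<ge> 0 \<Longrightarrow> sl1 (sl1 (\<omega> f s j)) t = 0" "j \<ge> 0 \<Longrightarrow> sl1 (sl2 (\<omega> f s j)) t = 0"
  by (simp_all add: \<omega>_vanish o_zero)

text \<open>The induction runs over slot 3, which Y leaves alone. A generator there is contracted
  with slot 2 at \<open>z1\<close> and with slot 1 at \<open>z1 + z2\<close>; the factor
  \<open>plus_coeff i m\<close> expands the latter power.\<close>

lemma HR_x3: "HR k l (X3 f s t) = sl2 ((*) (xplus f s)) (HR k l t)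
    + (HSUM i. HR (k - i) l (sl1 (sl2 (\<omega> f s i)) t))
    + (HSUM i. (HSUM m. plus_coeff i m *\<^sub>h HR (k - i) (l - m) (sl1 (sl1 (\<omega> f s (i + m))) t)))"
proof -
  let ?q = "\<lambda>(a, b). plus_coeff (k - a) (l - b) :: complex fps"
  define P where "P = (\<lambda>(a, b) i. plus_coeff (k - a) (l - b) *\<^sub>h W (a - i) b (k + l - a - b) (sl1 (sl2 (\<omega> f s i)) t))"
  define Q where "Q = (\<lambda>(a, b) n. plus_coeff (k - a) (l - b) *\<^sub>h W a b (k + l - a - b - n) (sl1 (sl1 (\<omega> f s n)) t))"
  have Psup: "k \<le> a \<and> a \<le> 0 \<and> k + l \<le> b \<and> b \<le> l \<and> k \<le> i \<and> i \<le> 0" if "P (a, b) i \<noteq> 0" for a b i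
  proof -
    have "\<not> (a - i > 0 \<or> k + l - a - b > 0)" using that by (auto simp: P_def W_vanish)
    moreover have "\<not> l - b < 0" using that by (cases "l - b < 0") (simp_all add: P_def)
    moreover have "\<not> i \<ge> 0" using that by (cases "i \<ge> 0") (simp_all add: P_def o1_\<omega>_vanish hlinear_zero[OF W_lin])
    ultimately show ?thesis by linarith
  qed
  have Qsup: "k \<le> a \<and> a \<le> 0 \<and> k + l \<le> b \<and> b \<le> l \<and> k \<le> n \<and> n \<le> 0" if "Q (a, b) n \<noteq> 0" for a b n
  proof -
    have "\<not> (a > 0 \<or> k + l - a - b - n > 0)" using that by (auto simp: Q_def W_vanish)
    moreover have "\<not> l - b < 0" using that by (cases "l - b < 0") (simp_all add: Q_def)
    moreover have "\<not> n \<ge> 0" using that by (cases "n \<ge> 0") (simp_all add: Q_def o1_\<omega>_vanish hlinear_zero[OF W_lin])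
    ultimately show ?thesis by linarith
  qed
  have nP: "hnull (\<lambda>(x, i). P x i) UNIV"
    by (rule hnull_finite_support, rule finite_subset[of _ "({k..0} \<times> {k + l..l}) \<times> {k..0}"]) (use Psup in auto)
  have nQ: "hnull (\<lambda>(x, i). Q x i) UNIV"
    by (rule hnull_finite_support, rule finite_subset[of _ "({k..0} \<times> {k + l..l}) \<times> {k..0}"]) (use Qsup in auto)
  have nX: "hnull (\<lambda>x. sl2 ((*) (xplus f s)) (case x of (a, b) \<Rightarrow> plus_coeff (k - a) (l - b) *\<^sub>h W a b (k + l - a - b) t)) UNIV"
    by (rule hnull_linear[OF sl2(1)[OF hlinear_x] HR_null])
  have nW: "hnull (\<lambda>i. W (a - i) b m (sl1 (sl2 (\<omega> f s i)) t)) UNIV" "hnull (\<lambda>n. W a b (m - n) (sl1 (sl1 (\<omega> f s n)) t)) UNIV" for a b m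
    unfolding W_def B13_o2[OF \<omega>_lin]
    by (rule hnull_linear[OF Y1(1) hnull_\<omega>2], rule hnull_linear[OF Y1(1) hnull_linear[OF B23(1) hnull_\<omega>1]])
  have step: "(case x of (a, b) \<Rightarrow> plus_coeff (k - a) (l - b) *\<^sub>h W a b (k + l - a - b) (X3 f s t)) =
      sl2 ((*) (xplus f s)) (case x of (a, b) \<Rightarrow> plus_coeff (k - a) (l - b) *\<^sub>h W a b (k + l - a - b) t)
      + hsum (P x) UNIV + hsum (Q x) UNIV" for x
    by (cases x) (simp add: W_x3 hscale_right_distrib P_def Q_def hsum_scale[OF nW(1)] hsum_scale[OF nW(2)]
        hlinear_scale[OF sl2(1)[OF hlinear_x]])
  have "HR k l (X3 f s t) = (HSUM x. sl2 ((*) (xplus f s)) (case x of (a, b) \<Rightarrow> plus_coeff (k - a) (l - b) *\<^sub>h W a b (k + l - a - b) t)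
      + hsum (P x) UNIV + hsum (Q x) UNIV)"
    unfolding HR_def by (rule hsum_cong[OF refl step])
  then have "HR k l (X3 f s t) = sl2 ((*) (xplus f s)) (HR k l t) + (HSUM x. hsum (P x) UNIV) + (HSUM x. hsum (Q x) UNIV)"
    unfolding hsum_add[OF hnull_add[OF nX hnull_hsum_pair(1)[OF nP]] hnull_hsum_pair(1)[OF nQ]]
      hsum_add[OF nX hnull_hsum_pair(1)[OF nP]] HR_def[of k l t] hsum_linear[OF sl2(1)[OF hlinear_x] HR_null] .
  moreover have "(HSUM x. hsum (P x) UNIV) = (HSUM i. HR (k - i) l (sl1 (sl2 (\<omega> f s i)) t))"
  proof -
    have "(HSUM x. P x i) = HR (k - i) l (sl1 (sl2 (\<omega> f s i)) t)" for i
      using hsum_shift[of "\<lambda>x. P x i" "(i, 0)"] unfolding HR_def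
      by (simp add: P_def split_def algebra_simps)
    then show ?thesis by (simp add: hsum_swap_UNIV[OF nP])
  qed
  moreover have "(HSUM x. hsum (Q x) UNIV) =
      (HSUM i. (HSUM m. plus_coeff i m *\<^sub>h HR (k - i) (l - m) (sl1 (sl1 (\<omega> f s (i + m))) t)))"
  proof -
    define g where "g i m = plus_coeff i m *\<^sub>h HR (k - i) (l - m) (sl1 (sl1 (\<omega> f s (i + m))) t)" for i m
    have gsup: "k \<le> i \<and> i \<le> 0 \<and> 0 \<le> m \<and> m \<le> - k" if "g i m \<noteq> 0" for i m
    proof -
      have "\<not> m < 0" using that by (cases "m < 0") (simp_all add: g_def)
      moreover have "\<not> k - i > 0" using that by (cases "k - i > 0") (simp_all add: g_def HR_vanish)
      moreover have "\<not> i + m \<ge> 0" using that by (cases "i + m \<ge> 0") (simp_all add: g_def o1_\<omega>_vanish hlinear_zero[OF HR_lin])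
      ultimately show ?thesis by linarith
    qed
    have ng: "hnull (\<lambda>(i, m). g i m) UNIV"
      by (rule hnull_finite_support, rule finite_subset[of _ "{k..0} \<times> {0..- k}"]) (use gsup in auto)
    have ng': "hnull (\<lambda>(m, n). g (n - m) m) UNIV"
    proof (rule hnull_finite_support, rule finite_subset[of _ "{0..- k} \<times> {k..- k}"])
      show "{x \<in> UNIV. (case x of (m, n) \<Rightarrow> g (n - m) m) \<noteq> 0} \<subseteq> {0..- k} \<times> {k..- k}"
      proof clarsimp
        fix m n assume "g (n - m) m \<noteq> 0"
        from gsup[OF this] show "0 \<le> m \<and> m \<le> - k \<and> k \<le> n \<and> n \<le> - k" by linarith
      qed
    qed simp
    have "(HSUM m. g (n - m) m) = (HSUM x. Q x n)" for n
    proof -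
      define h where "h m = (\<lambda>(a, b). (plus_coeff (n - m) m * plus_coeff (k - n + m - a) (l - m - b)) *\<^sub>h
          W a b (k + l - n - a - b) (sl1 (sl1 (\<omega> f s n)) t))" for m
      have g: "g (n - m) m = hsum (h m) UNIV" for m
      proof -
        have e: "k - (n - m) = k - n + m" "n - m + m = n" "k - n + m + (l - m) = k + l - n" by simp_all
        note n = HR_null[of "k - n + m" "l - m", unfolded e(3)]
        show ?thesis
          unfolding g_def e HR_def hsum_scale[OF n] h_def
          by (rule hsum_cong[OF refl]) (auto simp: hscale_hscale e)
      qed
      have hsup: "0 \<le> m \<and> m \<le> n - k \<and> k - n \<le> a \<and> a \<le> 0 \<and> k + l - n \<le> b \<and> b \<le> l" if "h m (a, b) \<noteq> 0" for m a b
      proof -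
        have "\<not> (a > 0 \<or> k + l - n - a - b > 0)" using that by (auto simp: h_def W_vanish)
        moreover have "\<not> l - m - b < 0" using that by (cases "l - m - b < 0") (simp_all add: h_def)
        moreover have "\<not> m < 0" using that by (cases "m < 0") (simp_all add: h_def)
        ultimately show ?thesis by linarith
      qed
      have nh: "hnull (\<lambda>(m, x). h m x) UNIV"
        by (rule hnull_finite_support, rule finite_subset[of _ "{0..n - k} \<times> {k - n..0} \<times> {k + l - n..l}"]) (use hsup in auto)
      \<comment> \<open>The power of \<open>z1 + z2\<close> coming from the contraction is merged
        with the one inside \<open>S_13\<close> by the Vandermonde identity.\<close>
      have "(HSUM m. h m x) = Q x n" for x
      proof -
        obtain a b where x: "x = (a, b)" by (cases x)
        show ?thesis
          using plus_coeff_Vandermonde[of n "k - n - a + (l - b)" "l - b" "W a b (k + l - n - a - b) (sl1 (sl1 (\<omega> f s n)) t)"]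
          by (simp add: x h_def Q_def algebra_simps)
      qed
      then show ?thesis unfolding g by (simp add: hsum_swap_UNIV[OF nh])
    qed
    then have "(HSUM x. hsum (Q x) UNIV) = (HSUM n. (HSUM m. g (n - m) m))"
      by (simp add: hsum_swap_UNIV[OF nQ])
    also have "\<dots> = (HSUM m. (HSUM n. g (n - m) m))"
      by (rule hsum_swap_UNIV[OF ng', symmetric])
    also have "\<dots> = (HSUM m. (HSUM i. g i m))"
    proof (rule hsum_cong[OF refl])
      fix m
      show "(HSUM n. g (n - m) m) = (HSUM i. g i m)"
        using hsum_shift[of "\<lambda>i. g i m" "- m"] by simp
    qed
    also have "\<dots> = (HSUM i. hsum (g i) UNIV)"
      by (rule hsum_swap_UNIV[OF ng, symmetric])
    finally show ?thesis unfolding g_def .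
  qed
  ultimately show ?thesis by simp
qed

text \<open>Both sides expand \<open>T(z1 + z2 + u - v)\<close>, once with \<open>z2 + u\<close> and
  once with \<open>z1 + z2\<close> bracketed.\<close>

lemma ker_T_shift: "plus_coeff m r * ker (Tser c) e (m + r) i f s = plus_coeff i m * ker (Tser c) e r (i + m) f s"
proof -
  have "plus_coeff i (m + r) * plus_coeff m r = plus_coeff (i + m) r * plus_coeff i m"
    by (rule plus_coeff_multinomial)
  then show ?thesis by (simp add: ker_def add.assoc mult_ac)
qed

text \<open>The contraction is a derivation of the product \<open>Y(x,z2)y\<close>; by
  \<open>Y_derv\<close> it acts on \<open>y\<close> directly and on \<open>x\<close> with its
  argument translated by \<open>z2\<close>. These are exactly the two terms of
  \<open>HR_x3\<close>.\<close>

lemma HL_x3: "Bm c k (Yv c x l y \<otimes> (xplus f s * z)) = sl2 ((*) (xplus f s)) (Bm c k (Yv c x l y \<otimes> z))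
    + (HSUM i. Bm c (k - i) (Yv c x l (\<omega> f s i y) \<otimes> z))
    + (HSUM i. (HSUM m. plus_coeff i m *\<^sub>h Bm c (k - i) (Yv c (\<omega> f s (i + m) x) (l - m) y \<otimes> z)))"
proof -
  define g where "g i m = plus_coeff i m *\<^sub>h Sv c (Yv c (\<omega> f s (i + m) x) (l - m) y) (k - i) z" for i m
  have gsup: "k \<le> i \<and> i \<le> 0 \<and> 0 \<le> m \<and> m \<le> - k" if "g i m \<noteq> 0" for i m
  proof -
    have "\<not> m < 0" using that by (cases "m < 0") (simp_all add: g_def)
    moreover have "\<not> k - i > 0" using that by (cases "k - i > 0") (simp_all add: g_def S_positive)
    moreover have "\<not> i + m \<ge> 0"
      using that by (cases "i + m \<ge> 0") (simp_all add: g_def \<omega>_vanish hlinear_zero[OF Y_lin1] hlinear_zero[OF S_lin1])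
    ultimately show ?thesis by linarith
  qed
  have ng: "hnull (\<lambda>(i, m). g i m) UNIV"
    by (rule hnull_finite_support, rule finite_subset[of _ "{k..0} \<times> {0..- k}"]) (use gsup in auto)
  have n1: "hnull (\<lambda>i. Sv c (Yv c x l (\<omega> f s i y)) (k - i) z) UNIV"
  proof (rule hnull_\<omega>[where G = "\<lambda>m y. Sv c (Yv c x l y) m z" and D = "\<lambda>i. \<omega> f s i"])
    show "\<omega> f s j = (\<lambda>_. 0) \<or> j \<le> 0" for j by (cases "j \<ge> 0") (simp_all add: \<omega>_vanish)
  qed (simp_all add: S_positive hlinear_zero[OF Y_lin2] hlinear_zero[OF S_lin1])
  have "Sv c (\<omega> f s i (Yv c x l y)) (k - i) z = Sv c (Yv c x l (\<omega> f s i y)) (k - i) z + hsum (g i) UNIV" for i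
  proof -
    have d: "derv (\<lambda>e r. plus_coeff m r * ker (Tser c) e (m + r) i f s) x = plus_coeff i m *\<^sub>h \<omega> f s (i + m) x" for m
      unfolding ker_T_shift by (rule derv_scale[OF \<omega>_tf])
    have eq: "\<omega> f s i (Yv c x l y) = Yv c x l (\<omega> f s i y) +
        (HSUM m. plus_coeff i m *\<^sub>h Yv c (\<omega> f s (i + m) x) (l - m) y)"
      using Y_derv(1)[where c = c and p = x and k = l and q = y, OF \<omega>_tf[where j = i and f = f and s = s]] unfolding d by (simp add: hlinear_scale[OF Y_lin1])
    have n: "hnull (\<lambda>m. plus_coeff i m *\<^sub>h Yv c (\<omega> f s (i + m) x) (l - m) y) UNIV"
      using Y_derv(2)[where c = c and p = x and k = l and q = y, OF \<omega>_tf[where j = i and f = f and s = s]] unfolding d by (simp add: hlinear_scale[OF Y_lin1])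
    show ?thesis
      unfolding eq hlinear_add[OF S_lin1] hsum_linear[OF S_lin1 n] g_def by (simp add: hlinear_scale[OF S_lin1])
  qed
  then have "Sv c (Yv c x l y) k (xplus f s * z) = sl2 ((*) (xplus f s)) (Sv c (Yv c x l y) k z)
      + ((HSUM i. Sv c (Yv c x l (\<omega> f s i y)) (k - i) z) + (HSUM i. hsum (g i) UNIV))"
    unfolding S_x2 by (simp add: hsum_add[OF n1 hnull_hsum_pair(1)[OF ng]])
  then show ?thesis unfolding g_def by (simp add: Bm add.assoc)
qed

lemma HR_one: "HR k l (x \<otimes> y \<otimes> 1) = (if k = 0 then Yv c x l y \<otimes> 1 else 0)"
proof -
  have W: "W a b m (x \<otimes> y \<otimes> 1) = (if a = 0 \<and> m = 0 then Yv c x b y \<otimes> 1 else 0)" for a b m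
    by (simp add: W_def B13 Bm S_right_one ins hlinear_zero[OF ins(1)] hlinear_zero[OF B23(1)] hlinear_zero[OF Y1(1)]
        B23 pre hlinear_zero[OF pre(1)] Y1 Ym)
  have "HR k l (x \<otimes> y \<otimes> 1) = (case (0, k + l) of (a, b) \<Rightarrow> plus_coeff (k - a) (l - b) *\<^sub>h W a b (k + l - a - b) (x \<otimes> y \<otimes> 1))"
    unfolding HR_def by (rule hsum_single) (auto simp: W split: if_splits)
  also have "\<dots> = (if k = 0 then Yv c x l y \<otimes> 1 else 0)"
  proof (cases "k = 0")
    case False
    have "plus_coeff k (- k) = 0"
      using False plus_coeff_vanish[of k "- k"] by (cases "k > 0") simp_all
    then show ?thesis using False by simp
  qed (simp add: W hscale_one)
  finally show ?thesis .
qed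

text \<open>Both sides obey the same recursion in the third slot. The vectors \<open>x\<close> and
  \<open>y\<close> and both exponents vary in the induction, since contractions act on
  \<open>x\<close> and \<open>y\<close>.\<close>

lemma HL_eq_HR: "Bm c k (Y1 l t) = HR k l t"
proof (rule tensor3_eqI[OF hlinear_compose[OF Bm(1) Y1(1)] HR_lin])
  fix x y z :: "'a Hplus"
  have "Bm c k (Yv c x l y \<otimes> z) = HR k l (x \<otimes> y \<otimes> z)"
  proof (rule Hplus_eqI[where i = "(k, l, x, y)" and F = "\<lambda>(k, l, x, y) z. Bm c k (Yv c x l y \<otimes> z)"
        and G = "\<lambda>(k, l, x, y) z. HR k l (x \<otimes> y \<otimes> z)", simplified])
    fix i :: "int \<times> int \<times> 'a Hplus \<times> 'a Hplus" and e :: "'a \<times> 'a" and r :: int and u :: "'a Hplus"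
    obtain k l x y where i: "i = (k, l, x, y)" by (cases i)
    show "hlinear (case i of (k, l, x, y) \<Rightarrow> \<lambda>z. Bm c k (Yv c x l y \<otimes> z))"
      by (simp add: i hlinear_compose[OF Bm(1) hlinear_tensor2[OF hlinear_id]])
    show "hlinear (case i of (k, l, x, y) \<Rightarrow> \<lambda>z. HR k l (x \<otimes> y \<otimes> z))"
      by (simp add: i hlinear_compose[OF HR_lin hlinear_tensor2[OF hlinear_id]])
    show "(case i of (k, l, x, y) \<Rightarrow> \<lambda>z. Bm c k (Yv c x l y \<otimes> z)) 1 = (case i of (k, l, x, y) \<Rightarrow> \<lambda>z. HR k l (x \<otimes> y \<otimes> z)) 1"
      by (simp add: i HR_one Bm S_right_one)
    assume IH': "\<And>i. (case i of (k, l, x, y) \<Rightarrow> \<lambda>z. Bm c k (Yv c x l y \<otimes> z)) u = (case i of (k, l, x, y) \<Rightarrow> \<lambda>z. HR k l (x \<otimes> y \<otimes> z)) u"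
    have IH: "Bm c k (Yv c x l y \<otimes> u) = HR k l (x \<otimes> y \<otimes> u)" for k l x y using IH'[of "(k, l, x, y)"] by simp
    have "HR k l (x \<otimes> y \<otimes> (xplus e r * u)) = HR k l (X3 e r (x \<otimes> y \<otimes> u))" by (simp add: sl2 hlinear_x)
    then have "Bm c k (Yv c x l y \<otimes> (xplus e r * u)) = HR k l (x \<otimes> y \<otimes> (xplus e r * u))"
      by (simp add: HR_x3 HL_x3 IH sl1 sl2 \<omega>_lin)
    then show "(case i of (k, l, x, y) \<Rightarrow> \<lambda>z. Bm c k (Yv c x l y \<otimes> z)) (xplus e r * u) = (case i of (k, l, x, y) \<Rightarrow> \<lambda>z. HR k l (x \<otimes> y \<otimes> z)) (xplus e r * u)"
      by (simp add: i)
  qed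
  then show "Bm c k (Y1 l (x \<otimes> y \<otimes> z)) = HR k l (x \<otimes> y \<otimes> z)" by (simp add: Y1 Ym)
qed

lemma hexagon_Bm: "hexagon (Ym c) (Bm c :: int \<Rightarrow> 'n::finite Hplus tensor2 \<Rightarrow> _)"
  unfolding hexagon_def Let_def Y1_def[symmetric, abs_def]
proof (intro ext, clarify)
  fix k l and t :: "'n Hplus tensor3"
  have 1: "(at_fst (Bm c) \<odot> at_snd Y1) (k, l) t = Bm c k (Y1 l t)"
    unfolding comp_at_fst by (subst hsum_single[of k]) (auto simp: at_snd_def hlinear_zero[OF Bm(1)])
  define w where "w = (\<lambda>(a, b). plus_coeff (k - a) (l - b) *\<^sub>h W a b (k + l - a - b) t)"
  have nw: "hnull (\<lambda>(a, b). w (a, b)) UNIV" using HR_null[of k l t] by (simp add: w_def)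
  have e: "k - a + (l - b) = k + l - a - b" for a b by simp
  have 2: "(at_snd Y1 \<odot> at_fst (B23 c) \<odot> at_plus (B13 c)) (k, l) t = (HSUM b. (HSUM a. w (a, b)))"
    unfolding comp_at_snd
  proof (rule hsum_cong[OF refl])
    fix b
    have n: "hnull (\<lambda>a. B23 c a (plus_coeff (k - a) (l - b) *\<^sub>h B13 c (k + l - a - b) t)) UNIV"
    proof (rule hnull_finite_support, rule finite_subset[of _ "{k + l - b..0}"])
      show "{a \<in> UNIV. B23 c a (plus_coeff (k - a) (l - b) *\<^sub>h B13 c (k + l - a - b) t) \<noteq> 0} \<subseteq> {k + l - b..0}"
      proof clarsimp
        fix a assume a: "B23 c a (plus_coeff (k - a) (l - b) *\<^sub>h B13 c (k + l - a - b) t) \<noteq> 0"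
        have "\<not> a > 0" using a by (cases "a > 0") (simp_all add: B_positive)
        moreover have "\<not> k + l - a - b > 0" using a by (cases "k + l - a - b > 0") (simp_all add: B_positive hlinear_zero[OF B23(1)])
        ultimately show "k + l - b \<le> a \<and> a \<le> 0" by linarith
      qed
    qed simp
    have 3: "(at_fst (B23 c) \<odot> at_plus (B13 c)) (k, l - b) t = (HSUM a. B23 c a (plus_coeff (k - a) (l - b) *\<^sub>h B13 c (k + l - a - b) t))"
      unfolding comp_at_fst by (simp add: at_plus_def e)
    have n: "hnull (\<lambda>a. plus_coeff (k - a) (l - b) *\<^sub>h B23 c a (B13 c (k + l - a - b) t)) UNIV"
      using n by (simp add: hlinear_scale[OF B23(1)])
    from 3 show "Y1 b ((at_fst (B23 c) \<odot> at_plus (B13 c)) (k, l - b) t) = (HSUM a. w (a, b))"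
      by (simp add: hsum_linear[OF Y1(1) n] w_def W_def hlinear_scale[OF B23(1)] hlinear_scale[OF Y1(1)])
  qed
  have "(HSUM b. (HSUM a. w (a, b))) = (HSUM a. (HSUM b. w (a, b)))"
    by (rule hsum_swap_UNIV[OF nw, symmetric])
  also have "\<dots> = hsum (\<lambda>(a, b). w (a, b)) UNIV"
    using hsum_Sigma(1)[of "\<lambda>a b. w (a, b)" UNIV "\<lambda>_. UNIV"] nw by simp
  also have "\<dots> = HR k l t" unfolding HR_def w_def by (rule hsum_cong) auto
  finally show "(at_fst (Bm c) \<odot> at_snd Y1) (k, l) t = (at_snd Y1 \<odot> at_fst (B23 c) \<odot> at_plus (B13 c)) (k, l) t"
    unfolding 1 2 HL_eq_HR by simp
qed

end

section \<open>Series in two variables\<close>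

text \<open>Adapted to iterated products of fields: modulo \<open>hpow n\<close> the exponent of the
  field applied first is bounded below independently of the other exponent, whereas the latter has
  no such uniform bound.\<close>

definition low :: "('p \<Rightarrow> int \<Rightarrow> int \<Rightarrow> 'a::hmodule) \<Rightarrow> bool"
  where "low F \<longleftrightarrow> (\<forall>n. \<exists>K. \<forall>p k l. l < K \<longrightarrow> F p k l \<in> hpow n)"

lemma lowD: "low F \<Longrightarrow> \<exists>K. \<forall>p k l. l < K \<longrightarrow> F p k l \<in> hpow n"
  unfolding low_def by blast

lemma low_at: "low F \<Longrightarrow> low (\<lambda>_ :: 'q. F p)"
  unfolding low_def by meson

lemma low_mono:
  assumes "low F" "\<And>p k l n. (\<And>p k. F p k l \<in> hpow n) \<Longrightarrow> G p k l \<in> hpow n"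
  shows "low G"
  unfolding low_def
proof
  fix n
  obtain K where "\<forall>p k l. l < K \<longrightarrow> F p k l \<in> hpow n" using lowD[OF assms(1)] by blast
  then show "\<exists>K. \<forall>p k l. l < K \<longrightarrow> G p k l \<in> hpow n" using assms(2) by blast
qed

lemma low_null:
  assumes F: "\<And>p. low (\<lambda>_ :: unit. F p)" and fin: "\<And>n. finite {p. \<exists>k l. F p k l \<notin> hpow n}"
  shows "low F"
  unfolding low_def
proof
  fix n
  have "\<forall>p. \<exists>K. \<forall>k l. l < K \<longrightarrow> F p k l \<in> hpow n" using lowD[OF F] by blast
  then obtain K where K: "\<And>p k l. l < K p \<Longrightarrow> F p k l \<in> hpow n" by metis
  obtain M where M: "\<forall>p\<in>{p. \<exists>k l. F p k l \<notin> hpow n}. M \<le> K p" using finite_lower_bound[OF fin] by blast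
  have "F p k l \<in> hpow n" if "l < M" for p k l
  proof (rule ccontr)
    assume F: "F p k l \<notin> hpow n"
    then have "M \<le> K p" using M by blast
    then show False using F K[of l p k] that by linarith
  qed
  then show "\<exists>K. \<forall>p k l. l < K \<longrightarrow> F p k l \<in> hpow n" by blast
qed

text \<open>Multiplication by a series of total degree 0 with coefficient \<open>\<gamma> i\<close> at \<open>x\<^sup>-\<^sup>i y\<^sup>i\<close>.\<close>

definition diag :: "(int \<Rightarrow> complex fps) \<Rightarrow> (int \<Rightarrow> int \<Rightarrow> 'a) \<Rightarrow> int \<Rightarrow> int \<Rightarrow> 'a::hmodule"
  where "diag \<gamma> F k l = (HSUM i. \<gamma> i *\<^sub>h F (k + i) (l - i))"

lemma diag_support:
  assumes "low F" "\<And>i. i < 0 \<Longrightarrow> \<gamma> i = 0"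
  shows "\<exists>K. \<forall>p k l i. \<gamma> i *\<^sub>h F p (k + i) (l - i) \<notin> hpow n \<longrightarrow> 0 \<le> i \<and> i \<le> l - K"
proof -
  obtain K where K: "\<And>p k l. l < K \<Longrightarrow> F p k l \<in> hpow n" using lowD[OF assms(1)] by blast
  have "0 \<le> i \<and> i \<le> l - K" if "\<gamma> i *\<^sub>h F p (k + i) (l - i) \<notin> hpow n" for p k l i
  proof -
    have "\<not> i < 0" using that assms(2)[of i] by (auto simp: hpow_zero)
    moreover have "\<not> l - i < K" using that K hpow_scale by blast
    ultimately show ?thesis by simp
  qed
  then show ?thesis by blast
qed

lemma diag_null:
  assumes "low (\<lambda>_ :: unit. F)" "\<And>i. i < 0 \<Longrightarrow> \<gamma> i = 0"
  shows "hnull (\<lambda>i. \<gamma> i *\<^sub>h F (k + i) (l - i)) UNIV"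
  unfolding hnull_def
proof
  fix n
  obtain K where K: "\<And>k l i. \<gamma> i *\<^sub>h F (k + i) (l - i) \<notin> hpow n \<Longrightarrow> 0 \<le> i \<and> i \<le> l - K"
    using diag_support[where F = "\<lambda>_ :: unit. F" and \<gamma> = \<gamma> and n = n, OF assms] by blast
  show "finite {i \<in> UNIV. \<gamma> i *\<^sub>h F (k + i) (l - i) \<notin> hpow n}"
    by (rule finite_subset[of _ "{0..l - K}"]) (use K in auto)
qed

lemma diag_hpow:
  assumes "low (\<lambda>_ :: unit. F)" "\<And>i. i < 0 \<Longrightarrow> \<gamma> i = 0" "\<And>i. i \<ge> 0 \<Longrightarrow> F (k + i) (l - i) \<in> hpow n"
  shows "diag \<gamma> F k l \<in> (hpow n :: 'a::hcomplete set)"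
  unfolding diag_def
proof (rule hsum_hpow[OF diag_null[OF assms(1,2)]])
  fix i
  show "\<gamma> i *\<^sub>h F (k + i) (l - i) \<in> hpow n"
    using assms(2)[of i] assms(3)[of i] by (cases "i < 0") (auto simp: hpow_zero hpow_scale)
qed

lemma diag_low:
  assumes "low F" "\<And>p k i. i < 0 \<Longrightarrow> \<gamma> p k i = 0"
  shows "low (\<lambda>p k l. diag (\<gamma> p k) (F p) (h p k) l :: 'a::hcomplete)"
  unfolding low_def
proof
  fix n
  obtain K where K: "\<And>p k l. l < K \<Longrightarrow> F p k l \<in> hpow n" using lowD[OF assms(1)] by blast
  have "diag (\<gamma> p k) (F p) (h p k) l \<in> hpow n" if "l < K" for p k l
    by (rule diag_hpow[OF low_at[OF assms(1)] assms(2)]) (use that K in auto)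
  then show "\<exists>K. \<forall>p k l. l < K \<longrightarrow> diag (\<gamma> p k) (F p) (h p k) l \<in> hpow n" by blast
qed

lemma low_hsum:
  assumes "low F" "\<And>k l. hnull (\<lambda>p. F p k l) UNIV"
  shows "low (\<lambda>_ :: unit. \<lambda>k l. (HSUM p. F p k l) :: 'a::hcomplete)"
  by (rule low_mono[OF assms(1)]) (rule hsum_hpow[OF assms(2)])

lemma low_add: "low F \<Longrightarrow> low G \<Longrightarrow> low (\<lambda>p k l. F p k l + G p k l)"
  unfolding low_def
proof
  fix n
  assume "\<forall>n. \<exists>K. \<forall>p k l. l < K \<longrightarrow> F p k l \<in> hpow n" "\<forall>n. \<exists>K. \<forall>p k l. l < K \<longrightarrow> G p k l \<in> hpow n"
  then obtain K K' where "\<forall>p k l. l < K \<longrightarrow> F p k l \<in> hpow n" "\<forall>p k l. l < K' \<longrightarrow> G p k l \<in> hpow n" by blast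
  then show "\<exists>K. \<forall>p k l. l < K \<longrightarrow> F p k l + G p k l \<in> hpow n"
    by (intro exI[of _ "min K K'"]) (simp add: hpow_add)
qed

lemma diag_add:
  assumes "low (\<lambda>_ :: unit. F)" "low (\<lambda>_ :: unit. G)" "\<And>i. i < 0 \<Longrightarrow> \<gamma> i = 0"
  shows "diag \<gamma> (\<lambda>k l. F k l + G k l) k l = diag \<gamma> F k l + (diag \<gamma> G k l :: 'a::hcomplete)"
  unfolding diag_def hscale_right_distrib
  by (rule hsum_add) (rule diag_null[OF assms(1,3)], assumption, rule diag_null[OF assms(2,3)])

lemma diag_linear:
  assumes "hlinear (f :: 'a::hcomplete \<Rightarrow> 'b::hcomplete)" "low (\<lambda>_ :: unit. F)" "\<And>i. i < 0 \<Longrightarrow> \<gamma> i = 0"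
  shows "diag \<gamma> (\<lambda>k l. f (F k l)) k l = f (diag \<gamma> F k l)"
  unfolding diag_def
  by (subst hsum_linear[OF assms(1) diag_null[where F = F and \<gamma> = \<gamma>, OF assms(2,3)]])
    (simp_all add: hlinear_scale[OF assms(1)])

lemma diag_hsum:
  fixes F :: "'p \<Rightarrow> int \<Rightarrow> int \<Rightarrow> 'a::hcomplete"
  assumes F: "low F" "\<And>k l. hnull (\<lambda>p. F p k l) UNIV" and \<gamma>: "\<And>i. i < 0 \<Longrightarrow> \<gamma> i = 0"
  shows "diag \<gamma> (\<lambda>k l. (HSUM p. F p k l)) k l = (HSUM p. diag \<gamma> (F p) k l)"
    and "hnull (\<lambda>p. diag \<gamma> (F p) k l) UNIV"
    and "hnull (\<lambda>(i, p). \<gamma> i *\<^sub>h F p (k + i) (l - i)) UNIV"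
proof -
  have fin: "finite {i \<in> UNIV. \<exists>p\<in>UNIV. \<gamma> i *\<^sub>h F p (k + i) (l - i) \<notin> hpow n}" for n
  proof -
    obtain K where K: "\<And>p k l i. \<gamma> i *\<^sub>h F p (k + i) (l - i) \<notin> hpow n \<Longrightarrow> 0 \<le> i \<and> i \<le> l - K"
      using diag_support[where \<gamma> = \<gamma> and n = n, OF F(1) \<gamma>] by blast
    show ?thesis by (rule finite_subset[of _ "{0..l - K}"]) (use K in auto)
  qed
  have n: "hnull (\<lambda>(i, p). \<gamma> i *\<^sub>h F p (k + i) (l - i)) (Sigma UNIV (\<lambda>_. UNIV))"
    by (rule hnull_Sigma[OF fin]) (rule hnull_scale[OF F(2)])
  then show n: "hnull (\<lambda>(i, p). \<gamma> i *\<^sub>h F p (k + i) (l - i)) UNIV" by simp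
  show "diag \<gamma> (\<lambda>k l. (HSUM p. F p k l)) k l = (HSUM p. diag \<gamma> (F p) k l)"
    unfolding diag_def hsum_scale[OF F(2)] by (rule hsum_swap_UNIV[OF n])
  show "hnull (\<lambda>p. diag \<gamma> (F p) k l) UNIV"
    unfolding diag_def using n unfolding hnull_pair_swap[of "\<lambda>i p. \<gamma> i *\<^sub>h F p (k + i) (l - i)"]
    by (rule hnull_hsum_pair(1))
qed

text \<open>Regrouping by the total shift \<open>m = i + j\<close> convolves the two multipliers.
  The inner one may depend on the first exponent, which covers substitutions such as
  \<open>x = z0 + z2\<close>.\<close>

lemma diag_diag:
  fixes F :: "int \<Rightarrow> int \<Rightarrow> 'a::hcomplete"
  assumes F: "low (\<lambda>_ :: unit. F)" and \<gamma>: "\<And>i. i < 0 \<Longrightarrow> \<gamma> i = 0" and \<delta>: "\<And>a i. i < 0 \<Longrightarrow> \<delta> a i = 0"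
    and \<zeta>: "\<And>m (x :: 'a). (HSUM j. (\<delta> (k + (m - j)) j * \<gamma> (m - j)) *\<^sub>h x) = \<zeta> m *\<^sub>h x"
  shows "diag \<gamma> (\<lambda>k l. diag (\<delta> k) F k l) k l = diag \<zeta> F k l"
proof -
  define f where "f i j = (\<delta> (k + i) j * \<gamma> i) *\<^sub>h F (k + i + j) (l - i - j)" for i j
  have sup: "\<exists>K. \<forall>i j. f i j \<notin> hpow n \<longrightarrow> 0 \<le> i \<and> 0 \<le> j \<and> i + j \<le> l - K" for n
  proof -
    obtain K where K: "\<And>p k l. l < K \<Longrightarrow> F k l \<in> hpow n" using lowD[OF F] by blast
    have "0 \<le> i \<and> 0 \<le> j \<and> i + j \<le> l - K" if "f i j \<notin> hpow n" for i j
    proof -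
      have "\<not> i < 0" "\<not> j < 0" using that \<gamma>[of i] \<delta>[of j "k + i"] by (auto simp: hpow_zero f_def)
      moreover have "\<not> l - i - j < K" using that K hpow_scale unfolding f_def by blast
      ultimately show ?thesis by simp
    qed
    then show ?thesis by blast
  qed
  have n1: "hnull (\<lambda>(i, j). f i j) UNIV"
    unfolding hnull_def
  proof
    fix n
    obtain K where K: "\<And>i j. f i j \<notin> hpow n \<Longrightarrow> 0 \<le> i \<and> 0 \<le> j \<and> i + j \<le> l - K" using sup[of n] by blast
    show "finite {x \<in> UNIV. (case x of (i, j) \<Rightarrow> f i j) \<notin> hpow n}"
    proof (rule finite_subset[of _ "{0..l - K} \<times> {0..l - K}"])
      show "{x \<in> UNIV. (case x of (i, j) \<Rightarrow> f i j) \<notin> hpow n} \<subseteq> {0..l - K} \<times> {0..l - K}"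
        by (clarsimp, drule K) linarith
    qed simp
  qed
  have n2: "hnull (\<lambda>(j, m). f (m - j) j) UNIV"
    unfolding hnull_def
  proof
    fix n
    obtain K where K: "\<And>i j. f i j \<notin> hpow n \<Longrightarrow> 0 \<le> i \<and> 0 \<le> j \<and> i + j \<le> l - K" using sup[of n] by blast
    show "finite {x \<in> UNIV. (case x of (j, m) \<Rightarrow> f (m - j) j) \<notin> hpow n}"
    proof (rule finite_subset[of _ "{0..l - K} \<times> {0..l - K}"])
      show "{x \<in> UNIV. (case x of (j, m) \<Rightarrow> f (m - j) j) \<notin> hpow n} \<subseteq> {0..l - K} \<times> {0..l - K}"
        by (clarsimp, drule K) linarith
    qed simp
  qed
  have "diag \<gamma> (\<lambda>k l. diag (\<delta> k) F k l) k l = (HSUM i. hsum (f i) UNIV)"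
    unfolding diag_def f_def
    by (subst hsum_scale[OF diag_null[where F = F and \<gamma> = "\<delta> a" for a, OF F \<delta>]]) (simp_all add: mult.commute)
  also have "\<dots> = (HSUM j. (HSUM i. f i j))" by (rule hsum_swap_UNIV[OF n1])
  also have "\<dots> = (HSUM j. (HSUM m. f (m - j) j))"
  proof (rule hsum_cong[OF refl])
    fix j
    show "(HSUM i. f i j) = (HSUM m. f (m - j) j)"
      using hsum_shift[of "\<lambda>i. f i j" "- j"] by simp
  qed
  also have "\<dots> = (HSUM m. (HSUM j. f (m - j) j))" by (rule hsum_swap_UNIV[OF n2])
  also have "\<dots> = (HSUM m. (HSUM j. (\<delta> (k + (m - j)) j * \<gamma> (m - j)) *\<^sub>h F (k + m) (l - m)))"
    unfolding f_def by simp
  finally show ?thesis unfolding \<zeta> diag_def .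
qed

text \<open>For \<open>\<gamma>\<close> equal to \<^const>\<open>plus_coeff\<close> or \<^const>\<open>minus_coeff\<close> this is multiplication by the
  expansion of \<open>(x \<plusminus> y)\<^sup>q\<close>.\<close>

definition bin :: "(int \<Rightarrow> int \<Rightarrow> complex fps) \<Rightarrow> int \<Rightarrow> (int \<Rightarrow> int \<Rightarrow> 'a) \<Rightarrow> int \<Rightarrow> int \<Rightarrow> 'a::hmodule"
  where "bin \<gamma> q F k l = diag (\<lambda>i. \<gamma> (q - i) i) F (k - q) l"

text \<open>The law of exponents for \<open>(x \<plusminus> y)^q\<close>, stated so that both signs
  are handled at once.\<close>

definition binomial_kernel :: "'a::hmodule itself \<Rightarrow> (int \<Rightarrow> int \<Rightarrow> complex fps) \<Rightarrow> bool"
  where "binomial_kernel _ \<gamma> \<longleftrightarrow> (\<forall>a i. i < 0 \<longrightarrow> \<gamma> a i = 0) \<and>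
    (\<forall>q r m (x :: 'a). (HSUM j. (\<gamma> (q - j) j * \<gamma> (r - (m - j)) (m - j)) *\<^sub>h x) = \<gamma> (q + r - m) m *\<^sub>h x)"

lemma binomial_kernel_plus: "binomial_kernel TYPE('a::hcomplete) plus_coeff"
  and binomial_kernel_minus: "binomial_kernel TYPE('a::hcomplete) minus_coeff"
  unfolding binomial_kernel_def by (simp_all only: plus_coeff_Vandermonde minus_coeff_Vandermonde) simp_all

lemma bin_bin:
  fixes F :: "int \<Rightarrow> int \<Rightarrow> 'a::hcomplete"
  assumes "binomial_kernel TYPE('a) \<gamma>" "low (\<lambda>_ :: unit. F)"
  shows "bin \<gamma> q (bin \<gamma> r F) k l = bin \<gamma> (q + r) F k l"
proof -
  have z: "i < 0 \<Longrightarrow> \<gamma> a i = 0" for a i using assms(1) unfolding binomial_kernel_def by blast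
  have V: "(HSUM j. (\<gamma> (r - j) j * \<gamma> (q - (m - j)) (m - j)) *\<^sub>h x) = \<gamma> (r + q - m) m *\<^sub>h x" for m and x :: 'a
    using assms(1) unfolding binomial_kernel_def by blast
  have 1: "diag (\<lambda>i. \<gamma> (q - i) i) (\<lambda>k l. diag (\<lambda>i. \<gamma> (r - i) i) F k l) k l = diag (\<lambda>i. \<gamma> (r + q - i) i) F k l" for k l
    by (rule diag_diag[where \<delta> = "\<lambda>_ i. \<gamma> (r - i) i", OF assms(2) z z V])
  have 2: "diag \<delta> (\<lambda>k l. G (k - r) l) k l = diag \<delta> G (k - r) l" for \<delta> k l and G :: "int \<Rightarrow> int \<Rightarrow> 'a"
    unfolding diag_def by (simp add: algebra_simps)
  show ?thesis unfolding bin_def[abs_def] 2 1 by (simp add: algebra_simps)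
qed

lemma bin_low:
  assumes "low F" "\<And>a i. i < 0 \<Longrightarrow> \<gamma> a i = 0"
  shows "low (\<lambda>p. bin \<gamma> (h p) (F p) :: int \<Rightarrow> int \<Rightarrow> 'a::hcomplete)"
  unfolding bin_def[abs_def] by (rule diag_low[OF assms])

text \<open>Collecting a double sum by \<open>q = i + j\<close> recognises the coefficients
  \<open>\<gamma> (q - j) j\<close> as those of \<open>(x \<plusminus> y)^q\<close>; contractions at
  a sum or difference of variables thus become multiplications by \<open>bin\<close>.\<close>

lemma bin_reindex:
  fixes F :: "int \<Rightarrow> int \<Rightarrow> int \<Rightarrow> 'a::hcomplete"
  assumes n: "hnull (\<lambda>(q, j). \<gamma> (q - j) j *\<^sub>h F q (l - q + j) (k - j)) UNIV"
  shows "hnull (\<lambda>(j, i). \<gamma> i j *\<^sub>h F (i + j) (l - i) (k - j)) UNIV"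
    and "(HSUM j. (HSUM i. \<gamma> i j *\<^sub>h F (i + j) (l - i) (k - j))) = (HSUM q. bin \<gamma> q (F q) l k)"
    and "(HSUM i. (HSUM j. \<gamma> i j *\<^sub>h F (i + j) (l - i) (k - j))) = (HSUM q. bin \<gamma> q (F q) l k)"
    and "hnull (\<lambda>q. bin \<gamma> q (F q) l k) UNIV"
proof -
  let ?g = "\<lambda>(q, j). \<gamma> (q - j) j *\<^sub>h F q (l - q + j) (k - j)"
  have e: "(\<lambda>(j, i). \<gamma> i j *\<^sub>h F (i + j) (l - i) (k - j)) = (\<lambda>x. ?g ((\<lambda>(j, i). (i + j, j)) x))"
    by (auto simp: fun_eq_iff)
  show n': "hnull (\<lambda>(j, i). \<gamma> i j *\<^sub>h F (i + j) (l - i) (k - j)) UNIV"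
    unfolding e by (rule hnull_inj[OF n]) (auto simp: inj_on_def)
  have s: "hnull (\<lambda>(j, q). \<gamma> (q - j) j *\<^sub>h F q (l - q + j) (k - j)) UNIV"
    using n by (rule hnull_pair_swap[THEN iffD1])
  have "(HSUM j. (HSUM i. \<gamma> i j *\<^sub>h F (i + j) (l - i) (k - j)))
      = (HSUM j. (HSUM q. \<gamma> (q - j) j *\<^sub>h F q (l - q + j) (k - j)))"
  proof (rule hsum_cong[OF refl])
    fix j
    show "(HSUM i. \<gamma> i j *\<^sub>h F (i + j) (l - i) (k - j)) = (HSUM q. \<gamma> (q - j) j *\<^sub>h F q (l - q + j) (k - j))"
      using hsum_shift[of "\<lambda>q. \<gamma> (q - j) j *\<^sub>h F q (l - q + j) (k - j)" j] by (simp add: algebra_simps)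
  qed
  also have "\<dots> = (HSUM q. (HSUM j. \<gamma> (q - j) j *\<^sub>h F q (l - q + j) (k - j)))"
    by (rule hsum_swap_UNIV[OF s])
  finally show 1: "(HSUM j. (HSUM i. \<gamma> i j *\<^sub>h F (i + j) (l - i) (k - j))) = (HSUM q. bin \<gamma> q (F q) l k)"
    unfolding bin_def diag_def .
  show "(HSUM i. (HSUM j. \<gamma> i j *\<^sub>h F (i + j) (l - i) (k - j))) = (HSUM q. bin \<gamma> q (F q) l k)"
    unfolding 1[symmetric] by (rule hsum_swap_UNIV[symmetric, OF n'])
  show "hnull (\<lambda>q. bin \<gamma> q (F q) l k) UNIV"
    unfolding bin_def diag_def by (rule hnull_hsum_pair(1)[OF n])
qed

lemma null_pairs:
  fixes F :: "int \<Rightarrow> int \<Rightarrow> int \<Rightarrow> 'a::hcomplete"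
  assumes F: "low F" and fin: "\<And>n. finite {q. \<exists>k l. F q k l \<notin> hpow n}" and \<gamma>: "\<And>q j. j < 0 \<Longrightarrow> \<gamma> q j = 0"
  shows "hnull (\<lambda>(q, j). \<gamma> q j *\<^sub>h F q (h q j) (k - j)) UNIV"
  unfolding hnull_def
proof
  fix n
  obtain K where K: "\<And>p k l. l < K \<Longrightarrow> F p k l \<in> hpow n" using lowD[OF F] by blast
  show "finite {x \<in> UNIV. (case x of (q, j) \<Rightarrow> \<gamma> q j *\<^sub>h F q (h q j) (k - j)) \<notin> hpow n}"
  proof (rule finite_subset[of _ "{q. \<exists>k l. F q k l \<notin> hpow n} \<times> {0..k - K}"])
    have "(\<exists>k l. F q k l \<notin> hpow n) \<and> 0 \<le> j \<and> j \<le> k - K" if "\<gamma> q j *\<^sub>h F q (h q j) (k - j) \<notin> hpow n" for q j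
    proof -
      have "\<not> j < 0" using that \<gamma>[of j] by (auto simp: hpow_zero)
      moreover have "F q (h q j) (k - j) \<notin> hpow n" using that hpow_scale by blast
      moreover from this have "\<not> k - j < K" using K by blast
      ultimately show ?thesis by force
    qed
    then show "{x \<in> UNIV. (case x of (q, j) \<Rightarrow> \<gamma> q j *\<^sub>h F q (h q j) (k - j)) \<notin> hpow n}
        \<subseteq> {q. \<exists>k l. F q k l \<notin> hpow n} \<times> {0..k - K}" by auto
  qed (simp add: fin)
qed

text \<open>Two families of series satisfying the same recursion agree up to a power of h once the exponent
  \<open>r\<close> is large: the recursion lowers \<open>r\<close> only by finitely many steps modulo a power of h.\<close>

lemma stabilise:
  fixes X Z :: "int \<Rightarrow> 'n::finite Hplus \<Rightarrow> 'n Hplus \<Rightarrow> 'n Hplus \<Rightarrow> int \<Rightarrow> int \<Rightarrow> 'n Hplus"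
  assumes lin: "\<And>r p y k l. hlinear (\<lambda>u. X r u p y k l)" "\<And>r p y k l. hlinear (\<lambda>u. Z r u p y k l)"
    and hp: "\<And>r u p y k l n. p \<in> hpow n \<Longrightarrow> X r u p y k l \<in> hpow n" "\<And>r u p y k l n. p \<in> hpow n \<Longrightarrow> Z r u p y k l \<in> hpow n"
    and hy: "\<And>r u p y k l n. y \<in> hpow n \<Longrightarrow> X r u p y k l \<in> hpow n" "\<And>r u p y k l n. y \<in> hpow n \<Longrightarrow> Z r u p y k l \<in> hpow n"
    and nA: "\<And>e s r u p y k l. hnull (\<lambda>j. YA e s j (X (r + \<alpha> * j) u p y (k - \<beta> * j) l)) UNIV"
      "\<And>e s r u p y k l. hnull (\<lambda>j. YA e s j (Z (r + \<alpha> * j) u p y (k - \<beta> * j) l)) UNIV"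
    and B: "\<And>e s y. hnull (\<lambda>j. B e s j y) UNIV" and C: "\<And>e s p. hnull (\<lambda>q. C e s q p) UNIV"
    and recX: "\<And>e s r u p y k l. X r (xplus e s * u) p y k l = (HSUM j. YA e s j (X (r + \<alpha> * j) u p y (k - \<beta> * j) l))
      + (HSUM j. X r u p (B e s j y) (k - j) l) + (HSUM q. X (r + q) u (C e s q p) y k l)"
    and recZ: "\<And>e s r u p y k l. Z r (xplus e s * u) p y k l = (HSUM j. YA e s j (Z (r + \<alpha> * j) u p y (k - \<beta> * j) l))
      + (HSUM j. Z r u p (B e s j y) (k - j) l) + (HSUM q. Z (r + q) u (C e s q p) y k l)"
    and base: "\<And>r p y k l. r \<ge> 0 \<Longrightarrow> X r 1 p y k l = Z r 1 p y k l"
    and \<alpha>: "\<alpha> \<ge> 0"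
  shows "\<exists>r0\<ge>0. \<forall>r\<ge>r0. \<forall>y k l. X r u p y k l - Z r u p y k l \<in> hpow n"
proof (induction u arbitrary: p rule: Hplus_induct_mod[where n = n])
  case one
  show ?case by (intro exI[of _ 0]) (simp add: base hpow_zero)
next
  case (times e s u)
  have "\<forall>p. \<exists>r0\<ge>0. \<forall>r\<ge>r0. \<forall>y k l. X r u p y k l - Z r u p y k l \<in> hpow n" using times(2) by blast
  then obtain \<rho> where \<rho>: "\<And>p. \<rho> p \<ge> 0" "\<And>p r y k l. r \<ge> \<rho> p \<Longrightarrow> X r u p y k l - Z r u p y k l \<in> hpow n" by metis
  have "finite {q. C e s q p \<notin> hpow n}" using hnullD[OF C[of e s p], of n] by simp
  then obtain M where M: "\<forall>q\<in>{q. C e s q p \<notin> hpow n}. M \<le> q - \<rho> (C e s q p)"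
    using finite_lower_bound[of "{q. C e s q p \<notin> hpow n}" "\<lambda>q. q - \<rho> (C e s q p)"] by blast
  \<comment> \<open>For the finitely many \<open>q\<close> with \<open>C e s q p\<close> outside
    \<open>hpow n\<close>, \<open>r \<ge> - M\<close> gives
    \<open>r + q \<ge> \<rho> (C e s q p)\<close>. Creation terms need only
    \<open>r \<ge> \<rho> p\<close>, as \<open>\<alpha>\<close> and the relevant \<open>j\<close>
    are nonnegative.\<close>
  define r0 where "r0 = max (\<rho> p) (- M)"
  have "X r (xplus e s * u) p y k l - Z r (xplus e s * u) p y k l \<in> hpow n" if r: "r \<ge> r0" for r y k l
  proof -
    have r1: "r \<ge> \<rho> p" and r2: "r \<ge> - M" using r by (simp_all add: r0_def)
    have nB: "hnull (\<lambda>j. X r u p (B e s j y) (k - j) l) UNIV" "hnull (\<lambda>j. Z r u p (B e s j y) (k - j) l) UNIV"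
      by (rule hnull_dominated[OF B], erule hy)+
    have nC: "hnull (\<lambda>q. X (r + q) u (C e s q p) y k l) UNIV" "hnull (\<lambda>q. Z (r + q) u (C e s q p) y k l) UNIV"
      by (rule hnull_dominated[OF C], erule hp)+
    have a: "(HSUM j. YA e s j (X (r + \<alpha> * j) u p y (k - \<beta> * j) l))
        - (HSUM j. YA e s j (Z (r + \<alpha> * j) u p y (k - \<beta> * j) l)) \<in> hpow n"
      unfolding hsum_diff[OF nA, symmetric]
    proof (rule hsum_hpow[OF hnull_diff[OF nA]])
      fix j
      show "YA e s j (X (r + \<alpha> * j) u p y (k - \<beta> * j) l) - YA e s j (Z (r + \<alpha> * j) u p y (k - \<beta> * j) l) \<in> hpow n"
      proof (cases "j < 0")
        case False
        then have "r + \<alpha> * j \<ge> \<rho> p" using r1 \<alpha> mult_nonneg_nonneg[of \<alpha> j] by linarith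
        then show ?thesis unfolding hlinear_diff[OF hlinear_YA, symmetric] by (intro hlinear_hpow[OF hlinear_YA] \<rho>(2))
      qed (simp add: YA_vanish hpow_zero)
    qed
    have b: "(HSUM j. X r u p (B e s j y) (k - j) l) - (HSUM j. Z r u p (B e s j y) (k - j) l) \<in> hpow n"
      unfolding hsum_diff[OF nB, symmetric] by (rule hsum_hpow[OF hnull_diff[OF nB]]) (rule \<rho>(2)[OF r1])
    have c: "(HSUM q. X (r + q) u (C e s q p) y k l) - (HSUM q. Z (r + q) u (C e s q p) y k l) \<in> hpow n"
      unfolding hsum_diff[OF nC, symmetric]
    proof (rule hsum_hpow[OF hnull_diff[OF nC]])
      fix q
      show "X (r + q) u (C e s q p) y k l - Z (r + q) u (C e s q p) y k l \<in> hpow n"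
      proof (cases "C e s q p \<in> hpow n")
        case True
        then show ?thesis by (intro hpow_diff hp)
      next
        case False
        then have "r + q \<ge> \<rho> (C e s q p)" using M r2 by force
        then show ?thesis by (rule \<rho>(2))
      qed
    qed
    show ?thesis unfolding recX recZ using hpow_add[OF hpow_add[OF a b] c] by (simp add: algebra_simps)
  qed
  then show ?case using \<rho>(1)[of p] by (intro exI[of _ r0]) (simp add: r0_def)
next
  case (plus u v)
  then obtain r0 r1 where "r0 \<ge> 0" "r1 \<ge> 0" "\<forall>r\<ge>r0. \<forall>y k l. X r u p y k l - Z r u p y k l \<in> hpow n"
    "\<forall>r\<ge>r1. \<forall>y k l. X r v p y k l - Z r v p y k l \<in> hpow n" by blast
  then have "\<forall>r\<ge>max r0 r1. \<forall>y k l. (X r u p y k l - Z r u p y k l) + (X r v p y k l - Z r v p y k l) \<in> hpow n"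
    by (simp add: hpow_add)
  then show ?case using \<open>r0 \<ge> 0\<close>
    by (intro exI[of _ "max r0 r1"]) (simp add: hlinear_add[OF lin(1)] hlinear_add[OF lin(2)] algebra_simps)
next
  case (scale a u)
  then obtain r0 where "r0 \<ge> 0" "\<forall>r\<ge>r0. \<forall>y k l. X r u p y k l - Z r u p y k l \<in> hpow n" by blast
  then show ?case
    unfolding hlinear_scale[OF lin(1)] hlinear_scale[OF lin(2)] hmod.scale_right_diff_distrib[symmetric]
    using hpow_scale by blast
next
  case (hpow u)
  then show ?case by (intro exI[of _ 0]) (simp add: hpow_diff hlinear_hpow[OF lin(1)] hlinear_hpow[OF lin(2)])
qed

section \<open>Weak associativity\<close>

lemma plus_coeff_swap: "i \<ge> 0 \<Longrightarrow> plus_coeff (j + r) i * plus_coeff j r = plus_coeff (j + i) r * plus_coeff j i"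
proof (cases "r < 0")
  case False
  assume "i \<ge> 0"
  then have "plus_coeff r i = plus_coeff i r" using False by (intro plus_coeff_symmetric) simp_all
  then show ?thesis using plus_coeff_multinomial[of j r i] plus_coeff_multinomial[of j i r] by (simp add: add.commute[of i r])
qed simp

text \<open>Two expansions of \<open>\<sigma>(z + u - (z' + v))\<close>: the left side substitutes
  \<open>z' + v\<close> for the second variable, the right side substitutes \<open>z - z'\<close>
  for z. Here \<open>i\<close> is the exponent of \<open>z'\<close>.\<close>

lemma ker_shift: "plus_coeff i s * ker \<sigma> e r j f (i + s) = minus_coeff j i * ker \<sigma> e r (j + i) f s"
proof -
  consider "s < 0" | "i < 0" "s \<ge> 0" | "i \<ge> 0" "s \<ge> 0" by linarith
  then show ?thesis
  proof cases
    case 2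
    then show ?thesis by (cases "i + s < 0") (simp_all add: ker_def plus_coeff_vanish)
  next
    case 3
    have "plus_coeff (j + r) (i + s) * plus_coeff i s = plus_coeff (j + r + i) s * plus_coeff (j + r) i"
      by (rule plus_coeff_multinomial)
    then have "plus_coeff i s * (plus_coeff j r * plus_coeff (j + r) (i + s)) =
        plus_coeff (j + r + i) s * (plus_coeff (j + r) i * plus_coeff j r)"
      by (simp add: mult_ac)
    also have "\<dots> = plus_coeff j i * (plus_coeff (j + i) r * plus_coeff (j + i + r) s)"
      unfolding plus_coeff_swap[OF 3(1)] by (simp add: mult_ac add_ac)
    finally have *: "plus_coeff i s * (plus_coeff j r * plus_coeff (j + r) (i + s)) =
        plus_coeff j i * (plus_coeff (j + i) r * plus_coeff (j + i + r) s)" .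
    have "plus_coeff i s * ker \<sigma> e r j f (i + s) =
        (plus_coeff i s * (plus_coeff j r * plus_coeff (j + r) (i + s))) * ((- 1) ^ nat i * (- 1) ^ nat s * \<sigma> e f (j + r + (i + s)))"
      using 3 by (simp add: ker_def minus_coeff_def minus_one_power_nat_add mult_ac)
    then show ?thesis unfolding *
      by (simp add: ker_def minus_coeff_def mult_ac add_ac)
  qed (simp add: ker_def)
qed

text \<open>Two expansions of \<open>\<sigma>(z + w + u - v)\<close>, bracketing
  \<open>w + u\<close> or \<open>z + w\<close>; here \<open>i\<close> and \<open>j\<close> are the
  exponents of z and w.\<close>

lemma ker_shift': "plus_coeff j r * ker \<sigma> e (j + r) i f s = plus_coeff i j * ker \<sigma> e r (i + j) f s"
proof -
  have "plus_coeff i (j + r) * plus_coeff j r = plus_coeff (i + j) r * plus_coeff i j"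
    by (rule plus_coeff_multinomial)
  then show ?thesis by (simp add: ker_def add.assoc mult_ac)
qed

lemma diag_shift: "diag \<gamma> (\<lambda>k l. F (k - p) l) k l = diag \<gamma> F (k - p) l"
  unfolding diag_def by (simp add: algebra_simps)

lemma diag_hsum3:
  fixes A :: "'p \<Rightarrow> int \<Rightarrow> int \<Rightarrow> 'a::hcomplete" and B :: "'q \<Rightarrow> int \<Rightarrow> int \<Rightarrow> 'a" and C :: "'r \<Rightarrow> int \<Rightarrow> int \<Rightarrow> 'a"
  assumes \<gamma>: "\<And>i. i < 0 \<Longrightarrow> \<gamma> i = 0"
    and A: "low A" "\<And>k l. hnull (\<lambda>p. A p k l) UNIV" and B: "low B" "\<And>k l. hnull (\<lambda>p. B p k l) UNIV"
    and C: "low C" "\<And>k l. hnull (\<lambda>p. C p k l) UNIV"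
    and F: "\<And>k l. F k l = (HSUM p. A p k l) + (HSUM p. B p k l) + (HSUM p. C p k l)"
  shows "diag \<gamma> F k l = (HSUM p. diag \<gamma> (A p) k l) + (HSUM p. diag \<gamma> (B p) k l)
    + (HSUM p. diag \<gamma> (C p) k l)"
proof -
  define SA where "SA k l = (HSUM p. A p k l)" for k l
  define SB where "SB k l = (HSUM p. B p k l)" for k l
  define SC where "SC k l = (HSUM p. C p k l)" for k l
  have lA: "low (\<lambda>_ :: unit. SA)" unfolding SA_def[abs_def] by (rule low_hsum[OF A])
  have lB: "low (\<lambda>_ :: unit. SB)" unfolding SB_def[abs_def] by (rule low_hsum[OF B])
  have lC: "low (\<lambda>_ :: unit. SC)" unfolding SC_def[abs_def] by (rule low_hsum[OF C])
  have "F = (\<lambda>k l. (SA k l + SB k l) + SC k l)" by (simp add: fun_eq_iff F SA_def SB_def SC_def)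
  then have "diag \<gamma> F k l = diag \<gamma> (\<lambda>k l. (SA k l + SB k l) + SC k l) k l" by (rule arg_cong)
  also have "\<dots> = diag \<gamma> (\<lambda>k l. SA k l + SB k l) k l + diag \<gamma> SC k l"
    by (rule diag_add[OF low_add[OF lA lB] lC \<gamma>])
  also have "diag \<gamma> (\<lambda>k l. SA k l + SB k l) k l = diag \<gamma> SA k l + diag \<gamma> SB k l" by (rule diag_add[OF lA lB \<gamma>])
  also have "diag \<gamma> SA k l = (HSUM p. diag \<gamma> (A p) k l)" unfolding SA_def[abs_def] by (rule diag_hsum(1)[OF A \<gamma>])
  also have "diag \<gamma> SB k l = (HSUM p. diag \<gamma> (B p) k l)" unfolding SB_def[abs_def] by (rule diag_hsum(1)[OF B \<gamma>])
  also have "diag \<gamma> SC k l = (HSUM p. diag \<gamma> (C p) k l)" unfolding SC_def[abs_def] by (rule diag_hsum(1)[OF C \<gamma>])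
  finally show ?thesis .
qed

lemma plus_coeff_flip: "s \<ge> 0 \<Longrightarrow> plus_coeff j (s - j) = plus_coeff (s - j) j"
proof -
  assume s: "s \<ge> 0"
  consider "j < 0" | "j > s" | "0 \<le> j" "j \<le> s" by linarith
  then show ?thesis using s by cases (simp_all add: plus_coeff_vanish plus_coeff_symmetric)
qed

text \<open>For \<open>s \<ge> 0\<close> the power is a polynomial, so expanding in either variable
  gives the same series up to the sign \<open>\<epsilon>\<close> from exchanging the variables. This
  is the point at which a high power removes the difference between two expansions.\<close>

lemma bin_flip:
  fixes F :: "int \<Rightarrow> int \<Rightarrow> 'a::hcomplete"
  assumes s: "s \<ge> 0" and \<gamma>: "\<And>j. \<gamma> j (s - j) = \<epsilon> * \<gamma> (s - j) j" "\<And>a i. i < 0 \<Longrightarrow> \<gamma> a i = 0" and \<epsilon>: "\<epsilon> \<noteq> 0"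
  shows "bin \<gamma> s F k l = \<epsilon> *\<^sub>h bin \<gamma> s (\<lambda>a b. F b a) l k"
proof -
  have z: "\<gamma> (s - j) j = 0" if "j > s" for j using \<gamma>(2)[of "s - j" j] \<gamma>(1)[of j] that \<epsilon> by simp
  have n: "hnull (\<lambda>i. \<gamma> (s - i) i *\<^sub>h F (k - i) (l - s + i)) UNIV"
  proof (rule hnull_finite_support, rule finite_subset[of _ "{0..s}"])
    show "{i \<in> UNIV. \<gamma> (s - i) i *\<^sub>h F (k - i) (l - s + i) \<noteq> 0} \<subseteq> {0..s}"
    proof
      fix i assume i: "i \<in> {i \<in> UNIV. \<gamma> (s - i) i *\<^sub>h F (k - i) (l - s + i) \<noteq> 0}"
      have "\<not> i < 0" using i \<gamma>(2)[of i "s - i"] by auto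
      moreover have "\<not> i > s" using i z[of i] by auto
      ultimately show "i \<in> {0..s}" by simp
    qed
  qed simp
  have "bin \<gamma> s F k l = (HSUM i. \<gamma> (s - i) i *\<^sub>h F (k - s + i) (l - i))" by (simp add: bin_def diag_def)
  also have "\<dots> = (HSUM j. \<gamma> (s - (s - j)) (s - j) *\<^sub>h F (k - s + (s - j)) (l - (s - j)))"
    by (rule hsum_bij) (rule bij_betw_byWitness[where f' = "\<lambda>j. s - j"], auto)
  also have "\<dots> = (HSUM j. \<epsilon> *\<^sub>h \<gamma> (s - j) j *\<^sub>h F (k - j) (l - s + j))"
  proof (rule hsum_cong[OF refl])
    fix j
    have "s - (s - j) = j" "k - s + (s - j) = k - j" "l - (s - j) = l - s + j" by simp_all
    then show "\<gamma> (s - (s - j)) (s - j) *\<^sub>h F (k - s + (s - j)) (l - (s - j)) = \<epsilon> *\<^sub>h \<gamma> (s - j) j *\<^sub>h F (k - j) (l - s + j)"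
      using \<gamma>(1)[of j] by (simp only: hscale_hscale)
  qed
  also have "\<dots> = \<epsilon> *\<^sub>h bin \<gamma> s (\<lambda>a b. F b a) l k"
    unfolding bin_def diag_def hsum_scale[OF n] ..
  finally show ?thesis .
qed

lemma hnull_YA: "in_laurent f \<Longrightarrow> hnull (\<lambda>j. YA e r j (f (k - j))) UNIV"
  by (rule Yx.hnull_A)

lemma comp_monomial:
  fixes G :: "int \<times> int \<Rightarrow> 'b \<Rightarrow> 'a::hcomplete"
  shows "(at_plus (monomial s) \<odot> G) (k, l) x = bin plus_coeff s (\<lambda>k l. G (k, l) x) k l" (is ?p)
    and "(at_minus (monomial s) \<odot> G) (k, l) x = bin minus_coeff s (\<lambda>k l. G (k, l) x) k l" (is ?m)
proof -
  have p: "inj (\<lambda>i. (s - i, i))" by (simp add: inj_def)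
  have r: "a + b \<noteq> s" if "(a, b) \<notin> range (\<lambda>i. (s - i, i))" for a b
  proof
    assume "a + b = s"
    then have "(a, b) = (\<lambda>i. (s - i, i)) b" by auto
    then show False using that by blast
  qed
  have e: "(k, l) - (s - i, i) = (k - s + i, l - i)" for i by simp
  have "(HSUM j. at_plus (monomial s) j (G ((k, l) - j) x))
      = (HSUM i. at_plus (monomial s) (s - i, i) (G ((k, l) - (s - i, i)) x))"
  proof (rule hsum_inj[OF p])
    fix j :: "int \<times> int" assume "j \<notin> range (\<lambda>i. (s - i, i))"
    then show "at_plus (monomial s) j (G ((k, l) - j) x) = 0"
      using r[of "fst j" "snd j"] by (simp add: at_plus_def monomial_def split_def)
  qed
  then show ?p unfolding series_comp_def e by (simp add: bin_def diag_def at_plus_def monomial_def)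
  have "(HSUM j. at_minus (monomial s) j (G ((k, l) - j) x))
      = (HSUM i. at_minus (monomial s) (s - i, i) (G ((k, l) - (s - i, i)) x))"
  proof (rule hsum_inj[OF p])
    fix j :: "int \<times> int" assume "j \<notin> range (\<lambda>i. (s - i, i))"
    then show "at_minus (monomial s) j (G ((k, l) - j) x) = 0"
      using r[of "fst j" "snd j"] by (simp add: at_minus_def monomial_def split_def)
  qed
  then show ?m unfolding series_comp_def e by (simp add: bin_def diag_def at_minus_def monomial_def)
qed

section \<open>Recursions for \<open>Y(u, z0 + z2) Y(v, z2) w\<close> and
  \<open>Y(Y(u, z0) v, z2) w\<close>\<close>

context
  fixes c :: complex
begin

abbreviation (input) \<beta> :: "'n::finite \<times> 'n \<Rightarrow> int \<Rightarrow> int \<Rightarrow> 'n Hplus \<Rightarrow> 'n Hplus"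
  where "\<beta> \<equiv> dop (negS c)"

abbreviation (input) \<Phi> :: "'n::finite Hplus \<Rightarrow> 'n Hplus \<Rightarrow> 'n Hplus \<Rightarrow> int \<Rightarrow> int \<Rightarrow> 'n Hplus"
  where "\<Phi> u v w k l \<equiv> Yv c u k (Yv c v l w)"

text \<open>The inner exponent \<open>k\<close> is the last argument, because it is the one bounded
  below in the sense of \<open>low\<close>.\<close>

abbreviation (input) RR :: "'n::finite Hplus \<Rightarrow> 'n Hplus \<Rightarrow> 'n Hplus \<Rightarrow> int \<Rightarrow> int \<Rightarrow> 'n Hplus"
  where "RR u v w l k \<equiv> Yv c (Yv c u k v) l w"

lemmas \<beta>_null = hnull_dop[OF pairing_negS, of c]
  and \<beta>_lin = hlinear_dop[OF pairing_negS, of c]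
  and \<beta>_finite = hnullD[OF hnull_dop[OF pairing_negS, of c], simplified]

lemma \<Phi>_low: "low (\<lambda>_ :: 'p. \<Phi> u v w)"
  unfolding low_def
proof
  fix n
  obtain K where "\<forall>k<K. Yv c v k w \<in> hpow n" using in_laurentD[OF Y_laurent] by blast
  then show "\<exists>K. \<forall>p k l. l < K \<longrightarrow> \<Phi> u v w k l \<in> hpow n" using hlinear_hpow[OF Y_lin2] by blast
qed

lemma RR_low: "low (\<lambda>_ :: 'p. RR u v w)"
  unfolding low_def
proof
  fix n
  obtain K where "\<forall>k<K. Yv c u k v \<in> hpow n" using in_laurentD[OF Y_laurent] by blast
  then show "\<exists>K. \<forall>p k l. l < K \<longrightarrow> RR u v w k l \<in> hpow n" using hlinear_hpow[OF Y_lin1] by blast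
qed

lemma \<Phi>_hpow: "v \<in> hpow n \<Longrightarrow> \<Phi> u v w k l \<in> hpow n" "w \<in> hpow n \<Longrightarrow> \<Phi> u v w k l \<in> hpow n"
  by (intro hlinear_hpow[OF Y_lin2] hlinear_hpow[OF Y_lin1], assumption)
    (intro hlinear_hpow[OF Y_lin2], assumption)

lemma RR_hpow: "v \<in> hpow n \<Longrightarrow> RR u v w k l \<in> hpow n" "w \<in> hpow n \<Longrightarrow> RR u v w k l \<in> hpow n"
  by (intro hlinear_hpow[OF Y_lin1] hlinear_hpow[OF Y_lin2], assumption)
    (rule hlinear_hpow[OF Y_lin2])

lemma finite_hpow:
  assumes "hnull y UNIV" "\<And>p k l n. y p \<in> hpow n \<Longrightarrow> F p k l \<in> hpow n"
  shows "finite {p. \<exists>k l. F p k l \<notin> hpow n}"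
  by (rule finite_subset[OF _ hnullD[OF assms(1), of n]]) (use assms(2) in blast)

lemma low_family:
  assumes "hnull y UNIV" "\<And>p k l n. y p \<in> hpow n \<Longrightarrow> F p k l \<in> hpow n" "\<And>p. low (\<lambda>_ :: unit. F p)"
  shows "low F"
  by (rule low_null[OF assms(3) finite_hpow[OF assms(1,2)]])

lemma \<Phi>_\<beta>v: "low (\<lambda>q. \<Phi> u (\<beta> e r q v) w)" "finite {q. \<exists>k l. \<Phi> u (\<beta> e r q v) w k l \<notin> hpow n}"
  by (rule low_family[OF \<beta>_null], erule \<Phi>_hpow, rule \<Phi>_low, rule finite_hpow[OF \<beta>_null], erule \<Phi>_hpow)

lemma \<Phi>_\<beta>w: "low (\<lambda>j k l. \<Phi> u v (\<beta> e r j w) (k - j) l)"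
proof (rule low_family[OF \<beta>_null])
  show "low (\<lambda>_ :: unit. \<lambda>k l. \<Phi> u v (\<beta> e r p w) (k - p) l)" for p by (rule low_mono[OF \<Phi>_low]) assumption
qed (erule \<Phi>_hpow)

lemma \<Phi>_\<beta>w_null: "hnull (\<lambda>j. \<Phi> u v (\<beta> e r j w) (k - j) l) UNIV"
  by (rule hnull_dominated[OF \<beta>_null]) (erule \<Phi>_hpow)

lemma \<Phi>_YA: "low (\<lambda>j k l. YA e r j (\<Phi> u v w (k - j) l))" "hnull (\<lambda>j. YA e r j (\<Phi> u v w (k - j) l)) UNIV"
  by (rule low_mono[OF \<Phi>_low[where u = u and v = v and w = w]], rule hlinear_hpow[OF hlinear_YA], assumption)
    (rule hnull_YA, rule Y_laurent)

lemma RR_\<beta>w: "low (\<lambda>q. RR u v (\<beta> e r q w))" "finite {q. \<exists>k l. RR u v (\<beta> e r q w) k l \<notin> hpow n}"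
  by (rule low_family[OF \<beta>_null], erule RR_hpow, rule RR_low, rule finite_hpow[OF \<beta>_null], erule RR_hpow)

lemma RR_\<beta>v_null: "hnull (\<lambda>q. RR u (\<beta> e r q v) w l (k - q)) UNIV"
  by (rule hnull_dominated[OF \<beta>_null]) (erule RR_hpow)

lemma low_shift: "low (\<lambda>_ :: unit. F) \<Longrightarrow> low (\<lambda>_ :: unit. \<lambda>k l. F k (l - d))"
  unfolding low_def
proof
  fix n assume "\<forall>n. \<exists>K. \<forall>(p :: unit) k l. l < K \<longrightarrow> F k l \<in> hpow n"
  then obtain K where "\<forall>(p :: unit) k l. l < K \<longrightarrow> F k l \<in> hpow n" by blast
  then show "\<exists>K. \<forall>(p :: unit) k l. l < K \<longrightarrow> F k (l - d) \<in> hpow n" by (intro exI[of _ "K + d"]) simp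
qed

lemma RR_\<beta>v: "low (\<lambda>q l k. RR u (\<beta> e r q v) w l (k - q))"
  by (rule low_family[OF \<beta>_null], erule RR_hpow, rule low_shift, rule RR_low)

text \<open>Annihilation at \<open>z1\<close> acts on \<open>w\<close> and, by \<open>Y_derv\<close>
  and \<open>ker_shift\<close>, on \<open>v\<close> with argument \<open>z1 - z2\<close>, expanded
  in nonnegative powers of \<open>z2\<close>.\<close>

lemma dop_Y: "\<beta> e r j (Yv c v l w) = Yv c v l (\<beta> e r j w) +
      (HSUM i. minus_coeff j i *\<^sub>h Yv c (\<beta> e r (j + i) v) (l - i) w)"
    "hnull (\<lambda>i. minus_coeff j i *\<^sub>h Yv c (\<beta> e r (j + i) v) (l - i) w) UNIV"
proof -
  have d: "derv (\<lambda>f s. plus_coeff i s * ker (negS c) e r j f (i + s)) v = minus_coeff j i *\<^sub>h \<beta> e r (j + i) v" for i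
    unfolding ker_shift dop_def by (rule derv_scale[OF tracefree_ker[OF pairing_negS]])
  show "\<beta> e r j (Yv c v l w) = Yv c v l (\<beta> e r j w) +
      (HSUM i. minus_coeff j i *\<^sub>h Yv c (\<beta> e r (j + i) v) (l - i) w)"
    "hnull (\<lambda>i. minus_coeff j i *\<^sub>h Yv c (\<beta> e r (j + i) v) (l - i) w) UNIV"
    using Y_derv[where c = c and p = v and k = l and q = w, OF tracefree_ker[OF pairing_negS, of c e r j]]
    unfolding d hlinear_scale[OF Y_lin1] dop_def[symmetric] by blast+
qed

lemma \<Phi>_rec: "\<Phi> (xplus e r * u) v w k l = (HSUM j. YA e r j (\<Phi> u v w (k - j) l))
    + (HSUM j. \<Phi> u v (\<beta> e r j w) (k - j) l)
    + (HSUM q. bin minus_coeff q (\<Phi> u (\<beta> e r q v) w) k l)" (is ?rec)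
  and \<Phi>_bin_null: "hnull (\<lambda>q. bin minus_coeff q (\<Phi> u (\<beta> e r q v) w) k l) UNIV" (is ?null)
proof -
  have n: "hnull (\<lambda>(q, j). minus_coeff (q - j) j *\<^sub>h \<Phi> u (\<beta> e r q v) w (k - q + j) (l - j)) UNIV"
    by (rule null_pairs[OF \<Phi>_\<beta>v]) simp
  note re = bin_reindex[where \<gamma> = minus_coeff and F = "\<lambda>q. \<Phi> u (\<beta> e r q v) w", OF n]
  show ?null by (rule re(4))
  have n': "hnull (\<lambda>(i, j). minus_coeff i j *\<^sub>h \<Phi> u (\<beta> e r (i + j) v) w (k - i) (l - j)) UNIV"
    using re(1) by (rule hnull_pair_swap[THEN iffD1])
  have "Yv c u (k - j) (\<beta> e r j (Yv c v l w)) = \<Phi> u v (\<beta> e r j w) (k - j) l +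
      (HSUM i. minus_coeff j i *\<^sub>h \<Phi> u (\<beta> e r (j + i) v) w (k - j) (l - i))" for j
    unfolding dop_Y(1) hlinear_add[OF Y_lin2] hsum_linear[OF Y_lin2 dop_Y(2)] hlinear_scale[OF Y_lin2] ..
  then show ?rec
    unfolding Y_step
    by (simp add: hsum_add[OF \<Phi>_\<beta>w_null hnull_hsum_pair(1)[OF n']] re(3) add.assoc)
qed

lemma RR_YA_pairs:
  "hnull (\<lambda>(p, j). plus_coeff (p - j) j *\<^sub>h YA e r p (RR u v w (l - p + j) (k - j))) UNIV"
proof (rule hnull_pair_swap[THEN iffD2])
  have l: "low (\<lambda>(_ :: unit) l k. RR u v w l k)" by (rule RR_low)
  have "finite {j \<in> UNIV. \<exists>p\<in>UNIV. plus_coeff (p - j) j *\<^sub>h YA e r p (RR u v w (l - p + j) (k - j)) \<notin> hpow n}" for n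
  proof -
    obtain K where K: "\<And>k l. k < K \<Longrightarrow> RR u v w l k \<in> hpow n" using lowD[OF l] by blast
    have *: "0 \<le> j \<and> j \<le> k - K" if "plus_coeff (p - j) j *\<^sub>h YA e r p (RR u v w (l - p + j) (k - j)) \<notin> hpow n" for p j
    proof -
      have "\<not> j < 0" using that by (auto simp: hpow_zero)
      moreover have "\<not> k - j < K" using that K hpow_scale hlinear_hpow[OF hlinear_YA] by blast
      ultimately show ?thesis by simp
    qed
    show ?thesis
    proof (rule finite_subset[of _ "{0..k - K}"], rule subsetI)
      fix j assume "j \<in> {j \<in> UNIV. \<exists>p\<in>UNIV. plus_coeff (p - j) j *\<^sub>h YA e r p (RR u v w (l - p + j) (k - j)) \<notin> hpow n}"
      then obtain p where "plus_coeff (p - j) j *\<^sub>h YA e r p (RR u v w (l - p + j) (k - j)) \<notin> hpow n" by blast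
      from *[OF this] show "j \<in> {0..k - K}" by simp
    qed simp
  qed
  moreover have "hnull (\<lambda>p. plus_coeff (p - j) j *\<^sub>h YA e r p (RR u v w (l - p + j) (k - j))) UNIV" for j
    using hnull_scale[OF hnull_YA[OF Y_laurent, where k = "l + j"], where c = "\<lambda>p. plus_coeff (p - j) j"]
    by (simp add: algebra_simps)
  ultimately have "hnull (\<lambda>(j, p). plus_coeff (p - j) j *\<^sub>h YA e r p (RR u v w (l - p + j) (k - j))) (Sigma UNIV (\<lambda>_. UNIV))"
    by (rule hnull_Sigma)
  then show "hnull (\<lambda>(j, p). plus_coeff (p - j) j *\<^sub>h YA e r p (RR u v w (l - p + j) (k - j))) UNIV" by simp
qed

lemma bin_YA: "bin plus_coeff p (\<lambda>l k. YA e r q (RR u v w l k)) l k = YA e r q (bin plus_coeff p (RR u v w) l k)"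
  unfolding bin_def by (rule diag_linear[OF hlinear_YA RR_low]) simp

text \<open>A created generator \<open>x^+(z0 + u)\<close> inside the left argument becomes a full
  field at \<open>z2 + z0 + u\<close>: its creation part and its annihilation part are both expanded
  in nonnegative powers of \<open>z0\<close>.\<close>

lemma Yv_YA: "Yv c (YA e r j y) l w = (HSUM i. plus_coeff i j *\<^sub>h YA e r (i + j) (Yv c y (l - i) w))
    + (HSUM i. plus_coeff i j *\<^sub>h Yv c y (l - i) (\<beta> e r (i + j) w))"
proof -
  have a: "plus_coeff j r *\<^sub>h YA e (j + r) i z = plus_coeff i j *\<^sub>h YA e r (i + j) z" for i and z :: "'a Hplus"
    using plus_coeff_multinomial[of i j r] by (simp add: YA_def hscale_hscale mult_ac add_ac)
  have b: "plus_coeff j r *\<^sub>h \<beta> e (j + r) i w = plus_coeff i j *\<^sub>h \<beta> e r (i + j) w" for i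
    unfolding dop_def derv_scale[OF tracefree_ker[OF pairing_negS], symmetric] ker_shift' ..
  have "Yv c (YA e r j y) l w = plus_coeff j r *\<^sub>h Yv c (xplus e (j + r) * y) l w"
    by (simp add: YA_def hlinear_scale[OF Y_lin1])
  also have "\<dots> = (HSUM i. plus_coeff j r *\<^sub>h YA e (j + r) i (Yv c y (l - i) w))
      + (HSUM i. plus_coeff j r *\<^sub>h Yv c y (l - i) (\<beta> e (j + r) i w))"
    unfolding Y_step hscale_right_distrib hsum_scale[OF Y_hnull(1)] hsum_scale[OF Y_hnull(2)] ..
  finally show ?thesis unfolding a hlinear_scale[OF Y_lin2, symmetric] b .
qed

lemma RR_rec: "RR (xplus e r * u) v w l k = (HSUM p. YA e r p (bin plus_coeff p (RR u v w) l k))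
    + (HSUM q. bin plus_coeff q (RR u v (\<beta> e r q w)) l k)
    + (HSUM q. RR u (\<beta> e r q v) w l (k - q))" (is ?rec)
  and RR_YA_null: "hnull (\<lambda>p. YA e r p (bin plus_coeff p (RR u v w) l k)) UNIV" (is ?nA)
  and RR_bin_null: "hnull (\<lambda>q. bin plus_coeff q (RR u v (\<beta> e r q w)) l k) UNIV" (is ?nB)
proof -
  note a = bin_reindex[where \<gamma> = plus_coeff and F = "\<lambda>p l k. YA e r p (RR u v w l k)", OF RR_YA_pairs, unfolded bin_YA]
  have "hnull (\<lambda>(q, j). plus_coeff (q - j) j *\<^sub>h RR u v (\<beta> e r q w) (l - q + j) (k - j)) UNIV"
    by (rule null_pairs[OF RR_\<beta>w]) simp
  note b = bin_reindex[where \<gamma> = plus_coeff and F = "\<lambda>q. RR u v (\<beta> e r q w)", OF this]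
  show ?nA ?nB by (rule a(4), rule b(4))
  have "Yv c (Yv c (xplus e r * u) k v) l w = (HSUM j. Yv c (YA e r j (Yv c u (k - j) v)) l w)
      + (HSUM q. RR u (\<beta> e r q v) w l (k - q))"
    unfolding Y_step[of c e r u k v] hlinear_add[OF Y_lin1] hsum_linear[OF Y_lin1 Y_hnull(1)] hsum_linear[OF Y_lin1 Y_hnull(2)] ..
  then show ?rec
    unfolding Yv_YA hsum_add[OF hnull_hsum_pair(1)[OF a(1)] hnull_hsum_pair(1)[OF b(1)]] a(2) b(2) .
qed

text \<open>The coefficient of \<open>z0^k z2^l\<close> in \<open>x^s Y(u,x) Y(v,z2) w\<close> at
  \<open>x = z0 + z2\<close>: the factor \<open>x^s\<close> shifts the first exponent, and the
  substitution is the multiplier \<open>plus_coeff k\<close>.\<close>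

definition XW :: "int \<Rightarrow> 'n::finite Hplus \<Rightarrow> 'n Hplus \<Rightarrow> 'n Hplus \<Rightarrow> int \<Rightarrow> int \<Rightarrow> 'n Hplus"
  where "XW s u w v k l = diag (plus_coeff k) (\<Phi> u v w) (k - s) l"

text \<open>The coefficient of \<open>z0^k z2^l\<close> in
  \<open>(z2 + z0)^s Y(Y(u,z0)v,z2)w\<close>, with the power expanded in nonnegative powers of
  \<open>z0\<close>, the opposite of the direction in \<open>XW\<close>.\<close>

definition ZW :: "int \<Rightarrow> 'n::finite Hplus \<Rightarrow> 'n Hplus \<Rightarrow> 'n Hplus \<Rightarrow> int \<Rightarrow> int \<Rightarrow> 'n Hplus"
  where "ZW s u w v k l = bin plus_coeff s (RR u v w) l k"

lemma XW_YA: "diag (plus_coeff k) (\<lambda>k l. YA e r j (\<Phi> u v w (k - j) l)) (k - s) l = YA e r j (XW (s + j) u w v k l)"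
proof -
  have "diag (plus_coeff k) (\<lambda>k l. YA e r j (\<Phi> u v w (k - j) l)) (k - s) l
      = YA e r j (diag (plus_coeff k) (\<lambda>k l. \<Phi> u v w (k - j) l) (k - s) l)"
    by (rule diag_linear[OF hlinear_YA]) (rule low_mono[OF \<Phi>_low], assumption, simp)
  then show ?thesis by (simp add: XW_def diag_shift[where F = "\<Phi> u v w"] algebra_simps)
qed

lemma XW_rec: "XW s (xplus e r * u) w v k l = (HSUM j. YA e r j (XW (s + j) u w v k l))
    + (HSUM j. XW s u w (\<beta> e r j v) (k - j) l) + (HSUM q. XW (s + q) u (\<beta> e r q w) v k l)" (is ?rec)
  and XW_null: "hnull (\<lambda>j. YA e r j (XW (s + j) u w v k l)) UNIV" (is ?null)
proof -
  have z: "i < 0 \<Longrightarrow> plus_coeff k i = 0" "i < 0 \<Longrightarrow> minus_coeff k i = 0" for k i by simp_all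
  have low_bin: "low (\<lambda>q. bin minus_coeff q (\<Phi> u (\<beta> e r q v) w))" by (rule bin_low[OF \<Phi>_\<beta>v(1) z(2)])
  show ?null unfolding XW_YA[symmetric] by (rule diag_hsum(2)[OF \<Phi>_YA]) simp
  \<comment> \<open>The contraction with \<open>v\<close> carries \<open>(x - z2)^q\<close>, which
    is \<open>z0^q\<close> at \<open>x = z0 + z2\<close>; so it merely shifts \<open>k\<close> by
    \<open>q\<close>, as in the recursion for \<open>ZW\<close>.\<close>
  have c: "diag (plus_coeff k) (bin minus_coeff q (\<Phi> u (\<beta> e r q v) w)) (k - s) l = XW s u w (\<beta> e r q v) (k - q) l" for q
  proof -
    let ?F = "\<Phi> u (\<beta> e r q v) w"
    have "diag (plus_coeff k) (\<lambda>k l. diag (\<lambda>i. minus_coeff (q - i) i) ?F k l) k' l = diag (plus_coeff (k - q)) ?F k' l" for k'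
      by (rule diag_diag[where \<delta> = "\<lambda>_ i. minus_coeff (q - i) i" and \<gamma> = "plus_coeff k", OF \<Phi>_low z(1) z(2)
            plus_minus_coeff_Vandermonde])
    then show ?thesis
      unfolding bin_def[abs_def] XW_def diag_shift[where F = "\<lambda>k l. diag (\<lambda>i. minus_coeff (q - i) i) ?F k l"]
      by (simp add: algebra_simps)
  qed
  have b: "diag (plus_coeff k) (\<lambda>k l. \<Phi> u v (\<beta> e r j w) (k - j) l) (k - s) l = XW (s + j) u (\<beta> e r j w) v k l" for j
    by (simp add: XW_def diag_shift[where F = "\<Phi> u v (\<beta> e r j w)"] algebra_simps)
  have "diag (plus_coeff k) (\<Phi> (xplus e r * u) v w) (k - s) l
      = (HSUM j. diag (plus_coeff k) (\<lambda>k l. YA e r j (\<Phi> u v w (k - j) l)) (k - s) l)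
      + (HSUM j. diag (plus_coeff k) (\<lambda>k l. \<Phi> u v (\<beta> e r j w) (k - j) l) (k - s) l)
      + (HSUM q. diag (plus_coeff k) (bin minus_coeff q (\<Phi> u (\<beta> e r q v) w)) (k - s) l)"
    by (rule diag_hsum3[OF _ \<Phi>_YA \<Phi>_\<beta>w \<Phi>_\<beta>w_null low_bin \<Phi>_bin_null \<Phi>_rec]) simp
  then show ?rec unfolding XW_def[of s "xplus e r * u"] XW_YA b c by (simp only: add_ac)
qed

lemma ZW_rec: "ZW s (xplus e r * u) w v k l = (HSUM j. YA e r j (ZW (s + j) u w v k l))
    + (HSUM j. ZW s u w (\<beta> e r j v) (k - j) l) + (HSUM q. ZW (s + q) u (\<beta> e r q w) v k l)" (is ?rec)
  and ZW_null: "hnull (\<lambda>j. YA e r j (ZW (s + j) u w v k l)) UNIV" (is ?null)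
proof -
  have z: "i < 0 \<Longrightarrow> plus_coeff k i = 0" for k i by simp
  have low_A: "low (\<lambda>p l k. YA e r p (bin plus_coeff p (RR u v w) l k))"
  proof -
    have "low (\<lambda>p. bin plus_coeff p (RR u v w))"
      by (rule bin_low[where F = "\<lambda>_. RR u v w" and \<gamma> = plus_coeff, OF RR_low]) simp
    then show ?thesis
    proof (rule low_mono)
      fix p k l n assume h: "\<And>p k. bin plus_coeff p (RR u v w) k l \<in> hpow n"
      show "YA e r p (bin plus_coeff p (RR u v w) k l) \<in> hpow n" by (rule hlinear_hpow[OF hlinear_YA h])
    qed
  qed
  have low_C: "low (\<lambda>q. bin plus_coeff q (RR u v (\<beta> e r q w)))" by (rule bin_low[OF RR_\<beta>w(1) z])
  have a: "diag (\<lambda>i. plus_coeff (s - i) i) (\<lambda>l k. YA e r p (bin plus_coeff p (RR u v w) l k)) (l - s) k = YA e r p (ZW (s + p) u w v k l)" for p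
  proof -
    have "diag (\<lambda>i. plus_coeff (s - i) i) (\<lambda>l k. YA e r p (bin plus_coeff p (RR u v w) l k)) (l - s) k
        = YA e r p (diag (\<lambda>i. plus_coeff (s - i) i) (\<lambda>l k. bin plus_coeff p (RR u v w) l k) (l - s) k)"
      by (rule diag_linear[OF hlinear_YA bin_low[OF RR_low z] z])
    then show ?thesis
      using bin_bin[OF binomial_kernel_plus RR_low, of s p u v w l k] by (simp add: bin_def[of _ s] ZW_def)
  qed
  show ?null unfolding a[symmetric] by (rule diag_hsum(2)[OF low_A RR_YA_null]) simp
  have b: "diag (\<lambda>i. plus_coeff (s - i) i) (\<lambda>l k. RR u (\<beta> e r q v) w l (k - q)) (l - s) k = ZW s u w (\<beta> e r q v) (k - q) l" for q
    by (simp add: ZW_def bin_def diag_def algebra_simps)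
  have c: "diag (\<lambda>i. plus_coeff (s - i) i) (bin plus_coeff q (RR u v (\<beta> e r q w))) (l - s) k = ZW (s + q) u (\<beta> e r q w) v k l" for q
    using bin_bin[OF binomial_kernel_plus RR_low, of s q u v "\<beta> e r q w" l k] by (simp add: bin_def[of _ s] ZW_def)
  let ?d = "diag (\<lambda>i. plus_coeff (s - i) i)"
  have "?d (RR (xplus e r * u) v w) (l - s) k
      = (HSUM p. ?d (\<lambda>l k. YA e r p (bin plus_coeff p (RR u v w) l k)) (l - s) k)
      + (HSUM q. ?d (bin plus_coeff q (RR u v (\<beta> e r q w))) (l - s) k)
      + (HSUM q. ?d (\<lambda>l k. RR u (\<beta> e r q v) w l (k - q)) (l - s) k)"
    by (rule diag_hsum3[OF _ low_A RR_YA_null low_C RR_bin_null RR_\<beta>v RR_\<beta>v_null RR_rec]) simp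
  then show ?rec unfolding ZW_def[of s "xplus e r * u"] bin_def[of _ s] a b c by (simp only: add_ac)
qed

lemma XW_hpow: "w \<in> hpow n \<Longrightarrow> XW s u w v k l \<in> hpow n" "v \<in> hpow n \<Longrightarrow> XW s u w v k l \<in> hpow n"
  unfolding XW_def by (rule diag_hpow[OF \<Phi>_low], simp, erule \<Phi>_hpow)+

lemma ZW_hpow: "w \<in> hpow n \<Longrightarrow> ZW s u w v k l \<in> hpow n" "v \<in> hpow n \<Longrightarrow> ZW s u w v k l \<in> hpow n"
  unfolding ZW_def bin_def by (rule diag_hpow[OF RR_low], simp, erule RR_hpow)+

lemma XW_lin: "hlinear (\<lambda>u. XW s u w v k l)"
  unfolding XW_def diag_def
  by (intro hlinear_hsum hlinear_hscale Y_lin1 diag_null[OF \<Phi>_low]) simp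

lemma ZW_lin: "hlinear (\<lambda>u. ZW s u w v k l)"
  unfolding ZW_def bin_def diag_def
  by (intro hlinear_hsum hlinear_hscale hlinear_compose[OF Y_lin1 Y_lin1] diag_null[OF RR_low]) simp

text \<open>Against \<open>ZW_one\<close> this shows the two directions of expansion of
  \<open>(z0 + z2)^s\<close>; the values agree for \<open>s \<ge> 0\<close> by
  \<open>plus_coeff_flip\<close>.\<close>

lemma XW_one: "XW s 1 w v k l = plus_coeff k (s - k) *\<^sub>h Yv c v (l - s + k) w"
  unfolding XW_def diag_def
  by (subst hsum_single[where i = "s - k"]) (auto simp: Y_one algebra_simps)

lemma ZW_one: "ZW s 1 w v k l = plus_coeff (s - k) k *\<^sub>h Yv c v (l - s + k) w"
  unfolding ZW_def bin_def diag_def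
  by (subst hsum_single[where i = k]) (auto simp: Y_one hlinear_zero[OF Y_lin1] algebra_simps)

lemma comp_plus: "(at_plus (vop (Ym c) u) \<odot> at_snd (vop (Ym c) v)) (k, l) w = diag (plus_coeff k) (\<Phi> u v w) k l"
  by (subst comp_right_snd) (simp_all add: split_def at_plus_def vop_def Ym tensor_zero2 hlinear_zero[OF Y_lin2] diag_def)

lemma weak_associativity_Ym: "weak_associativity (Ym c :: int \<Rightarrow> 'n::finite Hplus tensor2 \<Rightarrow> _)"
  unfolding weak_associativity_def
proof (intro allI)
  fix u v w :: "'n Hplus" and n
  have "\<exists>r0\<ge>0. \<forall>r\<ge>r0. \<forall>y k l. XW r u w y k l - ZW r u w y k l \<in> hpow n"
  \<comment> \<open>Creation at \<open>z0 + z2\<close> raises the power by \<open>j\<close> and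
    leaves the first exponent alone, hence \<open>\<alpha> = 1\<close> and
    \<open>\<beta> = 0\<close>. The contraction that changes the power is the one with
    \<open>w\<close>, so \<open>w\<close> takes the role of the third argument in
    \<open>stabilise\<close>.\<close>
  proof (rule stabilise[where \<alpha> = 1 and \<beta> = 0 and B = \<beta> and C = \<beta>])
    fix r k l :: int and p y :: "'n Hplus" assume "r \<ge> 0"
    then show "XW r 1 p y k l = ZW r 1 p y k l" by (simp add: XW_one ZW_one plus_coeff_flip)
  next
    fix e :: "'n \<times> 'n" and s r k l :: int and u p y :: "'n Hplus"
    show "hnull (\<lambda>j. YA e s j (XW (r + 1 * j) u p y (k - 0 * j) l)) UNIV" using XW_null by simp
    show "hnull (\<lambda>j. YA e s j (ZW (r + 1 * j) u p y (k - 0 * j) l)) UNIV" using ZW_null by simp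
    show "XW r (xplus e s * u) p y k l = (HSUM j. YA e s j (XW (r + 1 * j) u p y (k - 0 * j) l))
      + (HSUM j. XW r u p (\<beta> e s j y) (k - j) l) + (HSUM q. XW (r + q) u (\<beta> e s q p) y k l)"
      using XW_rec by simp
    show "ZW r (xplus e s * u) p y k l = (HSUM j. YA e s j (ZW (r + 1 * j) u p y (k - 0 * j) l))
      + (HSUM j. ZW r u p (\<beta> e s j y) (k - j) l) + (HSUM q. ZW (r + q) u (\<beta> e s q p) y k l)"
      using ZW_rec by simp
  qed (simp_all add: XW_lin ZW_lin XW_hpow ZW_hpow \<beta>_null)
  then obtain r0 where r0: "r0 \<ge> 0" "\<And>r y k l. r \<ge> r0 \<Longrightarrow> XW r u w y k l - ZW r u w y k l \<in> hpow n" by blast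
  define s where "s = nat r0"
  have s: "int s = r0" using r0(1) by (simp add: s_def)
  have "(at_plus (monomial (int s)) \<odot> at_plus (vop (Ym c) u) \<odot> at_snd (vop (Ym c) v)) e w -
      (at_plus (monomial (int s)) \<odot> (\<lambda>(k, l). vop (Ym c) (vop (Ym c) u k v) l)) e w \<in> hpow n" for e
  proof -
    obtain k l where e: "e = (k, l)" by (cases e)
    \<comment> \<open>Multiplying by \<open>(z0 + z2)^s\<close> after the substitution equals
      shifting the exponent of x before it.\<close>
    have 1: "bin plus_coeff (int s) (\<lambda>k l. diag (plus_coeff k) (\<Phi> u v w) k l) k l = XW r0 u w v k l"
      unfolding bin_def XW_def s
    proof (rule diag_diag[where \<delta> = plus_coeff and \<gamma> = "\<lambda>i. plus_coeff (r0 - i) i", OF \<Phi>_low])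
      fix m and x :: "'n Hplus"
      show "(HSUM j. (plus_coeff (k - r0 + (m - j)) j * plus_coeff (r0 - (m - j)) (m - j)) *\<^sub>h x) = plus_coeff k m *\<^sub>h x"
        using plus_coeff_Vandermonde[of "k - r0 + m" r0 m x] by (simp add: algebra_simps)
    qed simp_all
    have 2: "bin plus_coeff (int s) (\<lambda>k l. RR u v w l k) k l = ZW r0 u w v k l"
    proof -
      have "bin plus_coeff r0 (\<lambda>k l. RR u v w l k) k l = 1 *\<^sub>h bin plus_coeff r0 (\<lambda>l k. RR u v w l k) l k"
        by (rule bin_flip[OF r0(1)]) (simp_all add: plus_coeff_flip[OF r0(1)])
      then show ?thesis by (simp add: s ZW_def hscale_one)
    qed
    have 3: "bin plus_coeff (int s) (\<lambda>k l. (case (k, l) of (k, l) \<Rightarrow> vop (Ym c) (vop (Ym c) u k v) l) w) k l = ZW r0 u w v k l"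
      using 2 by (simp only: prod.case vop_def Ym)
    show ?thesis unfolding e comp_monomial comp_plus 1 3 by (rule r0(2)) simp
  qed
  then show "\<exists>s. \<forall>e. (at_plus (monomial (int s)) \<odot> at_plus (vop (Ym c) u) \<odot> at_snd (vop (Ym c) v)) e w -
      (at_plus (monomial (int s)) \<odot> (\<lambda>(k, l). vop (Ym c) (vop (Ym c) u k v) l)) e w \<in> hpow n"
    by (intro exI[of _ s] allI)
qed

end

section \<open>Locality\<close>

definition psgn :: "int \<Rightarrow> complex fps"
  where "psgn k = (if even k then 1 else - 1)"

lemma psgn_nat: "k \<ge> 0 \<Longrightarrow> (- 1) ^ nat k = psgn k" "(- 1) ^ nat \<bar>k\<bar> = psgn k"
  by (simp_all add: psgn_def even_nat_iff)

lemma psgn_add: "psgn (a + b) = psgn a * psgn b"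
  by (simp add: psgn_def)

lemma psgn_square: "psgn a * psgn a = 1" "psgn a \<noteq> 0"
  by (simp_all add: psgn_def)

text \<open>For \<open>r \<ge> 0\<close> the polynomial identity
  \<open>(x - y)^r = (-1)^r (y - x)^r\<close>.\<close>

lemma minus_coeff_flip:
  assumes r: "r \<ge> 0" shows "minus_coeff k (r - k) = psgn r * minus_coeff (r - k) k"
proof -
  consider "k < 0" | "k > r" | "0 \<le> k" "k \<le> r" by linarith
  then show ?thesis
  proof cases
    case 3
    have "psgn (r - k) = psgn r * psgn k" by (simp add: psgn_def)
    then show ?thesis using 3 plus_coeff_flip[OF r, of k] by (simp add: minus_coeff_def psgn_nat mult_ac)
  qed (use r in \<open>simp_all add: minus_coeff_vanish\<close>)
qed

lemma bin_linear:
  fixes f :: "'a::hcomplete \<Rightarrow> 'b::hcomplete"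
  assumes "hlinear f" "low (\<lambda>_ :: unit. F)" "\<And>a i. i < 0 \<Longrightarrow> \<gamma> a i = 0"
  shows "bin \<gamma> q (\<lambda>k l. f (F k l)) k l = f (bin \<gamma> q F k l)"
  unfolding bin_def by (rule diag_linear[OF assms(1,2)]) (rule assms(3))

section \<open>The two orders of fields in S-locality\<close>

context
  fixes c :: complex
begin

text \<open>The iterated product on an arbitrary tensor \<open>t\<close>, as the braiding does not
  return pure tensors.\<close>

definition PS :: "int \<Rightarrow> int \<Rightarrow> 'n::finite Hplus tensor2 \<Rightarrow> 'n Hplus \<Rightarrow> 'n Hplus"
  where "PS k l t w = lift3 (\<lambda>x y z. Yv c x k (Yv c y l z)) (t \<otimes> w)"

lemma PS: "hlinear (\<lambda>t. PS k l t w)" "hlinear (PS k l t)" "PS k l (x \<otimes> y) w = Yv c x k (Yv c y l w)"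
    "hlinear (lift3 (\<lambda>x y z. Yv c x k (Yv c y l z)))"
proof -
  note l = lift3[of "\<lambda>x y z. Yv c x k (Yv c y l z)", OF Y_lin1 hlinear_compose[OF Y_lin2 Y_lin1] hlinear_compose[OF Y_lin2 Y_lin2]]
  show "hlinear (\<lambda>t. PS k l t w)" "hlinear (PS k l t)" unfolding PS_def[abs_def]
    by (rule hlinear_compose[OF l(1) hlinear_tensor1[OF hlinear_id]], rule hlinear_compose[OF l(1) hlinear_tensor2[OF hlinear_id]])
  show "PS k l (x \<otimes> y) w = Yv c x k (Yv c y l w)" "hlinear (lift3 (\<lambda>x y z. Yv c x k (Yv c y l z)))"
    unfolding PS_def by (rule l(2), rule l(1))
qed

lemma PS_low: "low (\<lambda>_ :: 'p. \<lambda>k l. PS k l t w)"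
  unfolding low_def
proof
  fix n
  have "\<exists>K. \<forall>k l. l < K \<longrightarrow> PS k l t w \<in> hpow n"
  proof (induction t rule: tensor_induct_mod[where n = n])
    case (pure x y)
    show ?case using lowD[OF \<Phi>_low[where ?'p = unit and c = c and u = x and v = y and w = w], of n] unfolding PS(3) by blast
  next
    case (plus s t)
    then obtain K K' where "\<forall>k l. l < K \<longrightarrow> PS k l s w \<in> hpow n" "\<forall>k l. l < K' \<longrightarrow> PS k l t w \<in> hpow n" by blast
    then show ?case by (intro exI[of _ "min K K'"]) (simp add: hlinear_add[OF PS(1)] hpow_add)
  next
    case (hpow t)
    then show ?case using hlinear_hpow[OF PS(1)] by blast
  qed
  then show "\<exists>K. \<forall>p k l. l < K \<longrightarrow> PS k l t w \<in> hpow n" by blast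
qed

lemma PS_YA: "low (\<lambda>j k l. YA e r j (PS (k - j) l t w))" "hnull (\<lambda>j. YA e r j (PS (k - j) l t w)) UNIV"
proof -
  show "low (\<lambda>j k l. YA e r j (PS (k - j) l t w))"
  proof (rule low_mono[OF PS_low[where t = t and w = w]])
    fix j k l n assume h: "\<And>p k. PS k l t w \<in> hpow n"
    show "YA e r j (PS (k - j) l t w) \<in> hpow n" by (rule hlinear_hpow[OF hlinear_YA h])
  qed
  show "hnull (\<lambda>j. YA e r j (PS (k - j) l t w)) UNIV"
    by (rule hnull_YA, rule in_laurent_tensor[OF PS(1)]) (simp add: PS(3) Y_laurent)
qed

lemma PS_\<beta>w: "low (\<lambda>j k l. PS (k - j) l t (\<beta> c e r j w))" "hnull (\<lambda>j. PS (k - j) l t (\<beta> c e r j w)) UNIV"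
proof -
  show "low (\<lambda>j k l. PS (k - j) l t (\<beta> c e r j w))"
  proof (rule low_family[OF \<beta>_null])
    fix p show "low (\<lambda>_ :: unit. \<lambda>k l. PS (k - p) l t (\<beta> c e r p w))" by (rule low_mono[OF PS_low]) assumption
  qed (erule hlinear_hpow[OF PS(2)])
  show "hnull (\<lambda>j. PS (k - j) l t (\<beta> c e r j w)) UNIV"
    by (rule hnull_dominated[OF \<beta>_null]) (erule hlinear_hpow[OF PS(2)])
qed

lemma PS_family: "hnull y UNIV \<Longrightarrow> low (\<lambda>q k l. PS k l (y q) w)"
  by (rule low_family, assumption, erule hlinear_hpow[OF PS(1)], rule PS_low)

definition PB :: "int \<Rightarrow> int \<Rightarrow> int \<Rightarrow> 'n::finite Hplus tensor2 \<Rightarrow> 'n Hplus \<Rightarrow> 'n Hplus"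
  where "PB q k l t w = bin minus_coeff q (\<lambda>k l. PS k l t w) k l"

lemma PB_lin: "hlinear (\<lambda>t. PB q k l t w)" "hlinear (PB q k l t)"
proof -
  show "hlinear (\<lambda>t. PB q k l t w)" unfolding PB_def bin_def diag_def
    by (intro hlinear_hsum hlinear_hscale PS(1) diag_null[OF PS_low]) simp
  have "hlinear (\<lambda>w. PB q k l t w)" unfolding PB_def bin_def diag_def
    by (intro hlinear_hsum hlinear_hscale PS(2) diag_null[OF PS_low]) simp
  then show "hlinear (PB q k l t)" by simp
qed

lemma PB_null: "hnull y UNIV \<Longrightarrow> hnull (\<lambda>q. PB (h q) k l (y q) w) UNIV"
  by (rule hnull_dominated, assumption) (erule hlinear_hpow[OF PB_lin(1)])

lemma PB_low: "hnull y UNIV \<Longrightarrow> low (\<lambda>q k l. PB (h q) k l (y q) w)"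
  unfolding PB_def by (rule bin_low[OF PS_family]) simp_all

lemma PB_PB: "bin minus_coeff p (\<lambda>k l. PB q k l t w) k l = PB (p + q) k l t w"
  unfolding PB_def by (rule bin_bin[OF binomial_kernel_minus PS_low])

lemma \<beta>_sl2: "hlinear (sl2 (\<beta> c e r q))" "hnull (\<lambda>q. sl2 (\<beta> c e r q) t) UNIV"
  by (rule sl2(1)[OF \<beta>_lin], rule hnull_sl2[OF \<beta>_lin \<beta>_null])

lemma PS_rec: "PS k l (sl1 ((*) (xplus e r)) t) w = (HSUM j. YA e r j (PS (k - j) l t w))
    + (HSUM j. PS (k - j) l t (\<beta> c e r j w)) + (HSUM q. PB q k l (sl2 (\<beta> c e r q) t) w)"
proof (rule tensor_eqI[OF hlinear_compose[OF PS(1) sl1(1)[OF hlinear_x]]])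
  show "hlinear (\<lambda>t. (HSUM j. YA e r j (PS (k - j) l t w))
    + (HSUM j. PS (k - j) l t (\<beta> c e r j w)) + (HSUM q. PB q k l (sl2 (\<beta> c e r q) t) w))"
    by (intro hlinear_plus hlinear_hsum PS_YA PS_\<beta>w PB_null \<beta>_sl2 hlinear_compose[OF hlinear_YA PS(1)] PS(1)
        hlinear_compose[OF PB_lin(1) \<beta>_sl2(1)])
  fix x y
  show "PS k l (sl1 ((*) (xplus e r)) (x \<otimes> y)) w = (HSUM j. YA e r j (PS (k - j) l (x \<otimes> y) w))
    + (HSUM j. PS (k - j) l (x \<otimes> y) (\<beta> c e r j w)) + (HSUM q. PB q k l (sl2 (\<beta> c e r q) (x \<otimes> y)) w)"
    unfolding sl1(2)[OF hlinear_x] sl2(2)[OF \<beta>_lin] PB_def PS(3) by (rule \<Phi>_rec)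
qed

lemma PB_YA: "bin minus_coeff p (\<lambda>k l. YA e r j (PS (k - j) l t w)) k l = YA e r j (PB p (k - j) l t w)"
  and PB_YA_null: "hnull (\<lambda>j. YA e r j (PB p (k - j) l t w)) UNIV"
proof -
  have 1: "bin minus_coeff p (\<lambda>k l. YA e r j (PS (k - j) l t w)) k l = YA e r j (PB p (k - j) l t w)" for j k
  proof -
    have "bin minus_coeff p (\<lambda>k l. YA e r j (PS (k - j) l t w)) k l = YA e r j (bin minus_coeff p (\<lambda>k l. PS (k - j) l t w) k l)"
      by (rule bin_linear[OF hlinear_YA]) (rule low_mono[OF PS_low], assumption, simp)
    then show ?thesis by (simp add: PB_def bin_def diag_shift[where F = "\<lambda>k l. PS k l t w"] algebra_simps)
  qed
  then show "bin minus_coeff p (\<lambda>k l. YA e r j (PS (k - j) l t w)) k l = YA e r j (PB p (k - j) l t w)" .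
  show "hnull (\<lambda>j. YA e r j (PB p (k - j) l t w)) UNIV"
    unfolding 1[symmetric] bin_def by (rule diag_hsum(2)[OF PS_YA]) simp
qed

lemma PB_rec: "PB p k l (sl1 ((*) (xplus e r)) t) w = (HSUM j. YA e r j (PB p (k - j) l t w))
    + (HSUM j. PB p (k - j) l t (\<beta> c e r j w)) + (HSUM q. PB (p + q) k l (sl2 (\<beta> c e r q) t) w)"
proof -
  have b: "bin minus_coeff p (\<lambda>k l. PS (k - j) l t (\<beta> c e r j w)) k l = PB p (k - j) l t (\<beta> c e r j w)" for j
    by (simp add: PB_def bin_def diag_shift[where F = "\<lambda>k l. PS k l t (\<beta> c e r j w)"] algebra_simps)
  have "bin minus_coeff p (\<lambda>k l. PS k l (sl1 ((*) (xplus e r)) t) w) k l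
      = (HSUM j. bin minus_coeff p (\<lambda>k l. YA e r j (PS (k - j) l t w)) k l)
      + (HSUM j. bin minus_coeff p (\<lambda>k l. PS (k - j) l t (\<beta> c e r j w)) k l)
      + (HSUM q. bin minus_coeff p (\<lambda>k l. PB q k l (sl2 (\<beta> c e r q) t) w) k l)"
    unfolding bin_def
    by (rule diag_hsum3[OF _ PS_YA PS_\<beta>w PB_low[OF \<beta>_sl2(2)] PB_null[OF \<beta>_sl2(2)]]) (simp_all add: PS_rec)
  then show ?thesis unfolding PB_YA b PB_PB by (simp only: PB_def[symmetric])
qed

text \<open>The braided product multiplied by \<open>(z1 - z2)^r\<close>: the exponent
  \<open>m\<close> of the braiding is added to \<open>r\<close>, since both are powers of
  \<open>z1 - z2\<close>.\<close>

definition XL :: "int \<Rightarrow> 'n::finite Hplus \<Rightarrow> 'n Hplus \<Rightarrow> 'n Hplus \<Rightarrow> int \<Rightarrow> int \<Rightarrow> 'n Hplus"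
  where "XL r u v w k l = (HSUM m. PB (r + m) k l (Sv c u m v) w)"

lemma S_null: "hnull (\<lambda>m. Sv c u m v) UNIV"
  using hnull_negative[OF Bm_negative, of c "u \<otimes> v"] by (simp add: Bm)

lemma XL_null: "hnull (\<lambda>m. PB (r + m) k l (Sv c u m v) w) UNIV"
  by (rule PB_null[OF S_null])

lemma XL_lin: "hlinear (\<lambda>u. XL r u v w k l)" "hlinear (\<lambda>v. XL r u v w k l)" "hlinear (\<lambda>w. XL r u v w k l)"
  unfolding XL_def
  by (intro hlinear_hsum XL_null hlinear_compose[OF PB_lin(1) S_lin1] hlinear_compose[OF PB_lin(1) S_lin2] PB_lin(2))+

text \<open>Contraction by \<open>- S(z) + T(z) = - S(-z)\<close>, the kernel that appears when the
  fields stand in the opposite order.\<close>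

definition cop :: "'n::finite \<times> 'n \<Rightarrow> int \<Rightarrow> int \<Rightarrow> 'n Hplus \<Rightarrow> 'n Hplus"
  where "cop e r q v = \<beta> c e r q v + dop (Tser c) e r q v"

lemma cop_null: "hnull (\<lambda>q. cop e r q v) UNIV"
  unfolding cop_def by (rule hnull_add[OF \<beta>_null hnull_dop[OF pairing_kernel_T]])

lemma XL_rec: "XL r (xplus e s * u) v w k l = (HSUM j. YA e s j (XL r u v w (k - j) l))
    + (HSUM j. XL r u v (\<beta> c e s j w) (k - j) l) + (HSUM q. XL (r + q) u (cop e s q v) w k l)" (is ?rec)
  and XL_YA_null: "hnull (\<lambda>j. YA e s j (XL r u v w (k - j) l)) UNIV" (is ?null)
proof -
  \<comment> \<open>The four effects of a generator of \<open>u\<close>: creation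
    (\<open>fa\<close>), contraction with \<open>w\<close> (\<open>fb\<close>), contraction with
    \<open>v\<close> in the product of fields (\<open>fc\<close>) and contraction with
    \<open>v\<close> in the braiding (\<open>fd\<close>). The last two combine to
    \<open>cop\<close>.\<close>
  define fa where "fa m j = YA e s j (PB (r + m) (k - j) l (Sv c u m v) w)" for m j
  define fb where "fb m j = PB (r + m) (k - j) l (Sv c u m v) (\<beta> c e s j w)" for m j
  define fc where "fc m q = PB (r + m + q) k l (sl2 (\<beta> c e s q) (Sv c u m v)) w" for m q
  define fd where "fd m q = PB (r + m) k l (Sv c u (m - q) (dop (Tser c) e s q v)) w" for m q
  have na: "hnull (\<lambda>(m, j). fa m j) UNIV"
    unfolding fa_def
    by (rule hnull_pairI[OF PB_YA_null S_null]) (erule hlinear_hpow[OF hlinear_compose[OF hlinear_YA PB_lin(1)]])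
  have nb: "hnull (\<lambda>(m, j). fb m j) UNIV"
    unfolding fb_def
    by (rule hnull_pairI[OF hnull_dominated[OF \<beta>_null] S_null])
      (erule hlinear_hpow[OF PB_lin(2)], erule hlinear_hpow[OF PB_lin(1)])
  have nc: "hnull (\<lambda>(m, q). fc m q) UNIV"
    unfolding fc_def
    by (rule hnull_pairI[OF PB_null[OF \<beta>_sl2(2)] S_null]) (erule hlinear_hpow[OF hlinear_compose[OF PB_lin(1) \<beta>_sl2(1)]])
  have nd': "hnull (\<lambda>(q, m). fd m q) UNIV"
  proof (unfold fd_def, rule hnull_pairI[OF PB_null hnull_dop[OF pairing_kernel_T]])
    show "hnull (\<lambda>m. Sv c u (m - q) (dop (Tser c) e s q v)) UNIV" for q
      using hnull_shift[of "\<lambda>m. Sv c u m (dop (Tser c) e s q v)" "- q"] S_null by simp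
  qed (erule hlinear_hpow[OF hlinear_compose[OF PB_lin(1) S_lin2]])
  have nd: "hnull (\<lambda>(m, q). fd m q) UNIV" using nd' by (rule hnull_pair_swap[THEN iffD2])
  have swap: "(HSUM m. hsum (f m) UNIV) = (HSUM j. (HSUM m. f m j))"
    if "hnull (\<lambda>(m, j). f m j) UNIV" for f :: "int \<Rightarrow> int \<Rightarrow> 'a Hplus"
    by (rule hsum_swap_UNIV[OF that])
  have a: "(HSUM m. fa m j) = YA e s j (XL r u v w (k - j) l)" for j
    unfolding fa_def XL_def by (rule hsum_linear[OF hlinear_YA XL_null, symmetric])
  show ?null unfolding a[symmetric]
    using na unfolding hnull_pair_swap[of fa] by (rule hnull_hsum_pair(1))
  have b: "(HSUM m. fb m j) = XL r u v (\<beta> c e s j w) (k - j) l" for j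
    unfolding fb_def XL_def ..
  have cd: "(HSUM m. fc m q) + (HSUM m. fd m q) = XL (r + q) u (cop e s q v) w k l" for q
  proof -
    have "(HSUM m. fc m q) = XL (r + q) u (\<beta> c e s q v) w k l"
      unfolding fc_def XL_def dop_def S_derv2[OF tracefree_ker[OF pairing_negS]] by (simp add: add_ac)
    moreover have "(HSUM m. fd m q) = XL (r + q) u (dop (Tser c) e s q v) w k l"
      using hsum_shift[of "\<lambda>m. fd m q" q] unfolding fd_def XL_def by (simp add: add_ac)
    ultimately show ?thesis by (simp add: cop_def hlinear_add[OF XL_lin(2)])
  qed
  have "PB (r + m) k l (Sv c (xplus e s * u) m v) w = hsum (fa m) UNIV + hsum (fb m) UNIV + hsum (fc m) UNIV + hsum (fd m) UNIV" for m
    unfolding S_step hlinear_add[OF PB_lin(1)] PB_rec hsum_linear[OF PB_lin(1) S_hnull(2)] fa_def fb_def fc_def fd_def ..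
  then have "XL r (xplus e s * u) v w k l = (HSUM m. hsum (fa m) UNIV) + (HSUM m. hsum (fb m) UNIV)
      + ((HSUM m. hsum (fc m) UNIV) + (HSUM m. hsum (fd m) UNIV))"
    unfolding XL_def
    by (simp add: hsum_add hnull_add hnull_hsum_pair(1)[OF na] hnull_hsum_pair(1)[OF nb] hnull_hsum_pair(1)[OF nc]
        hnull_hsum_pair(1)[OF nd] add.assoc)
  also have "(HSUM m. hsum (fc m) UNIV) + (HSUM m. hsum (fd m) UNIV) = (HSUM q. XL (r + q) u (cop e s q v) w k l)"
  proof -
    have "hnull (\<lambda>q. (HSUM m. fc m q)) UNIV" using nc unfolding hnull_pair_swap[of fc] by (rule hnull_hsum_pair(1))
    moreover have "hnull (\<lambda>q. (HSUM m. fd m q)) UNIV" by (rule hnull_hsum_pair(1)[OF nd'])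
    ultimately show ?thesis unfolding swap[OF nc] swap[OF nd] cd[symmetric] by (rule hsum_add[symmetric])
  qed
  finally show ?rec unfolding swap[OF na] swap[OF nb] a b .
qed

abbreviation (input) QQ :: "'n::finite Hplus \<Rightarrow> 'n Hplus \<Rightarrow> 'n Hplus \<Rightarrow> int \<Rightarrow> int \<Rightarrow> 'n Hplus"
  where "QQ u v w l k \<equiv> Yv c v l (Yv c u k w)"

lemma QQ_hpow: "v \<in> hpow n \<Longrightarrow> QQ u v w l k \<in> hpow n" "w \<in> hpow n \<Longrightarrow> QQ u v w l k \<in> hpow n"
  by (rule hlinear_hpow[OF Y_lin1], assumption) (intro hlinear_hpow[OF Y_lin2], assumption)

lemma QQ_low: "low (\<lambda>_ :: 'p. QQ u v w)"
  by (rule \<Phi>_low)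

text \<open>Symmetry of S turns the contraction at \<open>z2 + v - (z1 + u)\<close> into the kernel
  of \<open>cop\<close> at \<open>z1 - z2 + u - v\<close>. Here \<open>i\<close> and
  \<open>j\<close> are the exponents of \<open>z2\<close> and \<open>z1\<close>, and
  \<open>psgn (i + j)\<close> converts the power of \<open>z2 - z1\<close> into one of
  \<open>z1 - z2\<close>, still expanded in nonnegative powers of \<open>z1\<close>.\<close>

lemma ker_opposite: "plus_coeff j r * ker (negS c) f s i e (j + r) =
    (minus_coeff i j * psgn (i + j)) * (ker (negS c) e r (i + j) f s + ker (Tser c) e r (i + j) f s)"
proof -
  consider "r < 0 \<or> s < 0" | "j < 0" "r \<ge> 0" "s \<ge> 0" | "j \<ge> 0" "r \<ge> 0" "s \<ge> 0" by linarith
  then show ?thesis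
  proof cases
    case 1
    then show ?thesis by (auto simp: ker_vanish[OF pairing_kernel_T] ker_vanish[OF pairing_negS])
  next
    case 2
    then show ?thesis by (cases "j + r < 0") (simp_all add: ker_vanish[OF pairing_negS] plus_coeff_vanish)
  next
    case 3
    have "plus_coeff j r * (plus_coeff i s * plus_coeff (i + s) (j + r)) =
        plus_coeff i s * (plus_coeff (i + s) (j + r) * plus_coeff j r)" by (simp only: mult_ac)
    also have "\<dots> = plus_coeff (i + j + s) r * (plus_coeff (i + s) j * plus_coeff i s)"
    proof -
      have "i + s + j = i + j + s" by simp
      then show ?thesis unfolding plus_coeff_multinomial by (simp only: mult_ac)
    qed
    also have "\<dots> = (plus_coeff (i + j + s) r * plus_coeff (i + j) s) * plus_coeff i j"
      unfolding plus_coeff_swap[OF 3(1), of i s] by (simp only: mult_ac)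
    also have "\<dots> = plus_coeff i j * (plus_coeff (i + j) r * plus_coeff (i + j + r) s)"
      unfolding plus_coeff_swap[OF 3(2)] by (simp only: mult_ac)
    finally have *: "plus_coeff j r * (plus_coeff i s * plus_coeff (i + s) (j + r)) =
        plus_coeff i j * (plus_coeff (i + j) r * plus_coeff (i + j + r) s)" .
    have sg: "psgn (j + r) = psgn j * psgn (i + j) * psgn s * psgn (i + j + r + s)"
      by (simp add: psgn_def)
    have m: "i + s + (j + r) = i + j + r + s" by simp
    have "plus_coeff j r * ker (negS c) f s i e (j + r) =
        - (plus_coeff j r * (plus_coeff i s * plus_coeff (i + s) (j + r))) * (psgn (j + r) * Sser c e f (i + j + r + s))"
      using 3 by (simp add: ker_def minus_coeff_def psgn_nat negS_def Sser_sym[of c f e] m mult_ac)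
    also have "\<dots> = (minus_coeff i j * psgn (i + j)) * (plus_coeff (i + j) r * minus_coeff (i + j + r) s)
        * - (psgn (i + j + r + s) * Sser c e f (i + j + r + s))"
      unfolding * sg using 3 by (simp add: minus_coeff_def psgn_nat mult_ac)
    also have "- (psgn (i + j + r + s) * Sser c e f (i + j + r + s)) = negS c e f (i + j + r + s) + Tser c e f (i + j + r + s)"
      by (simp add: negS_def Tser_def psgn_nat)
    finally show ?thesis by (simp add: ker_def distrib_left mult.assoc)
  qed
qed

text \<open>The creation operator of the inner field passes through \<open>Y(v, z2)\<close> at the
  cost of the contraction \<open>cop\<close>; this matches the sum of -S and T on the braided
  side.\<close>

lemma Y_YA: "Yv c v l (YA e r j y) = YA e r j (Yv c v l y)
    + (HSUM i. minus_coeff i j *\<^sub>h (psgn (i + j) *\<^sub>h Yv c (cop e r (i + j) v) (l - i) y))"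
proof -
  have d: "plus_coeff j r *\<^sub>h derv (\<lambda>f s. ker (negS c) f s i e (j + r)) v = (minus_coeff i j * psgn (i + j)) *\<^sub>h cop e r (i + j) v" for i
  proof -
    note t1 = tracefree_ker[OF pairing_negS, of c e r "i + j"] and t2 = tracefree_ker[OF pairing_kernel_T, of c e r "i + j"]
    have "plus_coeff j r *\<^sub>h derv (\<lambda>f s. ker (negS c) f s i e (j + r)) v
        = derv (\<lambda>f s. (minus_coeff i j * psgn (i + j)) * (ker (negS c) e r (i + j) f s + ker (Tser c) e r (i + j) f s)) v"
      unfolding derv_scale[OF tracefree_ker1[OF pairing_negS], symmetric] ker_opposite ..
    also have "\<dots> = (minus_coeff i j * psgn (i + j)) *\<^sub>h (derv (ker (negS c) e r (i + j)) v + derv (ker (Tser c) e r (i + j)) v)"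
      unfolding derv_scale[OF tracefree_add[OF t1 t2]] derv_add[OF t1 t2] ..
    finally show ?thesis by (simp add: cop_def dop_def)
  qed
  have "Yv c v l (YA e r j y) = plus_coeff j r *\<^sub>h Yv c v l (xplus e (j + r) * y)"
    by (simp add: YA_def hlinear_scale[OF Y_lin2])
  also have "\<dots> = YA e r j (Yv c v l y) + (HSUM i. Yv c (plus_coeff j r *\<^sub>h derv (\<lambda>f s. ker (negS c) f s i e (j + r)) v) (l - i) y)"
    unfolding Y_x(1) hscale_right_distrib hsum_scale[OF Y_x(2)] hlinear_scale[OF Y_lin1] YA_def ..
  finally show ?thesis unfolding d hlinear_scale[OF Y_lin1] by (simp add: hscale_hscale)
qed

lemma QQ_YA: "low (\<lambda>j l k. YA e r j (QQ u v w l (k - j)))" "hnull (\<lambda>j. YA e r j (QQ u v w l (k - j))) UNIV"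
proof -
  show "low (\<lambda>j l k. YA e r j (QQ u v w l (k - j)))"
    unfolding low_def
  proof
    fix n
    obtain K where K: "\<And>l k. k < K \<Longrightarrow> QQ u v w l k \<in> hpow n"
      using lowD[OF QQ_low[where ?'p = unit and u = u and v = v and w = w], of n] by blast
    have "YA e r j (QQ u v w l (k - j)) \<in> hpow n" if "k < K" for j l k
    proof (cases "j < 0")
      case False
      then show ?thesis using that by (intro hlinear_hpow[OF hlinear_YA] K) simp
    qed (simp add: YA_vanish hpow_zero)
    then show "\<exists>K. \<forall>j l k. k < K \<longrightarrow> YA e r j (QQ u v w l (k - j)) \<in> hpow n" by blast
  qed
  show "hnull (\<lambda>j. YA e r j (QQ u v w l (k - j))) UNIV"
  proof (rule hnull_YA)
    show "in_laurent (QQ u v w l)"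
      unfolding in_laurent_def using in_laurentD[OF Y_laurent] hlinear_hpow[OF Y_lin2] by meson
  qed
qed

lemma QQ_\<beta>w: "low (\<lambda>j l k. QQ u v (\<beta> c e r j w) l (k - j))" "hnull (\<lambda>j. QQ u v (\<beta> c e r j w) l (k - j)) UNIV"
  by (rule low_family[OF \<beta>_null], erule QQ_hpow, rule low_shift, rule QQ_low)
    (rule hnull_dominated[OF \<beta>_null], erule QQ_hpow)

lemma QQ_cop: "low (\<lambda>q l k. psgn q *\<^sub>h QQ u (cop e r q v) w l k)"
  "finite {q. \<exists>l k. psgn q *\<^sub>h QQ u (cop e r q v) w l k \<notin> hpow n}"
proof -
  show "low (\<lambda>q l k. psgn q *\<^sub>h QQ u (cop e r q v) w l k)"
  proof (rule low_family[OF cop_null])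
    fix q show "low (\<lambda>_ :: unit. \<lambda>l k. psgn q *\<^sub>h QQ u (cop e r q v) w l k)"
      by (rule low_mono[OF QQ_low[where u = u and v = "cop e r q v" and w = w]]) (rule hpow_scale)
  qed (intro hpow_scale, erule QQ_hpow)
  show "finite {q. \<exists>l k. psgn q *\<^sub>h QQ u (cop e r q v) w l k \<notin> hpow n}"
    by (rule finite_hpow[OF cop_null]) (intro hpow_scale, erule QQ_hpow)
qed

lemma bin_psgn: "bin minus_coeff p (\<lambda>l k. a *\<^sub>h QQ u v w l k) l k = a *\<^sub>h bin minus_coeff p (QQ u v w) l k"
  by (rule bin_linear[OF hlinear_hscale[OF hlinear_id] QQ_low]) simp

lemma QQ_rec: "QQ (xplus e r * u) v w l k = (HSUM j. YA e r j (QQ u v w l (k - j)))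
    + (HSUM j. QQ u v (\<beta> c e r j w) l (k - j))
    + (HSUM q. psgn q *\<^sub>h bin minus_coeff q (QQ u (cop e r q v) w) l k)" (is ?rec)
  and QQ_bin_null: "hnull (\<lambda>q. psgn q *\<^sub>h bin minus_coeff q (QQ u (cop e r q v) w) l k) UNIV" (is ?null)
proof -
  have "hnull (\<lambda>(q, j). minus_coeff (q - j) j *\<^sub>h (psgn q *\<^sub>h QQ u (cop e r q v) w (l - q + j) (k - j))) UNIV"
    by (rule null_pairs[where F = "\<lambda>q l k. psgn q *\<^sub>h QQ u (cop e r q v) w l k", OF QQ_cop]) simp
  note re = bin_reindex[where \<gamma> = minus_coeff and F = "\<lambda>q l k. psgn q *\<^sub>h QQ u (cop e r q v) w l k", OF this, unfolded bin_psgn]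
  show ?null by (rule re(4))
  have "Yv c v l (Yv c (xplus e r * u) k w) = (HSUM j. Yv c v l (YA e r j (Yv c u (k - j) w)))
      + (HSUM j. QQ u v (\<beta> c e r j w) l (k - j))"
    unfolding Y_step[of c e r u k w] hlinear_add[OF Y_lin2] hsum_linear[OF Y_lin2 Y_hnull(1)] hsum_linear[OF Y_lin2 Y_hnull(2)] ..
  also have "(HSUM j. Yv c v l (YA e r j (Yv c u (k - j) w))) = (HSUM j. YA e r j (QQ u v w l (k - j)))
      + (HSUM q. psgn q *\<^sub>h bin minus_coeff q (QQ u (cop e r q v) w) l k)"
    unfolding Y_YA hsum_add[OF QQ_YA(2) hnull_hsum_pair(1)[OF re(1)]] re(2) ..
  finally show ?rec by (simp only: add_ac)
qed

text \<open>The opposite product multiplied by \<open>(z1 - z2)^r\<close>, written as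
  \<open>(-1)^r (z2 - z1)^r\<close> because it is expanded in nonnegative powers of
  \<open>z1\<close>.\<close>

definition ZL :: "int \<Rightarrow> 'n::finite Hplus \<Rightarrow> 'n Hplus \<Rightarrow> 'n Hplus \<Rightarrow> int \<Rightarrow> int \<Rightarrow> 'n Hplus"
  where "ZL r u v w k l = psgn r *\<^sub>h bin minus_coeff r (QQ u v w) l k"

lemma ZL_rec: "ZL r (xplus e s * u) v w k l = (HSUM j. YA e s j (ZL r u v w (k - j) l))
    + (HSUM j. ZL r u v (\<beta> c e s j w) (k - j) l) + (HSUM q. ZL (r + q) u (cop e s q v) w k l)" (is ?rec)
  and ZL_YA_null: "hnull (\<lambda>j. YA e s j (ZL r u v w (k - j) l)) UNIV" (is ?null)
proof -
  have a: "psgn r *\<^sub>h bin minus_coeff r (\<lambda>l k. YA e s j (QQ u v w l (k - j))) l k = YA e s j (ZL r u v w (k - j) l)" for j k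
  proof -
    have "bin minus_coeff r (\<lambda>l k. YA e s j (QQ u v w l (k - j))) l k = YA e s j (bin minus_coeff r (\<lambda>l k. QQ u v w l (k - j)) l k)"
      by (rule bin_linear[OF hlinear_YA]) (rule low_shift, rule QQ_low, simp)
    then show ?thesis by (simp add: ZL_def bin_def diag_def hlinear_scale[OF hlinear_YA] algebra_simps)
  qed
  have b: "psgn r *\<^sub>h bin minus_coeff r (\<lambda>l k. QQ u v (\<beta> c e s j w) l (k - j)) l k = ZL r u v (\<beta> c e s j w) (k - j) l" for j
    by (simp add: ZL_def bin_def diag_def algebra_simps)
  have c: "psgn r *\<^sub>h bin minus_coeff r (\<lambda>l k. psgn q *\<^sub>h bin minus_coeff q (QQ u (cop e s q v) w) l k) l k = ZL (r + q) u (cop e s q v) w k l" for q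
  proof -
    have "bin minus_coeff r (\<lambda>l k. psgn q *\<^sub>h bin minus_coeff q (QQ u (cop e s q v) w) l k) l k
        = psgn q *\<^sub>h bin minus_coeff r (\<lambda>l k. bin minus_coeff q (QQ u (cop e s q v) w) l k) l k"
      by (rule bin_linear[OF hlinear_hscale[OF hlinear_id] bin_low[OF QQ_low]]) simp_all
    then show ?thesis
      using bin_bin[OF binomial_kernel_minus QQ_low[where u = u and v = "cop e s q v" and w = w], of r q l k]
      by (simp add: ZL_def hscale_hscale psgn_add)
  qed
  have low_C: "low (\<lambda>q l k. psgn q *\<^sub>h bin minus_coeff q (QQ u (cop e s q v) w) l k)"
    unfolding bin_psgn[symmetric] by (rule bin_low[OF QQ_cop(1)]) simp
  have n: "hnull (\<lambda>j. bin minus_coeff r (\<lambda>l k. YA e s j (QQ u v w l (k - j))) l k) UNIV"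
    "hnull (\<lambda>j. bin minus_coeff r (\<lambda>l k. QQ u v (\<beta> c e s j w) l (k - j)) l k) UNIV"
    "hnull (\<lambda>q. bin minus_coeff r (\<lambda>l k. psgn q *\<^sub>h bin minus_coeff q (QQ u (cop e s q v) w) l k) l k) UNIV"
    unfolding bin_def[of _ r]
    by (rule diag_hsum(2)[OF QQ_YA], simp, rule diag_hsum(2)[OF QQ_\<beta>w], simp, rule diag_hsum(2)[OF low_C QQ_bin_null], simp)
  show ?null unfolding a[symmetric] by (rule hnull_scale[OF n(1)])
  have "bin minus_coeff r (QQ (xplus e s * u) v w) l k
      = (HSUM j. bin minus_coeff r (\<lambda>l k. YA e s j (QQ u v w l (k - j))) l k)
      + (HSUM j. bin minus_coeff r (\<lambda>l k. QQ u v (\<beta> c e s j w) l (k - j)) l k)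
      + (HSUM q. bin minus_coeff r (\<lambda>l k. psgn q *\<^sub>h bin minus_coeff q (QQ u (cop e s q v) w) l k) l k)"
    unfolding bin_def[of _ r]
    by (rule diag_hsum3[OF _ QQ_YA QQ_\<beta>w low_C QQ_bin_null QQ_rec]) simp
  then show ?rec
    unfolding ZL_def[of r "xplus e s * u"]
    by (simp only: hscale_right_distrib hsum_scale[OF n(1)] hsum_scale[OF n(2)] hsum_scale[OF n(3)] a b c)
qed

lemma ZL_lin: "hlinear (\<lambda>u. ZL r u v w k l)"
  unfolding ZL_def bin_def diag_def
  by (intro hlinear_hscale hlinear_hsum hlinear_compose[OF Y_lin2 Y_lin1] diag_null[OF QQ_low]) simp

lemma ZL_hpow: "v \<in> hpow n \<Longrightarrow> ZL r u v w k l \<in> hpow n" "w \<in> hpow n \<Longrightarrow> ZL r u v w k l \<in> hpow n"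
  unfolding ZL_def bin_def by (rule hpow_scale, rule diag_hpow[OF QQ_low], simp, erule QQ_hpow)+

lemma XL_one: "XL r 1 v w k l = minus_coeff k (r - k) *\<^sub>h Yv c v (l - r + k) w"
proof -
  have "XL r 1 v w k l = PB (r + 0) k l (Sv c 1 0 v) w"
    unfolding XL_def by (rule hsum_single) (simp_all add: S_one hlinear_zero[OF PB_lin(1)])
  also have "\<dots> = minus_coeff k (r - k) *\<^sub>h Yv c v (l - r + k) w"
    unfolding PB_def bin_def diag_def
    by (subst hsum_single[where i = "r - k"]) (auto simp: S_one PS(3) Y_one algebra_simps)
  finally show ?thesis .
qed

lemma ZL_one: "ZL r 1 v w k l = psgn r *\<^sub>h minus_coeff (r - k) k *\<^sub>h Yv c v (l - r + k) w"
  unfolding ZL_def bin_def diag_def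
  by (subst hsum_single[where i = k]) (auto simp: Y_one hlinear_zero[OF Y_lin2] algebra_simps)

lemma comp_lift3: "((\<lambda>(k, l). lift3 (\<lambda>x y z. vop (Ym c) x k (vop (Ym c) y l z))) \<odot> at_minus (\<lambda>k w. Bm c k (u \<otimes> v) \<otimes> w)) (k, l) w
    = XL 0 u v w k l"
proof -
  define f where "f m i = minus_coeff (m - i) i *\<^sub>h PS (k - m + i) (l - i) (Sv c u m v) w" for m i
  have n: "hnull (\<lambda>(m, i). f m i) UNIV"
    unfolding f_def by (rule null_pairs[OF PS_family[OF S_null] finite_hpow[OF S_null]]) (erule hlinear_hpow[OF PS(1)], simp)
  have bij: "bij_betw (\<lambda>(m, i). (k - m + i, l - i)) UNIV UNIV"
    by (rule bij_betw_byWitness[where f' = "\<lambda>(a, b). (k - a + l - b, l - b)"]) auto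
  have "((\<lambda>(k, l). lift3 (\<lambda>x y z. vop (Ym c) x k (vop (Ym c) y l z))) \<odot> at_minus (\<lambda>k w. Bm c k (u \<otimes> v) \<otimes> w)) (k, l) w
      = hsum (\<lambda>(a, b). minus_coeff (k - a) (l - b) *\<^sub>h PS a b (Sv c u (k - a + (l - b)) v) w) UNIV"
    unfolding series_comp_def
    by (rule hsum_cong[OF refl]) (auto simp: at_minus_def vop_def Ym Bm PS_def hlinear_scale[OF PS(4)])
  also have "\<dots> = (HSUM x. (case (case x of (m, i) \<Rightarrow> (k - m + i, l - i)) of (a, b) \<Rightarrow>
      minus_coeff (k - a) (l - b) *\<^sub>h PS a b (Sv c u (k - a + (l - b)) v) w))"
    by (rule hsum_bij[OF bij])
  also have "\<dots> = hsum (\<lambda>(m, i). f m i) UNIV"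
    by (rule hsum_cong[OF refl]) (auto simp: f_def)
  also have "\<dots> = (HSUM m. hsum (f m) UNIV)"
    using hsum_Sigma(1)[of f UNIV "\<lambda>_. UNIV"] n by simp
  also have "\<dots> = XL 0 u v w k l"
    unfolding XL_def PB_def bin_def diag_def f_def by simp
  finally show ?thesis .
qed

lemma bin_XL: "bin minus_coeff r (XL 0 u v w) k l = XL r u v w k l"
proof -
  have "bin minus_coeff r (\<lambda>k l. (HSUM m. PB (0 + m) k l (Sv c u m v) w)) k l
      = (HSUM m. bin minus_coeff r (\<lambda>k l. PB (0 + m) k l (Sv c u m v) w) k l)"
    unfolding bin_def by (rule diag_hsum(1)[OF PB_low[OF S_null] XL_null]) simp
  then show ?thesis unfolding PB_PB XL_def[abs_def] by simp
qed

lemma S_locality_Bm: "S_locality (Ym c) (Bm c :: int \<Rightarrow> 'n::finite Hplus tensor2 \<Rightarrow> _)"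
  unfolding S_locality_def
proof (intro allI)
  fix u v :: "'n Hplus" and n
  have "\<exists>r0\<ge>0. \<forall>r\<ge>r0. \<forall>y k l. XL r u v y k l - ZL r u v y k l \<in> hpow n"
  \<comment> \<open>Creation at \<open>z1\<close> now shifts the exponent of \<open>z1\<close> and
    leaves the power alone. The bound depends on \<open>u\<close> and \<open>v\<close> only and is
    uniform in the vector \<open>w\<close>, as the order of quantifiers in locality demands.\<close>
  proof (rule stabilise[where \<alpha> = 0 and \<beta> = 1 and B = "\<beta> c" and C = cop])
    fix r k l :: int and p y :: "'n Hplus" assume "r \<ge> 0"
    then show "XL r 1 p y k l = ZL r 1 p y k l" by (simp add: XL_one ZL_one minus_coeff_flip hscale_hscale)
  next
    fix e :: "'n \<times> 'n" and s r k l :: int and u p y :: "'n Hplus"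
    show "hnull (\<lambda>j. YA e s j (XL (r + 0 * j) u p y (k - 1 * j) l)) UNIV" using XL_YA_null by simp
    show "hnull (\<lambda>j. YA e s j (ZL (r + 0 * j) u p y (k - 1 * j) l)) UNIV" using ZL_YA_null by simp
    show "XL r (xplus e s * u) p y k l = (HSUM j. YA e s j (XL (r + 0 * j) u p y (k - 1 * j) l))
      + (HSUM j. XL r u p (\<beta> c e s j y) (k - j) l) + (HSUM q. XL (r + q) u (cop e s q p) y k l)"
      using XL_rec by simp
    show "ZL r (xplus e s * u) p y k l = (HSUM j. YA e s j (ZL (r + 0 * j) u p y (k - 1 * j) l))
      + (HSUM j. ZL r u p (\<beta> c e s j y) (k - j) l) + (HSUM q. ZL (r + q) u (cop e s q p) y k l)"
      using ZL_rec by simp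
  qed (simp_all add: XL_lin ZL_lin hlinear_hpow[OF XL_lin(2)] hlinear_hpow[OF XL_lin(3)] ZL_hpow \<beta>_null cop_null)
  then obtain r0 where r0: "r0 \<ge> 0" "\<And>r y k l. r \<ge> r0 \<Longrightarrow> XL r u v y k l - ZL r u v y k l \<in> hpow n" by blast
  define s where "s = nat r0"
  have s: "int s = r0" using r0(1) by (simp add: s_def)
  have "(at_minus (monomial (int s)) \<odot> (\<lambda>(k, l). lift3 (\<lambda>x y z. vop (Ym c) x k (vop (Ym c) y l z)))
        \<odot> at_minus (\<lambda>k w. Bm c k (u \<otimes> v) \<otimes> w)) e w -
      (at_minus (monomial (int s)) \<odot> (\<lambda>(k, l) w. vop (Ym c) v l (vop (Ym c) u k w))) e w \<in> hpow n" for w e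
  proof -
    obtain k l where e: "e = (k, l)" by (cases e)
    have "bin minus_coeff r0 (\<lambda>k l. QQ u v w l k) k l = ZL r0 u v w k l"
      unfolding ZL_def by (rule bin_flip[OF r0(1)]) (simp_all add: minus_coeff_flip[OF r0(1)] psgn_square)
    then have 2: "bin minus_coeff r0 (\<lambda>k l. (case (k, l) of (k, l) \<Rightarrow> \<lambda>w. vop (Ym c) v l (vop (Ym c) u k w)) w) k l = ZL r0 u v w k l"
      by (simp only: prod.case vop_def Ym)
    show ?thesis unfolding e comp_monomial comp_lift3 bin_XL s 2 by (rule r0(2)) simp
  qed
  then show "\<exists>r. \<forall>w e. (at_minus (monomial (int r)) \<odot> (\<lambda>(k, l). lift3 (\<lambda>x y z. vop (Ym c) x k (vop (Ym c) y l z)))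
        \<odot> at_minus (\<lambda>k w. Bm c k (u \<otimes> v) \<otimes> w)) e w -
      (at_minus (monomial (int r)) \<odot> (\<lambda>(k, l) w. vop (Ym c) v l (vop (Ym c) u k w))) e w \<in> hpow n"
    by (intro exI[of _ s] allI)
qed

end

section \<open>Matchings\<close>

text \<open>One notion covering both index families: edges \<open>p < q\<close> give the sets in
  \<open>pairings\<close>, edges between two blocks those in \<open>bipairings\<close>, with all
  cardinalities taken together.\<close>

definition matchings :: "(nat \<times> nat) set \<Rightarrow> nat set \<Rightarrow> (nat \<times> nat) set set"
  where "matchings E V = {i. i \<subseteq> E \<and> \<Union>(coords ` i) \<subseteq> V \<and> pairwise (\<lambda>a b. coords a \<inter> coords b = {}) i}"

lemma coords_pair: "coords (p, q) = {p, q}"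
  by (simp add: coords_def)

lemma coords_subset: "\<Union>(coords ` i) \<subseteq> V \<longleftrightarrow> i \<subseteq> V \<times> V"
proof
  assume h: "\<Union>(coords ` i) \<subseteq> V"
  show "i \<subseteq> V \<times> V"
  proof
    fix x assume x: "x \<in> i"
    obtain p q where pq: "x = (p, q)" by (cases x)
    have "coords x \<subseteq> V" using h x by blast
    then show "x \<in> V \<times> V" by (simp add: pq coords_pair)
  qed
qed (auto simp: coords_def)

lemma finite_matchings: "finite V \<Longrightarrow> finite (matchings E V)"
  by (rule finite_subset[of _ "Pow (V \<times> V)"]) (auto simp: matchings_def coords_subset)

lemma matchings_finite: "finite V \<Longrightarrow> i \<in> matchings E V \<Longrightarrow> finite i"
  by (rule finite_subset[of _ "V \<times> V"]) (auto simp: matchings_def coords_subset)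

text \<open>The new vertex \<open>l\<close> never occurs as a second coordinate, so it is either
  unmatched or matched by a unique edge \<open>(l, q)\<close>.\<close>

lemma matchings_insert:
  assumes l: "l \<notin> V" "\<And>p. p \<in> insert l V \<Longrightarrow> (p, l) \<notin> E"
  shows "matchings E (insert l V) = matchings E V \<union> (\<Union>q\<in>{q \<in> V. (l, q) \<in> E}. insert (l, q) ` matchings E (V - {q}))" (is "?L = ?R")
proof
  show "?L \<subseteq> ?R"
  proof
    fix i assume i: "i \<in> ?L"
    show "i \<in> ?R"
    proof (cases "\<exists>q. (l, q) \<in> i")
      case False
      have "l \<notin> coords x" if x: "x \<in> i" for x
      proof
        assume lx: "l \<in> coords x"
        obtain p q where pq: "x = (p, q)" by (cases x)
        have "q = l" using lx False x by (auto simp: pq coords_def)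
        moreover have "p \<in> insert l V" using i x unfolding matchings_def pq coords_def by auto
        ultimately show False using l(2)[of p] i x unfolding matchings_def pq by auto
      qed
      then show ?thesis using i unfolding matchings_def by auto
    next
      case True
      then obtain q where q: "(l, q) \<in> i" by blast
      have qE: "(l, q) \<in> E" and "q \<in> insert l V" using i q unfolding matchings_def coords_def by auto
      then have qV: "q \<in> V" using l(2)[of l] by auto
      have dj: "coords x \<inter> {l, q} = {}" if "x \<in> i" "x \<noteq> (l, q)" for x
      proof -
        have "pairwise (\<lambda>a b. coords a \<inter> coords b = {}) i" using i by (simp add: matchings_def)
        from pairwiseD[OF this that(1) q that(2)] show ?thesis by (simp add: coords_pair)
      qed
      have "i - {(l, q)} \<in> matchings E (V - {q})"
      proof -
        have "coords x \<subseteq> V - {q}" if x: "x \<in> i - {(l, q)}" for x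
        proof -
          have "coords x \<subseteq> insert l V" using i x unfolding matchings_def by blast
          moreover have "coords x \<inter> {l, q} = {}" using dj[of x] x by blast
          ultimately show ?thesis by blast
        qed
        moreover have "pairwise (\<lambda>a b. coords a \<inter> coords b = {}) (i - {(l, q)})"
          using i unfolding matchings_def by (auto intro: pairwise_subset)
        moreover have "i - {(l, q)} \<subseteq> E" using i unfolding matchings_def by blast
        ultimately show ?thesis unfolding matchings_def by blast
      qed
      moreover have "i = insert (l, q) (i - {(l, q)})" using q by auto
      ultimately show ?thesis using qE qV by blast
    qed
  qed
  show "?R \<subseteq> ?L"
  proof
    fix i assume "i \<in> ?R"
    then consider "i \<in> matchings E V" | q i' where "q \<in> V" "(l, q) \<in> E" "i' \<in> matchings E (V - {q})" "i = insert (l, q) i'" by blast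
    then show "i \<in> ?L"
    proof cases
      case 2
      have "coords (l, q) \<inter> coords x = {}" if "x \<in> i'" for x
      proof -
        have "coords x \<subseteq> V - {q}" using 2(3) that unfolding matchings_def by blast
        then show ?thesis using l(1) by (auto simp: coords_pair)
      qed
      then have "pairwise (\<lambda>a b. coords a \<inter> coords b = {}) i"
        using 2(3) unfolding 2(4) matchings_def pairwise_insert by (auto simp: Int_commute)
      then show ?thesis using 2 unfolding matchings_def by (auto simp: coords_def)
    qed (auto simp: matchings_def)
  qed
qed

lemma sum_matchings_insert:
  fixes F :: "(nat \<times> nat) set \<Rightarrow> 'a::comm_monoid_add"
  assumes V: "finite V" and l: "l \<notin> V" "\<And>p. p \<in> insert l V \<Longrightarrow> (p, l) \<notin> E"
  shows "(\<Sum>i\<in>matchings E (insert l V). F i) = (\<Sum>i\<in>matchings E V. F i) +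
    (\<Sum>q\<in>{q \<in> V. (l, q) \<in> E}. \<Sum>i\<in>matchings E (V - {q}). F (insert (l, q) i))"
proof -
  have nl: "(l, q) \<notin> i" if "i \<in> matchings E V" for q i using that l(1) unfolding matchings_def coords_def by auto
  have nl': "(l, q) \<notin> i" if "i \<in> matchings E (V - A)" for q i A using that l(1) unfolding matchings_def coords_def by auto
  have inj: "inj_on (insert (l, q)) (matchings E (V - {q}))" for q
  proof (rule inj_onI)
    fix x y assume "x \<in> matchings E (V - {q})" "y \<in> matchings E (V - {q})" "insert (l, q) x = insert (l, q) y"
    then show "x = y" using nl'[of x "{q}" q] nl'[of y "{q}" q] by (simp add: insert_ident)
  qed
  have "(\<Sum>i\<in>matchings E (insert l V). F i) = (\<Sum>i\<in>matchings E V. F i) +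
      (\<Sum>i\<in>(\<Union>q\<in>{q \<in> V. (l, q) \<in> E}. insert (l, q) ` matchings E (V - {q})). F i)"
  proof -
    have eq: "matchings E (insert l V) = matchings E V \<union> (\<Union>q\<in>{q \<in> V. (l, q) \<in> E}. insert (l, q) ` matchings E (V - {q}))"
      by (rule matchings_insert[OF l(1)]) (rule l(2))
    have "matchings E V \<inter> (\<Union>q\<in>{q \<in> V. (l, q) \<in> E}. insert (l, q) ` matchings E (V - {q})) = {}"
      using nl by blast
    then show ?thesis unfolding eq by (intro sum.union_disjoint) (simp_all add: V finite_matchings)
  qed
  also have "(\<Sum>i\<in>(\<Union>q\<in>{q \<in> V. (l, q) \<in> E}. insert (l, q) ` matchings E (V - {q})). F i) =
      (\<Sum>q\<in>{q \<in> V. (l, q) \<in> E}. \<Sum>i\<in>insert (l, q) ` matchings E (V - {q}). F i)"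
  proof (rule sum.UNION_disjoint)
    show "\<forall>q\<in>{q \<in> V. (l, q) \<in> E}. \<forall>q'\<in>{q \<in> V. (l, q) \<in> E}. q \<noteq> q' \<longrightarrow>
        insert (l, q) ` matchings E (V - {q}) \<inter> insert (l, q') ` matchings E (V - {q'}) = {}"
    proof (intro ballI impI, rule ccontr)
      fix q q' assume "q \<noteq> q'" "insert (l, q) ` matchings E (V - {q}) \<inter> insert (l, q') ` matchings E (V - {q'}) \<noteq> {}"
      then obtain x where x: "x \<in> insert (l, q) ` matchings E (V - {q})" "x \<in> insert (l, q') ` matchings E (V - {q'})"
        by (meson disjoint_iff)
      from x(2) obtain i' where i': "i' \<in> matchings E (V - {q'})" "x = insert (l, q') i'" by (rule imageE)
      have "(l, q) \<in> x" using x(1) by (rule imageE) simp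
      then have "(l, q) \<in> i'" using i'(2) \<open>q \<noteq> q'\<close> by simp
      then show False using nl'[OF i'(1), of q] by simp
    qed
  qed (use V in \<open>auto simp: finite_matchings\<close>)
  also have "\<dots> = (\<Sum>q\<in>{q \<in> V. (l, q) \<in> E}. \<Sum>i\<in>matchings E (V - {q}). F (insert (l, q) i))"
    by (rule sum.cong[OF refl]) (simp add: sum.reindex[OF inj])
  finally show ?thesis .
qed

lemma card_matchings:
  assumes "finite V" "i \<in> matchings E V" "\<And>p. (p, p) \<notin> E"
  shows "2 * card i \<le> card V"
proof -
  have "card (coords x) = 2" if "x \<in> i" for x
  proof -
    obtain p q where x: "x = (p, q)" by (cases x)
    then have "p \<noteq> q" using assms(2,3) that unfolding matchings_def by auto
    then show ?thesis by (simp add: x coords_def)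
  qed
  then have "(\<Sum>x\<in>i. card (coords x)) = 2 * card i" by simp
  moreover have "card (\<Union>(coords ` i)) = (\<Sum>x\<in>i. card (coords x))"
    by (rule card_UN_disjoint[OF matchings_finite[OF assms(1,2)]])
      (use assms(2) in \<open>auto simp: coords_def matchings_def pairwise_def\<close>)
  moreover have "card (\<Union>(coords ` i)) \<le> card V"
    by (rule card_mono[OF assms(1)]) (use assms(2) in \<open>auto simp: matchings_def\<close>)
  ultimately show ?thesis by simp
qed

text \<open>Grouping by cardinality; the bound \<open>n div 2\<close> holds because \<open>k\<close>
  disjoint edges use \<open>2 * k\<close> vertices.\<close>

lemma sum_pairings: "(\<Sum>k=0..n div 2. \<Sum>i\<in>pairings n k. F i) = (\<Sum>i\<in>matchings {(p, q). p < q} {1..n}. F i)"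
proof -
  have "pairings n k = {i \<in> matchings {(p, q). p < q} {1..n}. card i = k}" for k
  proof -
    have "i \<subseteq> {(p, q). p \<in> {1..n} \<and> q \<in> {1..n} \<and> p < q} \<longleftrightarrow> i \<subseteq> {(p, q). p < q} \<and> i \<subseteq> {1..n} \<times> {1..n}" for i
      by blast
    then show ?thesis unfolding pairings_def matchings_def coords_subset by auto
  qed
  moreover have "card i \<le> n div 2" if "i \<in> matchings {(p, q). p < q} {1..n}" for i
    using card_matchings[OF _ that] by auto
  ultimately show ?thesis
    using sum.group[of "matchings {(p, q). p < q} {1..n}" "{0..n div 2}" card F, OF finite_matchings]
    by (simp add: image_subset_iff)
qed

lemma sum_bipairings:
  "(\<Sum>k=0..min m n. \<Sum>i\<in>bipairings n m k. F i) = (\<Sum>i\<in>matchings ({1..n} \<times> {n+1..n+m}) ({1..n} \<union> {n+1..n+m}). F i)"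
proof -
  let ?E = "{1..n} \<times> {n+1..n+m}" and ?V = "{1..n} \<union> {n+1..n+m}"
  have "bipairings n m k = {i \<in> matchings ?E ?V. card i = k}" for k
  proof -
    have "i \<subseteq> ?E \<longleftrightarrow> i \<subseteq> ?E \<and> i \<subseteq> ?V \<times> ?V" for i by blast
    then show ?thesis unfolding bipairings_def matchings_def coords_subset by auto
  qed
  moreover have "card i \<le> min m n" if i: "i \<in> matchings ?E ?V" for i
  proof -
    have pw: "x = y" if "x \<in> i" "y \<in> i" "coords x \<inter> coords y \<noteq> {}" for x y
    proof -
      have "pairwise (\<lambda>a b. coords a \<inter> coords b = {}) i" using i by (simp add: matchings_def)
      from pairwiseD[OF this that(1,2)] show ?thesis using that(3) by blast
    qed
    have m: "fst x \<in> coords x" "snd x \<in> coords x" for x by (cases x, simp add: coords_pair)+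
    have "inj_on fst i"
    proof (rule inj_onI)
      fix x y assume "x \<in> i" "y \<in> i" "fst x = fst y"
      then show "x = y" using pw[of x y] m(1)[of x] m(1)[of y] by auto
    qed
    moreover have "inj_on snd i"
    proof (rule inj_onI)
      fix x y assume "x \<in> i" "y \<in> i" "snd x = snd y"
      then show "x = y" using pw[of x y] m(2)[of x] m(2)[of y] by auto
    qed
    moreover have "fst ` i \<subseteq> {1..n}" "snd ` i \<subseteq> {n+1..n+m}" using i unfolding matchings_def by auto
    ultimately show ?thesis
      using card_inj_on_le[of fst i "{1..n}"] card_inj_on_le[of snd i "{n+1..n+m}"] by simp
  qed
  ultimately show ?thesis
    using sum.group[of "matchings ?E ?V" "{0..min m n}" card F, OF finite_matchings] by (simp add: image_subset_iff)
qed

section \<open>Sums over exponents\<close>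

text \<open>With \<open>bs\<close> the exponents of the u-variables, \<open>ks l - bs l\<close> is
  the exponent of z taken from the \<open>l\<close>-th factor and \<open>a\<close> the total
  exponent of z. With \<open>bs = 0\<close> it describes distributions of \<open>a\<close> over the
  factors T.\<close>

definition expo :: "'i set \<Rightarrow> ('i \<Rightarrow> int) \<Rightarrow> int \<Rightarrow> ('i \<Rightarrow> int) set"
  where "expo A bs a = {ks \<in> A \<rightarrow>\<^sub>E UNIV. (\<Sum>l\<in>A. ks l - bs l) = a}"

text \<open>The summation variable \<open>j = ks l - bs l\<close> is the exponent of z contributed
  by \<open>l\<close>; resetting position \<open>l\<close> to \<open>undefined\<close> keeps the
  functions extensional.\<close>

lemma expo_insert_bij:
  assumes "finite A" "l \<notin> A"
  shows "bij_betw (\<lambda>(j, ks). ks(l := j + bs l)) (Sigma UNIV (\<lambda>j. expo A bs (a - j))) (expo (insert l A) bs a)"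
proof (rule bij_betw_byWitness[where f' = "\<lambda>ks. (ks l - bs l, ks(l := undefined))"])
  have s: "(\<Sum>p\<in>A. (ks(l := x)) p - bs p) = (\<Sum>p\<in>A. ks p - bs p)" for ks x
    by (rule sum.cong) (use assms(2) in auto)
  show "\<forall>x\<in>Sigma UNIV (\<lambda>j. expo A bs (a - j)). (\<lambda>ks. (ks l - bs l, ks(l := undefined))) ((\<lambda>(j, ks). ks(l := j + bs l)) x) = x"
    using assms(2) by (auto simp: expo_def PiE_def extensional_def fun_eq_iff)
  show "\<forall>ks\<in>expo (insert l A) bs a. (\<lambda>(j, ks). ks(l := j + bs l)) (ks l - bs l, ks(l := undefined)) = ks" by simp
  show "(\<lambda>(j, ks). ks(l := j + bs l)) ` Sigma UNIV (\<lambda>j. expo A bs (a - j)) \<subseteq> expo (insert l A) bs a"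
    using assms s by (auto simp: expo_def PiE_def extensional_def)
  show "(\<lambda>ks. (ks l - bs l, ks(l := undefined))) ` expo (insert l A) bs a \<subseteq> Sigma UNIV (\<lambda>j. expo A bs (a - j))"
    using assms s by (auto simp: expo_def PiE_def extensional_def)
qed

lemma hsum_expo_insert:
  fixes f :: "('i \<Rightarrow> int) \<Rightarrow> 'a::hcomplete"
  assumes A: "finite A" "l \<notin> A" and n: "hnull f (expo (insert l A) bs a)"
  shows "hsum f (expo (insert l A) bs a) = (HSUM j. hsum (\<lambda>ks. f (ks(l := j + bs l))) (expo A bs (a - j)))"
proof -
  note bij = expo_insert_bij[OF A, of bs a]
  have e: "(\<lambda>x. f ((\<lambda>(j, ks). ks(l := j + bs l)) x)) = (\<lambda>(j, ks). f (ks(l := j + bs l)))" by (auto simp: fun_eq_iff)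
  have n': "hnull (\<lambda>(j, ks). f (ks(l := j + bs l))) (Sigma UNIV (\<lambda>j. expo A bs (a - j)))"
    using n unfolding hnull_bij[OF bij] e .
  show ?thesis unfolding hsum_bij[OF bij] e by (rule hsum_Sigma(1)[OF n', symmetric])
qed

lemma expo_empty: "expo {} bs a = (if a = 0 then {\<lambda>_. undefined} else {})"
  by (auto simp: expo_def)

lemma finite_expo:
  assumes "finite A" shows "finite {ks \<in> expo A bs a. \<forall>l\<in>A. K \<le> ks l}"
proof (rule finite_subset)
  \<comment> \<open>With the total fixed and all entries at least \<open>K\<close>, each entry is
    bounded by \<open>a + bs l\<close> plus what the other entries can contribute
    negatively.\<close>
  define M where "M = (\<Sum>l\<in>A. \<bar>bs l - K\<bar>) + \<bar>a\<bar> + (\<Sum>l\<in>A. \<bar>bs l\<bar>)"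
  show "{ks \<in> expo A bs a. \<forall>l\<in>A. K \<le> ks l} \<subseteq> A \<rightarrow>\<^sub>E {K..M}"
  proof
    fix ks assume ks: "ks \<in> {ks \<in> expo A bs a. \<forall>l\<in>A. K \<le> ks l}"
    have "ks l \<le> M" if l: "l \<in> A" for l
    proof -
      have "a = (\<Sum>p\<in>A. ks p - bs p)" using ks by (simp add: expo_def)
      also have "\<dots> = ks l - bs l + (\<Sum>p\<in>A - {l}. ks p - bs p)" by (rule sum.remove[OF assms l])
      also have "\<dots> \<ge> ks l - bs l + (\<Sum>p\<in>A - {l}. - \<bar>bs p - K\<bar>)"
      proof -
        have "(\<Sum>p\<in>A - {l}. - \<bar>bs p - K\<bar>) \<le> (\<Sum>p\<in>A - {l}. ks p - bs p)"
        proof (rule sum_mono)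
          fix p assume "p \<in> A - {l}"
          then have "K \<le> ks p" using ks by auto
          then show "- \<bar>bs p - K\<bar> \<le> ks p - bs p" by linarith
        qed
        then show ?thesis by linarith
      qed
      finally have "ks l \<le> a + bs l + (\<Sum>p\<in>A - {l}. \<bar>bs p - K\<bar>)" by (simp add: sum_negf)
      moreover have "(\<Sum>p\<in>A - {l}. \<bar>bs p - K\<bar>) \<le> (\<Sum>p\<in>A. \<bar>bs p - K\<bar>)" by (rule sum_mono2[OF assms]) auto
      moreover have "bs l \<le> (\<Sum>l\<in>A. \<bar>bs l\<bar>)"
        using member_le_sum[of l A "\<lambda>l. \<bar>bs l\<bar>"] l assms by simp
      ultimately show ?thesis unfolding M_def by linarith
    qed
    then show "ks \<in> A \<rightarrow>\<^sub>E {K..M}"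
      using ks by (intro PiE_I) (auto simp: expo_def PiE_def extensional_def)
  qed
  show "finite (A \<rightarrow>\<^sub>E {K..M})" by (rule finite_PiE[OF assms]) simp
qed

section \<open>The operators on monomials\<close>

text \<open>The offset \<open>m\<close> serves the right tensor factor, whose variables are numbered
  after those of the left one.\<close>

lemma plist_xplus_prod:
  "plist xs = (\<Prod>l\<in>{m+1..m+length xs}. xplus (fst (xs ! (l - m - 1))) (int (snd (xs ! (l - m - 1)))))"
proof (induction xs arbitrary: m)
  case (Cons g xs)
  let ?f = "\<lambda>l. xplus (fst ((g # xs) ! (l - m - 1))) (int (snd ((g # xs) ! (l - m - 1)))) :: 'a Hplus"
  have "{m+1..m+length (g # xs)} = insert (m+1) {Suc m+1..Suc m+length xs}" by auto
  then have "(\<Prod>l\<in>{m+1..m+length (g # xs)}. ?f l) = ?f (m+1) * (\<Prod>l\<in>{Suc m+1..Suc m+length xs}. ?f l)" by simp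
  also have "(\<Prod>l\<in>{Suc m+1..Suc m+length xs}. ?f l) = plist xs"
    unfolding Cons.IH[of "Suc m"]
  proof (rule prod.cong[OF refl])
    fix l assume l: "l \<in> {Suc m+1..Suc m+length xs}"
    then have "l - m - 1 = Suc (l - Suc m - 1)" by auto
    then show "?f l = xplus (fst (xs ! (l - Suc m - 1))) (int (snd (xs ! (l - Suc m - 1))))" by simp
  qed
  finally show ?case by (simp add: xplus_Hvar)
qed simp

lemma derv_xplus_prod:
  assumes tf: "tracefree \<kappa>" and A: "finite A"
  shows "derv \<kappa> (xplus_prod A es ks) = (\<Sum>j\<in>A. \<kappa> (es j) (ks j) *\<^sub>h xplus_prod (A - {j}) es ks)"
  using A
proof (induction A rule: finite_induct)
  case (insert l A)
  have "xplus (es l) (ks l) * xplus_prod (A - {j}) es ks = xplus_prod (insert l A - {j}) es ks" if "j \<in> A" for j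
  proof -
    have "insert l A - {j} = insert l (A - {j})" using that insert.hyps(2) by auto
    then show ?thesis using insert.hyps by (simp add: xplus_prod_def)
  qed
  moreover have "insert l A - {l} = A" using insert.hyps(2) by auto
  ultimately have "(\<Sum>j\<in>insert l A. \<kappa> (es j) (ks j) *\<^sub>h xplus_prod (insert l A - {j}) es ks) =
      \<kappa> (es l) (ks l) *\<^sub>h xplus_prod A es ks
      + (\<Sum>j\<in>A. \<kappa> (es j) (ks j) *\<^sub>h (xplus (es l) (ks l) * xplus_prod (A - {j}) es ks))"
    using insert.hyps by simp
  moreover have "xplus_prod (insert l A) es ks = xplus (es l) (ks l) * xplus_prod A es ks"
    using insert.hyps by (simp add: xplus_prod_def)
  ultimately show ?case
    by (simp add: derv(3)[OF tf] insert.IH sum_distrib_left Hplus_mult_scale)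
qed (simp add: xplus_prod_def derv(2)[OF tf])

lemma ker_zero: "ker \<sigma> e 0 k f s = minus_coeff k s * \<sigma> e f (k + s)"
  by (simp add: ker_def)

text \<open>At \<open>r = 0\<close> the kernel is that of \<open>- S(u_0 - u_j)\<close>, and the
  defining formula is the Leibniz rule for the corresponding derivation; monomials then determine
  the operator.\<close>

lemma xminus_eq: "xminus c e k v = dop (negS c) (e :: 'a :: finite \<times> 'a) 0 k v"
proof -
  let ?P = "\<lambda>X :: 'a \<times> 'a \<Rightarrow> int \<Rightarrow> 'a Hplus \<Rightarrow> 'a Hplus. (\<forall>e k. hlinear (X e k)) \<and>
    (\<forall>e v. in_negative (\<lambda>k. X e k v)) \<and> (\<forall>e v. X e 0 v = 0) \<and> (\<forall>e k. X e k 1 = 0) \<and>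
    (\<forall>n\<ge>1. \<forall>es ks. X (es 0) (ks 0) (xplus_prod {1..n} es ks) =
       - (\<Sum>j=1..n. Sdiff c es ks (0, j) *\<^sub>h xplus_prod ({1..n} - {j}) es ks))"
  let ?D = "\<lambda>(e :: 'a \<times> 'a) k. dop (negS c) e 0 k"
  have D: "?D (es 0) (ks 0) (xplus_prod {1..n} es ks) =
       - (\<Sum>j=1..n. Sdiff c es ks (0, j) *\<^sub>h xplus_prod ({1..n} - {j}) es ks)" for n es ks
    unfolding dop_def derv_xplus_prod[OF tracefree_ker[OF pairing_negS] finite_atLeastAtMost]
    by (simp add: ker_zero negS_def Sdiff_def flip: sum_negf)
  have PD: "?P ?D"
    using D by (auto simp: hlinear_dop[OF pairing_negS] dop_vanish[OF pairing_negS] dop_one[OF pairing_negS]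
        in_negative_def hnull_in_laurent[OF hnull_dop[OF pairing_negS]])
  have uniq: "X = ?D" if X: "?P X" for X
  proof (intro ext)
    fix e k v
    show "X e k v = ?D e k v"
    proof (rule Hplus_plist_eqI[where F = "X e k" and G = "?D e k"])
      show "hlinear (X e k)" using X by blast
      show "hlinear (?D e k)" by (rule hlinear_dop[OF pairing_negS])
      fix xs :: "(('a \<times> 'a) \<times> nat) list"
      show "X e k (plist xs) = ?D e k (plist xs)"
      proof (cases "xs = []")
        case True
        have "X e k 1 = 0" using X by blast
        then show ?thesis by (simp add: True dop_one[OF pairing_negS])
      next
        case False
        \<comment> \<open>Position 0 carries the matrix unit and exponent of the annihilation
          operator itself.\<close>
        define es where "es l = (if l = 0 then e else fst (xs ! (l - 1)))" for l
        define ks where "ks l = (if l = 0 then k else int (snd (xs ! (l - 1))))" for l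
        have "plist xs = xplus_prod {1..length xs} es ks"
          unfolding plist_xplus_prod[of xs 0] xplus_prod_def
          by (intro prod.cong) (auto simp: es_def ks_def)
        moreover have "length xs \<ge> 1" using False by (simp add: Suc_le_eq)
        then have "X (es 0) (ks 0) (xplus_prod {1..length xs} es ks) = ?D (es 0) (ks 0) (xplus_prod {1..length xs} es ks)"
          using X unfolding D by blast
        ultimately show ?thesis by (simp add: es_def ks_def)
      qed
    qed
  qed
  have "xminus c = ?D" unfolding xminus_def by (rule the_equality[where P = ?P, OF PD]) (rule uniq)
  then show ?thesis by simp
qed

section \<open>Wick's theorem for the bracket of fields\<close>

context
  fixes c :: complex and es :: "nat \<Rightarrow> 'n::finite \<times> 'n"
begin

text \<open>Coefficients of the normally ordered product: creation parts on the left, annihilation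
  parts on the right.\<close>

fun nop :: "(nat \<Rightarrow> int) \<Rightarrow> nat list \<Rightarrow> 'n Hplus \<Rightarrow> 'n Hplus" where
  "nop ks [] v = v"
| "nop ks (l # ls) v = xplus (es l) (ks l) * nop ks ls v + nop ks ls (xminus c (es l) (ks l) v)"

lemma xminus_lin: "hlinear (xminus c e k)"
  using hlinear_dop[OF pairing_negS, of c e 0 k] by (simp add: xminus_eq[abs_def])

lemma nop_lin: "hlinear (nop ks ls)"
proof (induction ls)
  case (Cons l ls)
  have "hlinear (\<lambda>v. xplus (es l) (ks l) * nop ks ls v + nop ks ls (xminus c (es l) (ks l) v))"
    by (intro hlinear_plus hlinear_times Cons hlinear_compose[OF Cons xminus_lin])
  then show ?case by simp
qed (simp add: hlinear_id)

lemma nop_cong: "(\<And>l. l \<in> set ls \<Longrightarrow> ks l = ks' l) \<Longrightarrow> nop ks ls v = nop ks' ls v"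
  by (induction ls arbitrary: v) auto

text \<open>A derivation commutes with the annihilation parts and hits each creation part once,
  deleting that factor.\<close>

lemma nop_derv:
  assumes tf: "tracefree \<kappa>"
  shows "distinct ls \<Longrightarrow> derv \<kappa> (nop ks ls v) = nop ks ls (derv \<kappa> v) + (\<Sum>q\<in>set ls. \<kappa> (es q) (ks q) *\<^sub>h nop ks (remove1 q ls) v)"
proof (induction ls arbitrary: v)
  case (Cons l ls)
  have d: "derv \<kappa> (xminus c (es l) (ks l) v) = xminus c (es l) (ks l) (derv \<kappa> v)" for v
    by (simp add: xminus_eq dop_commute_derv[OF pairing_negS tf])
  have r: "remove1 q (l # ls) = l # remove1 q ls" if "q \<in> set ls" for q using that Cons.prems by auto
  have "(\<Sum>q\<in>set ls. \<kappa> (es q) (ks q) *\<^sub>h nop ks (remove1 q (l # ls)) v) =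
      xplus (es l) (ks l) * (\<Sum>q\<in>set ls. \<kappa> (es q) (ks q) *\<^sub>h nop ks (remove1 q ls) v)
      + (\<Sum>q\<in>set ls. \<kappa> (es q) (ks q) *\<^sub>h nop ks (remove1 q ls) (xminus c (es l) (ks l) v))"
  proof -
    have "(\<Sum>q\<in>set ls. \<kappa> (es q) (ks q) *\<^sub>h nop ks (remove1 q (l # ls)) v) =
        (\<Sum>q\<in>set ls. xplus (es l) (ks l) * (\<kappa> (es q) (ks q) *\<^sub>h nop ks (remove1 q ls) v)
        + \<kappa> (es q) (ks q) *\<^sub>h nop ks (remove1 q ls) (xminus c (es l) (ks l) v))"
      by (rule sum.cong[OF refl]) (simp only: r nop.simps hscale_right_distrib Hplus_mult_scale)
    then show ?thesis by (simp only: sum.distrib sum_distrib_left)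
  qed
  moreover have "(\<Sum>q\<in>set (l # ls). \<kappa> (es q) (ks q) *\<^sub>h nop ks (remove1 q (l # ls)) v) =
      \<kappa> (es l) (ks l) *\<^sub>h nop ks ls v + (\<Sum>q\<in>set ls. \<kappa> (es q) (ks q) *\<^sub>h nop ks (remove1 q (l # ls)) v)"
    using Cons.prems by simp
  ultimately show ?case
    using Cons.IH[of v] Cons.IH[of "xminus c (es l) (ks l) v"] Cons.prems
    by (simp only: nop.simps hlinear_add[OF derv(1)[OF tf]] derv(3)[OF tf] d distrib_left distinct.simps) (simp add: add_ac)
qed simp

definition Wk :: "(nat \<Rightarrow> int) \<Rightarrow> nat set \<Rightarrow> 'n Hplus \<Rightarrow> 'n Hplus"
  where "Wk ks A v = (\<Sum>i\<in>matchings {(p, q). p < q} A.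
    (\<Prod>pq\<in>i. Sdiff c es ks pq) *\<^sub>h xop_prod c (A - \<Union>(coords ` i)) es ks v)"

lemma sorted_list_insert_min:
  assumes "finite A" "\<forall>x\<in>A. l < x"
  shows "sorted_list_of_set (insert l A) = l # sorted_list_of_set A"
proof -
  have "l \<notin> A" using assms(2) by blast
  moreover have "Min (insert l A) = l" by (rule Min_eqI) (use assms in \<open>auto simp: less_imp_le\<close>)
  ultimately show ?thesis
    using sorted_list_of_set_nonempty[of "insert l A"] assms(1) by simp
qed

lemma xop_prod_insert:
  assumes "finite A" "\<forall>x\<in>A. l < x"
  shows "xop_prod c (insert l A) es ks v = xop c (es l) (ks l) (xop_prod c A es ks v)"
  unfolding xop_prod_def sorted_list_insert_min[OF assms] by simp

lemma xop_lin: "hlinear (xop c e k)"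
  unfolding xop_def[abs_def] by (intro hlinear_plus hlinear_times hlinear_id xminus_lin)

text \<open>Matchings are split by the partner of the smallest index \<open>l\<close>, whose field
  stands outermost because products run in increasing order.\<close>

lemma Wk_insert:
  assumes A: "finite A" and l: "\<forall>x\<in>A. l < x"
  shows "Wk ks (insert l A) v = xop c (es l) (ks l) (Wk ks A v) + (\<Sum>q\<in>A. Sdiff c es ks (l, q) *\<^sub>h Wk ks (A - {q}) v)"
proof -
  let ?E = "{(p, q :: nat). p < q}"
  let ?F = "\<lambda>i. (\<Prod>pq\<in>i. Sdiff c es ks pq) *\<^sub>h xop_prod c (insert l A - \<Union>(coords ` i)) es ks v"
  have lA: "l \<notin> A" using l by blast
  have pl: "(p, l) \<notin> ?E" if "p \<in> insert l A" for p
  proof -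
    have "l \<le> p" using that l by (auto simp: less_imp_le)
    then show ?thesis by simp
  qed
  have 1: "?F i = xop c (es l) (ks l) ((\<Prod>pq\<in>i. Sdiff c es ks pq) *\<^sub>h xop_prod c (A - \<Union>(coords ` i)) es ks v)"
    if i: "i \<in> matchings ?E A" for i
  proof -
    have "insert l A - \<Union>(coords ` i) = insert l (A - \<Union>(coords ` i))"
      using i lA unfolding matchings_def by blast
    moreover have "xop_prod c (insert l (A - \<Union>(coords ` i))) es ks v = xop c (es l) (ks l) (xop_prod c (A - \<Union>(coords ` i)) es ks v)"
      by (rule xop_prod_insert) (use A l in auto)
    ultimately show ?thesis by (simp add: hlinear_scale[OF xop_lin])
  qed
  have 2: "?F (insert (l, q) i) = Sdiff c es ks (l, q) *\<^sub>h ((\<Prod>pq\<in>i. Sdiff c es ks pq) *\<^sub>h xop_prod c (A - {q} - \<Union>(coords ` i)) es ks v)"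
    if i: "i \<in> matchings ?E (A - {q})" for i q
  proof -
    have "(l, q) \<notin> i" using i lA unfolding matchings_def coords_subset by blast
    moreover have "finite i" by (rule matchings_finite[OF _ i]) (use A in simp)
    moreover have "insert l A - \<Union>(coords ` insert (l, q) i) = A - {q} - \<Union>(coords ` i)"
      using lA by (auto simp: coords_pair)
    ultimately show ?thesis by (simp add: hscale_hscale)
  qed
  have "Wk ks (insert l A) v = (\<Sum>i\<in>matchings ?E A. ?F i) + (\<Sum>q\<in>{q \<in> A. (l, q) \<in> ?E}. \<Sum>i\<in>matchings ?E (A - {q}). ?F (insert (l, q) i))"
    unfolding Wk_def by (rule sum_matchings_insert[OF A lA]) (rule pl)
  also have "{q \<in> A. (l, q) \<in> ?E} = A" using l by auto
  also have "(\<Sum>i\<in>matchings ?E A. ?F i) = xop c (es l) (ks l) (Wk ks A v)"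
    unfolding Wk_def hlinear_sum[OF xop_lin] by (rule sum.cong[OF refl 1])
  also have "(\<Sum>q\<in>A. \<Sum>i\<in>matchings ?E (A - {q}). ?F (insert (l, q) i)) = (\<Sum>q\<in>A. Sdiff c es ks (l, q) *\<^sub>h Wk ks (A - {q}) v)"
    unfolding Wk_def hmod.scale_sum_right by (intro sum.cong refl 2)
  finally show ?thesis .
qed

text \<open>Moving the annihilation part of the outermost field to the right produces contractions
  with -S, which cancel the terms with S that the bracket adds for pairs containing that
  index.\<close>

lemma wick: "finite A \<Longrightarrow> Wk ks A v = nop ks (sorted_list_of_set A) v"
proof (induction "card A" arbitrary: A v rule: less_induct)
  case less
  show ?case
  proof (cases "A = {}")
    case True
    have "matchings {(p, q). p < q} {} = {{}}" unfolding matchings_def coords_subset by auto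
    then show ?thesis by (simp add: True Wk_def xop_prod_def hscale_one)
  next
    case False
    define l where "l = Min A"
    define B where "B = A - {l}"
    have lA: "l \<in> A" unfolding l_def using less.prems False by (rule Min_in)
    have A: "A = insert l B" using lA by (auto simp: B_def)
    have B: "finite B" "\<forall>x\<in>B. l < x"
      using less.prems Min_le[of A] by (auto simp: B_def l_def order.strict_iff_order)
    have cB: "card B < card A" unfolding B_def by (rule card_Diff1_less[OF less.prems lA])
    have IB: "Wk ks B v = nop ks (sorted_list_of_set B) v" for v by (rule less.hyps[OF cB B(1)])
    have IBq: "Wk ks (B - {q}) v = nop ks (remove1 q (sorted_list_of_set B)) v" if "q \<in> B" for q
    proof -
      have "card (B - {q}) < card A" using cB card_Diff1_le[of B q] by linarith
      then show ?thesis using less.hyps[of "B - {q}"] B(1) by (simp add: sorted_list_of_set_remove)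
    qed
    have "Wk ks A v = xplus (es l) (ks l) * nop ks (sorted_list_of_set B) v
        + xminus c (es l) (ks l) (nop ks (sorted_list_of_set B) v)
        + (\<Sum>q\<in>B. Sdiff c es ks (l, q) *\<^sub>h nop ks (remove1 q (sorted_list_of_set B)) v)"
      unfolding A Wk_insert[OF B] IB xop_def using IBq by simp
    also have "xminus c (es l) (ks l) (nop ks (sorted_list_of_set B) v) =
        nop ks (sorted_list_of_set B) (xminus c (es l) (ks l) v)
        - (\<Sum>q\<in>B. Sdiff c es ks (l, q) *\<^sub>h nop ks (remove1 q (sorted_list_of_set B)) v)"
      unfolding xminus_eq dop_def nop_derv[OF tracefree_ker[OF pairing_negS] distinct_sorted_list_of_set]
      using B(1) by (simp add: ker_zero negS_def Sdiff_def sum_negf)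
    finally show ?thesis unfolding A sorted_list_insert_min[OF B] by simp
  qed
qed

lemma xbracket_nop: "xbracket c n es ks v = nop ks (sorted_list_of_set {1..n}) v"
  unfolding xbracket_def sum_pairings by (simp add: Wk_def flip: wick)

text \<open>An index with negative exponent has no creation part, and its annihilation part is small
  for very negative exponents. By induction one bound serves all indices at once.\<close>

lemma nop_low: "\<exists>K. \<forall>ks. (\<exists>l\<in>set ls. ks l < K) \<longrightarrow> nop ks ls v \<in> hpow n"
proof (induction ls arbitrary: v)
  case (Cons l ls)
  define J where "J = {k. xminus c (es l) k v \<notin> hpow n}"
  have J: "finite J" using hnullD[OF hnull_dop[OF pairing_negS, of c "es l" 0 v], of n] by (simp add: J_def xminus_eq)
  obtain \<rho> where \<rho>: "\<And>v ks. \<exists>l\<in>set ls. ks l < \<rho> v \<Longrightarrow> nop ks ls v \<in> hpow n" using Cons.IH by metis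
  obtain K1 where K1: "\<forall>k\<in>J. K1 \<le> k" using finite_lower_bound[OF J, of "\<lambda>k. k"] by blast
  obtain K2 where K2: "\<forall>k\<in>J. K2 \<le> \<rho> (xminus c (es l) k v)" using finite_lower_bound[OF J, of "\<lambda>k. \<rho> (xminus c (es l) k v)"] by blast
  define K where "K = min (min 0 K1) (min K2 (\<rho> v))"
  have "nop ks (l # ls) v \<in> hpow n" if low: "\<exists>l\<in>set (l # ls). ks l < K" for ks
  proof -
    consider "ks l < K" | "\<exists>l\<in>set ls. ks l < K" using low by auto
    then show ?thesis
    proof cases
      case 1
      then have "ks l \<notin> J" "ks l < 0" using K1 by (auto simp: K_def)
      then have "xminus c (es l) (ks l) v \<in> hpow n" "xplus (es l) (ks l) = (0 :: 'n Hplus)" by (simp_all add: J_def)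
      then show ?thesis by (simp add: hlinear_hpow[OF nop_lin])
    next
      case 2
      then have "\<exists>l\<in>set ls. ks l < \<rho> v" by (auto simp: K_def)
      then have a: "nop ks ls v \<in> hpow n" by (rule \<rho>)
      have "nop ks ls (xminus c (es l) (ks l) v) \<in> hpow n"
      proof (cases "ks l \<in> J")
        case True
        then have "K \<le> \<rho> (xminus c (es l) (ks l) v)" using K2 by (auto simp: K_def)
        then show ?thesis using 2 by (intro \<rho>) force
      next
        case False
        then show ?thesis by (intro hlinear_hpow[OF nop_lin]) (simp add: J_def)
      qed
      then show ?thesis using hlinear_hpow[OF hlinear_x a] by (simp add: hpow_add)
    qed
  qed
  then show ?case by blast
qed simp

lemma nop_null:
  assumes A: "finite A"
  shows "hnull (\<lambda>ks. g ks *\<^sub>h nop ks (sorted_list_of_set A) v) (expo A bs a)"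
  unfolding hnull_def
proof
  fix n
  obtain K where K: "\<And>ks. \<exists>l\<in>set (sorted_list_of_set A). ks l < K \<Longrightarrow> nop ks (sorted_list_of_set A) v \<in> hpow n"
    using nop_low[where ls = "sorted_list_of_set A"] by metis
  have "{ks \<in> expo A bs a. g ks *\<^sub>h nop ks (sorted_list_of_set A) v \<notin> hpow n} \<subseteq> {ks \<in> expo A bs a. \<forall>l\<in>A. K \<le> ks l}"
  proof
    fix ks assume ks: "ks \<in> {ks \<in> expo A bs a. g ks *\<^sub>h nop ks (sorted_list_of_set A) v \<notin> hpow n}"
    then have "nop ks (sorted_list_of_set A) v \<notin> hpow n" using hpow_scale by blast
    then have "\<not> (\<exists>l\<in>A. ks l < K)" using K[of ks] A by auto
    then show "ks \<in> {ks \<in> expo A bs a. \<forall>l\<in>A. K \<le> ks l}" using ks by (auto simp: not_less)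
  qed
  then show "finite {ks \<in> expo A bs a. g ks *\<^sub>h nop ks (sorted_list_of_set A) v \<notin> hpow n}"
    by (rule finite_subset) (rule finite_expo[OF A])
qed

text \<open>Both sides grow by adding a smallest index: \<open>Y_step\<close> on the left, the
  recursion of \<open>nop\<close> on the right, with the exponent of z taken from the new index as
  summation variable.\<close>

lemma Y_xplus_prod:
  "finite A \<Longrightarrow> Yv c (xplus_prod A es bs) a v =
    hsum (\<lambda>ks. (\<Prod>l\<in>A. plus_coeff (ks l - bs l) (bs l)) *\<^sub>h nop ks (sorted_list_of_set A) v) (expo A bs a)"
proof (induction A arbitrary: a v rule: finite_linorder_min_induct)
  case empty
  show ?case by (simp add: expo_empty xplus_prod_def Y_one hsum_finite hscale_one)
next
  case (insert l A)
  note A = insert.hyps(1)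
  have lt: "\<forall>x\<in>A. l < x" and lA: "l \<notin> A" using insert.hyps(2) by auto
  let ?P = "\<lambda>ks. \<Prod>l\<in>A. plus_coeff (ks l - bs l) (bs l)"
  let ?N = "\<lambda>ks. nop ks (sorted_list_of_set A)"
  let ?f = "\<lambda>ks. (\<Prod>l\<in>insert l A. plus_coeff (ks l - bs l) (bs l)) *\<^sub>h nop ks (sorted_list_of_set (insert l A)) v"
  let ?S = "\<lambda>j. expo A bs (a - j)"
  have f: "?f (ks(l := j + bs l)) = YA (es l) (bs l) j (?P ks *\<^sub>h ?N ks v) + ?P ks *\<^sub>h ?N ks (dop (negS c) (es l) (bs l) j v)" for ks j
  proof -
    have P: "?P (ks(l := j + bs l)) = ?P ks" by (rule prod.cong) (use lA in auto)
    have N: "?N (ks(l := j + bs l)) w = ?N ks w" for w by (rule nop_cong) (use lA A in auto)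
    \<comment> \<open>The contraction with parameter \<open>r\<close> is the substitution
      \<open>z + u\<close> in the plain annihilation operator.\<close>
    have D: "dop (negS c) (es l) (bs l) j v = plus_coeff j (bs l) *\<^sub>h xminus c (es l) (j + bs l) v"
    proof -
      have "ker (negS c) (es l) (bs l) j = (\<lambda>f s. plus_coeff j (bs l) * ker (negS c) (es l) 0 (j + bs l) f s)"
        by (simp add: fun_eq_iff ker_def mult.assoc)
      then show ?thesis unfolding dop_def xminus_eq
        by (simp add: derv_scale[OF tracefree_ker[OF pairing_negS]])
    qed
    show ?thesis
      unfolding sorted_list_insert_min[OF A lt] nop.simps prod.insert[OF A lA] P N D YA_def
      by (simp add: hscale_right_distrib hscale_hscale Hplus_mult_scale hlinear_scale[OF nop_lin] mult_ac)
  qed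
  have "hsum ?f (expo (insert l A) bs a) = (HSUM j. hsum (\<lambda>ks. ?f (ks(l := j + bs l))) (?S j))"
    by (rule hsum_expo_insert[OF A lA nop_null]) (use A in simp)
  also have "\<dots> = (HSUM j. YA (es l) (bs l) j (Yv c (xplus_prod A es bs) (a - j) v)
      + Yv c (xplus_prod A es bs) (a - j) (dop (negS c) (es l) (bs l) j v))"
  proof (rule hsum_cong[OF refl])
    fix j
    show "hsum (\<lambda>ks. ?f (ks(l := j + bs l))) (?S j) = YA (es l) (bs l) j (Yv c (xplus_prod A es bs) (a - j) v)
      + Yv c (xplus_prod A es bs) (a - j) (dop (negS c) (es l) (bs l) j v)"
      unfolding f insert.IH hsum_linear[OF hlinear_YA nop_null[OF A]]
      by (rule hsum_add[OF hnull_linear[OF hlinear_YA nop_null[OF A]] nop_null[OF A]])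
  qed
  also have "\<dots> = Yv c (xplus (es l) (bs l) * xplus_prod A es bs) a v"
    unfolding Y_step by (rule hsum_add[OF Y_hnull(1,2)])
  also have "xplus (es l) (bs l) * xplus_prod A es bs = xplus_prod (insert l A) es bs"
    using A lA by (simp add: xplus_prod_def)
  finally show ?case by (rule sym)
qed

lemma Ym_xbracket: "Ym c a (xplus_prod {1..n} es bs \<otimes> v) = xbracket_shift c n es a bs v"
  unfolding Ym Y_xplus_prod[OF finite_atLeastAtMost] xbracket_shift_def xbracket_nop expo_def ..

end

section \<open>The braiding on monomials\<close>

text \<open>\<open>Tshift\<close> expands \<open>T(z + (u - v))\<close>, the kernel
  \<open>T((z + u) - v)\<close>; the multinomial identity equates them.\<close>

lemma Tshift_ker: "Tshift c es ks (p, q) a = ker (Tser c) (es p) (ks p) a (es q) (ks q)"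
proof -
  have "plus_coeff a (ks p + ks q) * plus_coeff (ks p) (ks q) = plus_coeff (a + ks p) (ks q) * plus_coeff a (ks p)"
    by (rule plus_coeff_multinomial)
  then have "(plus_coeff a (ks p + ks q) * plus_coeff (ks p) (ks q)) * ((- 1) ^ nat (ks q) * Tser c (es p) (es q) (a + ks p + ks q)) =
      (plus_coeff (a + ks p) (ks q) * plus_coeff a (ks p)) * ((- 1) ^ nat (ks q) * Tser c (es p) (es q) (a + ks p + ks q))"
    by (rule arg_cong)
  then show ?thesis by (simp add: Tshift_def ker_def minus_coeff_def mult_ac)
qed

lemma Tshift_vanish: "a \<ge> 0 \<Longrightarrow> Tshift c es ks x a = 0"
  by (cases x) (simp add: Tshift_ker ker_vanish[OF pairing_kernel_T])

lemma Tshift_null: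
  assumes "finite i"
  shows "hnull (\<lambda>\<alpha>. (\<Prod>pq\<in>i. Tshift c es ks pq (\<alpha> pq)) *\<^sub>h t) (expo i bs a)"
proof (rule hnull_finite_support)
  show "finite {\<alpha> \<in> expo i bs a. (\<Prod>pq\<in>i. Tshift c es ks pq (\<alpha> pq)) *\<^sub>h t \<noteq> 0}"
  proof (rule finite_subset)
    define M where "M = (\<Sum>x\<in>i. \<bar>bs x\<bar>) + \<bar>a\<bar>"
    show "{\<alpha> \<in> expo i bs a. (\<Prod>pq\<in>i. Tshift c es ks pq (\<alpha> pq)) *\<^sub>h t \<noteq> 0} \<subseteq> i \<rightarrow>\<^sub>E {- M..0}"
    proof
      fix \<alpha> assume \<alpha>: "\<alpha> \<in> {\<alpha> \<in> expo i bs a. (\<Prod>pq\<in>i. Tshift c es ks pq (\<alpha> pq)) *\<^sub>h t \<noteq> 0}"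
      then have "(\<Prod>pq\<in>i. Tshift c es ks pq (\<alpha> pq)) \<noteq> 0" by auto
      then have "Tshift c es ks x (\<alpha> x) \<noteq> 0" if "x \<in> i" for x using that assms by auto
      then have neg: "\<alpha> x \<le> 0" if "x \<in> i" for x using that Tshift_vanish[of "\<alpha> x"] by (meson linear)
      have "- M \<le> \<alpha> x" if x: "x \<in> i" for x
      proof -
        have "a = (\<Sum>x\<in>i. \<alpha> x) - (\<Sum>x\<in>i. bs x)" using \<alpha> by (simp add: expo_def sum_subtractf)
        moreover have "(\<Sum>x\<in>i. \<alpha> x) = \<alpha> x + (\<Sum>y\<in>i - {x}. \<alpha> y)" by (rule sum.remove[OF assms x])
        moreover have "(\<Sum>y\<in>i - {x}. \<alpha> y) \<le> 0" by (rule sum_nonpos) (use neg in auto)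
        moreover have "- (\<Sum>x\<in>i. bs x) \<le> (\<Sum>x\<in>i. \<bar>bs x\<bar>)" using sum_abs[of bs i] by linarith
        ultimately show ?thesis unfolding M_def by linarith
      qed
      then show "\<alpha> \<in> i \<rightarrow>\<^sub>E {- M..0}"
        using \<alpha> neg by (intro PiE_I) (auto simp: expo_def PiE_def extensional_def)
    qed
    show "finite (i \<rightarrow>\<^sub>E {- M..0})" by (rule finite_PiE[OF assms]) simp
  qed
qed

text \<open>The edges are taken from fixed ambient blocks \<open>M\<close> and \<open>N\<close>, so
  that the edge set stays the same while \<open>A\<close> and \<open>B\<close> shrink in the
  induction. A new \<open>l\<close> of \<open>A\<close> is either created or contracted with some
  \<open>q\<close> in \<open>B\<close>.\<close>

lemma S_xplus_prod:
  fixes es :: "nat \<Rightarrow> 'n::finite \<times> 'n"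
  assumes "finite A" "A \<subseteq> M" "finite B" "B \<subseteq> N" "M \<inter> N = {}"
  shows "Sv c (xplus_prod A es ks) a (xplus_prod B es ks) =
    (\<Sum>i\<in>matchings (M \<times> N) (A \<union> B). hsum (\<lambda>\<alpha>. (\<Prod>pq\<in>i. Tshift c es ks pq (\<alpha> pq)) *\<^sub>h
      (xplus_prod (A - \<Union>(coords ` i)) es ks \<otimes> xplus_prod (B - \<Union>(coords ` i)) es ks)) (expo i (\<lambda>_. 0) a))"
  using assms(1-4)
proof (induction A arbitrary: a B rule: finite_induct)
  case empty
  have "matchings (M \<times> N) ({} \<union> B) = {{}}"
    using empty.prems assms(5) unfolding matchings_def coords_subset by auto
  then show ?case by (simp add: xplus_prod_def[of "{}"] S_one expo_empty hsum_finite hscale_one)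
next
  case (insert l A)
  let ?E = "M \<times> N" and ?V = "A \<union> B"
  let ?G = "\<lambda>A B i \<alpha>. (\<Prod>pq\<in>i. Tshift c es ks pq (\<alpha> pq)) *\<^sub>h
      (xplus_prod (A - \<Union>(coords ` i)) es ks \<otimes> (xplus_prod (B - \<Union>(coords ` i)) es ks :: 'n Hplus))"
  let ?H = "\<lambda>A B i a. hsum (?G A B i) (expo i (\<lambda>_. 0) a)"
  have A: "finite A" "A \<subseteq> M" "l \<notin> A" "l \<in> M" using insert by auto
  have B: "finite B" "B \<subseteq> N" using insert.prems by auto
  have fV: "finite ?V" using A B by simp
  have lN: "l \<notin> N" using A(4) assms(5) by blast
  have lV: "l \<notin> ?V" using lN A(3) B(2) by blast
  have xi: "xplus_prod (insert l C) es ks = xplus (es l) (ks l) * xplus_prod C es ks" if "finite C" "l \<notin> C" for C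
    using that by (simp add: xplus_prod_def)
  have fi: "finite i" if "i \<in> matchings ?E V'" "finite V'" for i V' using matchings_finite that by blast
  have nullG: "hnull (?G A' B' i) (expo i (\<lambda>_. 0) a)" if "finite i" for A' B' i a by (rule Tshift_null[OF that])
  have 1: "sl1 ((*) (xplus (es l) (ks l))) (?H A B i a) = ?H (insert l A) B i a" if i: "i \<in> matchings ?E ?V" for i
  proof -
    have e: "insert l A - \<Union>(coords ` i) = insert l (A - \<Union>(coords ` i))"
      using i lV unfolding matchings_def by blast
    have "xplus_prod (insert l (A - \<Union>(coords ` i))) es ks = xplus (es l) (ks l) * xplus_prod (A - \<Union>(coords ` i)) es ks"
      by (rule xi) (use A in auto)
    then show ?thesis
      unfolding e hsum_linear[OF sl1(1)[OF hlinear_x] nullG[OF fi[OF i fV]]]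
      by (simp add: hlinear_scale[OF sl1(1)[OF hlinear_x]] sl1(2)[OF hlinear_x])
  qed
  have Bq: "{q \<in> ?V. (l, q) \<in> ?E} = B" using A B assms(5) by auto
  have 2: "(HSUM j. Tshift c es ks (l, q) j *\<^sub>h ?H A (B - {q}) i (a - j)) = ?H (insert l A) B (insert (l, q) i) a"
    "hnull (\<lambda>j. Tshift c es ks (l, q) j *\<^sub>h ?H A (B - {q}) i (a - j)) UNIV"
    if q: "q \<in> B" and i: "i \<in> matchings ?E (A \<union> (B - {q}))" for q i
  proof -
    have f: "finite i" by (rule fi[OF i]) (use A B in simp)
    have lq: "(l, q) \<notin> i" using i lV unfolding matchings_def coords_subset by blast
    have f': "finite (insert (l, q) i)" using f by simp
    have qA: "q \<notin> A" using q B(2) A(2) assms(5) by blast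
    have c1: "insert l A - \<Union>(coords ` insert (l, q) i) = A - \<Union>(coords ` i)"
      "B - \<Union>(coords ` insert (l, q) i) = B - {q} - \<Union>(coords ` i)"
      using A(3) lV qA by (auto simp: coords_pair)
    have P: "(\<Prod>pq\<in>i. Tshift c es ks pq ((\<alpha>((l, q) := j + 0)) pq)) = (\<Prod>pq\<in>i. Tshift c es ks pq (\<alpha> pq))" for \<alpha> j
      by (rule prod.cong) (use lq in auto)
    have g: "?G (insert l A) B (insert (l, q) i) (\<alpha>((l, q) := j + 0)) = Tshift c es ks (l, q) j *\<^sub>h ?G A (B - {q}) i \<alpha>" for \<alpha> j
      unfolding c1 prod.insert[OF f lq] P by (simp add: hscale_hscale)
    have "?H (insert l A) B (insert (l, q) i) a =
        (HSUM j. hsum (\<lambda>\<alpha>. ?G (insert l A) B (insert (l, q) i) (\<alpha>((l, q) := j + 0))) (expo i (\<lambda>_. 0) (a - j)))"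
      by (rule hsum_expo_insert[OF f lq nullG[OF f']])
    also have "\<dots> = (HSUM j. Tshift c es ks (l, q) j *\<^sub>h ?H A (B - {q}) i (a - j))"
      unfolding g hsum_scale[OF nullG[OF f]] ..
    finally show "(HSUM j. Tshift c es ks (l, q) j *\<^sub>h ?H A (B - {q}) i (a - j)) = ?H (insert l A) B (insert (l, q) i) a" ..
    \<comment> \<open>Each factor T has a negative exponent of z, so no positive total can occur;
      this bounds the sum over \<open>j\<close>.\<close>
    have pos: "?H A (B - {q}) i b = 0" if "b > 0" for b
    proof (rule hsum_zeroI)
      fix \<alpha> assume "\<alpha> \<in> expo i (\<lambda>_. 0) b"
      then have "(\<Sum>x\<in>i. \<alpha> x) > 0" using that by (simp add: expo_def)
      then have "\<not> (\<forall>x\<in>i. \<alpha> x \<le> 0)" by (meson not_less sum_nonpos)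
      then obtain x where "x \<in> i" "\<alpha> x \<ge> 0" by force
      then have "(\<Prod>pq\<in>i. Tshift c es ks pq (\<alpha> pq)) = 0" using f Tshift_vanish by (meson prod_zero)
      then show "?G A (B - {q}) i \<alpha> = 0" by simp
    qed
    show "hnull (\<lambda>j. Tshift c es ks (l, q) j *\<^sub>h ?H A (B - {q}) i (a - j)) UNIV"
    proof (rule hnull_finite_support, rule finite_subset[of _ "{a..0}"], rule subsetI)
      fix j assume j: "j \<in> {j \<in> UNIV. Tshift c es ks (l, q) j *\<^sub>h ?H A (B - {q}) i (a - j) \<noteq> 0}"
      have "\<not> j > 0"
      proof
        assume "j > 0"
        then have "Tshift c es ks (l, q) j = 0" by (intro Tshift_vanish) simp
        then show False using j by simp
      qed
      moreover have "\<not> a - j > 0"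
      proof
        assume "a - j > 0"
        from pos[OF this] show False using j by simp
      qed
      ultimately show "j \<in> {a..0}" by simp
    qed simp
  qed
  have "Sv c (xplus_prod (insert l A) es ks) a (xplus_prod B es ks) =
      sl1 ((*) (xplus (es l) (ks l))) (Sv c (xplus_prod A es ks) a (xplus_prod B es ks))
      + (HSUM j. Sv c (xplus_prod A es ks) (a - j) (dop (Tser c) (es l) (ks l) j (xplus_prod B es ks)))"
    unfolding xi[OF A(1,3)] S_step ..
  also have "sl1 ((*) (xplus (es l) (ks l))) (Sv c (xplus_prod A es ks) a (xplus_prod B es ks)) = (\<Sum>i\<in>matchings ?E ?V. ?H (insert l A) B i a)"
    unfolding insert.IH[OF A(2) B] hlinear_sum[OF sl1(1)[OF hlinear_x]] by (rule sum.cong[OF refl 1])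
  also have "(HSUM j. Sv c (xplus_prod A es ks) (a - j) (dop (Tser c) (es l) (ks l) j (xplus_prod B es ks)))
      = (HSUM j. \<Sum>q\<in>B. \<Sum>i\<in>matchings ?E (A \<union> (B - {q})). Tshift c es ks (l, q) j *\<^sub>h ?H A (B - {q}) i (a - j))"
  proof (rule hsum_cong[OF refl])
    fix j
    have "Sv c (xplus_prod A es ks) (a - j) (dop (Tser c) (es l) (ks l) j (xplus_prod B es ks)) =
        (\<Sum>q\<in>B. Tshift c es ks (l, q) j *\<^sub>h Sv c (xplus_prod A es ks) (a - j) (xplus_prod (B - {q}) es ks))"
      unfolding dop_def derv_xplus_prod[OF tracefree_ker[OF pairing_kernel_T] B(1)] hlinear_sum[OF S_lin2] hlinear_scale[OF S_lin2] Tshift_ker ..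
    also have "\<dots> = (\<Sum>q\<in>B. \<Sum>i\<in>matchings ?E (A \<union> (B - {q})). Tshift c es ks (l, q) j *\<^sub>h ?H A (B - {q}) i (a - j))"
    proof (rule sum.cong[OF refl])
      fix q assume "q \<in> B"
      have "Sv c (xplus_prod A es ks) (a - j) (xplus_prod (B - {q}) es ks) = (\<Sum>i\<in>matchings ?E (A \<union> (B - {q})). ?H A (B - {q}) i (a - j))"
        by (rule insert.IH[OF A(2)]) (use B in auto)
      then show "Tshift c es ks (l, q) j *\<^sub>h Sv c (xplus_prod A es ks) (a - j) (xplus_prod (B - {q}) es ks) =
          (\<Sum>i\<in>matchings ?E (A \<union> (B - {q})). Tshift c es ks (l, q) j *\<^sub>h ?H A (B - {q}) i (a - j))"
        by (simp only: hmod.scale_sum_right)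
    qed
    finally show "Sv c (xplus_prod A es ks) (a - j) (dop (Tser c) (es l) (ks l) j (xplus_prod B es ks)) = \<dots>" .
  qed
  also have "\<dots> = (\<Sum>q\<in>B. \<Sum>i\<in>matchings ?E (A \<union> (B - {q})). (HSUM j. Tshift c es ks (l, q) j *\<^sub>h ?H A (B - {q}) i (a - j)))"
  proof -
    have n: "hnull (\<lambda>j. \<Sum>i\<in>matchings ?E (A \<union> (B - {q})). Tshift c es ks (l, q) j *\<^sub>h ?H A (B - {q}) i (a - j)) UNIV" if "q \<in> B" for q
      by (rule hsum_sum(2)) (rule 2(2)[OF that])
    show ?thesis
      by (subst hsum_sum(1)) (auto intro!: sum.cong hsum_sum(1) n 2(2))
  qed
  also have "\<dots> = (\<Sum>q\<in>{q \<in> ?V. (l, q) \<in> ?E}. \<Sum>i\<in>matchings ?E (?V - {q}). ?H (insert l A) B (insert (l, q) i) a)"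
    unfolding Bq
  proof (intro sum.cong refl)
    fix q assume q: "q \<in> B"
    have "q \<notin> A" using q B(2) A(2) assms(5) by blast
    then show e: "matchings ?E (A \<union> (B - {q})) = matchings ?E (?V - {q})" by (intro arg_cong[where f = "matchings ?E"]) blast
    fix i assume "i \<in> matchings ?E (?V - {q})"
    then show "(HSUM j. Tshift c es ks (l, q) j *\<^sub>h ?H A (B - {q}) i (a - j)) = ?H (insert l A) B (insert (l, q) i) a"
      by (intro 2(1)[OF q]) (simp add: e)
  qed
  also have "(\<Sum>i\<in>matchings ?E ?V. ?H (insert l A) B i a) + \<dots> = (\<Sum>i\<in>matchings ?E (insert l ?V). ?H (insert l A) B i a)"
    by (rule sum_matchings_insert[symmetric, OF fV lV]) (use lN in auto)
  finally show ?case by simp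
qed

lemma braiding_eq: "braiding c = Bm c"
proof -
  let ?P = "\<lambda>S :: int \<Rightarrow> 'a Hplus tensor2 \<Rightarrow> 'a Hplus tensor2. (\<forall>k. hlinear (S k)) \<and> (\<forall>t. in_negative (\<lambda>k. S k t)) \<and>
    (\<forall>n m es ks a. S a (xplus_prod {1..n} es ks \<otimes> xplus_prod {n+1..n+m} es ks) =
      (\<Sum>k=0..min m n. \<Sum>i\<in>bipairings n m k.
        hsum (\<lambda>\<alpha>. (\<Prod>pq\<in>i. Tshift c es ks pq (\<alpha> pq)) *\<^sub>h
            (xplus_prod ({1..n} - \<Union>(coords ` i)) es ks \<otimes>
             xplus_prod ({n+1..n+m} - \<Union>(coords ` i)) es ks))
          {\<alpha> \<in> i \<rightarrow>\<^sub>E UNIV. (\<Sum>pq\<in>i. \<alpha> pq) = a}))"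
  have e: "{\<alpha> \<in> i \<rightarrow>\<^sub>E UNIV. (\<Sum>pq\<in>i. \<alpha> pq) = a} = expo i (\<lambda>_. 0) a" for i :: "(nat \<times> nat) set" and a
    by (simp add: expo_def)
  have P: "?P (Bm c)"
    unfolding e sum_bipairings
  proof (intro conjI allI Bm(1) Bm_negative)
    fix n m es ks a
    show "Bm c a (xplus_prod {1..n} es ks \<otimes> xplus_prod {n+1..n+m} es ks) =
      (\<Sum>i\<in>matchings ({1..n} \<times> {n+1..n+m}) ({1..n} \<union> {n+1..n+m}). hsum (\<lambda>\<alpha>. (\<Prod>pq\<in>i. Tshift c es ks pq (\<alpha> pq)) *\<^sub>h
        (xplus_prod ({1..n} - \<Union>(coords ` i)) es ks \<otimes> xplus_prod ({n+1..n+m} - \<Union>(coords ` i)) es ks)) (expo i (\<lambda>_. 0) a))"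
      unfolding Bm(2) by (rule S_xplus_prod) auto
  qed
  have uniq: "S = Bm c" if S: "?P S" for S
  proof (intro ext)
    fix a t
    have lin: "hlinear (S a)" using S by blast
    show "S a t = Bm c a t"
    proof (rule tensor_eqI[OF lin Bm(1)])
      fix x y
      show "S a (x \<otimes> y) = Bm c a (x \<otimes> y)"
      proof (rule Hplus_plist_eqI[where F = "\<lambda>x. S a (x \<otimes> y)" and G = "\<lambda>x. Bm c a (x \<otimes> y)"])
        fix xs
        show "S a (plist xs \<otimes> y) = Bm c a (plist xs \<otimes> y)"
        proof (rule Hplus_plist_eqI[where F = "\<lambda>y. S a (plist xs \<otimes> y)" and G = "\<lambda>y. Bm c a (plist xs \<otimes> y)"])
          fix ys
          let ?n = "length xs"
          \<comment> \<open>The two lists are concatenated into one numbering, as the defining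
            equation of the braiding uses common families \<open>es\<close> and
            \<open>ks\<close>.\<close>
          define g where "g l = (if l \<le> ?n then xs ! (l - 1) else ys ! (l - ?n - 1))" for l
          define es where "es l = fst (g l)" for l
          define ks where "ks l = int (snd (g l))" for l
          have x: "plist xs = xplus_prod {1..?n} es ks"
            unfolding plist_xplus_prod[of xs 0] xplus_prod_def by (intro prod.cong) (auto simp: es_def ks_def g_def)
          have y: "plist ys = xplus_prod {?n+1..?n+length ys} es ks"
            unfolding plist_xplus_prod[of ys ?n] xplus_prod_def by (intro prod.cong) (auto simp: es_def ks_def g_def)
          show "S a (plist xs \<otimes> plist ys) = Bm c a (plist xs \<otimes> plist ys)"
            unfolding x y using S P by presburger
        qed (rule hlinear_compose[OF lin hlinear_tensor2[OF hlinear_id]], rule hlinear_compose[OF Bm(1) hlinear_tensor2[OF hlinear_id]])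
      qed (rule hlinear_compose[OF lin hlinear_tensor1[OF hlinear_id]], rule hlinear_compose[OF Bm(1) hlinear_tensor1[OF hlinear_id]])
    qed
  qed
  show ?thesis unfolding braiding_def by (rule the_equality[where P = ?P, OF P]) (rule uniq)
qed

theorem theorem2p10:
  fixes c :: complex
  assumes "CARD('n::finite) \<ge> 2"
  shows "\<exists>!Y :: int \<Rightarrow> 'n Hplus tensor2 \<Rightarrow> 'n Hplus.
    quantum_vertex_algebra Y 1 (braiding c) \<and>
    (\<forall>n es a bs v. Y a (xplus_prod {1..n} es bs \<otimes> v) = xbracket_shift c n es a bs v)"
proof (rule ex1I[of _ "Ym c"])
  show "quantum_vertex_algebra (Ym c :: int \<Rightarrow> 'n Hplus tensor2 \<Rightarrow> _) 1 (braiding c) \<and>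
    (\<forall>n es a bs v. Ym c a (xplus_prod {1..n} es bs \<otimes> v) = xbracket_shift c n es a bs v)"
    unfolding quantum_vertex_algebra_def braiding_eq
    by (intro conjI allI topologically_free_Hplus Ym(1) Ym_laurent weak_associativity_Ym vacuum_Ym Bm(1)
        in_negative_tensor_laurent[OF Bm_negative] Bm_mod_h yang_baxter_Bm unitarity_Bm shift_Bm S_locality_Bm
        hexagon_Bm Ym_xbracket)
next
  fix Y :: "int \<Rightarrow> 'n Hplus tensor2 \<Rightarrow> 'n Hplus"
  assume Y: "quantum_vertex_algebra Y 1 (braiding c) \<and>
    (\<forall>n es a bs v. Y a (xplus_prod {1..n} es bs \<otimes> v) = xbracket_shift c n es a bs v)"
  \<comment> \<open>Uniqueness: both operators are linear and agree when the left argument is a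
    monomial, which suffices by density of the span of monomials.\<close>
  show "Y = Ym c"
  proof (intro ext)
    fix a t
    have lin: "hlinear (Y a)" using Y unfolding quantum_vertex_algebra_def by blast
    show "Y a t = Ym c a t"
    proof (rule tensor_eqI[OF lin Ym(1)])
      fix x y
      show "Y a (x \<otimes> y) = Ym c a (x \<otimes> y)"
      proof (rule Hplus_plist_eqI[where F = "\<lambda>x. Y a (x \<otimes> y)" and G = "\<lambda>x. Ym c a (x \<otimes> y)"])
        fix xs :: "(('n \<times> 'n) \<times> nat) list"
        define es where "es l = fst (xs ! (l - 1))" for l
        define ks where "ks l = int (snd (xs ! (l - 1)))" for l
        have x: "plist xs = xplus_prod {1..length xs} es ks"
          unfolding plist_xplus_prod[of xs 0] xplus_prod_def by (intro prod.cong) (auto simp: es_def ks_def)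
        show "Y a (plist xs \<otimes> y) = Ym c a (plist xs \<otimes> y)" unfolding x Ym_xbracket using Y by blast
      qed (rule hlinear_compose[OF lin hlinear_tensor1[OF hlinear_id]], rule hlinear_compose[OF Ym(1) hlinear_tensor1[OF hlinear_id]])
    qed
  qed
qed

end
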